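(* Consider the two minimization problems $$\mathcal{L}:=\inf\Big\{\sum_{i=1}^k \lambda_{2,1}(\omega_i)\ \Big|\ \omega_i\subset\Omega \text{ open and non-empty},\ \omega_i\cap\omega_j=\emptyset \text{ for all } i\neq j\Big\}$$ and $$\ell:=\inf\Big\{\int_\Omega|\nabla \mathbf{u}|^2\,dx\ \Big|\ \mathbf{u}\in H^1_0(\Omega,\Sigma_k),\ \mathbf{u}\ge 0,\ \|u_i\|_{L^1(\Omega)}=1 \text{ for every } i=1,\dots,k\Big\}.$$ Then the following hold. (i) The minimization problem defining $\ell$ has a solution $\mathbf{u}\in H^1_0(\Omega,\Sigma_k)$. (ii) Any minimizer of the problem defining $\ell$ is Lipschitz continuous in $\overline{\Omega}$. (iii) The two problems are equivalent, in the following sense: $\mathcal{L}=\ell$; if $\mathbf{u}$ is a solution of the problem defining $\ell$, then $(\{u_1>0\},\dots,\{u_k>0\})$ is a solution of the problem defining $\mathcal{L}$; and, conversely, if $(\omega_1,\dots,\omega_k)$ solves the problem defining $\mathcal{L}$, then $\mathbf{u}=(u_1,\dots,u_k)$ defined by $$u_i:=\mathrm{argmin}\Big\{\int_{\omega_i}|\nabla u|^2\,dx\ \Big|\ u\in H^1_0(\omega_i),\ u\ge0,\ \|u\|_{L^1(\omega_i)}=1\Big\}$$ solves the problem defining $\ell$. In particular, the problem defining $\mathcal{L}$ has a solution.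
   Context: $N\ge 2$, $\Omega\subset\mathbb{R}^N$ is a bounded smooth domain, and $k\in\mathbb{N}$, $k\ge1$. For an open non-empty set $\omega\subset\Omega$, $$\lambda_{2,1}(\omega):=\inf\Big\{\int_\omega|\nabla u|^2\,dx\ \Big|\ u\in H^1_0(\omega),\ \|u\|_{L^1(\omega)}=1\Big\}.$$ $\Sigma_k:=\{\xi\in\mathbb{R}^k \mid \sum_{i\ne j}\xi_i^2\xi_j^2=0\}$, and $H^1_0(\Omega,\Sigma_k)$ is the set of $\mathbf{u}=(u_1,\dots,u_k)\in H^1_0(\Omega,\mathbb{R}^k)$ with $\mathbf{u}(x)\in\Sigma_k$ for a.e. $x\in\Omega$, i.e. $u_iu_j=0$ a.e. in $\Omega$ for all $i\neq j$. $\mathbf{u}\ge0$ means that every component is non-negative, and $|\nabla\mathbf{u}|^2=\sum_{i=1}^k|\nabla u_i|^2$. Functions in $H^1_0(\omega_i)$ are extended by zero outside $\omega_i$. Sets such as $\{u_i>0\}$ are understood for the continuous representative. *)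

theory Defs
  imports "HOL-Analysis.Analysis"
begin

section \<open>Smooth functions and bounded smooth domains\<close>

text \<open>\<open>Ck n f\<close>: all iterated partial derivatives of \<open>f\<close> of order less than \<open>n\<close> are
  differentiable, and those of order \<open>n\<close> are continuous.\<close>

primrec Ck :: "nat \<Rightarrow> ('a::euclidean_space \<Rightarrow> real) \<Rightarrow> bool" where
  "Ck 0 f \<longleftrightarrow> continuous_on UNIV f"
| "Ck (Suc n) f \<longleftrightarrow> (\<forall>x. f differentiable (at x)) \<and>
     (\<forall>b\<in>Basis. Ck n (\<lambda>x. frechet_derivative f (at x) b))"

definition smooth :: "('a::euclidean_space \<Rightarrow> real) \<Rightarrow> bool" where
  "smooth f \<longleftrightarrow> (\<forall>n. Ck n f)"

text \<open>Near each boundary point, after a rotation sending the last coordinate axis to the unit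
  vector \<open>e\<close>, the domain is the strict epigraph of a smooth function \<open>\<gamma>\<close> of the remaining
  coordinates. The latter are encoded by the orthogonal projection \<open>x - (x \<bullet> e) *\<^sub>R e\<close>, so only
  the restriction of \<open>\<gamma>\<close> to the hyperplane orthogonal to \<open>e\<close> matters.\<close>

definition smooth_boundary :: "'a::euclidean_space set \<Rightarrow> bool" where
  "smooth_boundary \<Omega> \<longleftrightarrow> (\<forall>p\<in>frontier \<Omega>. \<exists>r>0. \<exists>e \<gamma>. norm e = 1 \<and> smooth \<gamma> \<and>
     \<Omega> \<inter> ball p r = {x \<in> ball p r. \<gamma> (x - (x \<bullet> e) *\<^sub>R e) < x \<bullet> e})"

definition bounded_smooth_domain :: "'a::euclidean_space set \<Rightarrow> bool" where
  "bounded_smooth_domain \<Omega> \<longleftrightarrow>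
     open \<Omega> \<and> connected \<Omega> \<and> \<Omega> \<noteq> {} \<and> bounded \<Omega> \<and> smooth_boundary \<Omega>"

section \<open>Sobolev spaces\<close>

text \<open>Elements of Lebesgue and Sobolev spaces on an open set \<open>S\<close> are represented by total
  functions of which only the values on \<open>S\<close>, up to null sets, are relevant.\<close>

definition test_function :: "'a::euclidean_space set \<Rightarrow> ('a \<Rightarrow> real) \<Rightarrow> bool" where
  "test_function S \<phi> \<longleftrightarrow>
     smooth \<phi> \<and> compact (closure {x. \<phi> x \<noteq> 0}) \<and> closure {x. \<phi> x \<noteq> 0} \<subseteq> S"

definition L2 :: "'a::euclidean_space set \<Rightarrow> ('a \<Rightarrow> 'b::euclidean_space) set" where
  "L2 S = {f \<in> borel_measurable (lebesgue_on S). integrable (lebesgue_on S) (\<lambda>x. (norm (f x))\<^sup>2)}"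

definition L1_norm :: "'a::euclidean_space set \<Rightarrow> ('a \<Rightarrow> real) \<Rightarrow> real" where
  "L1_norm S u = (LINT x|lebesgue_on S. \<bar>u x\<bar>)"

definition has_weak_gradient ::
    "'a::euclidean_space set \<Rightarrow> ('a \<Rightarrow> real) \<Rightarrow> ('a \<Rightarrow> 'a) \<Rightarrow> bool" where
  "has_weak_gradient S u g \<longleftrightarrow> (\<forall>\<phi>. test_function S \<phi> \<longrightarrow> (\<forall>b\<in>Basis.
     (LINT x|lebesgue_on S. u x * frechet_derivative \<phi> (at x) b) =
       - (LINT x|lebesgue_on S. (g x \<bullet> b) * \<phi> x)))"

definition H1 :: "'a::euclidean_space set \<Rightarrow> ('a \<Rightarrow> real) set" where
  "H1 S = {u \<in> L2 S. \<exists>g\<in>L2 S. has_weak_gradient S u g}"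

text \<open>For \<open>u\<close> in \<open>H1 S\<close> the weak gradient is unique up to null sets of \<open>S\<close>, so the integrals
  below do not depend on the choice made here.\<close>

definition weak_grad :: "'a::euclidean_space set \<Rightarrow> ('a \<Rightarrow> real) \<Rightarrow> 'a \<Rightarrow> 'a" where
  "weak_grad S u = (SOME g. g \<in> L2 S \<and> has_weak_gradient S u g)"

definition dirichlet :: "'a::euclidean_space set \<Rightarrow> ('a \<Rightarrow> real) \<Rightarrow> real" where
  "dirichlet S u = (LINT x|lebesgue_on S. (norm (weak_grad S u x))\<^sup>2)"

definition H1_norm :: "'a::euclidean_space set \<Rightarrow> ('a \<Rightarrow> real) \<Rightarrow> real" where
  "H1_norm S u = sqrt ((LINT x|lebesgue_on S. (u x)\<^sup>2) + dirichlet S u)"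

definition H10 :: "'a::euclidean_space set \<Rightarrow> ('a \<Rightarrow> real) set" where
  "H10 S = {u \<in> H1 S. \<exists>\<phi>. (\<forall>n. test_function S (\<phi> n)) \<and>
     (\<lambda>n::nat. H1_norm S (\<lambda>x. \<phi> n x - u x)) \<longlonglongrightarrow> 0}"

section \<open>The optimal partition problem\<close>

definition lambda21 :: "'a::euclidean_space set \<Rightarrow> real" where
  "lambda21 \<omega> = Inf {dirichlet \<omega> u | u. u \<in> H10 \<omega> \<and> L1_norm \<omega> u = 1}"

definition partitions :: "'a::euclidean_space set \<Rightarrow> ('k::finite \<Rightarrow> 'a set) set" where
  "partitions \<Omega> = {\<omega>. (\<forall>i. \<omega> i \<subseteq> \<Omega> \<and> open (\<omega> i) \<and> \<omega> i \<noteq> {}) \<and>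
     (\<forall>i j. i \<noteq> j \<longrightarrow> \<omega> i \<inter> \<omega> j = {})}"

definition partition_cost :: "('k::finite \<Rightarrow> 'a::euclidean_space set) \<Rightarrow> real" where
  "partition_cost \<omega> = (\<Sum>i\<in>UNIV. lambda21 (\<omega> i))"

definition partition_solution ::
    "'a::euclidean_space set \<Rightarrow> ('k::finite \<Rightarrow> 'a set) \<Rightarrow> bool" where
  "partition_solution \<Omega> = is_arg_min partition_cost (\<lambda>\<omega>. \<omega> \<in> partitions \<Omega>)"

section \<open>The vector-valued problem\<close>

definition Sigma_k :: "(real^'k) set" where
  "Sigma_k = {\<xi>. (\<Sum>(i, j) \<in> {(i, j). i \<noteq> j}. (\<xi> $ i)\<^sup>2 * (\<xi> $ j)\<^sup>2) = 0}"

definition H10_Sigma :: "'a::euclidean_space set \<Rightarrow> ('a \<Rightarrow> real^'k) set" where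
  "H10_Sigma \<Omega> = {u. (\<forall>i. (\<lambda>x. u x $ i) \<in> H10 \<Omega>) \<and> (AE x in lebesgue_on \<Omega>. u x \<in> Sigma_k)}"

definition admissible :: "'a::euclidean_space set \<Rightarrow> ('a \<Rightarrow> real^'k) set" where
  "admissible \<Omega> = {u \<in> H10_Sigma \<Omega>. (AE x in lebesgue_on \<Omega>. \<forall>i. u x $ i \<ge> 0) \<and>
     (\<forall>i. L1_norm \<Omega> (\<lambda>x. u x $ i) = 1)}"

definition energy :: "'a::euclidean_space set \<Rightarrow> ('a \<Rightarrow> real^'k) \<Rightarrow> real" where
  "energy \<Omega> u = (\<Sum>i\<in>UNIV. dirichlet \<Omega> (\<lambda>x. u x $ i))"

definition energy_solution :: "'a::euclidean_space set \<Rightarrow> ('a \<Rightarrow> real^'k) \<Rightarrow> bool" where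
  "energy_solution \<Omega> = is_arg_min (energy \<Omega>) (\<lambda>u. u \<in> admissible \<Omega>)"

definition continuous_representative ::
    "'a::euclidean_space set \<Rightarrow> ('a \<Rightarrow> real^'k) \<Rightarrow> ('a \<Rightarrow> real^'k) \<Rightarrow> bool" where
  "continuous_representative \<Omega> u v \<longleftrightarrow>
     continuous_on \<Omega> v \<and> (AE x in lebesgue_on \<Omega>. v x = u x)"

definition scalar_solution :: "'a::euclidean_space set \<Rightarrow> ('a \<Rightarrow> real) \<Rightarrow> bool" where
  "scalar_solution \<omega> = is_arg_min (dirichlet \<omega>)
     (\<lambda>u. u \<in> H10 \<omega> \<and> (AE x in lebesgue_on \<omega>. u x \<ge> 0) \<and> L1_norm \<omega> u = 1)"

definition zero_extension ::
    "('k::finite \<Rightarrow> 'a set) \<Rightarrow> ('k \<Rightarrow> 'a \<Rightarrow> real) \<Rightarrow> 'a \<Rightarrow> real^'k" where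
  "zero_extension \<omega> w x = (\<chi> i. if x \<in> \<omega> i then w i x else 0)"

text \<open>For \<open>\<Omega>\<close> a bounded non-empty open set the infima below, and the one in \<open>lambda21\<close> for
  non-empty open subsets, are over non-empty sets of non-negative reals. The number \<open>k\<close> of
  components is \<open>CARD('k)\<close>; the type argument is needed since it does not occur in the value.\<close>

definition inf_partition :: "'k::finite itself \<Rightarrow> 'a::euclidean_space set \<Rightarrow> real" where
  "inf_partition _ \<Omega> = Inf (partition_cost ` (partitions \<Omega> :: ('k \<Rightarrow> 'a set) set))"

definition inf_energy :: "'k::finite itself \<Rightarrow> 'a::euclidean_space set \<Rightarrow> real" where
  "inf_energy _ \<Omega> = Inf (energy \<Omega> ` (admissible \<Omega> :: ('a \<Rightarrow> real^'k) set))"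

end

theory Submission
  imports Defs "HOL-Complex_Analysis.Great_Picard" "HOL-Library.Diagonal_Subsequence"
begin

text \<open>
  Solutions of the vector problem exist by the Rellich theorem and lower semicontinuity of the energy.
  Comparing a minimiser \<open>u\<close> with the rescaled competitors obtained by decreasing \<open>u j\<close>, or by pushing
  \<open>u j - (\<Sum>i\<noteq>j. u i)\<close> upwards, gives \<open>- \<Delta> (u j) \<le> \<Lambda>\<close> and \<open>- \<Delta> (u j - (\<Sum>i\<noteq>j. u i)) \<ge> - \<Lambda>\<close> in the
  weak sense, where \<open>\<Lambda>\<close> is the minimal energy. By the mean value inequality both functions have
  semicontinuous representatives, and disjointness of the supports turns this into continuity; a
  barrier on exterior balls gives linear decay at the boundary.

  The Lipschitz bound is a doubling argument of Ishii--Lions type for the tree metric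
  \<open>d x y = (\<Sum>i. \<bar>u i x - u i y\<bar>)\<close>. At an interior maximum of \<open>d x y - L \<Sum>b. phi \<bar>(x - y) \<bullet> b\<bar>\<close> with
  \<open>u j x < u j y\<close> one has \<open>d x y = u j y - (u j x - (\<Sum>i\<noteq>j. u i x))\<close>, and nearby \<open>d\<close> is bounded below by this
  difference of a subsolution and a supersolution. Averaging over \<open>(x + z, y + R z)\<close>, with \<open>R\<close> the
  reflection in a coordinate along which \<open>x\<close> and \<open>y\<close> differ, contradicts maximality for large \<open>L\<close>.

  Continuity makes the positivity sets open, and truncating at height \<open>\<epsilon>\<close> shows that \<open>u i\<close> belongs to
  the Sobolev space of \<open>{u i > 0}\<close>, so that these sets cost at most the energy of \<open>u\<close>. Conversely the
  extensions by zero of scalar minimisers on the members of a partition are admissible.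
\<close>

section \<open>A smooth kernel\<close>

text \<open>The nonnegative part of \<open>Sigma_k\<close> is a star of \<open>k\<close> half-lines
  glued at the origin. The sum of the component differences is its geodesic distance, and
  \<open>hat u j\<close> is the coordinate that grows along ray \<open>j\<close> and decreases along
  every other ray; hence these two expressions, and not the Euclidean norm, carry the argument. The
  mass constraint is removed by dividing each component of a competitor by its integral: for a
  perturbation of size t the masses drop by at most t times the integral of the test function, so
  the multiplier is bounded by the total energy and one constant serves all components. The obstacle
  to a Lipschitz bound is the interface between the phases, about whose shape nothing is known. The
  two one-sided inequalities hold across it, and away from the boundary of the domain the doubling
  uses nothing else: no monotonicity formula, no blow-up, no pointwise gradient. Second-order
  comparison works without second derivatives because the mean value inequality is available with
  the explicit error C r^2 / 4, for a radial kernel whose derivative in the radius is a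
  divergence.\<close>

definition psi :: "nat \<Rightarrow> real \<Rightarrow> real" where
  "psi m t = (if t > 0 then exp (- 1 / t) / t ^ m else 0)"

lemma psi_nonneg: "psi m t \<ge> 0"
  by (simp add: psi_def)

lemma psi_pos: "t > 0 \<Longrightarrow> psi m t > 0"
  by (simp add: psi_def)

lemma psi_eq_0: "t \<le> 0 \<Longrightarrow> psi m t = 0"
  by (simp add: psi_def)

text \<open>From the right, the substitution s = 1 / t turns \<open>psi m\<close> into s^m / exp s
  with s tending to infinity.\<close>

lemma psi_tendsto_0: "(psi m \<longlongrightarrow> 0) (at 0)"
proof (rule filterlim_split_at_real)
  have "(psi m \<longlongrightarrow> 0) (at_left 0) \<longleftrightarrow> ((\<lambda>t::real. 0::real) \<longlongrightarrow> 0) (at_left 0)"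
    by (intro tendsto_cong) (auto simp: psi_def eventually_at_filter)
  then show "(psi m \<longlongrightarrow> 0) (at_left 0)" by simp
  have *: "((\<lambda>t::real. (inverse t) ^ m / exp (inverse t)) \<longlongrightarrow> 0) (at_right 0)"
    by (rule filterlim_compose[OF tendsto_power_div_exp_0 filterlim_inverse_at_top_right])
  have "(psi m \<longlongrightarrow> 0) (at_right 0) \<longleftrightarrow> ((\<lambda>t::real. (inverse t) ^ m / exp (inverse t)) \<longlongrightarrow> 0) (at_right 0)"
    by (intro tendsto_cong)
      (auto simp: psi_def eventually_at_filter exp_minus field_simps power_inverse)
  with * show "(psi m \<longlongrightarrow> 0) (at_right 0)" by simp
qed

text \<open>The index \<open>m\<close> exists for this closure under differentiation. At 0 the
  difference quotient of \<open>psi m\<close> is exactly \<open>psi (Suc m)\<close>, which tends to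
  0 there.\<close>

lemma DERIV_psi: "(psi m has_real_derivative psi (m + 2) t - real m * psi (m + 1) t) (at t)"
proof -
  consider "t < 0" | "t = 0" | "t > 0" by linarith
  then show ?thesis
  proof cases
    case 1
    have "((\<lambda>t. 0) has_real_derivative 0) (at t)" by simp
    then have "(psi m has_real_derivative 0) (at t)"
      by (rule has_field_derivative_transform_within_open[where S="{..<0}"])
        (use 1 in \<open>auto simp: psi_def\<close>)
    then show ?thesis using 1 by (simp add: psi_def)
  next
    case 2
    have "((\<lambda>h. (psi m (0 + h) - psi m 0) / h) \<longlongrightarrow> 0) (at 0)"
    proof (rule Lim_transform_eventually[OF psi_tendsto_0[of "Suc m"]])
      show "\<forall>\<^sub>F x in at 0. psi (Suc m) x = (psi m (0 + x) - psi m 0) / x"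
        by (auto simp: psi_def eventually_at_filter)
    qed
    then show ?thesis using 2 by (simp add: DERIV_def psi_def)
  next
    case 3
    have "((\<lambda>t. exp (- 1 / t) / t ^ m) has_real_derivative psi (m + 2) t - real m * psi (m + 1) t) (at t)"
      using 3 by (cases m) (auto intro!: derivative_eq_intros simp: psi_def field_simps power2_eq_square,
        metis power_minus_mult mult.commute neq0_conv One_nat_def)
    then show ?thesis
      by (rule has_field_derivative_transform_within_open[where S="{0<..}"])
        (use 3 in \<open>auto simp: psi_def\<close>)
  qed
qed

lemma continuous_on_psi [continuous_intros]:
  "continuous_on A f \<Longrightarrow> continuous_on A (\<lambda>x. psi m (f x))"
  by (rule continuous_on_compose2[of UNIV "psi m"])
    (auto intro!: continuous_at_imp_continuous_on DERIV_isCont[OF DERIV_psi])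

text \<open>The arguments that occur have the form 1 - |x - a|^2 / r^2, which explains the
  restriction to t \<le> 1.\<close>

lemma psi_bounded: obtains B where "\<And>t. t \<le> 1 \<Longrightarrow> \<bar>psi m t\<bar> \<le> B"
proof -
  have "compact (psi m ` {0..1})"
    by (intro compact_continuous_image continuous_intros) auto
  then obtain B where B: "\<forall>y\<in>psi m ` {0..1}. norm y \<le> B"
    using compact_imp_bounded bounded_iff by blast
  have "\<bar>psi m t\<bar> \<le> max B 0" if "t \<le> 1" for t
  proof (cases "t \<le> 0")
    case False
    then have "psi m t \<in> psi m ` {0..1}" using that by auto
    with B have "norm (psi m t) \<le> B" by (rule bspec)
    then show ?thesis by simp
  qed (simp add: psi_eq_0)
  then show ?thesis by (rule that)
qed

text \<open>The generators are chosen so that their directional derivatives are again polynomials in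
  them. Smoothness of bumps then follows from closure of this algebra under differentiation, and no
  iterated derivative is ever computed.\<close>

inductive_set balg :: "'a::euclidean_space \<Rightarrow> real \<Rightarrow> ('a \<Rightarrow> real) set" for a r where
  balg_const: "(\<lambda>x. c) \<in> balg a r"
| balg_inner: "(\<lambda>x. x \<bullet> b) \<in> balg a r"
| balg_psi: "(\<lambda>x. psi m (1 - (x - a) \<bullet> (x - a) / r\<^sup>2)) \<in> balg a r"
| balg_add: "f \<in> balg a r \<Longrightarrow> g \<in> balg a r \<Longrightarrow> (\<lambda>x. f x + g x) \<in> balg a r"
| balg_mult: "f \<in> balg a r \<Longrightarrow> g \<in> balg a r \<Longrightarrow> (\<lambda>x. f x * g x) \<in> balg a r"

lemma balg_psi_derivative:
  "((\<lambda>x. psi m (1 - (x - a) \<bullet> (x - a) / r\<^sup>2)) has_derivative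
    (\<lambda>h. (psi (m + 2) (1 - (x - a) \<bullet> (x - a) / r\<^sup>2) - real m * psi (m + 1) (1 - (x - a) \<bullet> (x - a) / r\<^sup>2))
       * (- 2 / r\<^sup>2 * ((x - a) \<bullet> h)))) (at x)"
proof -
  have 1: "((\<lambda>x. 1 - (x - a) \<bullet> (x - a) / r\<^sup>2) has_derivative (\<lambda>h. - 2 / r\<^sup>2 * ((x - a) \<bullet> h))) (at x)"
    by (auto intro!: derivative_eq_intros simp: inner_commute divide_inverse)
  show ?thesis
    using has_derivative_compose[OF 1 DERIV_psi[of m, unfolded has_field_derivative_def]] by simp
qed

lemma balg_derivative:
  assumes "f \<in> balg a r"
  shows "\<exists>f'. (\<forall>x. (f has_derivative f' x) (at x)) \<and> (\<forall>b. (\<lambda>x. f' x b) \<in> balg a r)"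
  using assms
proof induction
  case (balg_const c)
  show ?case by (rule exI[of _ "\<lambda>_ _. 0"]) (auto intro: balg.balg_const)
next
  case (balg_inner b)
  show ?case
    by (rule exI[of _ "\<lambda>_ h. h \<bullet> b"]) (auto intro!: balg.balg_const derivative_eq_intros)
next
  case (balg_psi m)
  have *: "(\<lambda>x. (x - a) \<bullet> b) \<in> balg a r" for b
    using balg.balg_add[OF balg.balg_inner[of b a r] balg.balg_const[of "- (a \<bullet> b)"]]
    by (simp add: inner_diff_left)
  have **: "(\<lambda>x. psi m (1 - (x - a) \<bullet> (x - a) / r\<^sup>2) - c * psi n (1 - (x - a) \<bullet> (x - a) / r\<^sup>2)) \<in> balg a r"
    for m n c
    using balg.balg_add[OF balg.balg_psi[of m a r] balg.balg_mult[OF balg.balg_const[of "- c"] balg.balg_psi[of n]]]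
    by simp
  show ?case
    by (rule exI, rule conjI, rule allI, rule balg_psi_derivative)
      (intro allI balg.balg_mult balg.balg_const * **)
next
  case (balg_add f g)
  then obtain f' g' where "\<forall>x. (f has_derivative f' x) (at x)" "\<forall>b. (\<lambda>x. f' x b) \<in> balg a r"
    "\<forall>x. (g has_derivative g' x) (at x)" "\<forall>b. (\<lambda>x. g' x b) \<in> balg a r" by blast
  then show ?case
    by (intro exI[of _ "\<lambda>x h. f' x h + g' x h"]) (auto intro!: derivative_intros balg.balg_add)
next
  case (balg_mult f g)
  then obtain f' g' where "\<forall>x. (f has_derivative f' x) (at x)" "\<forall>b. (\<lambda>x. f' x b) \<in> balg a r"
    "\<forall>x. (g has_derivative g' x) (at x)" "\<forall>b. (\<lambda>x. g' x b) \<in> balg a r" by blast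
  then show ?case using balg_mult.hyps
    by (intro exI[of _ "\<lambda>x h. f x * g' x h + f' x h * g x"])
      (auto intro!: has_derivative_mult balg.balg_add balg.balg_mult)
qed

lemma balg_Ck: "f \<in> balg a r \<Longrightarrow> Ck n f"
proof (induction n arbitrary: f)
  case 0
  then obtain f' where "\<forall>x. (f has_derivative f' x) (at x)"
    using balg_derivative by blast
  then show ?case
    by (auto intro: continuous_at_imp_continuous_on has_derivative_continuous)
next
  case (Suc n)
  then obtain f' where f': "\<forall>x. (f has_derivative f' x) (at x)" "\<forall>b. (\<lambda>x. f' x b) \<in> balg a r"
    using balg_derivative by blast
  then have "frechet_derivative f (at x) = f' x" for x
    by (metis frechet_derivative_at)
  then show ?case using f' Suc.IH by (auto simp: differentiable_def)
qed

lemma balg_smooth: "f \<in> balg a r \<Longrightarrow> smooth f"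
  by (simp add: smooth_def balg_Ck)

text \<open>Since the derivative of \<open>psi 0\<close> is \<open>psi 2\<close>, the gradient of \<open>kP a r\<close> is a multiple of \<open>x - a\<close> times the
  kernel \<open>kern a r\<close> below; this is why the kernel is built from \<open>psi 2\<close>.\<close>

definition kP :: "'a::euclidean_space \<Rightarrow> real \<Rightarrow> 'a \<Rightarrow> real" where
  "kP a r x = psi 0 (1 - (x - a) \<bullet> (x - a) / r\<^sup>2)"

lemma psi_ball_outside:
  assumes "r > 0" "r \<le> norm (x - a)"
  shows "psi m (1 - (x - a) \<bullet> (x - a) / r\<^sup>2) = 0"
proof (rule psi_eq_0)
  have "r\<^sup>2 \<le> (norm (x - a))\<^sup>2" using assms by (intro power_mono) auto
  then show "1 - (x - a) \<bullet> (x - a) / r\<^sup>2 \<le> 0"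
    using assms by (simp add: dot_square_norm)
qed

lemma psi_ball_pos:
  assumes "norm (x - a) < r"
  shows "psi m (1 - (x - a) \<bullet> (x - a) / r\<^sup>2) > 0"
proof (rule psi_pos)
  have "(norm (x - a))\<^sup>2 < r\<^sup>2" using assms by (intro power_strict_mono) auto
  then show "1 - (x - a) \<bullet> (x - a) / r\<^sup>2 > 0"
    using assms by (simp add: dot_square_norm divide_simps)
qed

section \<open>Test functions and gradients\<close>

lemma test_functionI:
  assumes "smooth f" "compact K" "K \<subseteq> S" "\<And>x. x \<notin> K \<Longrightarrow> f x = 0"
  shows "test_function S f"
proof -
  have "closure {x. f x \<noteq> 0} \<subseteq> K"
    using assms by (intro closure_minimal compact_imp_closed) auto
  then show ?thesis unfolding test_function_def
    using assms closed_Int_compact[of "closure {x. f x \<noteq> 0}" K] by (auto simp: Int_absorb2)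
qed

lemma test_functionD:
  assumes "test_function S f"
  obtains K where "compact K" "K \<subseteq> S" "\<And>x. x \<notin> K \<Longrightarrow> f x = 0"
  using assms unfolding test_function_def
  by (intro that[of "closure {x. f x \<noteq> 0}"]) (auto intro: closure_subset[THEN subsetD])

lemma test_function_balg:
  assumes "f \<in> balg a r" "cball a r \<subseteq> S" "\<And>x. r \<le> norm (x - a) \<Longrightarrow> f x = 0"
  shows "test_function S f"
  using assms by (intro test_functionI[where K="cball a r"] balg_smooth)
    (auto simp: dist_norm norm_minus_commute)

definition grad :: "('a::euclidean_space \<Rightarrow> real) \<Rightarrow> 'a \<Rightarrow> 'a" where
  "grad f x = (\<Sum>b\<in>Basis. frechet_derivative f (at x) b *\<^sub>R b)"

lemma grad_inner: "b \<in> Basis \<Longrightarrow> grad f x \<bullet> b = frechet_derivative f (at x) b"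
  by (simp add: grad_def inner_sum_left inner_Basis if_distrib cong: if_cong)

lemma has_derivative_grad:
  assumes "f differentiable (at x)"
  shows "(f has_derivative (\<lambda>h. grad f x \<bullet> h)) (at x)"
proof -
  have 1: "(f has_derivative frechet_derivative f (at x)) (at x)"
    using assms frechet_derivative_works by blast
  then have lin: "linear (frechet_derivative f (at x))"
    by (rule has_derivative_linear)
  have "frechet_derivative f (at x) h = grad f x \<bullet> h" for h
  proof -
    have "frechet_derivative f (at x) h = frechet_derivative f (at x) (\<Sum>b\<in>Basis. (h \<bullet> b) *\<^sub>R b)"
      unfolding euclidean_representation ..
    also have "\<dots> = (\<Sum>b\<in>Basis. (h \<bullet> b) * frechet_derivative f (at x) b)"
      using lin by (simp add: linear_sum linear_scale)
    also have "\<dots> = grad f x \<bullet> h"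
      unfolding grad_def inner_sum_left inner_scaleR_left
      by (rule sum.cong) (auto simp: inner_commute mult.commute)
    finally show ?thesis .
  qed
  then have "frechet_derivative f (at x) = (\<lambda>h. grad f x \<bullet> h)" by (rule ext)
  then show ?thesis using 1 by simp
qed

lemma smooth_differentiable: "smooth f \<Longrightarrow> f differentiable (at x)"
  unfolding smooth_def by (metis Ck.simps(2))

lemma smooth_partial: "smooth f \<Longrightarrow> b \<in> Basis \<Longrightarrow> smooth (\<lambda>x. frechet_derivative f (at x) b)"
  unfolding smooth_def by (metis Ck.simps(2))

lemma smooth_continuous: "smooth f \<Longrightarrow> continuous_on A f"
  unfolding smooth_def by (metis Ck.simps(1) continuous_on_subset subset_UNIV)

lemma smooth_grad_continuous: "smooth f \<Longrightarrow> continuous_on A (grad f)"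
  unfolding grad_def by (intro continuous_intros smooth_continuous smooth_partial)

section \<open>Compactly supported continuously differentiable functions\<close>

text \<open>One continuous derivative suffices for integration by parts, and this class is stable
  under truncation by \<open>spos e\<close>, which would destroy smoothness. The derivative is
  required at every point of the space, so that extension by zero is built in and the gradient is
  carried along as data.\<close>

definition c1c :: "'a::euclidean_space set \<Rightarrow> ('a \<Rightarrow> real) \<Rightarrow> ('a \<Rightarrow> 'a) \<Rightarrow> bool" where
  "c1c S f h \<longleftrightarrow> (\<forall>x. (f has_derivative (\<lambda>v. h x \<bullet> v)) (at x)) \<and> continuous_on UNIV h \<and>
     (\<exists>K. compact K \<and> K \<subseteq> S \<and> (\<forall>x. x \<notin> K \<longrightarrow> f x = 0 \<and> h x = 0))"

lemma c1cI:
  assumes "\<And>x. (f has_derivative (\<lambda>v. h x \<bullet> v)) (at x)" "continuous_on UNIV h"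
    "compact K" "K \<subseteq> S" "\<And>x. x \<notin> K \<Longrightarrow> f x = 0"
  shows "c1c S f h"
proof -
  have "h x = 0" if "x \<notin> K" for x
  proof -
    have "((\<lambda>_. 0::real) has_derivative (\<lambda>v. h x \<bullet> v)) (at x)"
      by (rule has_derivative_transform_within_open[where s="- K", OF assms(1)])
        (use assms that in \<open>auto simp: compact_imp_closed open_Compl\<close>)
    then have "(\<lambda>v. h x \<bullet> v) = (\<lambda>v. 0)"
      by (rule has_derivative_unique) (rule has_derivative_const)
    then have "h x \<bullet> h x = 0" by (rule fun_cong)
    then show "h x = 0" by simp
  qed
  then show ?thesis using assms unfolding c1c_def by blast
qed

lemma c1c_test_function:
  assumes "test_function S f" shows "c1c S f (grad f)"
proof -
  have "smooth f" using assms by (simp add: test_function_def)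
  then show ?thesis
    using assms by (elim test_functionD)
      (auto intro!: c1cI has_derivative_grad smooth_differentiable smooth_grad_continuous)
qed

lemma c1cD:
  assumes "c1c S f h"
  shows "(f has_derivative (\<lambda>v. h x \<bullet> v)) (at x)" "continuous_on A h" "continuous_on A f"
proof -
  show 1: "(f has_derivative (\<lambda>v. h x \<bullet> v)) (at x)" for x
    using assms unfolding c1c_def by blast
  show "continuous_on A h"
    using assms unfolding c1c_def by (blast intro: continuous_on_subset)
  show "continuous_on A f"
    by (rule has_derivative_continuous_on) (blast intro: 1 has_derivative_at_withinI)
qed

lemma c1c_supp:
  assumes "c1c S f h"
  obtains K where "compact K" "K \<subseteq> S" "\<And>x. x \<notin> K \<Longrightarrow> f x = 0" "\<And>x. x \<notin> K \<Longrightarrow> h x = 0"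
  using assms unfolding c1c_def by blast

lemma c1c_mono: "c1c S f h \<Longrightarrow> S \<subseteq> T \<Longrightarrow> c1c T f h"
  unfolding c1c_def by blast

section \<open>Continuous functions with compact support\<close>

definition csupp :: "('a::euclidean_space \<Rightarrow> 'b::real_normed_vector) \<Rightarrow> bool" where
  "csupp f \<longleftrightarrow> continuous_on UNIV f \<and> (\<exists>K. compact K \<and> (\<forall>x. x \<notin> K \<longrightarrow> f x = 0))"

lemma csuppI: "continuous_on UNIV f \<Longrightarrow> compact K \<Longrightarrow> (\<And>x. x \<notin> K \<Longrightarrow> f x = 0) \<Longrightarrow> csupp f"
  unfolding csupp_def by blast

lemma csupp_c1c: "c1c S f h \<Longrightarrow> csupp f" "c1c S f h \<Longrightarrow> csupp h"
  by (metis c1cD(2,3) c1c_supp csuppI)+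

lemma csupp_bounded:
  assumes "csupp f" obtains B where "B > 0" "\<And>x. norm (f x) \<le> B"
proof -
  obtain K where K: "compact K" "\<And>x. x \<notin> K \<Longrightarrow> f x = 0" and c: "continuous_on UNIV f"
    using assms unfolding csupp_def by blast
  have "compact (f ` K)"
    by (intro compact_continuous_image K continuous_on_subset[OF c]) auto
  then obtain B where "B > 0" "\<forall>y\<in>f ` K. norm y \<le> B"
    using compact_imp_bounded[of "f ` K"] unfolding bounded_pos by auto
  then have "norm (f x) \<le> B" for x
    using K(2)[of x] by (cases "x \<in> K") auto
  then show ?thesis using that[of B] \<open>B > 0\<close> by simp
qed

lemma csupp_measurable: "csupp f \<Longrightarrow> f \<in> borel_measurable borel"
  "csupp f \<Longrightarrow> f \<in> borel_measurable lebesgue"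
proof -
  assume "csupp f"
  then show 1: "f \<in> borel_measurable borel"
    unfolding csupp_def by (auto intro!: borel_measurable_continuous_onI)
  show "f \<in> borel_measurable lebesgue"
    by (rule measurable_completion) (simp add: 1)
qed

lemma csupp_integrable:
  fixes f :: "'a::euclidean_space \<Rightarrow> 'b::euclidean_space"
  assumes "csupp f" shows "integrable lebesgue f"
proof -
  obtain K where K: "compact K" "\<And>x. x \<notin> K \<Longrightarrow> f x = 0"
    using assms unfolding csupp_def by blast
  obtain B where "\<And>x. norm (f x) \<le> B" using csupp_bounded[OF assms] by blast
  moreover have "K \<in> sets lebesgue" "emeasure lebesgue K < \<infinity>"
    using lmeasurable_compact[OF K(1)] by (auto simp: fmeasurable_def)
  ultimately show ?thesis
    using K(2) csupp_measurable(2)[OF assms] by (intro integrableI_bounded_set[of K _ _ B]) auto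
qed

text \<open>Compactness gives a modulus on the closed unit neighbourhood \<open>K'\<close> of
  \<open>K\<close>. With d at most 1, two close points lie both in \<open>K'\<close> or both off
  \<open>K\<close>, where \<open>f\<close> vanishes.\<close>

lemma csupp_uniform:
  fixes f :: "'a::euclidean_space \<Rightarrow> 'b::euclidean_space"
  assumes "csupp f" "e > 0"
  obtains d where "d > 0" "\<And>x y. norm (x - y) < d \<Longrightarrow> norm (f x - f y) < e"
proof -
  obtain K where K: "compact K" "\<And>x. x \<notin> K \<Longrightarrow> f x = 0" and c: "continuous_on UNIV f"
    using assms unfolding csupp_def by blast
  define K' where "K' = (\<lambda>p. fst p + snd p) ` (K \<times> cball 0 1)"
  have K': "compact K'" unfolding K'_def
    by (intro compact_continuous_image compact_Times K continuous_intros) auto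
  have in_K': "x \<in> K'" if "y \<in> K" "norm (x - y) \<le> 1" for x y
    unfolding K'_def using that by (intro image_eqI[of _ _ "(y, x - y)"]) auto
  have "uniformly_continuous_on K' f"
    by (intro compact_uniformly_continuous K' continuous_on_subset[OF c]) auto
  then obtain d where d: "d > 0" "\<And>x y. x \<in> K' \<Longrightarrow> y \<in> K' \<Longrightarrow> dist y x < d \<Longrightarrow> dist (f y) (f x) < e"
    using assms(2) by (auto simp: uniformly_continuous_on_def)
  show ?thesis
  proof (rule that[of "min d 1"])
    fix x y :: 'a assume xy: "norm (x - y) < min d 1"
    consider "x \<in> K" | "y \<in> K" | "x \<notin> K" "y \<notin> K" by blast
    then show "norm (f x - f y) < e"
    proof cases
      case 1
      then have "x \<in> K'" "y \<in> K'" using in_K'[of x x] in_K'[of x y] xy by (auto simp: norm_minus_commute)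
      then show ?thesis using d(2)[of y x] xy by (simp add: dist_norm)
    next
      case 2
      then have "x \<in> K'" "y \<in> K'" using in_K'[of y y] in_K'[of y x] xy by auto
      then show ?thesis using d(2)[of y x] xy by (simp add: dist_norm)
    next
      case 3
      then show ?thesis using K assms(2) by simp
    qed
  qed (use d in auto)
qed

section \<open>Changes of variables and integration by parts\<close>

lemma integral_lebesgue_affine:
  fixes f :: "'a::euclidean_space \<Rightarrow> 'b::{banach, second_countable_topology}"
  assumes [measurable]: "f \<in> borel_measurable borel" and "c \<noteq> 0"
  shows "\<bar>c\<bar> ^ DIM('a) *\<^sub>R (LINT x|lebesgue. f (t + c *\<^sub>R x)) = (LINT x|lebesgue. f x)"
proof -
  have "(LINT x|lebesgue. f x) = (LINT x|lborel. f x)"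
    by (rule integral_completion) simp
  also have "\<dots> = \<bar>c\<bar> ^ DIM('a) *\<^sub>R (LINT x|lborel. f (t + c *\<^sub>R x))"
    by (subst lborel_affine[OF assms(2), of t]) (simp add: integral_density integral_distr)
  also have "(LINT x|lborel. f (t + c *\<^sub>R x)) = (LINT x|lebesgue. f (t + c *\<^sub>R x))"
    by (rule integral_completion[symmetric]) simp
  finally show ?thesis ..
qed

lemma integral_lebesgue_translation:
  fixes f :: "'a::euclidean_space \<Rightarrow> 'b::{banach, second_countable_topology}"
  assumes "f \<in> borel_measurable borel"
  shows "(LINT x|lebesgue. f (x + t)) = (LINT x|lebesgue. f x)"
  using integral_lebesgue_affine[OF assms, of 1 t] by (simp add: add.commute)

lemma c1c_lipschitz:
  assumes "c1c S f h" "\<And>x. norm (h x) \<le> B"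
  shows "\<bar>f x - f y\<bar> \<le> B * norm (x - y)"
proof -
  have "norm (f x - f y) \<le> B * norm (x - y)"
  proof (rule differentiable_bound[of UNIV])
    show "(f has_derivative (\<lambda>v. h z \<bullet> v)) (at z within UNIV)" for z
      using c1cD(1)[OF assms(1)] by simp
    show "onorm (\<lambda>v. h z \<bullet> v) \<le> B" for z
      by (rule onorm_le) (metis Cauchy_Schwarz_ineq2 assms(2) mult_right_mono norm_ge_zero order_trans real_norm_def)
  qed auto
  then show ?thesis by simp
qed

text \<open>Translation invariance takes the place of the fundamental theorem of calculus: the
  difference quotients in direction \<open>b\<close> integrate to zero and converge, dominated, to
  the directional derivative. The later integrations by parts are this fact applied to a
  product.\<close>

lemma integral_grad_zero:
  assumes "c1c UNIV f h"
  shows "(LINT x|lebesgue. h x \<bullet> b) = 0"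
proof -
  obtain K where K: "compact K" "\<And>x. x \<notin> K \<Longrightarrow> f x = 0" "\<And>x. x \<notin> K \<Longrightarrow> h x = 0"
    using c1c_supp[OF assms] by metis
  obtain B where B: "B > 0" "\<And>x. norm (h x) \<le> B"
    using csupp_bounded[OF csupp_c1c(2)[OF assms]] by blast
  \<comment> \<open>All points from which a step s b with 0 \<le> s \<le> 1 leads into
    \<open>K\<close>. This set supports every quotient \<open>q n\<close>, because
    \<open>t n\<close> is at most 1.\<close>
  define K' where "K' = (\<lambda>p. fst p - snd p *\<^sub>R b) ` (K \<times> {0..1})"
  have K': "compact K'" unfolding K'_def
    by (intro compact_continuous_image compact_Times K(1) continuous_intros) auto
  define t where "t n = 1 / real (Suc n)" for n
  have t: "0 < t n" "t n \<le> 1" for n by (auto simp: t_def)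
  define q where "q n x = (f (x + t n *\<^sub>R b) - f x) / t n" for n x
  have [measurable]: "f \<in> borel_measurable borel" "h \<in> borel_measurable borel"
    using csupp_measurable(1) csupp_c1c[OF assms] by blast+
  have fi: "integrable lebesgue f"
    by (rule csupp_integrable[OF csupp_c1c(1)[OF assms]])
  have cs: "csupp (\<lambda>x. f (x + c *\<^sub>R b))" for c
  proof (rule csuppI)
    show "continuous_on UNIV (\<lambda>x. f (x + c *\<^sub>R b))"
      by (rule continuous_on_compose2[OF c1cD(3)[OF assms, of UNIV]]) (auto intro!: continuous_intros)
    show "compact ((\<lambda>x. x - c *\<^sub>R b) ` K)"
      by (intro compact_continuous_image K(1) continuous_intros)
    show "x \<notin> (\<lambda>x. x - c *\<^sub>R b) ` K \<Longrightarrow> f (x + c *\<^sub>R b) = 0" for x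
      by (rule K(2)) (metis add_diff_cancel image_eqI)
  qed
  have lim0: "(\<lambda>n. LINT x|lebesgue. q n x) \<longlonglongrightarrow> (LINT x|lebesgue. h x \<bullet> b)"
  proof (rule integral_dominated_convergence[where w="\<lambda>x. B * norm b * indicator K' x"])
    show "(\<lambda>x. h x \<bullet> b) \<in> borel_measurable lebesgue" "q n \<in> borel_measurable lebesgue" for n
      unfolding q_def by (rule measurable_completion, simp)+
    show "integrable lebesgue (\<lambda>x. B * norm b * indicator K' x)"
      using lmeasurable_compact[OF K'] by (auto simp: fmeasurable_def integrable_indicator_iff)
    have "(\<lambda>n. q n x) \<longlonglongrightarrow> h x \<bullet> b" for x
    proof -
      have "((\<lambda>s. f (x + s *\<^sub>R b)) has_derivative (\<lambda>s. h x \<bullet> (s *\<^sub>R b))) (at 0)"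
        by (rule has_derivative_compose[of "\<lambda>s. x + s *\<^sub>R b"])
          (use c1cD(1)[OF assms, of x] in \<open>auto intro!: derivative_eq_intros\<close>)
      then have "((\<lambda>s. f (x + s *\<^sub>R b)) has_real_derivative (h x \<bullet> b)) (at 0)"
        by (simp add: has_field_derivative_def mult_commute_abs)
      then have "((\<lambda>s. (f (x + s *\<^sub>R b) - f x) / s) \<longlongrightarrow> h x \<bullet> b) (at 0)"
        by (simp add: DERIV_def)
      moreover have "filterlim t (at 0) sequentially"
        unfolding filterlim_at t_def using LIMSEQ_inverse_real_of_nat by (auto simp: inverse_eq_divide)
      ultimately show ?thesis unfolding q_def by (rule filterlim_compose)
    qed
    then show "AE x in lebesgue. (\<lambda>n. q n x) \<longlonglongrightarrow> h x \<bullet> b" by simp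
    have "norm (q n x) \<le> B * norm b * indicator K' x" for n x
    proof (cases "x \<in> K'")
      case True
      have "\<bar>f (x + t n *\<^sub>R b) - f x\<bar> \<le> B * norm (x + t n *\<^sub>R b - x)"
        by (rule c1c_lipschitz[OF assms B(2)])
      then show ?thesis using True t[of n] by (simp add: q_def field_simps)
    next
      case False
      have "x \<notin> K"
      proof
        assume "x \<in> K"
        then have "x \<in> K'" unfolding K'_def by (intro image_eqI[of _ _ "(x, 0)"]) auto
        then show False using False by simp
      qed
      moreover have "x + t n *\<^sub>R b \<notin> K"
      proof
        assume "x + t n *\<^sub>R b \<in> K"
        then have "x \<in> K'" unfolding K'_def using t[of n]
          by (intro image_eqI[of _ _ "(x + t n *\<^sub>R b, t n)"]) auto
        then show False using False by simp
      qed
      ultimately show ?thesis using K(2) False by (simp add: q_def)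
    qed
    then show "AE x in lebesgue. norm (q n x) \<le> B * norm b * indicator K' x" for n by simp
  qed
  have "(LINT x|lebesgue. q n x) = 0" for n
  proof -
    have "(LINT x|lebesgue. q n x) = ((LINT x|lebesgue. f (x + t n *\<^sub>R b)) - (LINT x|lebesgue. f x)) / t n"
      unfolding q_def using csupp_integrable[OF cs[of "t n"]] fi by simp
    also have "(LINT x|lebesgue. f (x + t n *\<^sub>R b)) = (LINT x|lebesgue. f x)"
      by (rule integral_lebesgue_translation) simp
    finally show ?thesis by simp
  qed
  then show ?thesis using lim0 by (simp add: LIMSEQ_const_iff)
qed

text \<open>Products and truncations involve weights that are differentiable only on
  \<open>S\<close>. The open sets \<open>S\<close> and \<open>- K\<close> cover the space, and on
  the second one the function is identically zero.\<close>

lemma c1c_gluing: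
  assumes "open S" "compact K" "K \<subseteq> S"
    and F: "\<And>x. x \<in> S \<Longrightarrow> (F has_derivative (\<lambda>v. H x \<bullet> v)) (at x)" "continuous_on S H"
    and 0: "\<And>x. x \<notin> K \<Longrightarrow> F x = 0" "\<And>x. x \<notin> K \<Longrightarrow> H x = 0"
  shows "c1c S F H"
proof (rule c1cI)
  have op: "open (- K)" using assms by (simp add: compact_imp_closed open_Compl)
  show "(F has_derivative (\<lambda>v. H x \<bullet> v)) (at x)" for x
  proof (cases "x \<in> S")
    case False
    then have x: "x \<in> - K" using assms by blast
    have "(F has_derivative (\<lambda>v. 0)) (at x)"
      by (rule has_derivative_transform_within_open[where s="- K" and f="\<lambda>_. 0"])
        (use x op 0 in auto)
    then show ?thesis using 0 x by simp
  qed (rule F(1))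
  have "continuous_on (S \<union> - K) H"
  proof (rule continuous_on_open_Un[OF assms(1) op F(2)])
    show "continuous_on (- K) H"
      by (rule continuous_on_eq[OF continuous_on_const[of _ 0]]) (use 0(2) in auto)
  qed
  then show "continuous_on UNIV H"
    by (rule continuous_on_subset) (use assms in auto)
qed (use assms in auto)

definition c1 :: "'a::euclidean_space set \<Rightarrow> ('a \<Rightarrow> real) \<Rightarrow> ('a \<Rightarrow> 'a) \<Rightarrow> bool" where
  "c1 S w w' \<longleftrightarrow> (\<forall>x\<in>S. (w has_derivative (\<lambda>v. w' x \<bullet> v)) (at x)) \<and> continuous_on S w'"

lemma c1_continuous: "c1 S w w' \<Longrightarrow> continuous_on S w"
  unfolding c1_def
  by (auto intro!: continuous_at_imp_continuous_on has_derivative_continuous)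

lemma c1_c1c: "c1c S f h \<Longrightarrow> c1 T f h"
  unfolding c1_def by (simp add: c1cD)

lemma c1c_mult:
  assumes "open S" "c1c S f h" "c1 S w w'"
  shows "c1c S (\<lambda>x. f x * w x) (\<lambda>x. w x *\<^sub>R h x + f x *\<^sub>R w' x)"
proof -
  obtain K where K: "compact K" "K \<subseteq> S" "\<And>x. x \<notin> K \<Longrightarrow> f x = 0" "\<And>x. x \<notin> K \<Longrightarrow> h x = 0"
    using c1c_supp[OF assms(2)] by metis
  show ?thesis
  proof (rule c1c_gluing[OF assms(1) K(1,2)])
    fix x assume "x \<in> S"
    then have "(w has_derivative (\<lambda>v. w' x \<bullet> v)) (at x)" using assms(3) by (simp add: c1_def)
    from has_derivative_mult[OF c1cD(1)[OF assms(2)] this]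
    show "((\<lambda>x. f x * w x) has_derivative (\<lambda>v. (w x *\<^sub>R h x + f x *\<^sub>R w' x) \<bullet> v)) (at x)"
      by (simp add: inner_add_left algebra_simps)
  next
    show "continuous_on S (\<lambda>x. w x *\<^sub>R h x + f x *\<^sub>R w' x)"
      using assms(3) by (intro continuous_intros c1cD[OF assms(2)] c1_continuous[OF assms(3)])
        (simp add: c1_def)
  qed (use K in auto)
qed

lemma c1c_add:
  assumes "c1c S f h" "c1c S f' h'"
  shows "c1c S (\<lambda>x. f x + f' x) (\<lambda>x. h x + h' x)"
proof -
  obtain K where K: "compact K" "K \<subseteq> S" "\<And>x. x \<notin> K \<Longrightarrow> f x = 0"
    using c1c_supp[OF assms(1)] by metis
  obtain K' where K': "compact K'" "K' \<subseteq> S" "\<And>x. x \<notin> K' \<Longrightarrow> f' x = 0"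
    using c1c_supp[OF assms(2)] by metis
  show ?thesis
  proof (rule c1cI)
    show "((\<lambda>x. f x + f' x) has_derivative (\<lambda>v. (h x + h' x) \<bullet> v)) (at x)" for x
      using has_derivative_add[OF c1cD(1)[OF assms(1)] c1cD(1)[OF assms(2)]]
      by (simp add: inner_add_left)
    show "continuous_on UNIV (\<lambda>x. h x + h' x)"
      by (intro continuous_intros c1cD(2)[OF assms(1)] c1cD(2)[OF assms(2)])
    show "compact (K \<union> K')" using K K' by blast
  qed (use K K' in auto)
qed

lemma c1c_scale:
  assumes "c1c S f h" shows "c1c S (\<lambda>x. c * f x) (\<lambda>x. c *\<^sub>R h x)"
proof -
  obtain K where K: "compact K" "K \<subseteq> S" "\<And>x. x \<notin> K \<Longrightarrow> f x = 0"
    using c1c_supp[OF assms(1)] by metis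
  show ?thesis
  proof (rule c1cI[OF _ _ K(1,2)])
    show "((\<lambda>x. c * f x) has_derivative (\<lambda>v. (c *\<^sub>R h x) \<bullet> v)) (at x)" for x
      using has_derivative_mult_right[OF c1cD(1)[OF assms(1)]] by simp
    show "continuous_on UNIV (\<lambda>x. c *\<^sub>R h x)"
      by (intro continuous_intros c1cD(2)[OF assms])
  qed (use K in auto)
qed

section \<open>Square-integrable functions\<close>

definition l2 :: "('a::euclidean_space \<Rightarrow> 'b::euclidean_space) \<Rightarrow> bool" where
  "l2 f \<longleftrightarrow> f \<in> borel_measurable lebesgue \<and> integrable lebesgue (\<lambda>x. (norm (f x))\<^sup>2)"

definition n2 :: "('a::euclidean_space \<Rightarrow> 'b::euclidean_space) \<Rightarrow> real" where
  "n2 f = (LINT x|lebesgue. (norm (f x))\<^sup>2)"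

definition ip :: "('a::euclidean_space \<Rightarrow> 'b::euclidean_space) \<Rightarrow> ('a \<Rightarrow> 'b) \<Rightarrow> real" where
  "ip f g = (LINT x|lebesgue. f x \<bullet> g x)"

lemma l2_measurable [measurable_dest]: "l2 f \<Longrightarrow> f \<in> borel_measurable lebesgue"
  by (simp add: l2_def)

lemma n2_nonneg [simp]: "n2 f \<ge> 0"
  by (simp add: n2_def)

lemma l2_zero [simp]: "l2 (\<lambda>x. 0)"
  by (simp add: l2_def)

lemma n2_zero [simp]: "n2 (\<lambda>x. 0) = 0"
  by (simp add: n2_def)

lemma l2_bound:
  assumes "l2 f" "g \<in> borel_measurable lebesgue" "AE x in lebesgue. norm (g x) \<le> C * norm (f x)"
  shows "l2 g" "n2 g \<le> C\<^sup>2 * n2 f"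
proof -
  have *: "AE x in lebesgue. (norm (g x))\<^sup>2 \<le> C\<^sup>2 * (norm (f x))\<^sup>2"
    using assms(3) by eventually_elim (metis norm_ge_zero power_mono power_mult_distrib)
  have i: "integrable lebesgue (\<lambda>x. C\<^sup>2 * (norm (f x))\<^sup>2)"
    using assms(1) by (simp add: l2_def)
  have g: "integrable lebesgue (\<lambda>x. (norm (g x))\<^sup>2)"
    by (rule Bochner_Integration.integrable_bound[OF i]) (use assms(2) * in auto)
  then show "l2 g" using assms by (simp add: l2_def)
  have "n2 g \<le> (LINT x|lebesgue. C\<^sup>2 * (norm (f x))\<^sup>2)"
    unfolding n2_def by (rule integral_mono_AE[OF g i *])
  then show "n2 g \<le> C\<^sup>2 * n2 f" by (simp add: n2_def)
qed

lemma l2_mono: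
  assumes "l2 f" "g \<in> borel_measurable lebesgue" "AE x in lebesgue. norm (g x) \<le> norm (f x)"
  shows "l2 g" "n2 g \<le> n2 f"
  using l2_bound[OF assms(1,2), of 1] assms(3) by auto

lemma l2_scaleR:
  assumes "l2 f" shows "l2 (\<lambda>x. c *\<^sub>R f x)"
  by (rule l2_bound(1)[OF assms, of _ "\<bar>c\<bar>"]) (use assms in \<open>auto simp: l2_def\<close>)

lemma n2_scaleR: "n2 (\<lambda>x. c *\<^sub>R f x) = c\<^sup>2 * n2 f"
  by (simp add: n2_def power_mult_distrib)

lemma l2_cmult: "l2 f \<Longrightarrow> l2 (\<lambda>x. c * f x :: real)"
  using l2_scaleR[of f c] by simp

lemma l2_add:
  assumes "l2 f" "l2 g" shows "l2 (\<lambda>x. f x + g x)"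
proof -
  have [measurable]: "f \<in> borel_measurable lebesgue" "g \<in> borel_measurable lebesgue"
    using assms by (auto simp: l2_def)
  have i: "integrable lebesgue (\<lambda>x. 2 * (norm (f x))\<^sup>2 + 2 * (norm (g x))\<^sup>2)"
    using assms by (simp add: l2_def)
  have "(norm (f x + g x))\<^sup>2 \<le> 2 * (norm (f x))\<^sup>2 + 2 * (norm (g x))\<^sup>2" for x
  proof -
    have "(norm (f x + g x))\<^sup>2 \<le> (norm (f x) + norm (g x))\<^sup>2"
      by (simp add: norm_triangle_ineq power_mono)
    also have "\<dots> \<le> 2 * (norm (f x))\<^sup>2 + 2 * (norm (g x))\<^sup>2"
      using sum_squares_bound[of "norm (f x)" "norm (g x)"] by (simp add: power2_sum)
    finally show ?thesis .
  qed
  then have "integrable lebesgue (\<lambda>x. (norm (f x + g x))\<^sup>2)"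
    by (intro Bochner_Integration.integrable_bound[OF i]) auto
  then show ?thesis by (simp add: l2_def)
qed

lemma l2_diff: "l2 f \<Longrightarrow> l2 g \<Longrightarrow> l2 (\<lambda>x. f x - g x)"
  using l2_add[of f "\<lambda>x. (-1) *\<^sub>R g x"] l2_scaleR[of g "-1"] by simp

lemma l2_norm: "l2 f \<Longrightarrow> l2 (\<lambda>x. norm (f x))"
  by (auto simp: l2_def)

lemma n2_norm: "n2 (\<lambda>x. norm (f x)) = n2 f"
  by (simp add: n2_def)

lemma l2_indicator:
  assumes "l2 f" "A \<in> sets lebesgue"
  shows "l2 (\<lambda>x. indicator A x *\<^sub>R f x)"
  by (rule l2_mono(1)[OF assms(1)]) (use assms in \<open>auto simp: l2_def indicator_def\<close>)

lemma ip_integrable: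
  assumes "l2 f" "l2 g" shows "integrable lebesgue (\<lambda>x. f x \<bullet> g x)"
proof -
  have [measurable]: "f \<in> borel_measurable lebesgue" "g \<in> borel_measurable lebesgue"
    using assms by (auto simp: l2_def)
  have "norm (f x \<bullet> g x) \<le> (norm (f x))\<^sup>2 + (norm (g x))\<^sup>2" for x
  proof -
    have "\<bar>f x \<bullet> g x\<bar> \<le> norm (f x) * norm (g x)" by (rule Cauchy_Schwarz_ineq2)
    also have "\<dots> \<le> (norm (f x))\<^sup>2 + (norm (g x))\<^sup>2"
      using sum_squares_bound[of "norm (f x)" "norm (g x)"] mult_nonneg_nonneg[OF norm_ge_zero[of "f x"] norm_ge_zero[of "g x"]]
      by linarith
    finally show ?thesis by simp
  qed
  then show ?thesis
    by (rule_tac Bochner_Integration.integrable_bound[where f="\<lambda>x. (norm (f x))\<^sup>2 + (norm (g x))\<^sup>2"])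
      (use assms in \<open>auto simp: l2_def\<close>)
qed

lemma ip_commute: "ip f g = ip g f"
  by (simp add: ip_def inner_commute)

lemma ip_self: "ip f f = n2 f"
  by (simp add: ip_def n2_def power2_norm_eq_inner)

lemma ip_add: "l2 f \<Longrightarrow> l2 g \<Longrightarrow> l2 h \<Longrightarrow> ip (\<lambda>x. f x + g x) h = ip f h + ip g h"
  by (simp add: ip_def inner_add_left ip_integrable)

lemma ip_diff: "l2 f \<Longrightarrow> l2 g \<Longrightarrow> l2 h \<Longrightarrow> ip (\<lambda>x. f x - g x) h = ip f h - ip g h"
  by (simp add: ip_def inner_diff_left ip_integrable)

lemma ip_scaleR: "ip (\<lambda>x. c *\<^sub>R f x) h = c * ip f h"
  by (simp add: ip_def)

lemma n2_add:
  assumes "l2 f" "l2 g"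
  shows "n2 (\<lambda>x. f x + g x) = n2 f + 2 * ip f g + n2 g"
proof -
  have "ip (\<lambda>x. f x + g x) (\<lambda>x. f x + g x) = ip f (\<lambda>x. f x + g x) + ip g (\<lambda>x. f x + g x)"
    using assms by (intro ip_add l2_add)
  also have "ip f (\<lambda>x. f x + g x) = ip f f + ip g f"
    using ip_add[OF assms(1,2,1)] by (simp add: ip_commute)
  also have "ip g (\<lambda>x. f x + g x) = ip f g + ip g g"
    using ip_add[OF assms(1,2,2)] by (simp add: ip_commute)
  finally show ?thesis by (simp add: ip_self ip_commute[of g f])
qed

lemma n2_diff:
  assumes "l2 f" "l2 g"
  shows "n2 (\<lambda>x. f x - g x) = n2 f - 2 * ip f g + n2 g"
  using n2_add[OF assms(1) l2_scaleR[OF assms(2), of "-1"]] n2_scaleR[of "-1" g]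
    ip_scaleR[of "-1" g f] by (simp add: ip_commute[of f])

lemma ip_Cauchy_Schwarz:
  assumes "l2 f" "l2 g" shows "(ip f g)\<^sup>2 \<le> n2 f * n2 g"
proof -
  have q: "0 \<le> n2 f + 2 * t * ip f g + t\<^sup>2 * n2 g" for t
  proof -
    have "0 \<le> n2 (\<lambda>x. f x + t *\<^sub>R g x)" by simp
    also have "\<dots> = n2 f + 2 * t * ip f g + t\<^sup>2 * n2 g"
      using n2_add[OF assms(1) l2_scaleR[OF assms(2)], of t] ip_scaleR[of t g f]
      by (simp add: n2_scaleR ip_commute[of f])
    finally show ?thesis .
  qed
  show ?thesis
  proof (cases "n2 g = 0")
    case True
    have "ip f g = 0"
    proof (rule ccontr)
      assume "ip f g \<noteq> 0"
      \<comment> \<open>With \<open>n2 g = 0\<close> the quadratic polynomial in t is affine, and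
        this t gives it the value -1.\<close>
      then show False
        using q[of "- (n2 f + 1) / (2 * ip f g)"] True by (simp add: field_simps)
    qed
    then show ?thesis by simp
  next
    case False
    then have "n2 g > 0" using n2_nonneg[of g] by linarith
    then show ?thesis using q[of "- ip f g / n2 g"]
      by (simp add: field_simps power2_eq_square)
  qed
qed

lemma ip_bound:
  assumes "l2 f" "l2 g" shows "\<bar>ip f g\<bar> \<le> sqrt (n2 f) * sqrt (n2 g)"
  using ip_Cauchy_Schwarz[OF assms] real_sqrt_le_mono by (fastforce simp: real_sqrt_mult)

lemma n2_triangle:
  assumes "l2 f" "l2 g"
  shows "sqrt (n2 (\<lambda>x. f x + g x)) \<le> sqrt (n2 f) + sqrt (n2 g)"
proof (rule real_le_lsqrt)
  have "n2 (\<lambda>x. f x + g x) = n2 f + 2 * ip f g + n2 g" by (rule n2_add[OF assms])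
  also have "\<dots> \<le> (sqrt (n2 f) + sqrt (n2 g))\<^sup>2"
    using ip_bound[OF assms] by (simp add: power2_sum)
  finally show "n2 (\<lambda>x. f x + g x) \<le> (sqrt (n2 f) + sqrt (n2 g))\<^sup>2" .
qed auto

lemma n2_triangle_diff:
  assumes "l2 f" "l2 g" "l2 h"
  shows "sqrt (n2 (\<lambda>x. f x - h x)) \<le> sqrt (n2 (\<lambda>x. f x - g x)) + sqrt (n2 (\<lambda>x. g x - h x))"
  using n2_triangle[OF l2_diff[OF assms(1,2)] l2_diff[OF assms(2,3)]] by simp

lemma n2_diff_commute: "n2 (\<lambda>x. f x - g x) = n2 (\<lambda>x. g x - f x)"
  by (simp add: n2_def norm_minus_commute)

lemma n2_cong_AE:
  assumes "f \<in> borel_measurable lebesgue" "g \<in> borel_measurable lebesgue" "AE x in lebesgue. f x = g x"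
  shows "n2 f = n2 g"
  unfolding n2_def by (rule integral_cong_AE) (use assms in auto)

lemma l2_cong_AE:
  assumes "l2 f" "g \<in> borel_measurable lebesgue" "AE x in lebesgue. f x = g x"
  shows "l2 g"
  by (rule l2_mono(1)[OF assms(1,2)]) (use assms(3) in auto)

lemma n2_eq_0:
  assumes "l2 f" "n2 f = 0" shows "AE x in lebesgue. f x = 0"
  using assms integral_nonneg_eq_0_iff_AE[of lebesgue "\<lambda>x. (norm (f x))\<^sup>2"]
  by (simp add: l2_def n2_def)

section \<open>Convergence in the mean, Fatou's lemma and completeness\<close>

definition tol2 :: "(nat \<Rightarrow> 'a::euclidean_space \<Rightarrow> 'b::euclidean_space) \<Rightarrow> ('a \<Rightarrow> 'b) \<Rightarrow> bool" where
  "tol2 F f \<longleftrightarrow> (\<forall>n. l2 (F n)) \<and> l2 f \<and> (\<lambda>n. n2 (\<lambda>x. F n x - f x)) \<longlonglongrightarrow> 0"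

lemma tol2D: "tol2 F f \<Longrightarrow> l2 (F n)" "tol2 F f \<Longrightarrow> l2 f"
  "tol2 F f \<Longrightarrow> (\<lambda>n. n2 (\<lambda>x. F n x - f x)) \<longlonglongrightarrow> 0"
  by (auto simp: tol2_def)

lemma tol2_sqrt: "tol2 F f \<Longrightarrow> (\<lambda>n. sqrt (n2 (\<lambda>x. F n x - f x))) \<longlonglongrightarrow> 0"
  using tendsto_real_sqrt[of _ 0] by (auto simp: tol2_def)

lemma tol2_const: "l2 f \<Longrightarrow> tol2 (\<lambda>_. f) f"
  by (simp add: tol2_def)

lemma tol2_scaleR: "tol2 F f \<Longrightarrow> tol2 (\<lambda>n x. c *\<^sub>R F n x) (\<lambda>x. c *\<^sub>R f x)"
  unfolding tol2_def
  by (auto simp: l2_scaleR n2_scaleR scaleR_diff_right[symmetric] intro: tendsto_mult_right_zero)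

lemma tol2I_bound:
  assumes "\<And>n. l2 (F n)" "l2 f" "\<And>n. sqrt (n2 (\<lambda>x. F n x - f x)) \<le> e n" "e \<longlonglongrightarrow> 0"
  shows "tol2 F f"
proof -
  have "(\<lambda>n. sqrt (n2 (\<lambda>x. F n x - f x))) \<longlonglongrightarrow> 0"
    by (rule tendsto_sandwich[OF _ _ tendsto_const assms(4)]) (use assms(3) in auto)
  then have "(\<lambda>n. (sqrt (n2 (\<lambda>x. F n x - f x)))\<^sup>2) \<longlonglongrightarrow> 0\<^sup>2"
    by (rule tendsto_power)
  then show ?thesis using assms by (simp add: tol2_def)
qed

lemma tol2_add:
  assumes "tol2 F f" "tol2 G g" shows "tol2 (\<lambda>n x. F n x + G n x) (\<lambda>x. f x + g x)"
proof (rule tol2I_bound)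
  show "sqrt (n2 (\<lambda>x. F n x + G n x - (f x + g x))) \<le>
    sqrt (n2 (\<lambda>x. F n x - f x)) + sqrt (n2 (\<lambda>x. G n x - g x))" for n
    using n2_triangle[of "\<lambda>x. F n x - f x" "\<lambda>x. G n x - g x"] assms
    by (simp add: tol2D l2_diff algebra_simps)
  show "(\<lambda>n. sqrt (n2 (\<lambda>x. F n x - f x)) + sqrt (n2 (\<lambda>x. G n x - g x))) \<longlonglongrightarrow> 0"
    using tendsto_add[OF tol2_sqrt[OF assms(1)] tol2_sqrt[OF assms(2)]] by simp
qed (use assms in \<open>auto simp: tol2D l2_add\<close>)

lemma tol2_lipschitz:
  assumes "tol2 F f" "\<And>n. G n \<in> borel_measurable lebesgue" "l2 g" "\<And>n. l2 (\<lambda>x. G n x - g x)"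
    "\<And>n x. norm (G n x - g x) \<le> norm (F n x - f x)"
  shows "tol2 G g"
proof (rule tol2I_bound)
  show "l2 (G n)" for n using l2_add[OF assms(4)[of n] assms(3)] by simp
  show "sqrt (n2 (\<lambda>x. G n x - g x)) \<le> sqrt (n2 (\<lambda>x. F n x - f x))" for n
    using l2_mono(2)[OF l2_diff[OF tol2D(1,2)[OF assms(1)]], of "\<lambda>x. G n x - g x" n] assms(4)[of n] assms(5)
    by (simp add: l2_def)
qed (use assms tol2_sqrt in auto)

lemma tol2_subseq: "tol2 F f \<Longrightarrow> strict_mono r \<Longrightarrow> tol2 (\<lambda>n. F (r n)) f"
  unfolding tol2_def using LIMSEQ_subseq_LIMSEQ[of "\<lambda>n. n2 (\<lambda>x. F n x - f x)" 0 r]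
  by (auto simp: o_def)

lemma tol2_ip:
  assumes "tol2 F f" "tol2 G g" shows "(\<lambda>n. ip (F n) (G n)) \<longlonglongrightarrow> ip f g"
proof -
  have l: "l2 (F n)" "l2 f" "l2 (G n)" "l2 g" for n using assms by (auto simp: tol2D)
  have 1: "(\<lambda>n. sqrt (n2 (\<lambda>x. F n x - f x)) * (sqrt (n2 (\<lambda>x. G n x - g x)) + sqrt (n2 g))
      + sqrt (n2 f) * sqrt (n2 (\<lambda>x. G n x - g x))) \<longlonglongrightarrow> 0 * (0 + sqrt (n2 g)) + sqrt (n2 f) * 0"
    by (intro tendsto_intros tol2_sqrt assms)
  have 2: "\<bar>ip (F n) (G n) - ip f g\<bar> \<le> sqrt (n2 (\<lambda>x. F n x - f x)) * (sqrt (n2 (\<lambda>x. G n x - g x)) + sqrt (n2 g))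
      + sqrt (n2 f) * sqrt (n2 (\<lambda>x. G n x - g x))" for n
  proof -
    have "ip (F n) (G n) - ip f g = ip (\<lambda>x. F n x - f x) (G n) + ip f (\<lambda>x. G n x - g x)"
      using l by (simp add: ip_diff ip_commute[of f] l2_diff)
    moreover have "\<bar>ip (\<lambda>x. F n x - f x) (G n)\<bar> \<le> sqrt (n2 (\<lambda>x. F n x - f x)) * sqrt (n2 (G n))"
      using l by (intro ip_bound l2_diff)
    moreover have "sqrt (n2 (G n)) \<le> sqrt (n2 (\<lambda>x. G n x - g x)) + sqrt (n2 g)"
      using n2_triangle[OF l2_diff[OF l(3,4)] l(4)] by simp
    then have "sqrt (n2 (\<lambda>x. F n x - f x)) * sqrt (n2 (G n)) \<le>
        sqrt (n2 (\<lambda>x. F n x - f x)) * (sqrt (n2 (\<lambda>x. G n x - g x)) + sqrt (n2 g))"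
      by (intro mult_left_mono) auto
    moreover have "\<bar>ip f (\<lambda>x. G n x - g x)\<bar> \<le> sqrt (n2 f) * sqrt (n2 (\<lambda>x. G n x - g x))"
      using l by (intro ip_bound l2_diff)
    ultimately show ?thesis by linarith
  qed
  have "(\<lambda>n. ip (F n) (G n) - ip f g) \<longlonglongrightarrow> 0"
    by (rule Lim_null_comparison[OF _ 1[simplified]]) (use 2 in auto)
  then show ?thesis by (simp add: LIM_zero_iff)
qed

lemma tol2_n2: "tol2 F f \<Longrightarrow> (\<lambda>n. n2 (F n)) \<longlonglongrightarrow> n2 f"
  using tol2_ip[of F f F f] by (simp add: ip_self)

lemma tol2_AE_subseq:
  assumes "tol2 F f"
  obtains r where "strict_mono r" "AE x in lebesgue. (\<lambda>n. F (r n) x) \<longlonglongrightarrow> f x"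
proof -
  have l: "l2 (\<lambda>x. F n x - f x)" for n using assms by (simp add: tol2D l2_diff)
  have "\<exists>r::nat \<Rightarrow> nat. strict_mono r \<and> (AE x in lebesgue. (\<lambda>n. (norm (F (r n) x - f x))\<^sup>2) \<longlonglongrightarrow> 0)"
    by (rule tendsto_L1_AE_subseq) (use l tol2D(3)[OF assms] in \<open>auto simp: l2_def n2_def\<close>)
  then obtain r :: "nat \<Rightarrow> nat" where r: "strict_mono r"
    "AE x in lebesgue. (\<lambda>n. (norm (F (r n) x - f x))\<^sup>2) \<longlonglongrightarrow> 0" by blast
  have "AE x in lebesgue. (\<lambda>n. F (r n) x) \<longlonglongrightarrow> f x"
    using r(2)
  proof eventually_elim
    case (elim x)
    then have "(\<lambda>n. sqrt ((norm (F (r n) x - f x))\<^sup>2)) \<longlonglongrightarrow> sqrt 0" by (rule tendsto_real_sqrt)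
    then show ?case by (simp add: tendsto_norm_zero_iff LIM_zero_iff)
  qed
  then show ?thesis using r(1) that by blast
qed

lemma tol2_dominated:
  assumes "\<And>n. F n \<in> borel_measurable lebesgue" "f \<in> borel_measurable lebesgue" "l2 w"
    and lim: "AE x in lebesgue. (\<lambda>n. F n x) \<longlonglongrightarrow> f x"
    and bd: "\<And>n. AE x in lebesgue. norm (F n x) \<le> norm (w x)"
  shows "tol2 F f"
proof -
  have l: "l2 (F n)" for n by (rule l2_mono(1)[OF assms(3) assms(1) bd])
  have "AE x in lebesgue. \<forall>n. norm (F n x) \<le> norm (w x)" using bd by (simp add: AE_all_countable)
  then have bdf: "AE x in lebesgue. norm (f x) \<le> norm (w x)"
    using lim by eventually_elim (rule LIMSEQ_le_const2[OF tendsto_norm], auto)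
  have lf: "l2 f" by (rule l2_mono(1)[OF assms(3,2) bdf])
  have [measurable]: "F n \<in> borel_measurable lebesgue" "f \<in> borel_measurable lebesgue" for n
    using assms by auto
  have "(\<lambda>n. LINT x|lebesgue. (norm (F n x - f x))\<^sup>2) \<longlonglongrightarrow> (LINT x|(lebesgue :: 'a measure). (0::real))"
  proof (rule integral_dominated_convergence[where w="\<lambda>x. 4 * (norm (w x))\<^sup>2"])
    show "AE x in lebesgue. (\<lambda>n. (norm (F n x - f x))\<^sup>2) \<longlonglongrightarrow> 0"
      using lim
    proof eventually_elim
      case (elim x)
      from tendsto_power[OF tendsto_norm[OF tendsto_diff[OF elim tendsto_const[of "f x"]]], of 2]
      show ?case by simp
    qed
    show "AE x in lebesgue. norm ((norm (F n x - f x))\<^sup>2) \<le> 4 * (norm (w x))\<^sup>2" for n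
      using bd[of n] bdf
    proof eventually_elim
      case (elim x)
      have "norm (F n x - f x) \<le> 2 * norm (w x)" using elim norm_triangle_ineq4[of "F n x" "f x"] by linarith
      then have "(norm (F n x - f x))\<^sup>2 \<le> (2 * norm (w x))\<^sup>2" by (intro power_mono) auto
      then show ?case by simp
    qed
  qed (use assms(3) in \<open>auto simp: l2_def\<close>)
  then show ?thesis using l lf by (simp add: tol2_def n2_def)
qed

lemma l2_Fatou:
  assumes "\<And>n. l2 (F n)" "f \<in> borel_measurable lebesgue"
    and lim: "AE x in lebesgue. (\<lambda>n. F n x) \<longlonglongrightarrow> f x"
    and B: "eventually (\<lambda>n. n2 (F n) \<le> B) sequentially"
  shows "l2 f" "n2 f \<le> B"
proof -
  have [measurable]: "F n \<in> borel_measurable lebesgue" "f \<in> borel_measurable lebesgue" for n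
    using assms by (auto simp: l2_def)
  have B0: "B \<ge> 0"
    using eventually_happens'[OF sequentially_bot B] n2_nonneg order_trans by blast
  have eq: "(\<integral>\<^sup>+x. ennreal ((norm (F n x))\<^sup>2) \<partial>lebesgue) = ennreal (n2 (F n))" for n
    unfolding n2_def using assms(1)[of n] by (intro nn_integral_eq_integral) (auto simp: l2_def)
  have "(\<integral>\<^sup>+x. ennreal ((norm (f x))\<^sup>2) \<partial>lebesgue) =
      (\<integral>\<^sup>+x. liminf (\<lambda>n. ennreal ((norm (F n x))\<^sup>2)) \<partial>lebesgue)"
  proof (rule nn_integral_cong_AE)
    show "AE x in lebesgue. ennreal ((norm (f x))\<^sup>2) = liminf (\<lambda>n. ennreal ((norm (F n x))\<^sup>2))"
      using lim
    proof eventually_elim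
      case (elim x)
      then have "(\<lambda>n. ennreal ((norm (F n x))\<^sup>2)) \<longlonglongrightarrow> ennreal ((norm (f x))\<^sup>2)"
        by (intro tendsto_ennrealI tendsto_intros)
      then show ?case by (intro lim_imp_Liminf[symmetric]) auto
    qed
  qed
  also have "\<dots> \<le> liminf (\<lambda>n. \<integral>\<^sup>+x. ennreal ((norm (F n x))\<^sup>2) \<partial>lebesgue)"
    by (rule nn_integral_liminf) simp
  also have "\<dots> \<le> limsup (\<lambda>n. ennreal (n2 (F n)))"
    unfolding eq by (rule Liminf_le_Limsup) simp
  also have "\<dots> \<le> ennreal B"
    by (rule Limsup_bounded) (use B in \<open>auto elim!: eventually_mono intro: ennreal_leI\<close>)
  finally have le: "(\<integral>\<^sup>+x. ennreal ((norm (f x))\<^sup>2) \<partial>lebesgue) \<le> ennreal B" .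
  have i: "integrable lebesgue (\<lambda>x. (norm (f x))\<^sup>2)"
    using le by (intro integrableI_bounded) (auto simp: less_top[symmetric] top_unique)
  then show "l2 f" by (simp add: l2_def)
  have "ennreal (n2 f) \<le> ennreal B"
    using le i by (simp add: n2_def nn_integral_eq_integral)
  then show "n2 f \<le> B" using B0 by simp
qed

text \<open>Weighting the squared increments by 2^n keeps their integrals summable. At almost every
  point the weighted sum is finite, so the increments are bounded by a geometric sequence of ratio 1
  / sqrt 2.\<close>

lemma l2_rapid_Cauchy_AE:
  fixes F :: "nat \<Rightarrow> 'a::euclidean_space \<Rightarrow> 'b::euclidean_space"
  assumes l: "\<And>n. l2 (F n)" and d: "\<And>n. n2 (\<lambda>x. F (Suc n) x - F n x) \<le> (1 / 4) ^ n"
  shows "AE x in lebesgue. convergent (\<lambda>n. F n x)"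
proof -
  have [measurable]: "F n \<in> borel_measurable lebesgue" for n
    using l by (auto simp: l2_def)
  define s where "s n x = ennreal (2 ^ n * (norm (F (Suc n) x - F n x))\<^sup>2)" for n x
  have s: "(\<integral>\<^sup>+x. s n x \<partial>lebesgue) \<le> ennreal ((1 / 2) ^ n)" for n
  proof -
    have "integrable lebesgue (\<lambda>x. 2 ^ n * (norm (F (Suc n) x - F n x))\<^sup>2)"
      using l2_diff[OF l l] by (simp add: l2_def)
    then have "(\<integral>\<^sup>+x. s n x \<partial>lebesgue) = ennreal (2 ^ n * n2 (\<lambda>x. F (Suc n) x - F n x))"
      unfolding s_def n2_def by (subst nn_integral_eq_integral) auto
    also have "\<dots> \<le> ennreal (2 ^ n * (1 / 4) ^ n)"
      using d[of n] by (intro ennreal_leI mult_left_mono) auto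
    also have "2 ^ n * (1 / 4) ^ n = ((1 / 2) ^ n :: real)"
      by (simp flip: power_mult_distrib)
    finally show ?thesis .
  qed
  have "(\<integral>\<^sup>+x. (\<Sum>n. s n x) \<partial>lebesgue) = (\<Sum>n. \<integral>\<^sup>+x. s n x \<partial>lebesgue)"
    by (rule nn_integral_suminf) (simp add: s_def)
  also have "\<dots> \<le> (\<Sum>n. ennreal ((1 / 2) ^ n))"
    by (intro suminf_le s) auto
  also have "\<dots> = ennreal (\<Sum>n. (1 / 2) ^ n)"
    by (intro suminf_ennreal2) (auto intro: summable_geometric)
  also have "\<dots> < \<infinity>" by simp
  finally have "AE x in lebesgue. (\<Sum>n. s n x) \<noteq> \<infinity>"
    by (intro nn_integral_PInf_AE) (auto simp: s_def)
  then show ?thesis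
  proof eventually_elim
    case (elim x)
    define a where "a n = norm (F (Suc n) x - F n x)" for n
    define C where "C = enn2real (\<Sum>n. s n x)"
    have "a n \<le> sqrt C * (1 / sqrt 2) ^ n" for n
    proof -
      have "s n x \<le> (\<Sum>n. s n x)"
        using sum_le_suminf[of "\<lambda>n. s n x" "{n}"] by simp
      also have "\<dots> = ennreal C" unfolding C_def using elim by (simp add: less_top)
      finally have "2 ^ n * (a n)\<^sup>2 \<le> C"
        unfolding s_def a_def using C_def by (simp add: ennreal_le_iff)
      then have "(a n)\<^sup>2 \<le> C / 2 ^ n" by (simp add: field_simps)
      then have "a n \<le> sqrt (C / 2 ^ n)" by (rule real_le_rsqrt)
      then show ?thesis by (simp add: real_sqrt_divide real_sqrt_power power_divide)
    qed
    moreover have "summable (\<lambda>n. sqrt C * (1 / sqrt 2) ^ n)"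
      by (intro summable_mult summable_geometric) simp
    ultimately have "summable (\<lambda>n. F (Suc n) x - F n x)"
      using summable_comparison_test'[of "\<lambda>n. sqrt C * (1 / sqrt 2) ^ n" 0 "\<lambda>n. F (Suc n) x - F n x"]
      by (simp add: a_def)
    then have "convergent (\<lambda>n. \<Sum>i<n. F (Suc i) x - F i x)"
      by (simp add: summable_iff_convergent)
    then have "convergent (\<lambda>n. (\<Sum>i<n. F (Suc i) x - F i x) + F 0 x)"
      by (intro convergent_add convergent_const)
    then show ?case using sum_lessThan_telescope[of "\<lambda>n. F n x"] by simp
  qed
qed

text \<open>Riesz-Fischer: a rapidly Cauchy subsequence converges almost everywhere, and Fatou's
  lemma applied to \<open>F m - F (r n)\<close> with m fixed upgrades this to convergence in the
  mean of the whole sequence.\<close>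

lemma l2_complete:
  fixes F :: "nat \<Rightarrow> 'a::euclidean_space \<Rightarrow> 'b::euclidean_space"
  assumes l: "\<And>n. l2 (F n)"
    and C: "\<And>e. e > 0 \<Longrightarrow> \<exists>N. \<forall>m\<ge>N. \<forall>n\<ge>N. n2 (\<lambda>x. F m x - F n x) \<le> e"
  obtains f where "tol2 F f"
proof -
  obtain N where N: "\<And>k m n. m \<ge> N k \<Longrightarrow> n \<ge> N k \<Longrightarrow> n2 (\<lambda>x. F m x - F n x) \<le> (1 / 4) ^ k"
    using C[of "(1 / 4) ^ k" for k] by (simp add: choice_iff) metis
  \<comment> \<open>The sum dominates \<open>N k\<close>, and the summand k makes \<open>r\<close>
    strictly increasing.\<close>
  define r where "r k = (\<Sum>i\<le>k. N i) + k" for k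
  have r: "strict_mono r" by (simp add: strict_mono_Suc_iff r_def)
  have rN: "r k \<ge> N k" for k
    unfolding r_def using member_le_sum[of k "{..k}" N] by simp
  have "AE x in lebesgue. convergent (\<lambda>n. F (r n) x)"
  proof (rule l2_rapid_Cauchy_AE[OF l])
    show "n2 (\<lambda>x. F (r (Suc n)) x - F (r n) x) \<le> (1 / 4) ^ n" for n
      by (rule N) (use rN[of n] strict_monoD[OF r, of n "Suc n"] in auto)
  qed
  then have lim: "AE x in lebesgue. (\<lambda>n. F (r n) x) \<longlonglongrightarrow> lim (\<lambda>n. F (r n) x)"
    by eventually_elim (simp add: convergent_LIMSEQ_iff)
  \<comment> \<open>Where the sequence diverges \<open>lim\<close> is an arbitrary value, which
    concerns a null set only.\<close>
  define f where "f x = lim (\<lambda>n. F (r n) x)" for x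
  have [measurable]: "F n \<in> borel_measurable lebesgue" for n using l by (auto simp: l2_def)
  have [measurable]: "f \<in> borel_measurable lebesgue" unfolding f_def by measurable
  have ev: "\<exists>M. \<forall>m\<ge>M. l2 (\<lambda>x. F m x - f x) \<and> n2 (\<lambda>x. F m x - f x) \<le> e" if e: "e > 0" for e
  proof -
    obtain M where M: "\<forall>m\<ge>M. \<forall>n\<ge>M. n2 (\<lambda>x. F m x - F n x) \<le> e" using C[OF e] by blast
    have "l2 (\<lambda>x. F m x - f x) \<and> n2 (\<lambda>x. F m x - f x) \<le> e" if "m \<ge> M" for m
    proof -
      have 1: "AE x in lebesgue. (\<lambda>n. F m x - F (r n) x) \<longlonglongrightarrow> F m x - f x"
        using lim unfolding f_def by eventually_elim (intro tendsto_intros)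
      have 2: "\<forall>\<^sub>F n in sequentially. n2 (\<lambda>x. F m x - F (r n) x) \<le> e"
      proof (rule eventually_sequentiallyI[of M])
        fix n assume "M \<le> n"
        then have "M \<le> r n" using seq_suble[OF r, of n] by linarith
        then show "n2 (\<lambda>x. F m x - F (r n) x) \<le> e" using M that by blast
      qed
      show ?thesis
        using l2_Fatou[OF l2_diff[OF l l] _ 1 2] by simp
    qed
    then show ?thesis by blast
  qed
  have "l2 f"
  proof -
    obtain M where "l2 (\<lambda>x. F M x - f x)" using ev[of 1] by auto
    from l2_diff[OF l this, of M] show ?thesis by simp
  qed
  moreover have "(\<lambda>n. n2 (\<lambda>x. F n x - f x)) \<longlonglongrightarrow> 0"
  proof (rule LIMSEQ_I)
    fix e :: real assume "e > 0"
    then obtain M where "\<forall>m\<ge>M. n2 (\<lambda>x. F m x - f x) \<le> e / 2" using ev[of "e / 2"] by auto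
    then have "norm (n2 (\<lambda>x. F n x - f x) - 0) < e" if "n \<ge> M" for n
      using that \<open>e > 0\<close> n2_nonneg[of "\<lambda>x. F n x - f x"] by fastforce
    then show "\<exists>no. \<forall>n\<ge>no. norm (n2 (\<lambda>x. F n x - f x) - 0) < e" by blast
  qed
  ultimately show ?thesis using l that by (simp add: tol2_def)
qed

section \<open>Mollification\<close>

definition kmass :: "'a::euclidean_space itself \<Rightarrow> real" where
  "kmass _ = (LINT x|lebesgue. psi 2 (1 - (x::'a) \<bullet> x))"

definition kern :: "'a::euclidean_space \<Rightarrow> real \<Rightarrow> 'a \<Rightarrow> real" where
  "kern a r x = psi 2 (1 - (x - a) \<bullet> (x - a) / r\<^sup>2) / (kmass TYPE('a) * r ^ DIM('a))"

lemma csupp_psi: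
  assumes "r > 0" shows "csupp (\<lambda>x. psi m (1 - (x - a) \<bullet> (x - a) / r\<^sup>2))"
  by (rule csuppI[of _ "cball a r"])
    (use assms in \<open>auto intro!: continuous_intros psi_ball_outside simp: dist_norm norm_minus_commute\<close>)

lemma csupp_nonneg_integral_pos:
  fixes f :: "'a::euclidean_space \<Rightarrow> real"
  assumes "csupp f" "\<And>x. f x \<ge> 0" "f a > 0"
  shows "(LINT x|lebesgue. f x) > 0"
proof -
  have i: "integrable lebesgue f" by (rule csupp_integrable[OF assms(1)])
  have c: "continuous_on UNIV f" using assms by (simp add: csupp_def)
  have "(LINT x|lebesgue. f x) \<noteq> 0"
  proof
    assume "(LINT x|lebesgue. f x) = 0"
    then have "AE x in lebesgue. f x = 0"
      using integral_nonneg_eq_0_iff_AE[OF i] assms(2) by simp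
    moreover have op: "open {x. f x \<noteq> 0}"
      using open_Collect_neq[OF c continuous_on_const[of _ 0]] by simp
    ultimately have "negligible {x. f x \<noteq> 0}"
      using AE_iff_null[of lebesgue "\<lambda>x. f x = 0"] by (simp add: negligible_iff_null_sets)
    moreover have "{x. f x \<noteq> 0} \<noteq> {}" using assms(3) by force
    ultimately show False using op open_not_negligible by blast
  qed
  moreover have "(LINT x|lebesgue. f x) \<ge> 0" using assms(2) by simp
  ultimately show ?thesis by linarith
qed

lemma kmass_pos: "kmass TYPE('a::euclidean_space) > 0"
proof -
  have "(LINT x|lebesgue. psi 2 (1 - (x - (0::'a)) \<bullet> (x - 0) / 1\<^sup>2)) > 0"
    by (rule csupp_nonneg_integral_pos[where a="0::'a"]) (use csupp_psi[of 1 2 "0::'a"] in \<open>auto intro: psi_nonneg psi_pos\<close>)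
  then show ?thesis by (simp add: kmass_def)
qed

lemma kern_nonneg: "r > 0 \<Longrightarrow> kern a r x \<ge> 0"
  using kmass_pos[where 'a='a] by (simp add: kern_def psi_nonneg)

lemma kern_outside: "r > 0 \<Longrightarrow> r \<le> norm (x - a) \<Longrightarrow> kern a r x = 0"
  by (simp add: kern_def psi_ball_outside)

lemma kern_translate: "kern a r x = kern 0 r (a - x)"
  by (simp add: kern_def inner_diff_left inner_diff_right inner_commute algebra_simps)

lemma csupp_kern: "r > 0 \<Longrightarrow> csupp (kern a r)"
  using csupp_psi[of r 2 a] unfolding csupp_def kern_def
  by (auto intro!: continuous_intros simp: kmass_pos less_imp_neq[OF kmass_pos, symmetric])

lemma kern_integral:
  fixes a :: "'a::euclidean_space"
  assumes "r > 0" shows "(LINT x|lebesgue. kern a r x) = 1"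
proof -
  have "kern a r \<in> borel_measurable borel" using csupp_kern[OF assms] by (rule csupp_measurable)
  then have "(LINT x|lebesgue. kern a r x) = r ^ DIM('a) * (LINT x|lebesgue. kern a r (a + r *\<^sub>R x))"
    using integral_lebesgue_affine[of "kern a r" r a] assms by simp
  also have "(\<lambda>x. kern a r (a + r *\<^sub>R x)) = (\<lambda>x. psi 2 (1 - x \<bullet> x) / (kmass TYPE('a) * r ^ DIM('a)))"
    using assms by (simp add: kern_def power2_eq_square)
  also have "(LINT x|lebesgue. psi 2 (1 - (x::'a) \<bullet> x) / (kmass TYPE('a) * r ^ DIM('a))) =
      kmass TYPE('a) / (kmass TYPE('a) * r ^ DIM('a))"
    by (simp add: kmass_def)
  finally show ?thesis using assms kmass_pos[where 'a='a] by simp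
qed

lemma test_function_kern:
  assumes "r > 0" "cball a r \<subseteq> S" shows "test_function S (kern a r)"
proof (rule test_function_balg[of _ a r])
  have "(\<lambda>x. psi 2 (1 - (x - a) \<bullet> (x - a) / r\<^sup>2) * (1 / (kmass TYPE('a) * r ^ DIM('a)))) \<in> balg a r"
    by (intro balg_mult balg_psi balg_const)
  then show "kern a r \<in> balg a r" by (simp add: kern_def[abs_def])
qed (use assms kern_outside in auto)

section \<open>Convolutions and their derivatives\<close>

definition cv :: "('a::euclidean_space \<Rightarrow> real) \<Rightarrow> ('a \<Rightarrow> real) \<Rightarrow> 'a \<Rightarrow> real" where
  "cv f k x = (LINT y|lebesgue. f y * k (x - y))"

text \<open>The mean value inequality for \<open>k\<close> minus its linear part at
  \<open>z\<close>, whose gradient \<open>h w - h z\<close> is small on \<open>C\<close>.\<close>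

lemma c1_taylor:
  fixes k :: "'a::euclidean_space \<Rightarrow> real"
  assumes "convex C" "\<And>w. w \<in> C \<Longrightarrow> (k has_derivative (\<lambda>v. h w \<bullet> v)) (at w)"
    "\<And>w. w \<in> C \<Longrightarrow> norm (h w - h z) \<le> e" "z \<in> C" "y \<in> C"
  shows "\<bar>k y - k z - h z \<bullet> (y - z)\<bar> \<le> e * norm (y - z)"
proof -
  have "norm ((k y - h z \<bullet> y) - (k z - h z \<bullet> z)) \<le> e * norm (y - z)"
  proof (rule differentiable_bound[OF assms(1)])
    show "((\<lambda>w. k w - h z \<bullet> w) has_derivative (\<lambda>v. (h w - h z) \<bullet> v)) (at w within C)" if "w \<in> C" for w
      using has_derivative_diff[OF assms(2)[OF that] bounded_linear_imp_has_derivative[OF bounded_linear_inner_right[of "h z"]]]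
      by (auto simp: inner_diff_left intro: has_derivative_at_withinI)
    show "onorm (\<lambda>v. (h w - h z) \<bullet> v) \<le> e" if "w \<in> C" for w
      by (rule onorm_le) (metis Cauchy_Schwarz_ineq2 assms(3)[OF that] mult_right_mono norm_ge_zero order_trans real_norm_def)
  qed (use assms in auto)
  then show ?thesis by (simp add: inner_diff_right algebra_simps)
qed

lemma csupp_reflect:
  assumes "csupp k" shows "csupp (\<lambda>y. k (x - y))"
proof -
  obtain K where K: "compact K" "\<And>x. x \<notin> K \<Longrightarrow> k x = 0" and c: "continuous_on UNIV k"
    using assms unfolding csupp_def by blast
  show ?thesis
  proof (rule csuppI)
    show "continuous_on UNIV (\<lambda>y. k (x - y))"
      by (rule continuous_on_compose2[OF c]) (auto intro!: continuous_intros)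
    show "compact ((\<lambda>y. x - y) ` K)" by (intro compact_continuous_image K continuous_intros)
    show "y \<notin> (\<lambda>y. x - y) ` K \<Longrightarrow> k (x - y) = 0" for y
      by (rule K(2)) (metis diff_diff_eq2 add_diff_cancel_left' image_eqI)
  qed
qed

lemma csupp_times:
  assumes "csupp f" "continuous_on UNIV k" shows "csupp (\<lambda>y. f y *\<^sub>R k y)"
proof -
  obtain K where K: "compact K" "\<And>x. x \<notin> K \<Longrightarrow> f x = 0" and c: "continuous_on UNIV f"
    using assms unfolding csupp_def by blast
  show ?thesis
    by (rule csuppI[OF _ K(1)]) (use K c assms(2) in \<open>auto intro!: continuous_intros\<close>)
qed

text \<open>Uniform continuity of the kernel's gradient yields one Taylor remainder valid for all
  \<open>y\<close>; integrating it against \<open>f\<close> costs the factor \<open>A\<close>.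
  Dividing by \<open>A + 1\<close> instead of \<open>A\<close> covers the case f = 0.\<close>

lemma cv_has_derivative:
  fixes f :: "'a::euclidean_space \<Rightarrow> real"
  assumes f: "csupp f" and k: "c1c UNIV k h"
  shows "(cv f k has_derivative (\<lambda>v. (LINT y|lebesgue. f y *\<^sub>R h (x - y)) \<bullet> v)) (at x)"
  unfolding has_derivative_at_alt
proof (intro conjI allI impI)
  fix e :: real assume e: "e > 0"
  define A where "A = (LINT y|lebesgue. \<bar>f y\<bar>)"
  have fi: "integrable lebesgue f" by (rule csupp_integrable[OF f])
  have A: "A \<ge> 0" by (simp add: A_def)
  have e': "e / (A + 1) > 0" using e A by simp
  obtain d where d: "d > 0" "\<And>x y. norm (x - y) < d \<Longrightarrow> norm (h x - h y) < e / (A + 1)"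
    using csupp_uniform[OF csupp_c1c(2)[OF k] e'] by blast
  have cont: "continuous_on UNIV (\<lambda>y. k (x - y))" "continuous_on UNIV (\<lambda>y. h (x - y))" for x
    using csupp_reflect[OF csupp_c1c(1)[OF k]] csupp_reflect[OF csupp_c1c(2)[OF k]]
    by (auto simp: csupp_def)
  have i1: "integrable lebesgue (\<lambda>y. f y * k (x - y))" for x
    using csupp_integrable[OF csupp_times[OF f cont(1)]] by simp
  have i2: "integrable lebesgue (\<lambda>y. f y *\<^sub>R h (x - y))" for x
    by (rule csupp_integrable[OF csupp_times[OF f cont(2)]])
  show "\<exists>d>0. \<forall>y. norm (y - x) < d \<longrightarrow>
    norm (cv f k y - cv f k x - (LINT y|lebesgue. f y *\<^sub>R h (x - y)) \<bullet> (y - x)) \<le> e * norm (y - x)"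
  proof (intro exI[of _ d] conjI allI impI d(1))
    fix z assume z: "norm (z - x) < d"
    define q where "q y = k (z - y) - k (x - y) - h (x - y) \<bullet> (z - x)" for y
    have q: "\<bar>q y\<bar> \<le> e / (A + 1) * norm (z - x)" for y
    proof -
      have "\<bar>k (z - y) - k (x - y) - h (x - y) \<bullet> ((z - y) - (x - y))\<bar> \<le> e / (A + 1) * norm ((z - y) - (x - y))"
        by (rule c1_taylor[of "ball (x - y) d"])
          (use c1cD(1)[OF k] d z in \<open>auto simp: dist_norm norm_minus_commute intro!: less_imp_le[OF d(2)]\<close>)
      then show ?thesis by (simp add: q_def)
    qed
    have i3: "integrable lebesgue (\<lambda>y. f y * q y)"
      unfolding q_def using i1[of z] i1[of x] integrable_inner_left[OF i2[of x], of "z - x"]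
      by (simp add: right_diff_distrib)
    have "cv f k z - cv f k x - (LINT y|lebesgue. f y *\<^sub>R h (x - y)) \<bullet> (z - x) = (LINT y|lebesgue. f y * q y)"
      unfolding q_def cv_def using i1[of z] i1[of x] integrable_inner_left[OF i2[of x], of "z - x"] i2[of x]
      by (simp add: right_diff_distrib flip: integral_inner_left)
    also have "norm \<dots> \<le> (LINT y|lebesgue. \<bar>f y\<bar> * (e / (A + 1) * norm (z - x)))"
    proof (rule order_trans[OF integral_norm_bound integral_mono])
      show "integrable lebesgue (\<lambda>y. norm (f y * q y))" using i3 by simp
      show "integrable lebesgue (\<lambda>y. \<bar>f y\<bar> * (e / (A + 1) * norm (z - x)))"
        using fi by (intro integrable_mult_left) auto
      show "norm (f y * q y) \<le> \<bar>f y\<bar> * (e / (A + 1) * norm (z - x))" for y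
        using mult_left_mono[OF q, of "\<bar>f y\<bar>"] by (simp add: abs_mult)
    qed
    also have "\<dots> = A * (e / (A + 1) * norm (z - x))" by (simp add: A_def)
    also have "\<dots> \<le> e * norm (z - x)"
    proof -
      have "A * e / (A + 1) \<le> e" using A e by (simp add: field_simps)
      then show ?thesis using mult_right_mono[of "A * e / (A + 1)" e "norm (z - x)"] by simp
    qed
    finally show "norm (cv f k z - cv f k x - (LINT y|lebesgue. f y *\<^sub>R h (x - y)) \<bullet> (z - x)) \<le> e * norm (z - x)" .
  qed
qed (rule bounded_linear_inner_right)

lemma test_function_partial:
  assumes "test_function S k" "b \<in> Basis"
  shows "test_function S (\<lambda>x. frechet_derivative k (at x) b)"
proof -
  obtain K where K: "compact K" "K \<subseteq> S" "\<And>x. x \<notin> K \<Longrightarrow> grad k x = 0"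
    using c1c_supp[OF c1c_test_function[OF assms(1)]] by metis
  show ?thesis
  proof (rule test_functionI[OF _ K(1,2)])
    show "smooth (\<lambda>x. frechet_derivative k (at x) b)"
      using assms by (intro smooth_partial) (simp add: test_function_def)
    show "x \<notin> K \<Longrightarrow> frechet_derivative k (at x) b = 0" for x
      using K(3)[of x] grad_inner[OF assms(2), of k x] by simp
  qed
qed

lemma cv_partial:
  assumes f: "csupp f" and k: "test_function UNIV k" and b: "b \<in> Basis"
  shows "frechet_derivative (cv f k) (at x) b = cv f (\<lambda>x. frechet_derivative k (at x) b) x"
proof -
  note c = c1c_test_function[OF k]
  have i2: "integrable lebesgue (\<lambda>y. f y *\<^sub>R grad k (x - y))"
    using csupp_reflect[OF csupp_c1c(2)[OF c]]
    by (intro csupp_integrable csupp_times f) (auto simp: csupp_def)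
  have "frechet_derivative (cv f k) (at x) = (\<lambda>v. (LINT y|lebesgue. f y *\<^sub>R grad k (x - y)) \<bullet> v)"
    using frechet_derivative_at[OF cv_has_derivative[OF f c]] by simp
  then show ?thesis
    using b i2 by (simp add: cv_def grad_inner flip: integral_inner_left)
qed

text \<open>All derivatives fall on the kernel. Its partial derivatives are again test functions, so
  the induction has to generalise over \<open>k\<close>.\<close>

lemma cv_Ck:
  assumes "csupp f" shows "test_function UNIV k \<Longrightarrow> Ck n (cv f k)"
proof (induction n arbitrary: k)
  case 0
  then show ?case
    by (auto intro!: continuous_at_imp_continuous_on has_derivative_continuous
      intro: cv_has_derivative[OF assms c1c_test_function])
next
  case (Suc n)
  have "cv f k differentiable (at x)" for x
    unfolding differentiable_def using cv_has_derivative[OF assms c1c_test_function[OF Suc.prems]] by blast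
  moreover have "Ck n (\<lambda>x. frechet_derivative (cv f k) (at x) b)" if "b \<in> Basis" for b
    using Suc.IH[OF test_function_partial[OF Suc.prems that]] cv_partial[OF assms Suc.prems that]
    by (simp add: cv_def)
  ultimately show ?case by simp
qed

lemma csupp_l2: "csupp f \<Longrightarrow> l2 f"
proof -
  assume f: "csupp f"
  then obtain K where K: "compact K" "\<And>x. x \<notin> K \<Longrightarrow> f x = 0" and c: "continuous_on UNIV f"
    unfolding csupp_def by blast
  have "csupp (\<lambda>x. (norm (f x))\<^sup>2)"
    by (rule csuppI[OF _ K(1)]) (use K c in \<open>auto intro!: continuous_intros\<close>)
  then show ?thesis using csupp_measurable(2)[OF f] by (auto simp: l2_def intro: csupp_integrable)
qed

lemma l2_indicator_lmeasurable:
  assumes "K \<in> lmeasurable" shows "l2 (\<lambda>x. indicator K x :: real)" "n2 (\<lambda>x. indicator K x :: real) = measure lebesgue K"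
proof -
  have sq: "(norm (indicator K x :: real))\<^sup>2 = indicator K x" for x by (simp add: indicator_def)
  show "l2 (\<lambda>x. indicator K x :: real)" "n2 (\<lambda>x. indicator K x :: real) = measure lebesgue K"
    using assms unfolding l2_def n2_def sq by (auto simp: fmeasurable_def)
qed

lemma c1c_l2: "c1c S f h \<Longrightarrow> l2 f" "c1c S f h \<Longrightarrow> l2 h"
  by (auto intro: csupp_l2 csupp_c1c)

definition mollify :: "('a::euclidean_space \<Rightarrow> 'b::euclidean_space) \<Rightarrow> real \<Rightarrow> 'a \<Rightarrow> 'b" where
  "mollify f r x = (LINT y|lebesgue. kern x r y *\<^sub>R f y)"

lemma mollify_integrable:
  fixes f :: "'a::euclidean_space \<Rightarrow> 'b::euclidean_space"
  shows "csupp f \<Longrightarrow> r > 0 \<Longrightarrow> integrable lebesgue (\<lambda>y. kern x r y *\<^sub>R f y)"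
  by (rule csupp_integrable, rule csupp_times[OF csupp_kern]) (auto simp: csupp_def)

text \<open>Averages with respect to a probability density stay in the closed ball that contains the
  values. With c = 0 this is a uniform bound, with c = f x an approximation estimate.\<close>

lemma mollify_close:
  assumes "csupp f" "r > 0" "\<And>y. norm (x - y) < r \<Longrightarrow> norm (f y - c) \<le> e"
  shows "norm (mollify f r x - c) \<le> e"
proof -
  have k: "integrable lebesgue (kern x r)" by (intro csupp_integrable csupp_kern assms)
  have i: "integrable lebesgue (\<lambda>y. kern x r y *\<^sub>R (f y - c))"
    using mollify_integrable[OF assms(1,2), of x] k by (simp add: scaleR_diff_right)
  have "mollify f r x - c = (LINT y|lebesgue. kern x r y *\<^sub>R (f y - c))"
    unfolding mollify_def using mollify_integrable[OF assms(1,2), of x] k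
    by (simp add: scaleR_diff_right integral_scaleR_left kern_integral assms)
  also have "norm \<dots> \<le> (LINT y|lebesgue. e * kern x r y)"
  proof (rule order_trans[OF integral_norm_bound integral_mono])
    show "norm (kern x r y *\<^sub>R (f y - c)) \<le> e * kern x r y" for y
    proof (cases "norm (x - y) < r")
      case True
      then show ?thesis using mult_right_mono[OF assms(3)[OF True] kern_nonneg[OF assms(2)], of x y] kern_nonneg[OF assms(2)]
        by (metis abs_of_nonneg assms(2) kern_nonneg mult.commute norm_scaleR)
    next
      case False
      then have "kern x r y = 0" using kern_outside[OF assms(2), of y x] by (simp add: norm_minus_commute)
      then show ?thesis by simp
    qed
  qed (use i[THEN integrable_norm] k in auto)
  also have "\<dots> = e" by (simp add: kern_integral assms)
  finally show ?thesis .
qed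

lemma mollify_outside:
  assumes "r > 0" "\<And>y. norm (x - y) < r \<Longrightarrow> f y = 0"
  shows "mollify f r x = 0"
proof -
  have "kern x r y *\<^sub>R f y = 0" for y
    using assms kern_outside[OF assms(1), of y x] by (cases "norm (x - y) < r") (auto simp: norm_minus_commute)
  then have "(\<lambda>y. kern x r y *\<^sub>R f y) = (\<lambda>y. 0)" by blast
  then show ?thesis by (simp add: mollify_def)
qed

lemma mollify_cv: "mollify f r = cv f (kern (0::'a::euclidean_space) r)"
proof
  fix x :: 'a
  have "kern x r y = kern 0 r (x - y)" for y by (rule kern_translate)
  then show "mollify f r x = cv f (kern 0 r) x" by (simp add: mollify_def cv_def mult.commute)
qed

lemma test_function_cvv:
  assumes "csupp f" "compact K" "r > 0" "\<And>x. x \<notin> K \<Longrightarrow> f x = 0" "(\<Union>x\<in>K. cball x r) \<subseteq> S"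
  shows "test_function S (mollify f r)"
proof (rule test_functionI)
  show "smooth (mollify f r)"
    unfolding smooth_def mollify_cv using assms by (auto intro: cv_Ck test_function_kern)
  show "compact {x + y |x y. x \<in> K \<and> y \<in> cball 0 r}" using assms by (intro compact_sums) auto
  show "{x + y |x y. x \<in> K \<and> y \<in> cball 0 r} \<subseteq> S"
  proof safe
    fix x y :: 'a assume "x \<in> K" "y \<in> cball 0 r"
    then have "x + y \<in> (\<Union>x\<in>K. cball x r)" by (intro UN_I[of x]) (auto simp: dist_norm)
    then show "x + y \<in> S" using assms by blast
  qed
  fix x assume x: "x \<notin> {x + y |x y. x \<in> K \<and> y \<in> cball 0 r}"
  show "mollify f r x = 0"
  proof (rule mollify_outside[OF assms(3)])
    fix y assume "norm (x - y) < r"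
    then have "x - y \<in> cball 0 r" by simp
    moreover have "x = y + (x - y)" by simp
    ultimately have "y \<notin> K" using x by blast
    then show "f y = 0" by (rule assms(4))
  qed
qed

lemma mollify_tol2:
  assumes "csupp f" "d > 0" "\<And>n. mollify f (d / Suc n) \<in> borel_measurable lebesgue"
  shows "tol2 (\<lambda>n. mollify f (d / Suc n)) f"
proof -
  obtain K where K: "compact K" "\<And>x. x \<notin> K \<Longrightarrow> f x = 0"
    using assms(1) unfolding csupp_def by blast
  obtain B where B: "B > 0" "\<And>x. norm (f x) \<le> B" using csupp_bounded[OF assms(1)] by blast
  define K' where "K' = {x + y |x y. x \<in> K \<and> y \<in> cball 0 d}"
  have K': "compact K'" unfolding K'_def using K by (intro compact_sums) auto
  have r: "0 < d / Suc n" "d / Suc n \<le> d" for n using assms(2) by (auto simp: field_simps)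
  show ?thesis
  proof (rule tol2_dominated[OF assms(3) csupp_measurable(2)[OF assms(1)]])
    show "l2 (\<lambda>x. B * indicator K' x)"
      by (intro l2_cmult l2_indicator_lmeasurable lmeasurable_compact K')
    show "AE x in lebesgue. norm (mollify f (d / Suc n) x) \<le> norm (B * indicator K' x)" for n
    proof (rule AE_I2)
      fix x :: 'a
      show "norm (mollify f (d / Suc n) x) \<le> norm (B * indicator K' x)"
      proof (cases "x \<in> K'")
        case True
        have "norm (mollify f (d / Suc n) x - 0) \<le> B"
          by (rule mollify_close[OF assms(1) r(1)]) (use B in auto)
        then show ?thesis using True B by simp
      next
        case False
        have "mollify f (d / Suc n) x = 0"
        proof (rule mollify_outside[OF r(1)])
          fix y assume y: "norm (x - y) < d / Suc n"
          have "y \<notin> K"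
          proof
            assume "y \<in> K"
            moreover have "x - y \<in> cball 0 d" using y r(2)[of n] by simp
            ultimately have "y + (x - y) \<in> K'" unfolding K'_def by blast
            then show False using False by simp
          qed
          then show "f y = 0" by (rule K(2))
        qed
        then show ?thesis by simp
      qed
    qed
    have "(\<lambda>n. mollify f (d / Suc n) x) \<longlonglongrightarrow> f x" for x
    proof (rule LIMSEQ_I)
      fix e :: real assume "e > 0"
      then obtain s where s: "s > 0" "\<And>x y. norm (x - y) < s \<Longrightarrow> norm (f x - f y) < e / 2"
        using csupp_uniform[OF assms(1), of "e / 2"] by auto
      obtain N where N: "d / Suc N < s"
      proof -
        obtain N where "d / s < real N" using reals_Archimedean2 by blast
        then have "d / Suc N < s" using s(1) by (simp add: field_simps)
        then show ?thesis using that by blast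
      qed
      have "norm (mollify f (d / Suc n) x - f x) \<le> e / 2" if "n \<ge> N" for n
      proof (rule mollify_close[OF assms(1) r(1)])
        fix y assume "norm (x - y) < d / Suc n"
        moreover have "d / Suc n \<le> d / Suc N" using that assms(2) by (intro divide_left_mono) auto
        ultimately have "norm (y - x) < s" using N by (simp add: norm_minus_commute)
        then show "norm (f y - f x) \<le> e / 2" by (intro less_imp_le s)
      qed
      then show "\<exists>no. \<forall>n\<ge>no. norm (mollify f (d / Suc n) x - f x) < e"
        using \<open>e > 0\<close> by (intro exI[of _ N]) fastforce
    qed
    then show "AE x in lebesgue. (\<lambda>n. mollify f (d / Suc n) x) \<longlonglongrightarrow> f x" by simp
  qed
qed

text \<open>Differentiation under the integral puts the gradient on the kernel; integrating by parts
  in \<open>y\<close> moves it to \<open>f\<close>. The sign from the parts cancels the one from the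
  reflected argument x - y.\<close>

lemma grad_cvv:
  assumes "c1c UNIV f h" "r > 0" shows "grad (mollify f r) x = mollify h r x"
proof (rule euclidean_eqI)
  fix b :: 'a assume b: "b \<in> Basis"
  have k: "test_function UNIV (kern 0 r :: 'a \<Rightarrow> real)" using assms by (intro test_function_kern) auto
  note f = csupp_c1c(1)[OF assms(1)] note h = csupp_c1c(2)[OF assms(1)]
  note kk = c1c_test_function[OF k]
  have c: "c1 UNIV (\<lambda>y. kern 0 r (x - y)) (\<lambda>y. - grad (kern 0 r) (x - y))"
    unfolding c1_def
  proof safe
    show "((\<lambda>y. kern 0 r (x - y)) has_derivative (\<lambda>v. - grad (kern 0 r) (x - y) \<bullet> v)) (at y)" for y
    proof -
      have "((\<lambda>y. x - y) has_derivative (\<lambda>v. - v)) (at y)" by (auto intro!: derivative_eq_intros)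
      from has_derivative_compose[OF this c1cD(1)[OF kk]] show ?thesis by simp
    qed
    show "continuous_on UNIV (\<lambda>y. - grad (kern 0 r) (x - y))"
      using csupp_reflect[OF csupp_c1c(2)[OF kk], of x] by (auto simp: csupp_def intro!: continuous_intros)
  qed
  have i1: "integrable lebesgue (\<lambda>y. f y *\<^sub>R grad (kern 0 r) (x - y))"
    using csupp_reflect[OF csupp_c1c(2)[OF kk]]
    by (intro csupp_integrable csupp_times f) (auto simp: csupp_def)
  note i2 = mollify_integrable[OF h assms(2), of x]
  have "0 = (LINT y|lebesgue. (kern 0 r (x - y) *\<^sub>R h y + f y *\<^sub>R - grad (kern 0 r) (x - y)) \<bullet> b)"
    by (rule integral_grad_zero[OF c1c_mult[OF open_UNIV assms(1) c], symmetric])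
  also have "\<dots> = mollify h r x \<bullet> b - (LINT y|lebesgue. f y *\<^sub>R grad (kern 0 r) (x - y)) \<bullet> b"
  proof -
    have "integrable lebesgue (\<lambda>y. kern 0 r (x - y) *\<^sub>R h y)" using i2 by (simp add: kern_translate[of x])
    from integrable_inner_left[OF this, of b] integrable_inner_left[OF i1, of b]
    show ?thesis using i1 i2 by (simp add: mollify_def inner_diff_left kern_translate[of x] flip: integral_inner_left)
  qed
  also have "(LINT y|lebesgue. f y *\<^sub>R grad (kern 0 r) (x - y)) \<bullet> b = grad (mollify f r) x \<bullet> b"
    using frechet_derivative_at[OF cv_has_derivative[OF f kk, of x]] b
    by (simp add: grad_inner mollify_cv)
  finally show "grad (mollify f r) x \<bullet> b = mollify h r x \<bullet> b" by simp
qed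

lemma csupp_approx:
  assumes "open S" "csupp f" "compact K" "K \<subseteq> S" "\<And>x. x \<notin> K \<Longrightarrow> f x = 0"
  obtains d where "d > 0" "\<And>n. test_function S (mollify f (d / Suc n))" "tol2 (\<lambda>n. mollify f (d / Suc n)) f"
proof -
  obtain d where d: "d > 0" "(\<Union>x\<in>K. cball x d) \<subseteq> S"
    using compact_subset_open_imp_cball_epsilon_subset[OF assms(3,1,4)] by blast
  have r: "0 < d / Suc n" "d / Suc n \<le> d" for n using d(1) by (auto simp: field_simps)
  have t: "test_function S (mollify f (d / Suc n))" for n
  proof (rule test_function_cvv[OF assms(2,3) r(1) assms(5)])
    show "(\<Union>x\<in>K. cball x (d / real (Suc n))) \<subseteq> S"
      using d(2) r(2)[of n] by force
  qed
  show ?thesis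
    by (rule that[OF d(1) t mollify_tol2[OF assms(2) d(1)]])
      (rule csupp_measurable(2)[OF csupp_c1c(1)[OF c1c_test_function[OF t]]])
qed

lemma c1c_approx:
  assumes "open S" "c1c S f h"
  obtains \<phi> where "\<And>n. test_function S (\<phi> n)" "tol2 \<phi> f" "tol2 (\<lambda>n. grad (\<phi> n)) h"
proof -
  obtain K where K: "compact K" "K \<subseteq> S" "\<And>x. x \<notin> K \<Longrightarrow> f x = 0"
    using c1c_supp[OF assms(2)] by metis
  obtain d where d: "d > 0" "\<And>n. test_function S (mollify f (d / Suc n))" "tol2 (\<lambda>n. mollify f (d / Suc n)) f"
    using csupp_approx[OF assms(1) csupp_c1c(1)[OF assms(2)] K] by blast
  have g: "grad (mollify f (d / Suc n)) = mollify h (d / Suc n)" for n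
    using grad_cvv[OF c1c_mono[OF assms(2)]] d(1) by auto
  have "tol2 (\<lambda>n. mollify h (d / Suc n)) h"
    by (rule mollify_tol2[OF csupp_c1c(2)[OF assms(2)] d(1)])
      (unfold g[symmetric], rule csupp_measurable(2)[OF csupp_c1c(2)[OF c1c_test_function[OF d(2)]]])
  then show ?thesis using that[OF d(2,3)] g by simp
qed

section \<open>Weak gradients and the closure of the test functions\<close>

lemma orthogonal_csupp:
  fixes g :: "'a::euclidean_space \<Rightarrow> real"
  assumes "open S" "l2 g" and t: "\<And>\<phi>. test_function S \<phi> \<Longrightarrow> ip g \<phi> = 0"
    and f: "csupp f" "compact K" "K \<subseteq> S" "\<And>x. x \<notin> K \<Longrightarrow> f x = 0"
  shows "ip g f = 0"
proof -
  obtain d where d: "d > 0" "\<And>n. test_function S (mollify f (d / Suc n))" "tol2 (\<lambda>n. mollify f (d / Suc n)) f"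
    using csupp_approx[OF assms(1) f] by blast
  have "(\<lambda>n. ip g (mollify f (d / Suc n))) \<longlonglongrightarrow> ip g f"
    by (rule tol2_ip[OF tol2_const[OF assms(2)] d(3)])
  then show ?thesis using t[OF d(2)] by (simp add: LIMSEQ_const_iff)
qed

text \<open>The continuous functions \<open>p n\<close> decrease to the indicator of
  \<open>C\<close> and are supported in one compact subset of \<open>S\<close>, so
  \<open>orthogonal_csupp\<close> applies to them. Dominated convergence makes the integral of
  \<open>g\<close> over \<open>C\<close> vanish although \<open>g\<close> is positive there.\<close>

lemma orthogonal_compact:
  fixes g :: "'a::euclidean_space \<Rightarrow> real"
  assumes "open S" "l2 g" and t: "\<And>\<phi>. test_function S \<phi> \<Longrightarrow> ip g \<phi> = 0"
    and C: "compact C" "C \<subseteq> S" and pos: "\<And>x. x \<in> C \<Longrightarrow> g x > 0"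
  shows "C \<in> null_sets lebesgue"
proof (cases "C = {}")
  case False
  have Cm: "C \<in> sets lebesgue" "emeasure lebesgue C < \<infinity>"
    using lmeasurable_compact[OF C(1)] by (auto simp: fmeasurable_def)
  obtain d where d: "d > 0" "(\<Union>x\<in>C. cball x d) \<subseteq> S"
    using compact_subset_open_imp_cball_epsilon_subset[OF C(1) assms(1) C(2)] by blast
  define K where "K = {x + y |x y. x \<in> C \<and> y \<in> cball 0 d}"
  have K: "compact K" unfolding K_def using C by (intro compact_sums) auto
  have KS: "K \<subseteq> S"
  proof
    fix z assume "z \<in> K"
    then obtain x y where "z = x + y" "x \<in> C" "y \<in> cball 0 d" unfolding K_def by blast
    then have "z \<in> (\<Union>x\<in>C. cball x d)" by (intro UN_I[of x]) (auto simp: dist_norm)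
    then show "z \<in> S" using d by blast
  qed
  define p where "p n x = max 0 (1 - real (Suc n) / d * infdist x C)" for n x
  have p01: "0 \<le> p n x" "p n x \<le> 1" for n x using d(1) by (auto simp: p_def infdist_nonneg)
  have pK: "p n x = 0" if "x \<notin> K" for n x
  proof -
    obtain y where y: "y \<in> C" "infdist x C = dist x y"
      using infdist_attains_inf[OF compact_imp_closed[OF C(1)] False] by blast
    have "dist x y > d"
    proof (rule ccontr)
      assume "\<not> dist x y > d"
      then have "x - y \<in> cball 0 d" by (simp add: dist_norm norm_minus_commute)
      then have "y + (x - y) \<in> K" unfolding K_def using y(1) by blast
      then show False using that by simp
    qed
    then have "d < infdist x C" using y by simp
    then have "1 < infdist x C / d" using d(1) by simp
    also have "\<dots> \<le> real (Suc n) * (infdist x C / d)"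
      using \<open>1 < infdist x C / d\<close> mult_right_mono[of 1 "real (Suc n)" "infdist x C / d"] by simp
    finally show ?thesis by (simp add: p_def)
  qed
  have pc: "csupp (p n)" for n
  proof (rule csuppI[OF _ K])
    show "continuous_on UNIV (p n)"
      unfolding p_def using d(1) by (intro continuous_intros) auto
  qed (rule pK)
  have gC: "integrable lebesgue (\<lambda>x. indicator C x * g x)"
  proof -
    have "l2 (\<lambda>x. indicator C x :: real)" by (intro l2_indicator_lmeasurable lmeasurable_compact C)
    from ip_integrable[OF this assms(2)] show ?thesis by simp
  qed
  have gK: "integrable lebesgue (\<lambda>x. indicator K x * g x)"
  proof -
    have "l2 (\<lambda>x. indicator K x :: real)" by (intro l2_indicator_lmeasurable lmeasurable_compact K)
    from ip_integrable[OF this assms(2)] show ?thesis by simp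
  qed
  have "(\<lambda>n. LINT x|lebesgue. g x * p n x) \<longlonglongrightarrow> (LINT x|lebesgue. indicator C x * g x)"
  proof (rule integral_dominated_convergence[where w="\<lambda>x. \<bar>indicator K x * g x\<bar>"])
    show "(\<lambda>x. g x * p n x) \<in> borel_measurable lebesgue" for n
      using assms(2) csupp_measurable(2)[OF pc[of n]] by (intro borel_measurable_times) (auto simp: l2_def)
    show "AE x in lebesgue. norm (g x * p n x) \<le> \<bar>indicator K x * g x\<bar>" for n
    proof (rule AE_I2)
      fix x :: 'a
      show "norm (g x * p n x) \<le> \<bar>indicator K x * g x\<bar>"
        using p01[of n x] pK[of x n] mult_left_le[of "p n x" "\<bar>g x\<bar>"] by (cases "x \<in> K") (auto simp: abs_mult)
    qed
    have "(\<lambda>n. g x * p n x) \<longlonglongrightarrow> indicator C x * g x" for x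
    proof (cases "x \<in> C")
      case True
      then show ?thesis by (simp add: p_def)
    next
      case F: False
      then have i: "infdist x C > 0" using infdist_pos_not_in_closed[OF compact_imp_closed[OF C(1)] False] by blast
      obtain N where N: "real N > d / infdist x C" using reals_Archimedean2 by blast
      have "p n x = 0" if "n \<ge> N" for n
      proof -
        have "d / infdist x C < real (Suc n)" using N that by linarith
        then have "1 < real (Suc n) / d * infdist x C" using i d(1) by (simp add: field_simps)
        then show ?thesis by (simp add: p_def)
      qed
      then have "\<forall>\<^sub>F n in sequentially. g x * p n x = 0"
        by (intro eventually_sequentiallyI[of N]) simp
      then show ?thesis using F by (simp add: tendsto_eventually)
    qed
    then show "AE x in lebesgue. (\<lambda>n. g x * p n x) \<longlonglongrightarrow> indicator C x * g x" by simp
  qed (use gC gK in auto)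
  moreover have "(LINT x|lebesgue. g x * p n x) = 0" for n
    using orthogonal_csupp[OF assms(1,2) t pc K KS] pK by (simp add: ip_def)
  ultimately have "(LINT x|lebesgue. indicator C x * g x) = 0" by (simp add: LIMSEQ_const_iff)
  then have "AE x in lebesgue. indicator C x * g x = 0"
    using integral_nonneg_eq_0_iff_AE[OF gC] pos by (force simp: indicator_def intro: less_imp_le)
  then have "AE x in lebesgue. x \<notin> C"
    by eventually_elim (use pos in \<open>fastforce simp: indicator_def split: if_splits\<close>)
  then show ?thesis using Cm AE_iff_null_sets by blast
qed auto

text \<open>Inner regularity: up to a null set, the part of \<open>S\<close> where \<open>g\<close>
  is positive is a countable union of compact sets, each of which is null by the previous
  lemma.\<close>

lemma orthogonal_pos:
  fixes g :: "'a::euclidean_space \<Rightarrow> real"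
  assumes "open S" "l2 g" and t: "\<And>\<phi>. test_function S \<phi> \<Longrightarrow> ip g \<phi> = 0"
  shows "AE x in lebesgue. x \<in> S \<longrightarrow> g x \<le> 0"
proof -
  have [measurable]: "g \<in> borel_measurable lebesgue" "S \<in> sets lebesgue"
    using assms by (auto simp: l2_def)
  define A where "A = {x \<in> S. g x > 0}"
  have "A \<in> sets lebesgue" unfolding A_def by measurable
  then obtain C T where CT: "fsigma C" "T \<in> null_sets lebesgue" "C \<union> T = A" "disjnt C T"
    by (rule lebesgue_set_almost_fsigma)
  then obtain F :: "nat \<Rightarrow> 'a set" where F: "range F \<subseteq> Collect compact" "C = \<Union>(F ` UNIV)"
    unfolding fsigma_Union_compact by blast
  have "F n \<in> null_sets lebesgue" for n
  proof (rule orthogonal_compact[OF assms(1,2) t])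
    have "F n \<subseteq> A" using F CT by blast
    then show "F n \<subseteq> S" "\<And>x. x \<in> F n \<Longrightarrow> g x > 0" unfolding A_def by auto
  qed (use F in auto)
  then have "C \<in> null_sets lebesgue" unfolding F by (intro null_sets_UN) auto
  then have "A \<in> null_sets lebesgue" using CT by (metis null_sets.Un)
  then show ?thesis by (rule AE_I'[of A]) (auto simp: A_def)
qed

lemma fundamental_lemma:
  fixes g :: "'a::euclidean_space \<Rightarrow> real"
  assumes "open S" "l2 g" and t: "\<And>\<phi>. test_function S \<phi> \<Longrightarrow> ip g \<phi> = 0"
  shows "AE x in lebesgue. x \<in> S \<longrightarrow> g x = 0"
proof -
  have "AE x in lebesgue. x \<in> S \<longrightarrow> - g x \<le> 0"
    by (rule orthogonal_pos[OF assms(1)])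
      (use assms l2_cmult[of g "-1"] in \<open>auto simp: ip_def\<close>)
  moreover have "AE x in lebesgue. x \<in> S \<longrightarrow> g x \<le> 0" by (rule orthogonal_pos) (fact assms)+
  ultimately show ?thesis by eventually_elim auto
qed

section \<open>Weak gradients and their uniqueness\<close>

lemma norm_indicator_power2:
  "(norm (indicator S x *\<^sub>R y))\<^sup>2 = indicator S x *\<^sub>R (norm y)\<^sup>2"
  by (simp add: indicator_def)

lemma L2_iff: "S \<in> sets lebesgue \<Longrightarrow> f \<in> L2 S \<longleftrightarrow> l2 (\<lambda>x. indicator S x *\<^sub>R f x)"
  unfolding L2_def l2_def norm_indicator_power2
  by (simp add: borel_measurable_restrict_space_iff integrable_restrict_space)

lemma integral_on: "S \<in> sets lebesgue \<Longrightarrow>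
   (LINT x|lebesgue_on S. (f x :: real)) = (LINT x|lebesgue. indicator S x * f x)"
  by (subst integral_restrict_space) auto

text \<open>Written with \<open>ip\<close> on the whole space, weak derivatives become bilinear
  identities between square-integrable functions and pass to limits by
  \<open>tol2_ip\<close>.\<close>

lemma has_weak_gradient_iff:
  assumes "open S"
  shows "has_weak_gradient S u g \<longleftrightarrow> (\<forall>\<phi>. test_function S \<phi> \<longrightarrow> (\<forall>b\<in>Basis.
    ip (\<lambda>x. indicator S x * u x) (\<lambda>x. grad \<phi> x \<bullet> b) = - ip (\<lambda>x. (indicator S x *\<^sub>R g x) \<bullet> b) \<phi>))"
  using assms unfolding has_weak_gradient_def
  by (simp add: integral_on ip_def grad_inner mult.assoc)

lemma weak_gradient_unique:
  assumes S: "open S" and g: "g1 \<in> L2 S" "g2 \<in> L2 S" "has_weak_gradient S u g1" "has_weak_gradient S u g2"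
  shows "AE x in lebesgue. x \<in> S \<longrightarrow> g1 x = g2 x"
proof -
  have l: "l2 (\<lambda>x. indicator S x *\<^sub>R g1 x)" "l2 (\<lambda>x. indicator S x *\<^sub>R g2 x)"
    using g S by (auto simp: L2_iff)
  have lb: "l2 (\<lambda>x. f x \<bullet> b)" if "l2 f" for f :: "'a \<Rightarrow> 'a" and b
    by (rule l2_bound(1)[OF that, of _ "norm b"])
      (use that in \<open>auto simp: l2_def mult.commute[of "norm b"] Cauchy_Schwarz_ineq2\<close>)
  have "AE x in lebesgue. \<forall>b\<in>Basis. x \<in> S \<longrightarrow> (indicator S x *\<^sub>R g1 x) \<bullet> b - (indicator S x *\<^sub>R g2 x) \<bullet> b = 0"
  proof (rule AE_finite_allI[OF finite_Basis])
    fix b :: 'a assume b: "b \<in> Basis"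
    show "AE x in lebesgue. x \<in> S \<longrightarrow> (indicator S x *\<^sub>R g1 x) \<bullet> b - (indicator S x *\<^sub>R g2 x) \<bullet> b = 0"
    proof (rule fundamental_lemma[OF S l2_diff[OF lb[OF l(1)] lb[OF l(2)]]])
      fix \<phi> assume t: "test_function S \<phi>"
      have "l2 \<phi>" using c1c_l2(1)[OF c1c_test_function[OF t]] .
      then have "ip (\<lambda>x. (indicator S x *\<^sub>R g1 x) \<bullet> b - (indicator S x *\<^sub>R g2 x) \<bullet> b) \<phi> =
          ip (\<lambda>x. (indicator S x *\<^sub>R g1 x) \<bullet> b) \<phi> - ip (\<lambda>x. (indicator S x *\<^sub>R g2 x) \<bullet> b) \<phi>"
        by (rule ip_diff[OF lb[OF l(1)] lb[OF l(2)]])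
      also have "ip (\<lambda>x. (indicator S x *\<^sub>R g1 x) \<bullet> b) \<phi> = ip (\<lambda>x. (indicator S x *\<^sub>R g2 x) \<bullet> b) \<phi>"
        using g(3,4)[unfolded has_weak_gradient_iff[OF S], rule_format, OF t b] by linarith
      finally show "ip (\<lambda>x. (indicator S x *\<^sub>R g1 x) \<bullet> b - (indicator S x *\<^sub>R g2 x) \<bullet> b) \<phi> = 0"
        by simp
    qed
  qed
  then show ?thesis
  proof eventually_elim
    case (elim x)
    show ?case
    proof
      assume "x \<in> S"
      then show "g1 x = g2 x" using elim by (auto intro: euclidean_eqI[of "g1 x" "g2 x"])
    qed
  qed
qed

lemma weak_grad_props:
  assumes S: "open S" and g: "g \<in> L2 S" "has_weak_gradient S u g"
  shows "weak_grad S u \<in> L2 S" "has_weak_gradient S u (weak_grad S u)"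
    "AE x in lebesgue. x \<in> S \<longrightarrow> weak_grad S u x = g x"
proof -
  have "weak_grad S u \<in> L2 S \<and> has_weak_gradient S u (weak_grad S u)"
    unfolding weak_grad_def by (rule someI[of _ g]) (use g in blast)
  then show *: "weak_grad S u \<in> L2 S" "has_weak_gradient S u (weak_grad S u)" by auto
  show "AE x in lebesgue. x \<in> S \<longrightarrow> weak_grad S u x = g x"
    by (rule weak_gradient_unique[OF S *(1) g(1) *(2) g(2)])
qed

lemma dirichlet_eq:
  assumes S: "open S" and g: "g \<in> L2 S" "has_weak_gradient S u g"
  shows "dirichlet S u = n2 (\<lambda>x. indicator S x *\<^sub>R g x)"
proof -
  have "dirichlet S u = n2 (\<lambda>x. indicator S x *\<^sub>R weak_grad S u x)"
    using S unfolding n2_def norm_indicator_power2 by (simp add: dirichlet_def integral_on)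
  also have "\<dots> = n2 (\<lambda>x. indicator S x *\<^sub>R g x)"
    by (rule n2_cong_AE)
      (use weak_grad_props[OF assms] g S in \<open>auto simp: L2_iff l2_def indicator_def elim!: eventually_mono\<close>)
  finally show ?thesis .
qed

text \<open>\<open>H0 S u g\<close> says that \<open>u\<close> lies in \<open>H10 S\<close> with weak gradient \<open>g\<close>, both extended by zero to the whole
  space.\<close>

definition H0 :: "'a::euclidean_space set \<Rightarrow> ('a \<Rightarrow> real) \<Rightarrow> ('a \<Rightarrow> 'a) \<Rightarrow> bool" where
  "H0 S u g \<longleftrightarrow> (\<exists>f h. (\<forall>n. c1c S (f n) (h n)) \<and> tol2 f u \<and> tol2 h g)"

section \<open>The closure of the test functions\<close>

lemma H0_l2: "H0 S u g \<Longrightarrow> l2 u" "H0 S u g \<Longrightarrow> l2 g"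
  by (auto simp: H0_def tol2_def)

lemma c1c_vanish:
  assumes "c1c S f h" "x \<notin> S" shows "f x = 0" "h x = 0"
  using assms unfolding c1c_def by blast+

lemma H0E:
  assumes "H0 S u g"
  obtains f h where "\<And>n. c1c S (f n) (h n)" "tol2 f u" "tol2 h g"
  using assms unfolding H0_def by blast

lemma H0I: "(\<And>n. c1c S (f n) (h n)) \<Longrightarrow> tol2 f u \<Longrightarrow> tol2 h g \<Longrightarrow> H0 S u g"
  unfolding H0_def by blast

lemma H0_c1c: "c1c S f h \<Longrightarrow> H0 S f h"
  unfolding H0_def by (intro exI[of _ "\<lambda>_. f"] exI[of _ "\<lambda>_. h"]) (auto intro: tol2_const c1c_l2)

lemma H0_test: "test_function S \<phi> \<Longrightarrow> H0 S \<phi> (grad \<phi>)"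
  by (intro H0_c1c c1c_test_function)

lemma H0_mono: "H0 S u g \<Longrightarrow> S \<subseteq> T \<Longrightarrow> H0 T u g"
  unfolding H0_def using c1c_mono by blast

lemma H0_add:
  assumes "H0 S u g" "H0 S v h" shows "H0 S (\<lambda>x. u x + v x) (\<lambda>x. g x + h x)"
proof -
  obtain a b where ab: "\<And>n. c1c S (a n) (b n)" "tol2 a u" "tol2 b g" using H0E[OF assms(1)] by metis
  obtain c d where cd: "\<And>n. c1c S (c n) (d n)" "tol2 c v" "tol2 d h" using H0E[OF assms(2)] by metis
  show ?thesis
    by (rule H0I[OF c1c_add[OF ab(1) cd(1)] tol2_add[OF ab(2) cd(2)] tol2_add[OF ab(3) cd(3)]])
qed

lemma H0_scale:
  assumes "H0 S u g" shows "H0 S (\<lambda>x. c * u x) (\<lambda>x. c *\<^sub>R g x)"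
proof -
  obtain f h where fh: "\<And>n. c1c S (f n) (h n)" "tol2 f u" "tol2 h g"
    using assms unfolding H0_def by blast
  show ?thesis
    using tol2_scaleR[OF fh(2), of c] tol2_scaleR[OF fh(3), of c]
    by (intro H0I[OF c1c_scale[OF fh(1)]]) auto
qed

lemma H0_diff: "H0 S u g \<Longrightarrow> H0 S v h \<Longrightarrow> H0 S (\<lambda>x. u x - v x) (\<lambda>x. g x - h x)"
  using H0_add[of S u g "\<lambda>x. (-1) * v x" "\<lambda>x. (-1) *\<^sub>R h x"] H0_scale[of S v h "-1"] by simp

lemma H0_zero: "H0 S (\<lambda>x. 0) (\<lambda>x. 0)"
  by (rule H0_c1c, rule c1cI[where K="{}"]) auto

lemma H0_sum:
  "(\<And>i. i \<in> I \<Longrightarrow> H0 S (u i) (g i)) \<Longrightarrow> H0 S (\<lambda>x. \<Sum>i\<in>I. u i x) (\<lambda>x. \<Sum>i\<in>I. g i x)"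
  by (induction I rule: infinite_finite_induct) (auto intro: H0_zero H0_add)

lemma tol2_diagonal:
  assumes "tol2 U u" "\<And>n. l2 (F n)" "\<And>n. n2 (\<lambda>x. F n x - U n x) \<le> 1 / Suc n"
  shows "tol2 F u"
proof (rule tol2I_bound[OF assms(2) tol2D(2)[OF assms(1)]])
  show "sqrt (n2 (\<lambda>x. F n x - u x)) \<le> sqrt (1 / Suc n) + sqrt (n2 (\<lambda>x. U n x - u x))" for n
    using n2_triangle_diff[OF assms(2) tol2D(1,2)[OF assms(1)], of n n] assms(3)[of n]
    by (smt (verit) real_sqrt_le_mono)
  have "(\<lambda>n. sqrt (1 / Suc n) + sqrt (n2 (\<lambda>x. U n x - u x))) \<longlonglongrightarrow> sqrt 0 + 0"
    by (intro tendsto_add tendsto_real_sqrt tol2_sqrt assms(1)) (rule LIMSEQ_Suc, rule lim_1_over_n)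
  then show "(\<lambda>n. sqrt (1 / Suc n) + sqrt (n2 (\<lambda>x. U n x - u x))) \<longlonglongrightarrow> 0" by simp
qed

lemma tol2_ex_close:
  assumes "tol2 F f" "tol2 G g" "e > 0"
  obtains n where "n2 (\<lambda>x. F n x - f x) \<le> e" "n2 (\<lambda>x. G n x - g x) \<le> e"
proof -
  have "\<forall>\<^sub>F n in sequentially. n2 (\<lambda>x. F n x - f x) < e" "\<forall>\<^sub>F n in sequentially. n2 (\<lambda>x. G n x - g x) < e"
    using order_tendstoD(2)[OF tol2D(3)[OF assms(1)] assms(3)] order_tendstoD(2)[OF tol2D(3)[OF assms(2)] assms(3)] by auto
  then have "\<forall>\<^sub>F n in sequentially. n2 (\<lambda>x. F n x - f x) < e \<and> n2 (\<lambda>x. G n x - g x) < e"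
    by (rule eventually_conj)
  then obtain n where "n2 (\<lambda>x. F n x - f x) < e \<and> n2 (\<lambda>x. G n x - g x) < e"
    using eventually_happens'[OF sequentially_bot] by blast
  then show ?thesis using that[of n] by simp
qed

lemma H0_closed:
  assumes "\<And>n. H0 S (U n) (G n)" "tol2 U u" "tol2 G g"
  shows "H0 S u g"
proof -
  have "\<exists>f h. c1c S f h \<and> n2 (\<lambda>x. f x - U n x) \<le> 1 / Suc n \<and> n2 (\<lambda>x. h x - G n x) \<le> 1 / Suc n" for n
  proof -
    obtain f h where fh: "\<And>n. c1c S (f n) (h n)" "tol2 f (U n)" "tol2 h (G n)"
      using assms(1)[of n] unfolding H0_def by blast
    obtain m where "n2 (\<lambda>x. f m x - U n x) \<le> 1 / Suc n" "n2 (\<lambda>x. h m x - G n x) \<le> 1 / Suc n"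
      using tol2_ex_close[OF fh(2,3), of "1 / Suc n"] by auto
    then show ?thesis using fh(1) by blast
  qed
  then obtain f h where fh: "\<And>n. c1c S (f n) (h n)" "\<And>n. n2 (\<lambda>x. f n x - U n x) \<le> 1 / Suc n"
    "\<And>n. n2 (\<lambda>x. h n x - G n x) \<le> 1 / Suc n" by metis
  have "tol2 f u" "tol2 h g"
    using tol2_diagonal[OF assms(2) c1c_l2(1)[OF fh(1)] fh(2)]
      tol2_diagonal[OF assms(3) c1c_l2(2)[OF fh(1)] fh(3)] by auto
  then show ?thesis unfolding H0_def using fh(1) by blast
qed

lemma H0_approx_test:
  assumes "open S" "H0 S u g"
  obtains \<phi> where "\<And>n. test_function S (\<phi> n)" "tol2 \<phi> u" "tol2 (\<lambda>n. grad (\<phi> n)) g"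
proof -
  obtain f h where fh: "\<And>n. c1c S (f n) (h n)" "tol2 f u" "tol2 h g"
    using assms unfolding H0_def by blast
  have "\<exists>\<phi>. test_function S \<phi> \<and> n2 (\<lambda>x. \<phi> x - f n x) \<le> 1 / Suc n \<and> n2 (\<lambda>x. grad \<phi> x - h n x) \<le> 1 / Suc n" for n
  proof -
    obtain \<phi> where \<phi>: "\<And>m. test_function S (\<phi> m)" "tol2 \<phi> (f n)" "tol2 (\<lambda>m. grad (\<phi> m)) (h n)"
      using c1c_approx[OF assms(1) fh(1)] by blast
    obtain m where "n2 (\<lambda>x. \<phi> m x - f n x) \<le> 1 / Suc n" "n2 (\<lambda>x. grad (\<phi> m) x - h n x) \<le> 1 / Suc n"
      using tol2_ex_close[OF \<phi>(2,3), of "1 / Suc n"] by auto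
    then show ?thesis using \<phi>(1) by blast
  qed
  then obtain \<phi> where \<phi>: "\<And>n. test_function S (\<phi> n)" "\<And>n. n2 (\<lambda>x. \<phi> n x - f n x) \<le> 1 / Suc n"
    "\<And>n. n2 (\<lambda>x. grad (\<phi> n) x - h n x) \<le> 1 / Suc n" by metis
  show ?thesis
    by (rule that[OF \<phi>(1) tol2_diagonal[OF fh(2) _ \<phi>(2)] tol2_diagonal[OF fh(3) _ \<phi>(3)]])
      (rule c1c_l2[OF c1c_test_function[OF \<phi>(1)]])+
qed

lemma tol2_vanish:
  assumes "tol2 F f" "\<And>n x. x \<notin> S \<Longrightarrow> F n x = 0" shows "AE x in lebesgue. x \<notin> S \<longrightarrow> f x = 0"
proof -
  obtain r where "AE x in lebesgue. (\<lambda>n. F (r n) x) \<longlonglongrightarrow> f x"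
    using tol2_AE_subseq[OF assms(1)] by blast
  then show ?thesis by eventually_elim (auto simp: assms(2) LIMSEQ_const_iff)
qed

lemma H0_outside:
  assumes "H0 S u g"
  shows "AE x in lebesgue. x \<notin> S \<longrightarrow> u x = 0" "AE x in lebesgue. x \<notin> S \<longrightarrow> g x = 0"
proof -
  obtain f h where fh: "\<And>n. c1c S (f n) (h n)" "tol2 f u" "tol2 h g"
    using assms unfolding H0_def by blast
  show "AE x in lebesgue. x \<notin> S \<longrightarrow> u x = 0" "AE x in lebesgue. x \<notin> S \<longrightarrow> g x = 0"
    by (rule tol2_vanish[OF fh(2)] tol2_vanish[OF fh(3)], erule c1c_vanish[OF fh(1)])+
qed

lemma H0_cong_AE:
  assumes "H0 S u g" "AE x in lebesgue. u x = v x" "AE x in lebesgue. g x = h x"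
    "v \<in> borel_measurable lebesgue" "h \<in> borel_measurable lebesgue"
  shows "H0 S v h"
proof -
  note l = H0_l2[OF assms(1)]
  have l': "l2 v" "l2 h" by (rule l2_cong_AE[OF l(1) assms(4,2)], rule l2_cong_AE[OF l(2) assms(5,3)])
  have "n2 (\<lambda>x. u x - v x) = n2 (\<lambda>x :: 'a. 0 :: real)"
    by (rule n2_cong_AE) (use assms(2) l2_diff[OF l(1) l'(1)] in \<open>auto simp: l2_measurable\<close>)
  moreover have "n2 (\<lambda>x. g x - h x) = n2 (\<lambda>x :: 'a. 0 :: 'a)"
    by (rule n2_cong_AE) (use assms(3) l2_diff[OF l(2) l'(2)] in \<open>auto simp: l2_measurable\<close>)
  ultimately have "tol2 (\<lambda>_. u) v" "tol2 (\<lambda>_. g) h"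
    using l l' by (auto simp: tol2_def)
  then show ?thesis by (rule H0_closed[OF assms(1)])
qed

lemma H0_cong_fun:
  assumes "H0 S u g" "AE x in lebesgue. u x = v x" "v \<in> borel_measurable lebesgue"
  shows "H0 S v g"
  by (rule H0_cong_AE[OF assms(1,2) _ assms(3)]) (use H0_l2(2)[OF assms(1)] in \<open>auto simp: l2_def\<close>)

lemma H0_restrict:
  assumes "open S" "H0 S u g"
  shows "H0 S (\<lambda>x. indicator S x * u x) (\<lambda>x. indicator S x *\<^sub>R g x)"
proof (rule H0_cong_AE[OF assms(2)])
  show "AE x in lebesgue. u x = indicator S x * u x" "AE x in lebesgue. g x = indicator S x *\<^sub>R g x"
    using H0_outside[OF assms(2)] by (auto elim!: eventually_mono simp: indicator_def)
  show "(\<lambda>x. indicator S x * u x) \<in> borel_measurable lebesgue" "(\<lambda>x. indicator S x *\<^sub>R g x) \<in> borel_measurable lebesgue"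
    using l2_indicator[OF H0_l2(1)[OF assms(2)], of S] l2_indicator[OF H0_l2(2)[OF assms(2)], of S] assms(1)
    by (auto simp: l2_measurable)
qed

section \<open>Integration by parts and agreement with \<open>H10\<close>\<close>

lemma l2_inner_const:
  assumes "l2 f" shows "l2 (\<lambda>x. f x \<bullet> b)"
  by (rule l2_bound(1)[OF assms, of _ "norm b"])
    (use assms in \<open>auto simp: l2_def mult.commute[of "norm b"] Cauchy_Schwarz_ineq2\<close>)

lemma tol2_inner_const:
  assumes "tol2 F f" shows "tol2 (\<lambda>n x. F n x \<bullet> b) (\<lambda>x. f x \<bullet> b)"
proof (rule tol2I_bound)
  show "sqrt (n2 (\<lambda>x. F n x \<bullet> b - f x \<bullet> b)) \<le> norm b * sqrt (n2 (\<lambda>x. F n x - f x))" for n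
  proof -
    have "n2 (\<lambda>x. F n x \<bullet> b - f x \<bullet> b) \<le> (norm b)\<^sup>2 * n2 (\<lambda>x. F n x - f x)"
    proof (rule l2_bound(2)[of "\<lambda>x. F n x - f x"])
      show "AE x in lebesgue. norm (F n x \<bullet> b - f x \<bullet> b) \<le> norm b * norm (F n x - f x)"
        by (rule AE_I2) (metis Cauchy_Schwarz_ineq2 inner_diff_left mult.commute real_norm_def)
      show "l2 (\<lambda>x. F n x - f x)" using assms by (auto simp: tol2D l2_diff)
      then show "(\<lambda>x. F n x \<bullet> b - f x \<bullet> b) \<in> borel_measurable lebesgue"
        using l2_inner_const[of "\<lambda>x. F n x - f x" b] by (simp add: inner_diff_left l2_measurable)
    qed
    from real_sqrt_le_mono[OF this] show ?thesis by (simp add: real_sqrt_mult)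
  qed
  show "(\<lambda>n. norm b * sqrt (n2 (\<lambda>x. F n x - f x))) \<longlonglongrightarrow> 0"
    using tendsto_mult_right_zero[OF tol2_sqrt[OF assms]] by simp
qed (use assms in \<open>auto simp: tol2D l2_inner_const\<close>)

text \<open>For the approximants this is \<open>integral_grad_zero\<close> for the product with
  \<open>w\<close>. They have compact support in \<open>S\<close>, so \<open>w\<close> is free of
  boundary conditions, and both sides are continuous in the mean.\<close>

lemma H0_ibp:
  assumes "open S" "c1 S w w'" "l2 (\<lambda>x. indicator S x * w x)" "l2 (\<lambda>x. indicator S x *\<^sub>R w' x)" "H0 S u g"
  shows "ip u (\<lambda>x. (indicator S x *\<^sub>R w' x) \<bullet> b) = - ip (\<lambda>x. g x \<bullet> b) (\<lambda>x. indicator S x * w x)"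
proof -
  obtain f h where fh: "\<And>n. c1c S (f n) (h n)" "tol2 f u" "tol2 h g"
    using assms(5) unfolding H0_def by blast
  note z = c1c_vanish[OF fh(1)]
  have "ip (f n) (\<lambda>x. (indicator S x *\<^sub>R w' x) \<bullet> b) + ip (\<lambda>x. h n x \<bullet> b) (\<lambda>x. indicator S x * w x) = 0" for n
  proof -
    have "0 = (LINT x|lebesgue. (w x *\<^sub>R h n x + f n x *\<^sub>R w' x) \<bullet> b)"
      by (rule integral_grad_zero[OF c1c_mono[OF c1c_mult[OF assms(1) fh(1) assms(2)]], symmetric]) simp
    also have "\<dots> = (LINT x|lebesgue. f n x \<bullet> ((indicator S x *\<^sub>R w' x) \<bullet> b) + (h n x \<bullet> b) \<bullet> (indicator S x * w x))"
      by (intro Bochner_Integration.integral_cong refl)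
        (use z in \<open>auto simp: indicator_def inner_add_left\<close>)
    also have "\<dots> = ip (f n) (\<lambda>x. (indicator S x *\<^sub>R w' x) \<bullet> b) + ip (\<lambda>x. h n x \<bullet> b) (\<lambda>x. indicator S x * w x)"
      unfolding ip_def using fh assms
      by (intro Bochner_Integration.integral_add ip_integrable l2_inner_const) (auto simp: tol2D)
    finally show ?thesis by simp
  qed
  moreover have "(\<lambda>n. ip (f n) (\<lambda>x. (indicator S x *\<^sub>R w' x) \<bullet> b) + ip (\<lambda>x. h n x \<bullet> b) (\<lambda>x. indicator S x * w x))
      \<longlonglongrightarrow> ip u (\<lambda>x. (indicator S x *\<^sub>R w' x) \<bullet> b) + ip (\<lambda>x. g x \<bullet> b) (\<lambda>x. indicator S x * w x)"
    by (intro tendsto_add tol2_ip tol2_const tol2_inner_const fh l2_inner_const assms)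
  ultimately show ?thesis by (simp add: LIMSEQ_const_iff)
qed

lemma H0_has_weak_gradient:
  assumes "open S" "H0 S u g"
  shows "has_weak_gradient S u g" "u \<in> L2 S" "g \<in> L2 S"
proof -
  note r = H0_restrict[OF assms]
  show "u \<in> L2 S" "g \<in> L2 S" using H0_l2[OF r] assms(1) by (auto simp: L2_iff)
  show "has_weak_gradient S u g"
    unfolding has_weak_gradient_iff[OF assms(1)]
  proof (intro allI impI ballI)
    fix \<phi> and b :: 'a assume t: "test_function S \<phi>"
    note c = c1c_test_function[OF t]
    have z: "indicator S x * \<phi> x = \<phi> x" "indicator S x *\<^sub>R grad \<phi> x = grad \<phi> x" for x
      using c1c_vanish[OF c, of x] by (cases "x \<in> S"; simp)+
    show "ip (\<lambda>x. indicator S x * u x) (\<lambda>x. grad \<phi> x \<bullet> b) = - ip (\<lambda>x. (indicator S x *\<^sub>R g x) \<bullet> b) \<phi>"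
      using H0_ibp[OF assms(1) c1_c1c[OF c] _ _ r, of b] c1c_l2[OF c] by (simp add: z)
  qed
qed

lemma H0_dirichlet:
  assumes "open S" "H0 S u g" shows "dirichlet S u = n2 g"
proof -
  have "dirichlet S u = n2 (\<lambda>x. indicator S x *\<^sub>R g x)"
    using H0_has_weak_gradient[OF assms] by (intro dirichlet_eq assms)
  also have "\<dots> = n2 g"
  proof (rule n2_cong_AE)
    show "AE x in lebesgue. indicator S x *\<^sub>R g x = g x"
      using H0_outside(2)[OF assms(2)] by eventually_elim (auto simp: indicator_def)
  qed (use H0_l2(2)[OF assms(2)] H0_l2(2)[OF H0_restrict[OF assms]] in \<open>auto simp: l2_measurable\<close>)
  finally show ?thesis .
qed

lemma H0_unique:
  assumes "open S" "H0 S u g" "H0 S u h" shows "AE x in lebesgue. g x = h x"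
proof -
  have "AE x in lebesgue. x \<in> S \<longrightarrow> g x = h x"
    using H0_has_weak_gradient[OF assms(1,2)] H0_has_weak_gradient[OF assms(1,3)]
    by (intro weak_gradient_unique[OF assms(1)])
  with H0_outside(2)[OF assms(2)] H0_outside(2)[OF assms(3)]
  show ?thesis by eventually_elim auto
qed

lemma l2_integral_on:
  fixes u :: "'a::euclidean_space \<Rightarrow> real"
  assumes "open S" "l2 u" shows "(LINT x|lebesgue_on S. (u x)\<^sup>2) \<le> n2 u"
proof -
  have "(LINT x|lebesgue_on S. (u x)\<^sup>2) = n2 (\<lambda>x. indicator S x *\<^sub>R u x)"
    unfolding n2_def norm_indicator_power2 using assms(1) by (simp add: integral_on)
  also have "\<dots> \<le> n2 u"
    by (rule l2_mono(2)[OF assms(2)])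
      (use assms l2_indicator[OF assms(2), of S] in \<open>auto simp: l2_measurable indicator_def\<close>)
  finally show ?thesis .
qed

lemma H0_imp_H10:
  assumes "open S" "H0 S u g" shows "u \<in> H10 S"
proof -
  obtain \<phi> where \<phi>: "\<And>n. test_function S (\<phi> n)" "tol2 \<phi> u" "tol2 (\<lambda>n. grad (\<phi> n)) g"
    using H0_approx_test[OF assms] by blast
  have H: "H0 S (\<lambda>x. \<phi> n x - u x) (\<lambda>x. grad (\<phi> n) x - g x)" for n
    by (intro H0_diff H0_test \<phi> assms)
  have "H1_norm S (\<lambda>x. \<phi> n x - u x) \<le> sqrt (n2 (\<lambda>x. \<phi> n x - u x) + n2 (\<lambda>x. grad (\<phi> n) x - g x))" for n
    unfolding H1_norm_def H0_dirichlet[OF assms(1) H]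
    using l2_integral_on[OF assms(1) H0_l2(1)[OF H]] by simp
  moreover have "(\<lambda>n. sqrt (n2 (\<lambda>x. \<phi> n x - u x) + n2 (\<lambda>x. grad (\<phi> n) x - g x))) \<longlonglongrightarrow> sqrt (0 + 0)"
    by (intro tendsto_real_sqrt tendsto_add tol2D(3)[OF \<phi>(2)] tol2D(3)[OF \<phi>(3)])
  ultimately have "(\<lambda>n. H1_norm S (\<lambda>x. \<phi> n x - u x)) \<longlonglongrightarrow> 0"
  proof (intro tendsto_sandwich[of "\<lambda>_. 0" "\<lambda>n. H1_norm S (\<lambda>x. \<phi> n x - u x)" _
      "\<lambda>n. sqrt (n2 (\<lambda>x. \<phi> n x - u x) + n2 (\<lambda>x. grad (\<phi> n) x - g x))"] always_eventually allI)
    show "0 \<le> H1_norm S (\<lambda>x. \<phi> n x - u x)" for n by (simp add: H1_norm_def dirichlet_def)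
  qed auto
  moreover have "u \<in> H1 S"
    unfolding H1_def using H0_has_weak_gradient[OF assms] by blast
  ultimately show ?thesis unfolding H10_def using \<phi>(1) by blast
qed

text \<open>\<open>weak_grad\<close> is an arbitrary choice, so the Dirichlet term of
  \<open>H1_norm\<close> for \<open>\<phi> n - u\<close> must first be identified. Linearity
  exhibits the difference of gradients as a weak gradient and uniqueness makes the choice
  immaterial; the squared norm then splits into two nonnegative terms that both tend to
  zero.\<close>

lemma H10_imp_H0:
  assumes "open S" "u \<in> H10 S"
  shows "H0 S (\<lambda>x. indicator S x * u x) (\<lambda>x. indicator S x *\<^sub>R weak_grad S u x)"
proof -
  have S: "S \<in> sets lebesgue" using assms(1) by simp
  obtain g where g: "g \<in> L2 S" "has_weak_gradient S u g" and u: "u \<in> L2 S"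
    using assms(2) unfolding H10_def H1_def by blast
  note w = weak_grad_props[OF assms(1) g]
  obtain \<phi> where \<phi>: "\<And>n. test_function S (\<phi> n)" "(\<lambda>n. H1_norm S (\<lambda>x. \<phi> n x - u x)) \<longlonglongrightarrow> 0"
    using assms(2) unfolding H10_def by blast
  have l: "l2 (\<lambda>x. indicator S x * u x)" "l2 (\<lambda>x. indicator S x *\<^sub>R weak_grad S u x)"
    using u w(1) S by (auto simp: L2_iff)
  have lp: "l2 (\<phi> n)" "l2 (grad (\<phi> n))" for n using c1c_l2[OF c1c_test_function[OF \<phi>(1)]] by auto
  have z: "indicator S x * \<phi> n x = \<phi> n x" "indicator S x *\<^sub>R grad (\<phi> n) x = grad (\<phi> n) x" for n x
    using c1c_vanish[OF c1c_test_function[OF \<phi>(1)[of n]], of x] by (cases "x \<in> S"; simp)+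
  have lpS: "\<phi> n \<in> L2 S" "grad (\<phi> n) \<in> L2 S" for n using lp[of n] S by (auto simp: L2_iff z)
  have sq: "(H1_norm S (\<lambda>x. \<phi> n x - u x))\<^sup>2 =
      n2 (\<lambda>x. \<phi> n x - indicator S x * u x) + n2 (\<lambda>x. grad (\<phi> n) x - indicator S x *\<^sub>R weak_grad S u x)" for n
  proof -
    have 1: "(\<lambda>x. grad (\<phi> n) x - weak_grad S u x) \<in> L2 S"
      using l2_diff[OF lp(2)[of n] l(2)] S by (simp add: L2_iff scaleR_diff_right z)
    have 2: "has_weak_gradient S (\<lambda>x. \<phi> n x - u x) (\<lambda>x. grad (\<phi> n) x - weak_grad S u x)"
      unfolding has_weak_gradient_iff[OF assms(1)]
    proof (intro allI impI ballI)
      fix \<psi> and b :: 'a assume t: "test_function S \<psi>" and b: "b \<in> Basis"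
      note lt = c1c_l2[OF c1c_test_function[OF t]]
      have "ip (\<phi> n) (\<lambda>x. grad \<psi> x \<bullet> b) = - ip (\<lambda>x. grad (\<phi> n) x \<bullet> b) \<psi>"
        using H0_has_weak_gradient(1)[OF assms(1) H0_test[OF \<phi>(1)[of n]]] t b
        unfolding has_weak_gradient_iff[OF assms(1)] by (simp add: z)
      moreover have "ip (\<lambda>x. indicator S x * u x) (\<lambda>x. grad \<psi> x \<bullet> b) =
          - ip (\<lambda>x. (indicator S x *\<^sub>R weak_grad S u x) \<bullet> b) \<psi>"
        using w(2) t b unfolding has_weak_gradient_iff[OF assms(1)] by blast
      moreover have "ip (\<lambda>x. \<phi> n x - indicator S x * u x) (\<lambda>x. grad \<psi> x \<bullet> b) =
          ip (\<phi> n) (\<lambda>x. grad \<psi> x \<bullet> b) - ip (\<lambda>x. indicator S x * u x) (\<lambda>x. grad \<psi> x \<bullet> b)"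
        by (intro ip_diff lp l l2_inner_const lt)
      moreover have "ip (\<lambda>x. grad (\<phi> n) x \<bullet> b - (indicator S x *\<^sub>R weak_grad S u x) \<bullet> b) \<psi> =
          ip (\<lambda>x. grad (\<phi> n) x \<bullet> b) \<psi> - ip (\<lambda>x. (indicator S x *\<^sub>R weak_grad S u x) \<bullet> b) \<psi>"
        by (intro ip_diff lp l l2_inner_const lt)
      ultimately show "ip (\<lambda>x. indicator S x * (\<phi> n x - u x)) (\<lambda>x. grad \<psi> x \<bullet> b) =
          - ip (\<lambda>x. (indicator S x *\<^sub>R (grad (\<phi> n) x - weak_grad S u x)) \<bullet> b) \<psi>"
        unfolding right_diff_distrib scaleR_diff_right z inner_diff_left by linarith
    qed
    have "dirichlet S (\<lambda>x. \<phi> n x - u x) = n2 (\<lambda>x. grad (\<phi> n) x - indicator S x *\<^sub>R weak_grad S u x)"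
      using dirichlet_eq[OF assms(1) 1 2] by (simp add: scaleR_diff_right z)
    moreover have "(LINT x|lebesgue_on S. (\<phi> n x - u x)\<^sup>2) = n2 (\<lambda>x. \<phi> n x - indicator S x * u x)"
    proof -
      have "(LINT x|lebesgue_on S. (\<phi> n x - u x)\<^sup>2) = n2 (\<lambda>x. indicator S x *\<^sub>R (\<phi> n x - u x))"
        unfolding n2_def norm_indicator_power2 using S by (simp add: integral_on)
      then show ?thesis by (simp add: right_diff_distrib z)
    qed
    ultimately show ?thesis by (simp add: H1_norm_def)
  qed
  have lim: "(\<lambda>n. n2 (\<lambda>x. \<phi> n x - indicator S x * u x) + n2 (\<lambda>x. grad (\<phi> n) x - indicator S x *\<^sub>R weak_grad S u x)) \<longlonglongrightarrow> 0"
    using tendsto_power[OF \<phi>(2), of 2] unfolding sq by simp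
  have "tol2 \<phi> (\<lambda>x. indicator S x * u x)"
    unfolding tol2_def using l lp
    by (auto intro!: tendsto_sandwich[OF _ _ tendsto_const lim] always_eventually)
  moreover have "tol2 (\<lambda>n. grad (\<phi> n)) (\<lambda>x. indicator S x *\<^sub>R weak_grad S u x)"
    unfolding tol2_def using l lp
    by (auto intro!: tendsto_sandwich[OF _ _ tendsto_const lim] always_eventually)
  ultimately show ?thesis by (rule H0I[OF c1c_test_function[OF \<phi>(1)]])
qed

text \<open>Integrating the derivative of (x . b) f^2 in direction b gives that the integral of f^2
  equals -2 times the integral of (x . b) f (h . b). Since |x . b| \<le> R on \<open>S\<close>,
  Cauchy-Schwarz yields the factor 2 R before squaring.\<close>

lemma H0_Poincare:
  assumes "H0 S u g" "S \<subseteq> ball 0 R"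
  shows "n2 u \<le> 4 * R\<^sup>2 * n2 g"
proof -
  have c: "n2 f \<le> 4 * R\<^sup>2 * n2 h" if fh: "c1c S f h" for f h
  proof (cases "S = {}")
    case True
    then have "f = (\<lambda>x. 0)" using c1c_vanish(1)[OF fh] by blast
    then show ?thesis by simp
  next
    case False
    then have R: "R > 0" using assms(2) by (metis ball_eq_empty subset_empty not_less)
    obtain b :: 'a where b: "b \<in> Basis" using nonempty_Basis by blast
    note z = c1c_vanish(1)[OF fh]
    have xb: "c1 UNIV (\<lambda>x. x \<bullet> b) (\<lambda>x. b)"
      unfolding c1_def by (auto intro!: derivative_eq_intros simp: inner_commute)
    have ff: "c1c UNIV (\<lambda>x. f x * f x) (\<lambda>x. f x *\<^sub>R h x + f x *\<^sub>R h x)"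
      by (rule c1c_mult[OF open_UNIV c1c_mono[OF fh] c1_c1c[OF fh]]) simp
    have l: "l2 f" "l2 h" using c1c_l2[OF fh] by auto
    have lx: "l2 (\<lambda>x. (x \<bullet> b) * f x)" "n2 (\<lambda>x. (x \<bullet> b) * f x) \<le> R\<^sup>2 * n2 f"
    proof -
      have "csupp (\<lambda>x. f x *\<^sub>R (x \<bullet> b))"
        by (intro csupp_times csupp_c1c(1)[OF fh] continuous_intros)
      then have "l2 (\<lambda>x. f x *\<^sub>R (x \<bullet> b))" by (rule csupp_l2)
      then have m: "(\<lambda>x. (x \<bullet> b) * f x) \<in> borel_measurable lebesgue" by (simp add: l2_def mult.commute)
      have "norm ((x \<bullet> b) * f x) \<le> R * norm (f x)" for x
      proof (cases "x \<in> S")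
        case True
        then have "\<bar>x \<bullet> b\<bar> \<le> R" using assms(2) Basis_le_norm[OF b, of x] by (force simp: dist_norm)
        then show ?thesis by (simp add: abs_mult mult_right_mono)
      qed (simp add: z)
      then have "AE x in lebesgue. norm ((x \<bullet> b) * f x) \<le> R * norm (f x)" by simp
      from l2_bound[OF l(1) m this] show "l2 (\<lambda>x. (x \<bullet> b) * f x)" "n2 (\<lambda>x. (x \<bullet> b) * f x) \<le> R\<^sup>2 * n2 f" .
    qed
    have hb: "l2 (\<lambda>x. h x \<bullet> b)" "n2 (\<lambda>x. h x \<bullet> b) \<le> n2 h"
      using l2_inner_const[OF l(2)] l2_mono(2)[OF l(2), of "\<lambda>x. h x \<bullet> b"] Basis_le_norm[OF b]
      by (auto simp: l2_def)
    have "0 = (LINT x|lebesgue. ((x \<bullet> b) *\<^sub>R (f x *\<^sub>R h x + f x *\<^sub>R h x) + (f x * f x) *\<^sub>R b) \<bullet> b)"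
      by (rule integral_grad_zero[OF c1c_mult[OF open_UNIV ff xb], symmetric])
    also have "\<dots> = (LINT x|lebesgue. 2 * (((x \<bullet> b) * f x) \<bullet> (h x \<bullet> b)) + f x \<bullet> f x)"
      by (intro Bochner_Integration.integral_cong refl)
        (use b in \<open>auto simp: inner_add_left algebra_simps inner_Basis\<close>)
    also have "\<dots> = 2 * ip (\<lambda>x. (x \<bullet> b) * f x) (\<lambda>x. h x \<bullet> b) + n2 f"
      unfolding ip_self[symmetric] unfolding ip_def
      using ip_integrable[OF lx(1) hb(1)] ip_integrable[OF l(1) l(1)] by (subst Bochner_Integration.integral_add) auto
    finally have "n2 f \<le> 2 * \<bar>ip (\<lambda>x. (x \<bullet> b) * f x) (\<lambda>x. h x \<bullet> b)\<bar>" by linarith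
    also have "\<dots> \<le> 2 * (sqrt (n2 (\<lambda>x. (x \<bullet> b) * f x)) * sqrt (n2 (\<lambda>x. h x \<bullet> b)))"
      using ip_bound[OF lx(1) hb(1)] by simp
    also have "\<dots> \<le> 2 * (sqrt (R\<^sup>2 * n2 f) * sqrt (n2 h))"
      using lx(2) hb(2) by (intro mult_left_mono mult_mono) auto
    also have "\<dots> = sqrt (n2 f) * (2 * R * sqrt (n2 h))" using R by (simp add: real_sqrt_mult)
    finally have le: "sqrt (n2 f) * sqrt (n2 f) \<le> sqrt (n2 f) * (2 * R * sqrt (n2 h))" by simp
    have "sqrt (n2 f) \<le> 2 * R * sqrt (n2 h)"
    proof (cases "sqrt (n2 f) = 0")
      case False
      then have "sqrt (n2 f) > 0" using n2_nonneg[of f] by (simp add: less_le)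
      then show ?thesis using le by (rule mult_left_le_imp_le[rotated])
    qed (use R in simp)
    then have "(sqrt (n2 f))\<^sup>2 \<le> (2 * R * sqrt (n2 h))\<^sup>2" by (intro power_mono) auto
    then show ?thesis by (simp add: power_mult_distrib)
  qed
  obtain f h where fh: "\<And>n. c1c S (f n) (h n)" "tol2 f u" "tol2 h g"
    using assms unfolding H0_def by blast
  have "(\<lambda>n. 4 * R\<^sup>2 * n2 (h n)) \<longlonglongrightarrow> 4 * R\<^sup>2 * n2 g"
    by (rule tendsto_mult_left[OF tol2_n2[OF fh(3)]])
  then show ?thesis
    by (rule LIMSEQ_le[OF tol2_n2[OF fh(2)]]) (blast intro: c[OF fh(1)])
qed

text \<open>A continuously differentiable approximation of the positive part.\<close>

definition spos :: "real \<Rightarrow> real \<Rightarrow> real" where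
  "spos e t = (max 0 t)\<^sup>2 / (max 0 t + e)"

definition spos' :: "real \<Rightarrow> real \<Rightarrow> real" where
  "spos' e t = 1 - (e / (max 0 t + e))\<^sup>2"

text \<open>For t > 0 the function is t - e + e^2 / (t + e), so its slope increases from 0 to 1. At
  0 it vanishes to second order, which makes the two pieces fit together.\<close>

lemma DERIV_spos:
  assumes "e > 0" shows "(spos e has_real_derivative spos' e t) (at t)"
proof -
  consider "t < 0" | "t = 0" | "t > 0" by linarith
  then show ?thesis
  proof cases
    case 1
    have "((\<lambda>t. 0) has_real_derivative 0) (at t)" by simp
    then have "(spos e has_real_derivative 0) (at t)"
      by (rule has_field_derivative_transform_within_open[where S="{..<0}"])
        (use 1 in \<open>auto simp: spos_def\<close>)
    then show ?thesis using 1 assms by (simp add: spos'_def)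
  next
    case 2
    have "((\<lambda>h. (spos e (0 + h) - spos e 0) / h) \<longlongrightarrow> 0) (at 0)"
    proof (rule Lim_null_comparison)
      show "\<forall>\<^sub>F h in at 0. norm ((spos e (0 + h) - spos e 0) / h) \<le> \<bar>h\<bar> / e"
      proof (rule eventually_at_topological[THEN iffD2], intro exI[of _ UNIV] conjI ballI impI)
        fix h :: real
        have "(max 0 h)\<^sup>2 / (max 0 h + e) \<le> h\<^sup>2 / e"
          using assms by (intro frac_le) (auto simp: max_def)
        then have "\<bar>spos e h\<bar> \<le> h\<^sup>2 / e" using assms by (simp add: spos_def)
        then show "norm ((spos e (0 + h) - spos e 0) / h) \<le> \<bar>h\<bar> / e" if "h \<noteq> 0"
          using that assms by (simp add: spos_def[of e 0] field_simps power2_eq_square abs_mult)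
      qed auto
      show "((\<lambda>h. \<bar>h\<bar> / e) \<longlongrightarrow> 0) (at 0)" by (auto intro!: tendsto_eq_intros simp: assms less_imp_neq[OF assms, symmetric])
    qed
    then show ?thesis using 2 assms by (simp add: DERIV_def spos'_def)
  next
    case 3
    have "((\<lambda>t. t\<^sup>2 / (t + e)) has_real_derivative (2 * t * (t + e) - t\<^sup>2) / ((t + e) * (t + e))) (at t)"
      using 3 assms by (auto intro!: derivative_eq_intros)
    also have "(2 * t * (t + e) - t\<^sup>2) / ((t + e) * (t + e)) = 1 - (e / (t + e))\<^sup>2"
      using 3 assms by (simp add: divide_simps power2_eq_square) (simp add: algebra_simps)
    finally have "((\<lambda>t. t\<^sup>2 / (t + e)) has_real_derivative 1 - (e / (t + e))\<^sup>2) (at t)" .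
    then have "(spos e has_real_derivative 1 - (e / (t + e))\<^sup>2) (at t)"
      by (rule has_field_derivative_transform_within_open[where S="{0<..}"])
        (use 3 in \<open>auto simp: spos_def\<close>)
    then show ?thesis using 3 by (simp add: spos'_def)
  qed
qed

lemma spos'_range: "e > 0 \<Longrightarrow> 0 \<le> spos' e t \<and> spos' e t \<le> 1"
  by (auto simp: spos'_def power_le_one_iff divide_le_eq_1)

lemma spos_nonpos: "e > 0 \<Longrightarrow> t \<le> 0 \<Longrightarrow> spos e t = 0 \<and> spos' e t = 0"
  by (simp add: spos_def spos'_def)

lemma spos_lipschitz:
  assumes "e > 0" shows "\<bar>spos e a - spos e b\<bar> \<le> \<bar>a - b\<bar>"
proof -
  have "norm (spos e a - spos e b) \<le> 1 * norm (a - b)"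
    by (rule field_differentiable_bound[of UNIV])
      (use DERIV_spos[OF assms] spos'_range[OF assms] in \<open>auto intro: has_field_derivative_at_within\<close>)
  then show ?thesis by simp
qed

lemma spos_abs_le: "e > 0 \<Longrightarrow> \<bar>spos e t\<bar> \<le> \<bar>t\<bar>"
  using spos_lipschitz[of e t 0] by (simp add: spos_def)

lemma continuous_on_spos [continuous_intros]:
  assumes "e > 0" "continuous_on A f"
  shows "continuous_on A (\<lambda>x. spos e (f x))" "continuous_on A (\<lambda>x. spos' e (f x))"
proof -
  have 1: "max 0 t + e \<noteq> 0" for t using assms(1) by (simp add: max_def)
  show "continuous_on A (\<lambda>x. spos e (f x))" "continuous_on A (\<lambda>x. spos' e (f x))"
    unfolding spos_def spos'_def using 1 by (intro continuous_intros assms(2) ballI; simp)+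
qed

lemma spos_measurable [measurable]:
  assumes "e > 0" shows "spos e \<in> borel_measurable borel" "spos' e \<in> borel_measurable borel"
  using assms by (auto intro!: borel_measurable_continuous_onI continuous_intros)

lemma spos_limit: "(\<lambda>n. spos (1 / Suc n) t) \<longlonglongrightarrow> max 0 t"
proof (cases "t > 0")
  case True
  have "(\<lambda>n. (max 0 t)\<^sup>2 / (max 0 t + 1 / Suc n)) \<longlonglongrightarrow> (max 0 t)\<^sup>2 / (max 0 t + 0)"
    by (intro tendsto_intros LIMSEQ_Suc[OF lim_1_over_n]) (use True in auto)
  then show ?thesis using True by (simp add: spos_def power2_eq_square del: of_nat_Suc)
qed (simp add: spos_def)

lemma spos'_limit: "(\<lambda>n. spos' (1 / Suc n) t) \<longlonglongrightarrow> (if t > 0 then 1 else 0)"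
proof (cases "t > 0")
  case True
  have "(\<lambda>n. 1 - ((1 / Suc n) / (max 0 t + 1 / Suc n))\<^sup>2) \<longlonglongrightarrow> 1 - (0 / (max 0 t + 0))\<^sup>2"
    by (intro tendsto_intros LIMSEQ_Suc[OF lim_1_over_n]) (use True in auto)
  then show ?thesis using True by (simp add: spos'_def del: of_nat_Suc)
qed (simp add: spos'_def)

text \<open>The weight has no compact support, but w \<ge> 0 makes the truncation of
  \<open>f n - w\<close> vanish wherever \<open>f n\<close> does, so the approximants stay
  admissible. Their gradients converge in two pieces: a bounded coefficient times
  \<open>h n - g\<close>, and an almost everywhere convergent coefficient times a fixed function.
  The second piece is why a subsequence converging almost everywhere is chosen.\<close>

lemma H0_spos:
  assumes S: "open S" and H: "H0 S u g" and w: "c1 S w w'" "\<And>x. x \<in> S \<Longrightarrow> w x \<ge> 0"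
    and l: "l2 (\<lambda>x. indicator S x * w x)" "l2 (\<lambda>x. indicator S x *\<^sub>R w' x)" and e: "e > 0"
  shows "H0 S (\<lambda>x. indicator S x * spos e (u x - indicator S x * w x))
    (\<lambda>x. (indicator S x * spos' e (u x - indicator S x * w x)) *\<^sub>R (g x - indicator S x *\<^sub>R w' x))"
proof -
  define W where "W x = indicator S x * w x" for x
  define W' where "W' x = indicator S x *\<^sub>R w' x" for x
  have lW: "l2 W" "l2 W'" using l unfolding W_def W'_def by auto
  note lu = H0_l2[OF H]
  obtain f0 h0 where fh0: "\<And>n. c1c S (f0 n) (h0 n)" "tol2 f0 u" "tol2 h0 g" using H0E[OF H] by metis
  obtain r where r: "strict_mono r" "AE x in lebesgue. (\<lambda>n. f0 (r n) x) \<longlonglongrightarrow> u x"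
    using tol2_AE_subseq[OF fh0(2)] by blast
  define f where "f n = f0 (r n)" for n
  define h where "h n = h0 (r n)" for n
  have fh: "\<And>n. c1c S (f n) (h n)" "tol2 f u" "tol2 h g" "AE x in lebesgue. (\<lambda>n. f n x) \<longlonglongrightarrow> u x"
    unfolding f_def h_def using fh0 r by (auto intro: tol2_subseq)
  have [measurable]: "u \<in> borel_measurable lebesgue" "g \<in> borel_measurable lebesgue"
    "W \<in> borel_measurable lebesgue" "W' \<in> borel_measurable lebesgue" "S \<in> sets lebesgue"
    "f n \<in> borel_measurable lebesgue" "h n \<in> borel_measurable lebesgue" for n
    using lu lW S tol2D(1)[OF fh(2)] tol2D(1)[OF fh(3)] by (auto simp: l2_measurable)
  have [measurable]: "(\<lambda>x. spos e (k x)) \<in> borel_measurable lebesgue" "(\<lambda>x. spos' e (k x)) \<in> borel_measurable lebesgue"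
    if "k \<in> borel_measurable lebesgue" for k :: "'a \<Rightarrow> real"
    using measurable_compose[OF that spos_measurable(1)[OF e]] measurable_compose[OF that spos_measurable(2)[OF e]] by auto
  define F where "F k x = indicator S x * spos e (k x - W x)" for k x
  define D where "D k j x = (indicator S x * spos' e (k x - W x)) *\<^sub>R (j x - W' x)" for k j x
  have c: "c1c S (F (f n)) (D (f n) (h n))" for n
  proof -
    obtain K where K: "compact K" "K \<subseteq> S" "\<And>x. x \<notin> K \<Longrightarrow> f n x = 0"
      using c1c_supp[OF fh(1)[of n]] by metis
    show ?thesis
    proof (rule c1c_gluing[OF S K(1,2)])
      fix x assume x: "x \<in> S"
      have 1: "((\<lambda>x. f n x - w x) has_derivative (\<lambda>v. (h n x - w' x) \<bullet> v)) (at x)"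
        using has_derivative_diff[OF c1cD(1)[OF fh(1)[of n], of x], of w "\<lambda>v. w' x \<bullet> v"] w(1) x
        by (simp add: c1_def inner_diff_left)
      have "((\<lambda>x. spos e (f n x - w x)) has_derivative (\<lambda>v. ((h n x - w' x) \<bullet> v) * spos' e (f n x - w x))) (at x)"
        using has_derivative_compose[OF 1 DERIV_spos[OF e, unfolded has_field_derivative_def]] by (simp add: mult.commute)
      then have "(F (f n) has_derivative (\<lambda>v. ((h n x - w' x) \<bullet> v) * spos' e (f n x - w x))) (at x)"
        by (rule has_derivative_transform_within_open[OF _ S x]) (simp add: F_def W_def)
      then show "(F (f n) has_derivative (\<lambda>v. D (f n) (h n) x \<bullet> v)) (at x)"
        using x by (simp add: D_def W_def W'_def mult.commute)
    next
      have "continuous_on S (\<lambda>x. spos' e (f n x - w x) *\<^sub>R (h n x - w' x))"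
        using w(1) by (intro continuous_intros e c1cD[OF fh(1)] c1_continuous[OF w(1)]) (simp add: c1_def)
      then show "continuous_on S (D (f n) (h n))"
        by (rule continuous_on_eq) (simp add: D_def W_def W'_def)
    next
      fix x assume "x \<notin> K"
      then have "x \<in> S \<Longrightarrow> f n x - W x \<le> 0" using K(3) w(2) by (simp add: W_def)
      then show "F (f n) x = 0" "D (f n) (h n) x = 0"
        using spos_nonpos[OF e, of "f n x - W x"] by (auto simp: F_def D_def indicator_def)
    qed
  qed
  have Fm: "F k \<in> borel_measurable lebesgue" if "k \<in> borel_measurable lebesgue" for k
    unfolding F_def using that by measurable
  have lF: "l2 (F u)"
  proof (rule l2_mono(1)[OF l2_diff[OF lu(1) lW(1)] Fm])
    show "AE x in lebesgue. norm (F u x) \<le> norm (u x - W x)"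
      by (rule AE_I2) (auto simp: F_def indicator_def spos_abs_le[OF e])
  qed measurable
  have 1: "tol2 (\<lambda>n. F (f n)) (F u)"
  proof (rule tol2_lipschitz[OF fh(2) _ lF])
    show "l2 (\<lambda>x. F (f n) x - F u x)" for n by (intro l2_diff lF c1c_l2(1)[OF c])
    show "norm (F (f n) x - F u x) \<le> norm (f n x - u x)" for n x
      using spos_lipschitz[OF e, of "f n x - W x" "u x - W x"] by (simp add: F_def indicator_def)
  qed (rule Fm, measurable)
  have 2: "tol2 (\<lambda>n x. (indicator S x * spos' e (f n x - W x)) *\<^sub>R (h n x - g x)) (\<lambda>x. 0)"
  proof (rule tol2_lipschitz[OF fh(3)])
    have b: "norm ((indicator S x * spos' e (f n x - W x)) *\<^sub>R (h n x - g x)) \<le> norm (h n x - g x)" for n x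
      using spos'_range[OF e, of "f n x - W x"] mult_right_mono[of "spos' e (f n x - W x)" 1 "norm (h n x - g x)"]
      by (auto simp: indicator_def)
    then show "norm ((indicator S x * spos' e (f n x - W x)) *\<^sub>R (h n x - g x) - 0) \<le> norm (h n x - g x)" for n x by simp
    show m: "(\<lambda>x. (indicator S x * spos' e (f n x - W x)) *\<^sub>R (h n x - g x)) \<in> borel_measurable lebesgue" for n
      by measurable
    show "l2 (\<lambda>x. (indicator S x * spos' e (f n x - W x)) *\<^sub>R (h n x - g x) - 0)" for n
      using l2_mono(1)[OF l2_diff[OF tol2D(1)[OF fh(3), of n] lu(2)] m[of n]] b by simp
  qed simp
  have 3: "tol2 (\<lambda>n x. (indicator S x * spos' e (f n x - W x)) *\<^sub>R (g x - W' x)) (D u g)"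
  proof (rule tol2_dominated[OF _ _ l2_diff[OF lu(2) lW(2)]])
    show "AE x in lebesgue. norm ((indicator S x * spos' e (f n x - W x)) *\<^sub>R (g x - W' x)) \<le> norm (g x - W' x)" for n
      using spos'_range[OF e] by (intro AE_I2) (auto simp: indicator_def mult_left_le_one_le)
    show "AE x in lebesgue. (\<lambda>n. (indicator S x * spos' e (f n x - W x)) *\<^sub>R (g x - W' x)) \<longlonglongrightarrow> D u g x"
      using fh(4)
    proof eventually_elim
      case (elim x)
      have "isCont (spos' e) (u x - W x)"
        using continuous_on_spos(2)[OF e continuous_on_id[of UNIV]] by (simp add: continuous_on_eq_continuous_at)
      then have "(\<lambda>n. spos' e (f n x - W x)) \<longlonglongrightarrow> spos' e (u x - W x)"
        by (rule isCont_tendsto_compose) (intro tendsto_intros elim)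
      then show ?case unfolding D_def by (intro tendsto_intros)
    qed
  qed (unfold D_def, measurable)
  have "tol2 (\<lambda>n. D (f n) (h n)) (D u g)"
    using tol2_add[OF 2 3] unfolding D_def by (simp add: algebra_simps)
  from H0I[OF c 1 this] show ?thesis unfolding F_def[abs_def] D_def[abs_def] W_def W'_def .
qed

text \<open>The limit e \<rightarrow> 0 of \<open>H0_spos\<close>. Since \<open>spos'\<close>
  vanishes at 0 for every e, the limit gradient is zero on the contact set u = w.\<close>

lemma H0_pos:
  assumes S: "open S" and H: "H0 S u g" and w: "c1 S w w'" "\<And>x. x \<in> S \<Longrightarrow> w x \<ge> 0"
    and l: "l2 (\<lambda>x. indicator S x * w x)" "l2 (\<lambda>x. indicator S x *\<^sub>R w' x)"
  shows "H0 S (\<lambda>x. indicator S x * max 0 (u x - w x))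
    (\<lambda>x. (indicator S x * (if u x > w x then 1 else 0)) *\<^sub>R (g x - w' x))"
proof -
  define W where "W x = indicator S x * w x" for x
  define W' where "W' x = indicator S x *\<^sub>R w' x" for x
  have lW: "l2 W" "l2 W'" using l unfolding W_def W'_def by auto
  note lu = H0_l2[OF H]
  have [measurable]: "u \<in> borel_measurable lebesgue" "g \<in> borel_measurable lebesgue"
    "W \<in> borel_measurable lebesgue" "W' \<in> borel_measurable lebesgue" "S \<in> sets lebesgue"
    using lu lW S by (auto simp: l2_measurable)
  have [measurable]: "(\<lambda>x. spos (1 / Suc n) (k x)) \<in> borel_measurable lebesgue"
    "(\<lambda>x. spos' (1 / Suc n) (k x)) \<in> borel_measurable lebesgue"
    if "k \<in> borel_measurable lebesgue" for k :: "'a \<Rightarrow> real" and n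
    using measurable_compose[OF that spos_measurable(1)[of "1 / Suc n"]]
      measurable_compose[OF that spos_measurable(2)[of "1 / Suc n"]] by auto
  have 1: "tol2 (\<lambda>n x. indicator S x * spos (1 / Suc n) (u x - W x)) (\<lambda>x. indicator S x * max 0 (u x - W x))"
  proof (rule tol2_dominated[OF _ _ l2_diff[OF lu(1) lW(1)]])
    show "AE x in lebesgue. (\<lambda>n. indicator S x * spos (1 / Suc n) (u x - W x)) \<longlonglongrightarrow> indicator S x * max 0 (u x - W x)"
      by (intro AE_I2 tendsto_mult_left spos_limit)
    show "AE x in lebesgue. norm (indicator S x * spos (1 / Suc n) (u x - W x)) \<le> norm (u x - W x)" for n
      using spos_abs_le[of "1 / Suc n"] by (intro AE_I2) (auto simp: indicator_def simp del: of_nat_Suc)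
  qed measurable
  have 2: "tol2 (\<lambda>n x. (indicator S x * spos' (1 / Suc n) (u x - W x)) *\<^sub>R (g x - W' x))
     (\<lambda>x. (indicator S x * (if u x - W x > 0 then 1 else 0)) *\<^sub>R (g x - W' x))"
  proof (rule tol2_dominated[OF _ _ l2_diff[OF lu(2) lW(2)]])
    show "AE x in lebesgue. (\<lambda>n. (indicator S x * spos' (1 / Suc n) (u x - W x)) *\<^sub>R (g x - W' x))
        \<longlonglongrightarrow> (indicator S x * (if u x - W x > 0 then 1 else 0)) *\<^sub>R (g x - W' x)"
      by (intro AE_I2 tendsto_scaleR tendsto_mult_left spos'_limit tendsto_const)
    show "AE x in lebesgue. norm ((indicator S x * spos' (1 / Suc n) (u x - W x)) *\<^sub>R (g x - W' x)) \<le> norm (g x - W' x)" for n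
      using spos'_range[of "1 / Suc n"] by (intro AE_I2) (auto simp: indicator_def mult_left_le_one_le simp del: of_nat_Suc)
  qed measurable
  have "H0 S (\<lambda>x. indicator S x * max 0 (u x - W x))
    (\<lambda>x. (indicator S x * (if u x - W x > 0 then 1 else 0)) *\<^sub>R (g x - W' x))"
    by (rule H0_closed[OF _ 1 2], unfold W_def W'_def, rule H0_spos[OF S H w l]) auto
  moreover have "(\<lambda>x. indicator S x * max 0 (u x - W x)) = (\<lambda>x. indicator S x * max 0 (u x - w x))"
    "(\<lambda>x. (indicator S x * (if u x - W x > 0 then 1 else 0)) *\<^sub>R (g x - W' x)) =
     (\<lambda>x. (indicator S x * (if u x > w x then 1 else 0)) *\<^sub>R (g x - w' x))"
    by (auto simp: W_def W'_def indicator_def fun_eq_iff)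
  ultimately show ?thesis by simp
qed

lemma H0_max0:
  assumes S: "open S" and H: "H0 S u g"
  shows "H0 S (\<lambda>x. max 0 (u x)) (\<lambda>x. if u x > 0 then g x else 0)"
proof -
  note lu = H0_l2[OF H]
  have [measurable]: "u \<in> borel_measurable lebesgue" "g \<in> borel_measurable lebesgue"
    using lu by (auto simp: l2_measurable)
  have "c1 S (\<lambda>x. 0) (\<lambda>x. 0)" by (simp add: c1_def)
  from H0_pos[OF S H this]
  have "H0 S (\<lambda>x. indicator S x * max 0 (u x)) (\<lambda>x. (indicator S x * (if u x > 0 then 1 else 0)) *\<^sub>R g x)"
    by simp
  then show ?thesis
  proof (rule H0_cong_AE)
    show "AE x in lebesgue. indicator S x * max 0 (u x) = max 0 (u x)"
      using H0_outside(1)[OF H] by eventually_elim (auto simp: indicator_def)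
    show "AE x in lebesgue. (indicator S x * (if u x > 0 then 1 else 0)) *\<^sub>R g x = (if u x > 0 then g x else 0)"
      using H0_outside(2)[OF H] by eventually_elim (auto simp: indicator_def)
  qed measurable
qed

text \<open>Truncating a nonnegative function at 0 does not change it, yet produces a gradient that
  is cut off where u = 0; uniqueness identifies both gradients.\<close>

lemma H0_grad_zero:
  assumes S: "open S" and H: "H0 S u g" and "AE x in lebesgue. u x \<ge> 0"
  shows "AE x in lebesgue. u x = 0 \<longrightarrow> g x = 0"
proof -
  have "H0 S u (\<lambda>x. if u x > 0 then g x else 0)"
    by (rule H0_cong_fun[OF H0_max0[OF S H]])
      (use assms(3) H0_l2(1)[OF H] in \<open>auto simp: l2_measurable elim!: eventually_mono\<close>)
  from H0_unique[OF S H this] show ?thesis by eventually_elim auto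
qed

lemma H0_abs:
  assumes S: "open S" and H: "H0 S u g"
  obtains h where "H0 S (\<lambda>x. \<bar>u x\<bar>) h" "n2 h \<le> n2 g"
proof -
  have H': "H0 S (\<lambda>x. (-1) * u x) (\<lambda>x. (-1) *\<^sub>R g x)" by (rule H0_scale[OF H])
  have A: "H0 S (\<lambda>x. max 0 (u x) + max 0 ((-1) * u x))
    (\<lambda>x. (if u x > 0 then g x else 0) + (if (-1) * u x > 0 then (-1) *\<^sub>R g x else 0))" (is "H0 S _ ?h")
    by (rule H0_add[OF H0_max0[OF S H] H0_max0[OF S H']])
  have "(\<lambda>x. max 0 (u x) + max 0 ((-1) * u x)) = (\<lambda>x. \<bar>u x\<bar>)" by (auto simp: fun_eq_iff)
  moreover have "n2 ?h \<le> n2 g"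
    by (rule l2_mono(2)[OF H0_l2(2)[OF H]]) (use H0_l2(2)[OF A] in \<open>auto simp: l2_measurable\<close>)
  ultimately show ?thesis using that A by simp
qed

text \<open>Let p be the difference f(x + y) - f(x) and \<open>q t\<close> the integral of p times
  the translate of \<open>f\<close> by t y. Then q 1 - q 0 = n2 p, while Cauchy-Schwarz bounds the
  slope of q by sqrt (n2 p) |y| sqrt (n2 h). The one-variable mean value inequality and division by
  sqrt (n2 p) give the estimate.\<close>

lemma c1c_translation_bound:
  assumes fh: "c1c UNIV f h"
  shows "n2 (\<lambda>x. f (x + y) - f x) \<le> (norm y)\<^sup>2 * n2 h"
proof -
  note cs = csupp_c1c[OF fh]
  have tr: "csupp (\<lambda>x. F (x + z))" if "csupp F" for z and F :: "'a \<Rightarrow> 'b::euclidean_space"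
    using csupp_reflect[OF csupp_reflect[OF that, of 0], of "-z"] by (simp add: algebra_simps)
  have trn: "n2 (\<lambda>x. F (x + z)) = n2 F" if "csupp F" for z and F :: "'a \<Rightarrow> 'b::euclidean_space"
    unfolding n2_def using csupp_measurable(1)[OF that]
    by (intro integral_lebesgue_translation[of "\<lambda>x. (norm (F x))\<^sup>2"]) auto
  define p where "p x = f (x + y) - f x" for x
  have p: "csupp p"
  proof -
    obtain K L where "compact K" "\<And>x. x \<notin> K \<Longrightarrow> f (x + y) = 0" "compact L" "\<And>x. x \<notin> L \<Longrightarrow> f x = 0"
      "continuous_on UNIV (\<lambda>x. f (x + y))" "continuous_on UNIV f"
      using tr[OF cs(1), of y] cs(1) unfolding csupp_def by metis
    then show ?thesis unfolding p_def
      by (intro csuppI[where K="K \<union> L"]) (auto intro!: continuous_intros)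
  qed
  \<comment> \<open>Reflecting \<open>f\<close> turns \<open>q\<close> into a convolution evaluated
    at - t y, so that \<open>cv_has_derivative\<close> differentiates it.\<close>
  define k where "k z = f (0 - z)" for z
  have k: "c1c UNIV k (\<lambda>z. - h (0 - z))"
  proof -
    obtain K where K: "compact K" "\<And>x. x \<notin> K \<Longrightarrow> k x = 0"
      using csupp_reflect[OF cs(1), of 0] unfolding k_def csupp_def by blast
    show ?thesis
    proof (rule c1cI[OF _ _ K(1)])
      have "((\<lambda>y. 0 - y) has_derivative (\<lambda>v. - v)) (at x)" for x :: 'a by (auto intro!: derivative_eq_intros)
      from has_derivative_compose[OF this c1cD(1)[OF fh]]
      show "(k has_derivative (\<lambda>v. - h (0 - x) \<bullet> v)) (at x)" for x unfolding k_def by simp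
      show "continuous_on UNIV (\<lambda>z. - h (0 - z))"
        using csupp_reflect[OF cs(2), of 0] by (auto simp: csupp_def intro!: continuous_intros)
    qed (use K in auto)
  qed
  define q where "q t = cv p k (- (t *\<^sub>R y))" for t :: real
  have q: "q t = (LINT x|lebesgue. p x * f (x + t *\<^sub>R y))" for t
    by (simp add: q_def cv_def k_def add.commute)
  have bd: "\<bar>ip p (\<lambda>x. h (x + z) \<bullet> y)\<bar> \<le> sqrt (n2 p) * (norm y * sqrt (n2 h))" for z
  proof -
    have c: "csupp (\<lambda>x. h (x + z))" by (rule tr[OF cs(2)])
    have l: "l2 (\<lambda>x. h (x + z))" by (rule csupp_l2[OF c])
    have "n2 (\<lambda>x. h (x + z) \<bullet> y) \<le> (norm y)\<^sup>2 * n2 (\<lambda>x. h (x + z))"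
      by (rule l2_bound(2)[OF l]) (use l2_inner_const[OF l] in \<open>auto simp: l2_measurable mult.commute[of "norm y"] Cauchy_Schwarz_ineq2\<close>)
    then have "sqrt (n2 (\<lambda>x. h (x + z) \<bullet> y)) \<le> norm y * sqrt (n2 h)"
      using real_sqrt_le_mono[of _ "(norm y)\<^sup>2 * n2 h"] by (simp add: trn[OF cs(2)] real_sqrt_mult)
    then show ?thesis
      using ip_bound[OF csupp_l2[OF p] l2_inner_const[OF l], of y]
      by (smt (verit) mult_left_mono real_sqrt_ge_zero n2_nonneg)
  qed
  have dq: "(q has_derivative (\<lambda>s. s * ip p (\<lambda>x. h (x + t *\<^sub>R y) \<bullet> y))) (at t)" for t
  proof -
    have "((\<lambda>t. - (t *\<^sub>R y)) has_derivative (\<lambda>s. - (s *\<^sub>R y))) (at t)"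
      by (auto intro!: derivative_eq_intros)
    from has_derivative_compose[OF this cv_has_derivative[OF p k]]
    have 1: "(q has_derivative (\<lambda>s. (LINT x|lebesgue. p x *\<^sub>R - h (0 - (- (t *\<^sub>R y) - x))) \<bullet> - (s *\<^sub>R y))) (at t)"
      unfolding q_def .
    have i: "integrable lebesgue (\<lambda>x. p x *\<^sub>R h (x + t *\<^sub>R y))"
      using tr[OF cs(2)] by (intro csupp_integrable csupp_times p) (auto simp: csupp_def)
    have "(LINT x|lebesgue. p x *\<^sub>R - h (0 - (- (t *\<^sub>R y) - x))) = - (LINT x|lebesgue. p x *\<^sub>R h (x + t *\<^sub>R y))"
      by (simp add: add.commute)
    moreover have "(LINT x|lebesgue. p x *\<^sub>R h (x + t *\<^sub>R y)) \<bullet> y = ip p (\<lambda>x. h (x + t *\<^sub>R y) \<bullet> y)"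
      unfolding ip_def using i by (simp flip: integral_inner_left)
    ultimately show ?thesis using 1 by simp
  qed
  have "norm (q 1 - q 0) \<le> sqrt (n2 p) * (norm y * sqrt (n2 h)) * norm (1 - 0 :: real)"
  proof (rule differentiable_bound[of UNIV])
    show "(q has_derivative (\<lambda>s. s * ip p (\<lambda>x. h (x + t *\<^sub>R y) \<bullet> y))) (at t within UNIV)" for t
      using dq by simp
    show "onorm (\<lambda>s. s * ip p (\<lambda>x. h (x + t *\<^sub>R y) \<bullet> y)) \<le> sqrt (n2 p) * (norm y * sqrt (n2 h))" for t
      by (rule onorm_le) (use mult_left_mono[OF bd] in \<open>simp add: abs_mult mult.commute\<close>)
  qed auto
  moreover have "q 1 - q 0 = n2 p"
  proof -
    have i: "integrable lebesgue (\<lambda>x. p x * f (x + t *\<^sub>R y))" for t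
      using csupp_integrable[OF csupp_times[OF p, of "\<lambda>x. f (x + t *\<^sub>R y)"]] tr[OF cs(1)] by (simp add: csupp_def)
    have "q 1 - q 0 = (LINT x|lebesgue. p x * f (x + 1 *\<^sub>R y) - p x * f (x + 0 *\<^sub>R y))"
      unfolding q by (rule Bochner_Integration.integral_diff[symmetric]) (rule i)+
    then show ?thesis by (simp add: n2_def p_def power2_eq_square right_diff_distrib)
  qed
  ultimately have le: "sqrt (n2 p) * sqrt (n2 p) \<le> sqrt (n2 p) * (norm y * sqrt (n2 h))" by simp
  have "sqrt (n2 p) \<le> norm y * sqrt (n2 h)"
  proof (cases "sqrt (n2 p) = 0")
    case False
    then have "sqrt (n2 p) > 0" using n2_nonneg[of p] by (simp add: less_le)
    then show ?thesis using le by (rule mult_left_le_imp_le[rotated])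
  qed simp
  then have "(sqrt (n2 p))\<^sup>2 \<le> (norm y * sqrt (n2 h))\<^sup>2" by (intro power_mono) auto
  then show ?thesis by (simp add: power_mult_distrib p_def[abs_def])
qed

section \<open>The mean-square error of mollification\<close>

lemma kern_integrable: "r > 0 \<Longrightarrow> integrable lebesgue (kern a r)"
  by (intro csupp_integrable csupp_kern)

lemma mollify_minus:
  fixes f :: "'a::euclidean_space \<Rightarrow> real"
  assumes f: "csupp f" and r: "r > 0"
  shows "mollify f r x - f x = (LINT z|lebesgue. kern 0 r z * (f (z + x) - f x))"
    "integrable lebesgue (\<lambda>z. kern 0 r z * (f (z + x) - f x))"
    "integrable lebesgue (\<lambda>z. kern 0 r z * (f (z + x) - f x)\<^sup>2)"
proof -
  have c: "continuous_on UNIV f" using f by (simp add: csupp_def)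
  have c': "continuous_on UNIV (\<lambda>z. f (z + x) - f x)"
    by (intro continuous_intros continuous_on_compose2[OF c]) auto
  show "integrable lebesgue (\<lambda>z. kern 0 r z * (f (z + x) - f x))"
    using csupp_integrable[OF csupp_times[OF csupp_kern[OF r] c']] by simp
  show "integrable lebesgue (\<lambda>z. kern 0 r z * (f (z + x) - f x)\<^sup>2)"
    using csupp_integrable[OF csupp_times[OF csupp_kern[OF r] continuous_on_power[OF c']]] by simp
  have "mollify f r x - f x = (LINT y|lebesgue. kern x r y * (f y - f x))"
    unfolding mollify_def using mollify_integrable[OF f r, of x] kern_integrable[OF r, of x]
    by (simp add: right_diff_distrib kern_integral r)
  also have "\<dots> = (LINT z|lebesgue. kern x r (z + x) * (f (z + x) - f x))"
  proof (rule integral_lebesgue_translation[symmetric])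
    have "csupp (\<lambda>y. kern x r y *\<^sub>R (f y - f x))"
      by (intro csupp_times csupp_kern r continuous_intros c)
    then show "(\<lambda>y. kern x r y * (f y - f x)) \<in> borel_measurable borel"
      using csupp_measurable(1) by auto
  qed
  finally show "mollify f r x - f x = (LINT z|lebesgue. kern 0 r z * (f (z + x) - f x))"
    by (simp add: kern_def)
qed

text \<open>The squared error at a point is at most the kernel average of the squared differences.
  Exchanging the integrals leaves, for each z with |z| < r, the translation bound r^2 n2 h, and the
  kernel has mass one.\<close>

lemma mollification_c1c:
  assumes fh: "c1c UNIV f h" and r: "r > 0"
  shows "n2 (\<lambda>x. mollify f r x - f x) \<le> r\<^sup>2 * n2 h"
proof -
  note f = csupp_c1c(1)[OF fh]
  define q where "q z x = (f (z + x) - f x)\<^sup>2" for z x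
  have [measurable]: "f \<in> borel_measurable borel" "(kern 0 r :: 'a \<Rightarrow> real) \<in> borel_measurable borel"
    using csupp_measurable(1) f csupp_kern[OF r] by auto
  have CS: "(mollify f r x - f x)\<^sup>2 \<le> (LINT z|lebesgue. kern 0 r z * q z x)" for x
  proof -
    define m where "m = mollify f r x - f x"
    note i = mollify_minus(2,3)[OF f r, of x] kern_integrable[OF r, of 0]
    have gen: "(LINT z|lebesgue. a z - c * b z + d * k z) = (LINT z|lebesgue. a z) - c * (LINT z|lebesgue. b z) + d * (LINT z|lebesgue. k z)"
      if "integrable lebesgue a" "integrable lebesgue b" "integrable lebesgue k" for a b k :: "'a \<Rightarrow> real" and c d
      using that by simp
    \<comment> \<open>Jensen's inequality as nonnegativity of a variance: under the density
      \<open>kern 0 r\<close> the difference f(z + x) - f(x) has mean m.\<close>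
    have "0 \<le> (LINT z|lebesgue. kern 0 r z * ((f (z + x) - f x) - m)\<^sup>2)"
      by (intro Bochner_Integration.integral_nonneg mult_nonneg_nonneg kern_nonneg r) simp
    also have "\<dots> = (LINT z|lebesgue. kern 0 r z * (f (z + x) - f x)\<^sup>2 - 2 * m * (kern 0 r z * (f (z + x) - f x)) + m\<^sup>2 * kern 0 r z)"
      by (intro Bochner_Integration.integral_cong refl) (simp add: power2_eq_square algebra_simps)
    also have "\<dots> = (LINT z|lebesgue. kern 0 r z * (f (z + x) - f x)\<^sup>2) - 2 * m * m + m\<^sup>2"
      using gen[OF i(2,1,3), of "2 * m" "m\<^sup>2"] mollify_minus(1)[OF f r, of x] by (simp add: m_def kern_integral r)
    finally have "m\<^sup>2 \<le> (LINT z|lebesgue. kern 0 r z * (f (z + x) - f x)\<^sup>2)" by (simp add: power2_eq_square[of m])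
    then show ?thesis by (simp add: m_def q_def)
  qed
  have i2: "integrable lebesgue (\<lambda>z. kern 0 r z * q z x)" for x
    unfolding q_def by (rule mollify_minus(3)[OF f r])
  have qm: "(\<lambda>x. kern 0 r z * q z x) \<in> borel_measurable borel" "(\<lambda>z. kern 0 r z * q z x) \<in> borel_measurable borel" for x z
    unfolding q_def by measurable
  have cs: "csupp (\<lambda>x. f (z + x) - f x)" for z
  proof -
    obtain K where K: "compact K" "\<And>x. x \<notin> K \<Longrightarrow> f x = 0" and c: "continuous_on UNIV f"
      using f unfolding csupp_def by blast
    show ?thesis
    proof (rule csuppI)
      show "continuous_on UNIV (\<lambda>x. f (z + x) - f x)"
        by (intro continuous_intros continuous_on_compose2[OF c]) auto
      show "compact ((\<lambda>x. x - z) ` K \<union> K)"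
        by (intro compact_Un compact_continuous_image K continuous_intros)
      fix x assume x: "x \<notin> (\<lambda>x. x - z) ` K \<union> K"
      then have "z + x \<notin> K" by (metis UnCI add_diff_cancel_left' image_eqI)
      then show "f (z + x) - f x = 0" using K(2) x by simp
    qed
  qed
  have tr: "(\<integral>\<^sup>+x. ennreal (kern 0 r z * q z x) \<partial>lborel) \<le> ennreal (r\<^sup>2 * n2 h * kern 0 r z)" for z
  proof -
    have l: "integrable lebesgue (\<lambda>x. kern 0 r z * q z x)"
      using csupp_l2[OF cs[of z]] by (simp add: l2_def q_def)
    have "(\<integral>\<^sup>+x. ennreal (kern 0 r z * q z x) \<partial>lborel) = (\<integral>\<^sup>+x. ennreal (kern 0 r z * q z x) \<partial>lebesgue)"
      by (rule nn_integral_completion[symmetric])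
    also have "\<dots> = ennreal (kern 0 r z * n2 (\<lambda>x. f (z + x) - f x))"
      using kern_nonneg[OF r, of 0 z] l by (subst nn_integral_eq_integral) (auto simp: q_def n2_def)
    also have "\<dots> \<le> ennreal (r\<^sup>2 * n2 h * kern 0 r z)"
    proof (rule ennreal_leI, cases "norm z < r")
      case True
      have "n2 (\<lambda>x. f (z + x) - f x) \<le> (norm z)\<^sup>2 * n2 h"
        using c1c_translation_bound[OF fh, of z] by (simp add: add.commute)
      also have "\<dots> \<le> r\<^sup>2 * n2 h" using True by (intro mult_right_mono power_mono) auto
      finally show "kern 0 r z * n2 (\<lambda>x. f (z + x) - f x) \<le> r\<^sup>2 * n2 h * kern 0 r z"
        using kern_nonneg[OF r, of 0 z] by (simp add: mult.commute mult_left_mono)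
    next
      case False
      then show "kern 0 r z * n2 (\<lambda>x. f (z + x) - f x) \<le> r\<^sup>2 * n2 h * kern 0 r z"
        using kern_outside[OF r, of z 0] by simp
    qed
    finally show ?thesis .
  qed
  have lF: "l2 (\<lambda>x. mollify f r x - f x)"
  proof -
    obtain K where K: "compact K" "\<And>x. x \<notin> K \<Longrightarrow> f x = 0" using f unfolding csupp_def by blast
    have "test_function UNIV (mollify f r)" by (rule test_function_cvv[OF f K(1) r K(2)]) auto
    then show ?thesis by (intro l2_diff c1c_l2(1)[OF fh]) (auto intro: c1c_l2 c1c_test_function)
  qed
  have "ennreal (n2 (\<lambda>x. mollify f r x - f x)) = (\<integral>\<^sup>+x. ennreal ((mollify f r x - f x)\<^sup>2) \<partial>lebesgue)"
    unfolding n2_def using lF by (subst nn_integral_eq_integral) (auto simp: l2_def)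
  also have "\<dots> \<le> (\<integral>\<^sup>+x. (\<integral>\<^sup>+z. ennreal (kern 0 r z * q z x) \<partial>lborel) \<partial>lebesgue)"
  proof (rule nn_integral_mono)
    fix x :: 'a
    have "ennreal ((mollify f r x - f x)\<^sup>2) \<le> ennreal (LINT z|lebesgue. kern 0 r z * q z x)"
      by (intro ennreal_leI CS)
    also have "\<dots> = (\<integral>\<^sup>+z. ennreal (kern 0 r z * q z x) \<partial>lebesgue)"
      by (rule nn_integral_eq_integral[symmetric, OF i2]) (auto simp: q_def kern_nonneg[OF r])
    also have "\<dots> = (\<integral>\<^sup>+z. ennreal (kern 0 r z * q z x) \<partial>lborel)"
      by (rule nn_integral_completion)
    finally show "ennreal ((mollify f r x - f x)\<^sup>2) \<le> (\<integral>\<^sup>+z. ennreal (kern 0 r z * q z x) \<partial>lborel)" .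
  qed
  also have "\<dots> = (\<integral>\<^sup>+x. (\<integral>\<^sup>+z. ennreal (kern 0 r z * q z x) \<partial>lborel) \<partial>lborel)"
    by (rule nn_integral_completion)
  also have "\<dots> = (\<integral>\<^sup>+z. (\<integral>\<^sup>+x. ennreal (kern 0 r z * q z x) \<partial>lborel) \<partial>lborel)"
    by (rule lborel_pair.Fubini') (simp add: q_def split_def)
  also have "\<dots> \<le> (\<integral>\<^sup>+z. ennreal (r\<^sup>2 * n2 h * kern (0::'a) r z) \<partial>lborel)"
    by (rule nn_integral_mono) (rule tr)
  also have "\<dots> = (\<integral>\<^sup>+z. ennreal (r\<^sup>2 * n2 h * kern (0::'a) r z) \<partial>lebesgue)"
    by (rule nn_integral_completion[symmetric])
  also have "\<dots> = ennreal (r\<^sup>2 * n2 h)"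
    using kern_integrable[OF r, of "0::'a"] kern_nonneg[OF r, of "0::'a"]
    by (subst nn_integral_eq_integral) (auto simp: kern_integral r)
  finally show ?thesis by simp
qed

lemma mollify_l2:
  assumes "l2 (u :: 'a::euclidean_space \<Rightarrow> real)" "r > 0"
  shows "mollify u r x = ip (kern x r) u" "integrable lebesgue (\<lambda>y. kern x r y * u y)"
  using ip_integrable[OF csupp_l2[OF csupp_kern[OF assms(2)]] assms(1)] by (auto simp: mollify_def ip_def)

text \<open>Each mollified value is a pairing with a fixed kernel, so it converges at every point
  along the approximants; Fatou's lemma then carries the estimate over.\<close>

lemma mollification_H0:
  assumes "H0 S u g" "r > 0"
  shows "l2 (\<lambda>x. mollify u r x - u x)" "n2 (\<lambda>x. mollify u r x - u x) \<le> r\<^sup>2 * n2 g"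
proof -
  obtain f0 h0 where fh0: "\<And>n. c1c S (f0 n) (h0 n)" "tol2 f0 u" "tol2 h0 g" using H0E[OF assms(1)] by metis
  obtain s where s: "strict_mono s" "AE x in lebesgue. (\<lambda>n. f0 (s n) x) \<longlonglongrightarrow> u x"
    using tol2_AE_subseq[OF fh0(2)] by blast
  define f where "f n = f0 (s n)" for n
  define h where "h n = h0 (s n)" for n
  have fh: "\<And>n. c1c UNIV (f n) (h n)" "tol2 f u" "tol2 h g" "AE x in lebesgue. (\<lambda>n. f n x) \<longlonglongrightarrow> u x"
    unfolding f_def h_def using fh0 s by (auto intro: tol2_subseq c1c_mono)
  have lim: "(\<lambda>n. mollify (f n) r x) \<longlonglongrightarrow> mollify u r x" for x
    unfolding mollify_l2(1)[OF tol2D(1)[OF fh(2)] assms(2)] mollify_l2(1)[OF tol2D(2)[OF fh(2)] assms(2)]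
    by (intro tol2_ip tol2_const csupp_l2 csupp_kern assms fh)
  have lF: "l2 (\<lambda>x. mollify (f n) r x - f n x)" and lc: "l2 (mollify (f n) r)" for n
  proof -
    obtain K where K: "compact K" "\<And>x. x \<notin> K \<Longrightarrow> f n x = 0" using c1c_supp[OF fh(1)[of n]] by metis
    have "test_function UNIV (mollify (f n) r)"
      by (rule test_function_cvv[OF csupp_c1c(1)[OF fh(1)] K(1) assms(2) K(2)]) auto
    then show "l2 (mollify (f n) r)" by (rule c1c_l2(1)[OF c1c_test_function])
    then show "l2 (\<lambda>x. mollify (f n) r x - f n x)" by (intro l2_diff c1c_l2(1)[OF fh(1)])
  qed
  have m: "(\<lambda>x. mollify u r x - u x) \<in> borel_measurable lebesgue"
  proof (rule borel_measurable_diff)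
    show "mollify u r \<in> borel_measurable lebesgue"
      by (rule borel_measurable_LIMSEQ_metric[OF l2_measurable[OF lc] lim])
  qed (rule l2_measurable[OF tol2D(2)[OF fh(2)]])
  have ae: "AE x in lebesgue. (\<lambda>n. mollify (f n) r x - f n x) \<longlonglongrightarrow> mollify u r x - u x"
    using fh(4) by eventually_elim (intro tendsto_diff lim)
  have *: "l2 (\<lambda>x. mollify u r x - u x) \<and> n2 (\<lambda>x. mollify u r x - u x) \<le> r\<^sup>2 * n2 g + e" if "e > 0" for e
  proof -
    have "(\<lambda>n. r\<^sup>2 * n2 (h n)) \<longlonglongrightarrow> r\<^sup>2 * n2 g" by (intro tendsto_mult_left tol2_n2 fh)
    then have "\<forall>\<^sub>F n in sequentially. r\<^sup>2 * n2 (h n) < r\<^sup>2 * n2 g + e"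
      by (rule order_tendstoD) (use that in simp)
    then have "\<forall>\<^sub>F n in sequentially. n2 (\<lambda>x. mollify (f n) r x - f n x) \<le> r\<^sup>2 * n2 g + e"
      by eventually_elim (use mollification_c1c[OF fh(1) assms(2)] in \<open>fastforce intro: order_trans less_imp_le\<close>)
    from l2_Fatou[OF lF m ae this] show ?thesis by simp
  qed
  show "l2 (\<lambda>x. mollify u r x - u x)" using *[of 1] by simp
  show "n2 (\<lambda>x. mollify u r x - u x) \<le> r\<^sup>2 * n2 g"
    by (rule field_le_epsilon) (use * in blast)
qed

section \<open>Compactness and lower semicontinuity\<close>

lemma H0_integrable:
  assumes "H0 S u g" "bounded S"
  shows "integrable lebesgue u"
    "(LINT x|lebesgue. \<bar>u x\<bar>) \<le> sqrt (n2 u) * sqrt (measure lebesgue (closure S))"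
proof -
  note l = H0_l2(1)[OF assms(1)]
  have K: "closure S \<in> lmeasurable" using assms(2) by (intro lmeasurable_compact) (simp add: compact_closure)
  note i = l2_indicator_lmeasurable[OF K]
  have ae: "AE x in lebesgue. indicator (closure S) x \<bullet> u x = u x"
    "AE x in lebesgue. \<bar>u x\<bar> = indicator (closure S) x \<bullet> \<bar>u x\<bar>"
    using H0_outside(1)[OF assms(1)] closure_subset[of S] by (auto simp: indicator_def elim!: eventually_mono)
  have mu: "u \<in> borel_measurable lebesgue" using l by (rule l2_measurable)
  show "integrable lebesgue u"
    by (rule integrable_cong_AE_imp[OF ip_integrable[OF i(1) l] mu]) (use ae(1) in auto)
  have "(LINT x|lebesgue. \<bar>u x\<bar>) = ip (\<lambda>x. indicator (closure S) x) (\<lambda>x. \<bar>u x\<bar>)"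
    unfolding ip_def using l2_norm[OF l] i mu ae(2) by (intro integral_cong_AE) (auto simp: l2_measurable)
  also have "\<dots> \<le> sqrt (measure lebesgue (closure S)) * sqrt (n2 u)"
    using ip_bound[OF i(1) l2_norm[OF l]] n2_norm[of u] i(2) by simp
  finally show "(LINT x|lebesgue. \<bar>u x\<bar>) \<le> sqrt (n2 u) * sqrt (measure lebesgue (closure S))"
    by (simp add: mult.commute)
qed

lemma H0_integral_tendsto:
  assumes "\<And>n. H0 S (U n) (G n)" "H0 S u g" "bounded S" "tol2 U u"
  shows "(\<lambda>n. LINT x|lebesgue. U n x) \<longlonglongrightarrow> (LINT x|lebesgue. u x)"
proof -
  have b: "norm ((LINT x|lebesgue. U n x) - (LINT x|lebesgue. u x)) \<le>
      sqrt (n2 (\<lambda>x. U n x - u x)) * sqrt (measure lebesgue (closure S))" for n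
  proof -
    have "(LINT x|lebesgue. U n x) - (LINT x|lebesgue. u x) = (LINT x|lebesgue. U n x - u x)"
      using H0_integrable(1)[OF assms(1,3)] H0_integrable(1)[OF assms(2,3)] by simp
    also have "norm \<dots> \<le> (LINT x|lebesgue. \<bar>U n x - u x\<bar>)"
      using integral_norm_bound[of lebesgue "\<lambda>x. U n x - u x"] by simp
    also have "\<dots> \<le> sqrt (n2 (\<lambda>x. U n x - u x)) * sqrt (measure lebesgue (closure S))"
      by (rule H0_integrable(2)[OF H0_diff[OF assms(1,2)] assms(3)])
    finally show ?thesis .
  qed
  have "(\<lambda>n. sqrt (n2 (\<lambda>x. U n x - u x)) * sqrt (measure lebesgue (closure S))) \<longlonglongrightarrow> 0"
    by (rule tendsto_mult_left_zero[OF tol2_sqrt[OF assms(4)]])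
  then have "(\<lambda>n. (LINT x|lebesgue. U n x) - (LINT x|lebesgue. u x)) \<longlonglongrightarrow> 0"
    by (rule Lim_null_comparison[rotated]) (use b in auto)
  then show ?thesis by (simp add: LIM_zero_iff)
qed

lemma mollify_diff:
  assumes lu: "l2 u" and iu: "integrable lebesgue u" and r: "r > 0"
    and \<eta>: "\<And>z. \<bar>kern 0 r (x - z) - kern 0 r (y - z)\<bar> \<le> \<eta>"
  shows "\<bar>mollify u r x - mollify u r y\<bar> \<le> \<eta> * (LINT z|lebesgue. \<bar>u z :: real\<bar>)"
proof -
  have "mollify u r x - mollify u r y = (LINT z|lebesgue. (kern x r z - kern y r z) * u z)"
    unfolding mollify_def using mollify_l2(2)[OF lu r] by (simp add: left_diff_distrib)
  also have "norm \<dots> \<le> (LINT z|lebesgue. \<eta> * \<bar>u z\<bar>)"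
  proof (rule order_trans[OF integral_norm_bound integral_mono])
    show "integrable lebesgue (\<lambda>z. norm ((kern x r z - kern y r z) * u z))"
      using mollify_l2(2)[OF lu r] by (intro integrable_norm) (simp add: left_diff_distrib)
    show "integrable lebesgue (\<lambda>z. \<eta> * \<bar>u z\<bar>)" using iu by simp
    show "norm ((kern x r z - kern y r z) * u z) \<le> \<eta> * \<bar>u z\<bar>" for z
      using \<eta>[of z] kern_translate[of x r z] kern_translate[of y r z]
      by (simp add: abs_mult mult_right_mono)
  qed
  finally show ?thesis by simp
qed

lemma continuous_on_cvv:
  assumes lu: "l2 u" and iu: "integrable lebesgue u" and r: "r > 0"
  shows "continuous_on A (mollify (u :: 'a::euclidean_space \<Rightarrow> real) r)"
proof (rule continuous_onI)
  fix x and e :: real assume e: "e > 0"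
  define I where "I = (LINT z|lebesgue. \<bar>u z\<bar>)"
  have I: "I \<ge> 0" by (simp add: I_def)
  have p: "e / (I + 1) > 0" using e I by simp
  obtain d where d: "d > 0" "\<And>x y. norm (x - y) < d \<Longrightarrow> norm (kern (0::'a) r x - kern 0 r y) < e / (I + 1)"
    using csupp_uniform[OF csupp_kern[OF r] p] by blast
  have "dist (mollify u r y) (mollify u r x) \<le> e" if "dist y x < d" for y
  proof -
    have "\<bar>mollify u r y - mollify u r x\<bar> \<le> e / (I + 1) * I"
      unfolding I_def by (rule mollify_diff[OF lu iu r])
        (use d(2)[of "y - z" "x - z" for z] that in \<open>auto intro!: less_imp_le simp: I_def dist_norm\<close>)
    also have "\<dots> \<le> e" using e I by (simp add: field_simps)
    finally show ?thesis by (simp add: dist_real_def)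
  qed
  then show "\<exists>d>0. \<forall>x'\<in>A. dist x' x < d \<longrightarrow> dist (mollify u r x') (mollify u r x) \<le> e" using d(1) by blast
qed

text \<open>At a fixed radius the mollified functions are equibounded and equicontinuous on the
  closure of \<open>S\<close>, so Arzela-Ascoli gives uniform convergence along a subsequence. The
  error of mollification is small uniformly in n because the gradients are bounded.\<close>

lemma Rellich_step:
  assumes H: "\<And>n. H0 S (U n) (G n)" and S: "bounded S" and B: "\<And>n. n2 (G n) \<le> B" and C: "\<And>n. n2 (U n) \<le> C"
    and e: "e > 0"
  shows "\<exists>s::nat \<Rightarrow> nat. strict_mono s \<and> (\<exists>N. \<forall>i\<ge>N. \<forall>j\<ge>N. n2 (\<lambda>x. U (s i) x - U (s j) x) \<le> e)"
proof -
  define X where "X = closure S"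
  have X: "compact X" unfolding X_def using S by (simp add: compact_closure)
  define m where "m = measure lebesgue X"
  have m: "m \<ge> 0" by (simp add: m_def)
  define A where "A = sqrt C * sqrt m"
  have A: "(LINT x|lebesgue. \<bar>U n x\<bar>) \<le> A" for n
  proof -
    have "sqrt (n2 (U n)) \<le> sqrt C" using C by simp
    then show ?thesis
      using H0_integrable(2)[OF H S, of n] m mult_right_mono[of "sqrt (n2 (U n))" "sqrt C" "sqrt m"]
      unfolding A_def m_def X_def by simp
  qed
  have B0: "B \<ge> 0" using B[of 0] n2_nonneg[of "G 0"] by linarith
  have A0: "A \<ge> 0" by (rule order_trans[OF _ A[of 0]]) simp
  \<comment> \<open>Two mollification errors of size r^2 B, each with factor 3 from squaring a sum
    of three terms, must stay below e / 2. The summand 1 covers B = 0.\<close>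
  define r where "r = sqrt (e / (12 * (B + 1)))"
  have r: "r > 0" using e B0 by (simp add: r_def)
  have rB: "6 * (r\<^sup>2 * B) \<le> e / 2"
  proof -
    have "r\<^sup>2 = e / (12 * (B + 1))" using e B0 by (simp add: r_def)
    then have "r\<^sup>2 * (12 * (B + 1)) = e" using B0 nonzero_eq_divide_eq[of "12 * (B + 1)" "r\<^sup>2" e] by auto
    then have "12 * (r\<^sup>2 * B) + 12 * r\<^sup>2 = e" by (simp add: algebra_simps)
    moreover have "0 \<le> r\<^sup>2" by simp
    ultimately show ?thesis by linarith
  qed
  \<comment> \<open>Two functions within d of \<open>g\<close> differ by at most 2 d, whose square
    times 3 is 12 d^2; integrated over a set of measure m this must stay below e / 2.\<close>
  define d where "d = sqrt (e / (24 * (m + 1)))"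
  have d: "d > 0" using e m by (simp add: d_def)
  have dm: "12 * (d\<^sup>2 * m) \<le> e / 2"
  proof -
    have "d\<^sup>2 = e / (24 * (m + 1))" using e m by (simp add: d_def)
    then have "d\<^sup>2 * (24 * (m + 1)) = e" using m nonzero_eq_divide_eq[of "24 * (m + 1)" "d\<^sup>2" e] by auto
    then have "24 * (d\<^sup>2 * m) + 24 * d\<^sup>2 = e" by (simp add: algebra_simps)
    moreover have "0 \<le> d\<^sup>2" by simp
    ultimately show ?thesis by linarith
  qed
  have lU: "l2 (U n)" for n by (rule H0_l2(1)[OF H])
  have iU: "integrable lebesgue (U n)" for n by (rule H0_integrable(1)[OF H S])
  obtain kB where kB: "kB > 0" "\<And>x. norm (kern (0::'a) r x) \<le> kB"
    using csupp_bounded[OF csupp_kern[OF r]] by blast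
  have c_diff: "\<bar>mollify (U n) r x - mollify (U n) r y\<bar> \<le> \<eta> * A"
    if "\<And>z. \<bar>kern 0 r (x - z) - kern 0 r (y - z)\<bar> \<le> \<eta>" "\<eta> \<ge> 0" for n x y \<eta>
    by (rule order_trans[OF mollify_diff[OF lU iU r that(1)] mult_left_mono[OF A that(2)]])
  have c_bd: "\<bar>mollify (U n) r x\<bar> \<le> kB * A" for n x
  proof -
    have "norm (mollify (U n) r x) \<le> (LINT z|lebesgue. kB * \<bar>U n z\<bar>)"
      unfolding mollify_def
    proof (rule order_trans[OF integral_norm_bound integral_mono])
      show "integrable lebesgue (\<lambda>z. norm (kern x r z *\<^sub>R U n z))"
        using mollify_l2(2)[OF lU r] by (intro integrable_norm) simp
      show "integrable lebesgue (\<lambda>z. kB * \<bar>U n z\<bar>)" using iU by simp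
      show "norm (kern x r z *\<^sub>R U n z) \<le> kB * \<bar>U n z\<bar>" for z
        using kB(2)[of "x - z"] kern_translate[of x r z] by (simp add: abs_mult mult_right_mono)
    qed
    also have "\<dots> \<le> kB * A" using A[of n] kB(1) by simp
    finally show ?thesis by simp
  qed
  obtain g s where s: "strict_mono (s :: nat \<Rightarrow> nat)"
    "\<And>e. 0 < e \<Longrightarrow> \<exists>N. \<forall>n x. n \<ge> N \<and> x \<in> X \<longrightarrow> norm (mollify (U (s n)) r x - g x) < e"
  proof (rule Arzela_Ascoli[OF X, of "\<lambda>n. mollify (U n) r" "kB * A"])
    show "\<exists>d>0. \<forall>n y. y \<in> X \<and> norm (x - y) < d \<longrightarrow> norm (mollify (U n) r x - mollify (U n) r y) < \<epsilon>"
      if "\<epsilon> > 0" for x \<epsilon>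
    proof -
      have p: "\<epsilon> / (2 * (A + 1)) > 0" using that A0 by simp
      obtain \<delta> where \<delta>: "\<delta> > 0" "\<And>x y. norm (x - y) < \<delta> \<Longrightarrow> norm (kern (0::'a) r x - kern 0 r y) < \<epsilon> / (2 * (A + 1))"
        using csupp_uniform[OF csupp_kern[OF r] p] by blast
      have "norm (mollify (U n) r x - mollify (U n) r y) < \<epsilon>" if "norm (x - y) < \<delta>" for n y
      proof -
        have "\<bar>mollify (U n) r x - mollify (U n) r y\<bar> \<le> \<epsilon> / (2 * (A + 1)) * A"
          by (rule c_diff) (use \<delta>(2)[of "x - z" "y - z" for z] that p in \<open>auto intro!: less_imp_le\<close>)
        also have "\<dots> < \<epsilon>" using \<open>\<epsilon> > 0\<close> A0 by (simp add: field_simps add_nonneg_pos)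
        finally show ?thesis by simp
      qed
      then show ?thesis using \<delta>(1) by blast
    qed
  qed (use c_bd that in auto)
  obtain N where N: "\<And>n x. n \<ge> N \<Longrightarrow> x \<in> X \<Longrightarrow> \<bar>mollify (U (s n)) r x - g x\<bar> < d"
    using s(2)[OF d] by (metis real_norm_def)
  have "n2 (\<lambda>x. U (s i) x - U (s j) x) \<le> e" if "i \<ge> N" "j \<ge> N" for i j
  proof -
    define ci where "ci x = mollify (U (s i)) r x - U (s i) x" for x
    define cj where "cj x = mollify (U (s j)) r x - U (s j) x" for x
    have ci: "l2 ci" "n2 ci \<le> r\<^sup>2 * B" and cj: "l2 cj" "n2 cj \<le> r\<^sup>2 * B"
      unfolding ci_def cj_def using mollification_H0[OF H r] B r
      by (auto intro!: order_trans[OF mollification_H0(2)[OF H r] mult_left_mono])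
    have Xm: "X \<in> lmeasurable" using X by (rule lmeasurable_compact)
    have "n2 (\<lambda>x. U (s i) x - U (s j) x) \<le>
      (LINT x|lebesgue. 3 * (norm (ci x))\<^sup>2 + 3 * (norm (cj x))\<^sup>2 + 12 * d\<^sup>2 * indicator X x)"
      unfolding n2_def
    proof (rule integral_mono_AE)
      show "integrable lebesgue (\<lambda>x. (norm (U (s i) x - U (s j) x))\<^sup>2)"
        using l2_diff[OF lU lU] by (simp add: l2_def)
      show "integrable lebesgue (\<lambda>x. 3 * (norm (ci x))\<^sup>2 + 3 * (norm (cj x))\<^sup>2 + 12 * d\<^sup>2 * indicator X x)"
        using ci(1) cj(1) Xm by (auto simp: l2_def fmeasurable_def)
      show "AE x in lebesgue. (norm (U (s i) x - U (s j) x))\<^sup>2 \<le> 3 * (norm (ci x))\<^sup>2 + 3 * (norm (cj x))\<^sup>2 + 12 * d\<^sup>2 * indicator X x"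
        using H0_outside(1)[OF H[of "s i"]] H0_outside(1)[OF H[of "s j"]]
      proof eventually_elim
        case (elim x)
        show ?case
        proof (cases "x \<in> X")
          case True
          define t where "t = mollify (U (s i)) r x - mollify (U (s j)) r x"
          have "\<bar>t\<bar> \<le> \<bar>2 * d\<bar>" using N[OF that(1) True] N[OF that(2) True] d unfolding t_def by linarith
          then have t: "t\<^sup>2 \<le> 4 * d\<^sup>2" using abs_le_square_iff[of t "2 * d"] by simp
          have "U (s i) x - U (s j) x = t - ci x + cj x" by (simp add: t_def ci_def cj_def)
          moreover have "(t - ci x + cj x)\<^sup>2 \<le> 3 * t\<^sup>2 + 3 * (ci x)\<^sup>2 + 3 * (cj x)\<^sup>2"
            using sum_squares_bound[of t "- ci x"] sum_squares_bound[of t "cj x"] sum_squares_bound[of "- ci x" "cj x"]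
            by (simp add: power2_eq_square algebra_simps)
          ultimately show ?thesis using t True by simp
        next
          case False
          then have "x \<notin> S" using closure_subset[of S] unfolding X_def by blast
          then show ?thesis using elim by (simp add: False)
        qed
      qed
    qed
    also have "\<dots> = 3 * n2 ci + 3 * n2 cj + 12 * d\<^sup>2 * m"
    proof -
      have "(LINT x|lebesgue. 3 * a x + 3 * b x + c * k x) = 3 * (LINT x|lebesgue. a x) + 3 * (LINT x|lebesgue. b x) + c * (LINT x|lebesgue. k x)"
        if "integrable lebesgue a" "integrable lebesgue b" "integrable lebesgue k" for a b k :: "'a \<Rightarrow> real" and c
        using that by simp
      moreover have "integrable lebesgue (\<lambda>x. (norm (ci x))\<^sup>2)" "integrable lebesgue (\<lambda>x. (norm (cj x))\<^sup>2)"
        "integrable lebesgue (indicator X :: 'a \<Rightarrow> real)"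
        using ci(1) cj(1) Xm by (auto simp: l2_def fmeasurable_def)
      moreover have "(LINT x|lebesgue. indicator X x) = m" using Xm by (simp add: m_def)
      ultimately show ?thesis unfolding n2_def by presburger
    qed
    also have "\<dots> \<le> e" using ci(2) cj(2) rB dm by simp
    finally show ?thesis .
  qed
  then show ?thesis using s(1) by blast
qed

text \<open>\<open>Rellich_step\<close> controls the tail only up to a given tolerance. The diagonal
  sequence over the tolerances 1 / (k + 1) is Cauchy, with the bound on the functions themselves
  supplied by the Poincare inequality.\<close>

lemma Rellich:
  fixes U :: "nat \<Rightarrow> 'a::euclidean_space \<Rightarrow> real"
  assumes H: "\<And>n. H0 S (U n) (G n)" and S: "bounded S" and B: "\<And>n. n2 (G n) \<le> B"
  obtains s u where "strict_mono s" "tol2 (\<lambda>n. U (s n)) u"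
proof -
  obtain R where R: "S \<subseteq> ball 0 R" using bounded_subset_ballD[OF S] by blast
  have C: "n2 (U n) \<le> 4 * R\<^sup>2 * B" for n
    using H0_Poincare[OF H R, of n] mult_left_mono[OF B[of n], of "4 * R\<^sup>2"] by simp
  define P where "P k s \<longleftrightarrow> (\<exists>N. \<forall>i\<ge>N. \<forall>j\<ge>N. n2 (\<lambda>x. U (s i) x - U (s j) x) \<le> 1 / Suc k)" for k and s :: "nat \<Rightarrow> nat"
  interpret subseqs P
  proof
    fix k and s :: "nat \<Rightarrow> nat" assume "strict_mono s"
    show "\<exists>r'. strict_mono r' \<and> P k (s \<circ> r')"
      unfolding P_def using Rellich_step[of S "\<lambda>n. U (s n)" "\<lambda>n. G (s n)" B "4 * R\<^sup>2 * B" "1 / Suc k"] H S B C by simp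
  qed
  have P: "P k (diagseq \<circ> (+) (Suc k))" for k
  proof (rule diagseq_holds)
    fix r s :: "nat \<Rightarrow> nat" and n assume rs: "strict_mono r" "P n s"
    then obtain N where N: "\<forall>i\<ge>N. \<forall>j\<ge>N. n2 (\<lambda>x. U (s i) x - U (s j) x) \<le> 1 / Suc n" unfolding P_def by blast
    show "P n (s \<circ> r)" unfolding P_def
    proof (intro exI[of _ N] allI impI)
      fix i j assume "N \<le> i" "N \<le> j"
      then show "n2 (\<lambda>x. U ((s \<circ> r) i) x - U ((s \<circ> r) j) x) \<le> 1 / Suc n"
        using N seq_suble[OF rs(1), of i] seq_suble[OF rs(1), of j] by auto
    qed
  qed
  have "\<exists>N. \<forall>i\<ge>N. \<forall>j\<ge>N. n2 (\<lambda>x. U (diagseq i) x - U (diagseq j) x) \<le> e" if "e > 0" for e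
  proof -
    obtain k where k: "1 / real (Suc k) < e" using nat_approx_posE[OF \<open>e > 0\<close>] by metis
    obtain N where N: "\<forall>i\<ge>N. \<forall>j\<ge>N. n2 (\<lambda>x. U (diagseq (Suc k + i)) x - U (diagseq (Suc k + j)) x) \<le> 1 / Suc k"
      using P[of k] unfolding P_def by auto
    have "n2 (\<lambda>x. U (diagseq i) x - U (diagseq j) x) \<le> e" if "i \<ge> N + Suc k" "j \<ge> N + Suc k" for i j
    proof -
      have "N \<le> i - Suc k" "N \<le> j - Suc k" using that by auto
      from N[rule_format, OF this] show ?thesis using that k by simp
    qed
    then show ?thesis by blast
  qed
  then obtain u where "tol2 (\<lambda>n. U (diagseq n)) u"
    using l2_complete[of "\<lambda>n. U (diagseq n)"] H0_l2(1)[OF H] by blast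
  then show ?thesis using that subseq_diagseq by blast
qed

lemma n2_parallelogram:
  assumes "l2 f" "l2 g"
  shows "n2 (\<lambda>x. (1/2) *\<^sub>R (f x + g x)) + n2 (\<lambda>x. (1/2) *\<^sub>R (f x - g x)) = (n2 f + n2 g) / 2"
  using assms by (simp only: n2_scaleR n2_add n2_diff) (simp add: power2_eq_square field_simps)

text \<open>Near-minimisers of the energy over shrinking \<open>L\<^sup>2\<close>-balls around the limit form a Cauchy sequence by the
  parallelogram law; this replaces weak compactness.\<close>

lemma H0_lsc:
  assumes H: "\<And>n. H0 S (U n) (G n)" and u: "tol2 U u" and c: "(\<lambda>n. n2 (G n)) \<longlonglongrightarrow> c"
  obtains g where "H0 S u g" "n2 g \<le> c"
proof -
  define A where "A k = {h. \<exists>v. H0 S v h \<and> n2 (\<lambda>x. v x - u x) \<le> 1 / real (Suc k)}" for k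
  define d where "d k = Inf (n2 ` A k)" for k
  have bb: "bdd_below (n2 ` A k)" for k by (rule bdd_belowI[of _ 0]) auto
  have ev: "\<forall>\<^sub>F n in sequentially. G n \<in> A k" for k
  proof -
    have "\<forall>\<^sub>F n in sequentially. n2 (\<lambda>x. U n x - u x) < 1 / real (Suc k)"
      by (rule order_tendstoD(2)[OF tol2D(3)[OF u]]) simp
    then show ?thesis
      by eventually_elim (use H in \<open>auto simp: A_def intro: less_imp_le\<close>)
  qed
  have ne: "A k \<noteq> {}" for k using eventually_happens'[OF sequentially_bot ev[of k]] by auto
  have d_le: "d k \<le> n2 h" if "h \<in> A k" for h k
    unfolding d_def using that bb by (intro cInf_lower) auto
  have dc: "d k \<le> c" for k
    by (rule tendsto_le[OF _ c tendsto_const]) (use ev[of k] in \<open>auto elim!: eventually_mono intro: d_le\<close>)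
  have A_mono: "A l \<subseteq> A k" if "k \<le> l" for k l
  proof -
    have "1 / real (Suc l) \<le> 1 / real (Suc k)" using that by (intro divide_left_mono) auto
    then show ?thesis unfolding A_def using order_trans by blast
  qed
  have d_mono: "d k \<le> d l" if "k \<le> l" for k l
    unfolding d_def using A_mono[OF that] ne bb by (intro cInf_superset_mono) auto
  have "\<exists>h v. H0 S v h \<and> n2 (\<lambda>x. v x - u x) \<le> 1 / real (Suc k) \<and> n2 h < d k + 1 / real (Suc k)" for k
  proof -
    have "\<exists>y\<in>n2 ` A k. y < d k + 1 / real (Suc k)"
      using cInf_less_iff[of "n2 ` A k" "d k + 1 / real (Suc k)"] ne bb unfolding d_def by auto
    then show ?thesis unfolding A_def by blast
  qed
  then obtain h v where hv: "\<And>k. H0 S (v k) (h k)" "\<And>k. n2 (\<lambda>x. v k x - u x) \<le> 1 / real (Suc k)"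
    "\<And>k. n2 (h k) < d k + 1 / real (Suc k)" by metis
  have lh: "l2 (h k)" "l2 (v k)" for k using H0_l2[OF hv(1)] by auto
  have lu: "l2 u" using u by (rule tol2D)
  have lin: "a \<le> 2 * (y - x) + 4 * t" if "a / 4 \<le> (b + c) / 2 - x" "b \<le> x + t" "c \<le> y + t" for a b c x y t :: real
    using that by argo
  have close: "n2 (\<lambda>x. h k x - h l x) \<le> 2 * (d l - d k) + 4 * (1 / real (Suc k))" if kl: "k \<le> l" for k l
  proof -
    have "n2 (\<lambda>x. (1/2) *\<^sub>R ((v k x - u x) + (v l x - u x))) \<le> (n2 (\<lambda>x. v k x - u x) + n2 (\<lambda>x. v l x - u x)) / 2"
      using n2_parallelogram[OF l2_diff[OF lh(2) lu] l2_diff[OF lh(2) lu], of k l]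
        n2_nonneg[of "\<lambda>x. (1/2) *\<^sub>R ((v k x - u x) - (v l x - u x))"] by linarith
    also have "\<dots> \<le> (1 / real (Suc k) + 1 / real (Suc l)) / 2" using hv(2)[of k] hv(2)[of l] by simp
    also have "\<dots> \<le> 1 / real (Suc k)"
    proof -
      have "1 / real (Suc l) \<le> 1 / real (Suc k)" using kl by (intro divide_left_mono) auto
      then show ?thesis by simp
    qed
    finally have 1: "n2 (\<lambda>x. (1/2) * (v k x + v l x) - u x) \<le> 1 / real (Suc k)"
      by (simp add: algebra_simps)
    \<comment> \<open>The midpoint lies again in the larger ball of index k, so its energy is at
      least \<open>d k\<close>; this lower bound makes the parallelogram law effective.\<close>
    have "H0 S (\<lambda>x. (1/2) * (v k x + v l x)) (\<lambda>x. (1/2) *\<^sub>R (h k x + h l x))"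
      by (intro H0_scale H0_add hv)
    with 1 have "d k \<le> n2 (\<lambda>x. (1/2) *\<^sub>R (h k x + h l x))"
      by (intro d_le) (auto simp: A_def)
    then have "n2 (\<lambda>x. (1/2) *\<^sub>R (h k x - h l x)) \<le> (n2 (h k) + n2 (h l)) / 2 - d k"
      using n2_parallelogram[OF lh(1) lh(1), of k l] by linarith
    moreover have "n2 (h k) \<le> d k + 1 / real (Suc k)" "n2 (h l) \<le> d l + 1 / real (Suc k)"
    proof -
      show "n2 (h k) \<le> d k + 1 / real (Suc k)" using hv(3)[of k] by simp
      have "1 / real (Suc l) \<le> 1 / real (Suc k)" using kl by (intro divide_left_mono) auto
      then show "n2 (h l) \<le> d l + 1 / real (Suc k)" using hv(3)[of l] by linarith
    qed
    moreover have "n2 (\<lambda>x. (1/2) *\<^sub>R (h k x - h l x)) = n2 (\<lambda>x. h k x - h l x) / 4"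
      by (simp only: n2_scaleR) (simp add: power2_eq_square)
    ultimately show ?thesis by (intro lin) auto
  qed
  have "\<exists>L. d \<longlonglongrightarrow> L"
    by (rule Bseq_mono_convergent[THEN convergentD])
      (use d_mono dc in \<open>auto intro!: BseqI'[of _ "max \<bar>d 0\<bar> \<bar>c\<bar>"] simp: \<close>,
       smt (verit) d_mono dc le0)
  then have Cd: "Cauchy d" by (auto intro: LIMSEQ_imp_Cauchy)
  have "\<exists>N. \<forall>m\<ge>N. \<forall>n\<ge>N. n2 (\<lambda>x. h m x - h n x) \<le> e" if "e > 0" for e
  proof -
    obtain M where M: "\<And>m n. m \<ge> M \<Longrightarrow> n \<ge> M \<Longrightarrow> \<bar>d m - d n\<bar> < e / 4"
      using Cd \<open>e > 0\<close> unfolding Cauchy_def dist_real_def by (metis divide_pos_pos zero_less_numeral)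
    obtain M' where M': "1 / real (Suc M') < e / 8" using nat_approx_posE[of "e / 8"] \<open>e > 0\<close> by auto
    have *: "n2 (\<lambda>x. h k x - h l x) \<le> e" if "k \<ge> max M M'" "k \<le> l" for k l
    proof -
      have "1 / real (Suc k) \<le> 1 / real (Suc M')" using that by (intro divide_left_mono) auto
      moreover have "\<bar>d l - d k\<bar> < e / 4" using that by (intro M) auto
      moreover have lin2: "a \<le> e" if "a \<le> 2 * b + 4 * t" "t \<le> t'" "t' < e / 8" "b < e / 4" for a b t t' :: real
        using that by argo
      ultimately show ?thesis by (intro lin2[OF close[OF that(2)] _ M']) linarith+
    qed
    have "n2 (\<lambda>x. h m x - h n x) \<le> e" if "m \<ge> max M M'" "n \<ge> max M M'" for m n
      using *[of m n] *[of n m] that n2_diff_commute[of "h m" "h n"] by (cases "m \<le> n") auto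
    then show ?thesis by blast
  qed
  then obtain g where g: "tol2 h g" using l2_complete[of h] lh(1) by blast
  have "tol2 v u"
  proof (rule tol2_diagonal[OF tol2_const[OF lu] lh(2)])
    show "n2 (\<lambda>x. v n x - u x) \<le> 1 / real (Suc n)" for n by (rule hv(2))
  qed
  then have "H0 S u g" by (rule H0_closed[OF hv(1) _ g])
  moreover have "n2 g \<le> c"
  proof (rule LIMSEQ_le[OF tol2_n2[OF g]])
    have "(\<lambda>k. c + 1 / real (Suc k)) \<longlonglongrightarrow> c + 0"
      by (intro tendsto_add tendsto_const LIMSEQ_Suc[OF lim_1_over_n])
    then show "(\<lambda>k. c + 1 / real (Suc k)) \<longlonglongrightarrow> c" by simp
    show "\<exists>N. \<forall>n\<ge>N. n2 (h n) \<le> c + 1 / real (Suc n)"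
      by (intro exI[of _ 0] allI impI order_trans[OF less_imp_le[OF hv(3)]] add_right_mono dc)
  qed
  ultimately show ?thesis by (rule that)
qed

text \<open>One common subsequence is extracted by induction over the components. The energies are
  made convergent too, so that lower semicontinuity holds componentwise and can be summed.\<close>

lemma H0_compactness:
  fixes U :: "'i \<Rightarrow> nat \<Rightarrow> 'a::euclidean_space \<Rightarrow> real"
  assumes S: "bounded S" and "finite I"
    and H: "\<And>i n. i \<in> I \<Longrightarrow> H0 S (U i n) (G i n)" and B: "\<And>i n. i \<in> I \<Longrightarrow> n2 (G i n) \<le> B"
  shows "\<exists>s. strict_mono s \<and> (\<forall>i\<in>I. \<exists>u g c. tol2 (\<lambda>n. U i (s n)) u \<and> H0 S u g \<and>
    (\<lambda>n. n2 (G i (s n))) \<longlonglongrightarrow> c \<and> n2 g \<le> c)"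
  using assms(2) H B
proof (induction I)
  case empty
  show ?case by (intro exI[of _ id]) (simp add: strict_mono_def)
next
  case (insert j I)
  then obtain s where s: "strict_mono s" "\<forall>i\<in>I. \<exists>u g c. tol2 (\<lambda>n. U i (s n)) u \<and> H0 S u g \<and>
    (\<lambda>n. n2 (G i (s n))) \<longlonglongrightarrow> c \<and> n2 g \<le> c" by force
  obtain t u where t: "strict_mono t" "tol2 (\<lambda>n. U j (s (t n))) u"
    using Rellich[of S "\<lambda>n. U j (s n)" "\<lambda>n. G j (s n)" B] insert.prems S by auto
  have "seq_compact {0..B}" by (intro compact_imp_seq_compact) simp
  then obtain c q where q: "strict_mono q" "((\<lambda>n. n2 (G j (s (t n)))) \<circ> q) \<longlonglongrightarrow> c"
    unfolding seq_compact_def using insert.prems(2)[of j] by (metis (no_types, lifting) atLeastAtMost_iff insertI1 n2_nonneg)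
  define r where "r = s \<circ> (t \<circ> q)"
  have tq: "strict_mono (t \<circ> q)" using t(1) q(1) by (rule strict_mono_o)
  have r: "strict_mono r" unfolding r_def using s(1) tq by (rule strict_mono_o)
  have uj: "tol2 (\<lambda>n. U j (r n)) u" using tol2_subseq[OF t(2) q(1)] by (simp add: r_def)
  have cj: "(\<lambda>n. n2 (G j (r n))) \<longlonglongrightarrow> c" using q(2) by (simp add: r_def o_def)
  obtain g where g: "H0 S u g" "n2 g \<le> c"
    using H0_lsc[OF _ uj cj, of S] insert.prems(1) by auto
  have "\<exists>u g c. tol2 (\<lambda>n. U i (r n)) u \<and> H0 S u g \<and> (\<lambda>n. n2 (G i (r n))) \<longlonglongrightarrow> c \<and> n2 g \<le> c" if i: "i \<in> I" for i
  proof -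
    obtain u g c where "tol2 (\<lambda>n. U i (s n)) u" "H0 S u g" "(\<lambda>n. n2 (G i (s n))) \<longlonglongrightarrow> c" "n2 g \<le> c"
      using s(2) i by blast
    then show ?thesis using tol2_subseq[OF _ tq, of "\<lambda>n. U i (s n)" u]
        LIMSEQ_subseq_LIMSEQ[OF _ tq, of "\<lambda>n. n2 (G i (s n))" c] unfolding r_def o_def by blast
  qed
  then show ?case using r uj cj g by (intro exI[of _ r]) auto
qed

section \<open>Minimisers and their variational inequalities\<close>

text \<open>For nonnegative components the integral replaces the L1 norm, which makes the constraint
  linear. Gradients are explicit, so that the energy involves no choice.\<close>

definition adm :: "'a::euclidean_space set \<Rightarrow> ('k::finite \<Rightarrow> 'a \<Rightarrow> real) \<Rightarrow> ('k \<Rightarrow> 'a \<Rightarrow> 'a) \<Rightarrow> bool" where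
  "adm S U G \<longleftrightarrow> (\<forall>i. H0 S (U i) (G i)) \<and> (\<forall>i. (LINT x|lebesgue. U i x) = 1) \<and>
     (AE x in lebesgue. (\<forall>i. U i x \<ge> 0) \<and> (\<forall>i j. i \<noteq> j \<longrightarrow> U i x * U j x = 0))"

definition en :: "('k::finite \<Rightarrow> 'a::euclidean_space \<Rightarrow> 'a) \<Rightarrow> real" where
  "en G = (\<Sum>i\<in>UNIV. n2 (G i))"

text \<open>For minimising densities \<open>u\<close>, every \<open>hat u j\<close> satisfies the differential inequality opposite to that of \<open>u j\<close>.\<close>

definition hat :: "('k::finite \<Rightarrow> 'b::ab_group_add) \<Rightarrow> 'k \<Rightarrow> 'b" where
  "hat f j = f j - (\<Sum>i\<in>- {j}. f i)"

lemma sum_single: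
  assumes "finite A" "\<And>i. i \<noteq> l \<Longrightarrow> f i = 0"
  shows "sum f A = (if l \<in> A then f l else 0)"
proof -
  have "sum f A = (\<Sum>i\<in>A. if i = l then f l else 0)" by (rule sum.cong) (use assms(2) in auto)
  then show ?thesis using assms(1) by (simp add: sum.delta)
qed

lemma hat_single: "(\<And>i. i \<noteq> l \<Longrightarrow> f i = 0) \<Longrightarrow> hat f j = (if l = j then f l else - f l)"
  unfolding hat_def using sum_single[of "- {j}" l f] by auto

lemma en_nonneg: "en G \<ge> 0"
  by (simp add: en_def sum_nonneg)

lemma tol2_AE_nonneg:
  assumes "tol2 F (f :: 'a::euclidean_space \<Rightarrow> real)" "\<And>n. AE x in lebesgue. F n x \<ge> 0"
  shows "AE x in lebesgue. f x \<ge> 0"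
proof -
  obtain r where "AE x in lebesgue. (\<lambda>n. F (r n) x) \<longlonglongrightarrow> f x"
    using tol2_AE_subseq[OF assms(1)] by blast
  moreover have "AE x in lebesgue. \<forall>n. F (r n) x \<ge> 0" using assms(2) by (simp add: AE_all_countable)
  ultimately show ?thesis by eventually_elim (auto intro: LIMSEQ_le_const)
qed

lemma adm_minimiser:
  fixes U0 :: "'k::finite \<Rightarrow> 'a::euclidean_space \<Rightarrow> real"
  assumes S: "bounded S" and "adm S U0 G0"
  obtains U :: "'k \<Rightarrow> 'a \<Rightarrow> real" and G where "adm S U G" "\<And>(V :: 'k \<Rightarrow> 'a \<Rightarrow> real) H. adm S V H \<Longrightarrow> en G \<le> en H"
proof -
  define E where "E = {en H | H. \<exists>V :: 'k \<Rightarrow> 'a \<Rightarrow> real. adm S V H}"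
  define m where "m = Inf E"
  have bb: "bdd_below E" unfolding E_def by (rule bdd_belowI[of _ 0]) (auto simp: en_nonneg)
  have ne: "E \<noteq> {}" using assms(2) unfolding E_def by blast
  have "\<exists>(V :: 'k \<Rightarrow> 'a \<Rightarrow> real) H. adm S V H \<and> en H < m + 1 / Suc n" for n
  proof -
    have "\<exists>y\<in>E. y < m + 1 / Suc n" using cInf_less_iff[OF ne bb, of "m + 1 / Suc n"] unfolding m_def by simp
    then show ?thesis unfolding E_def by blast
  qed
  then obtain V :: "nat \<Rightarrow> 'k \<Rightarrow> 'a \<Rightarrow> real" and H where VH: "\<And>n. adm S (V n) (H n)" "\<And>n. en (H n) < m + 1 / Suc n" by metis
  have m_le: "m \<le> en H" if "adm S V H" for V :: "'k \<Rightarrow> 'a \<Rightarrow> real" and H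
    unfolding m_def using that bb by (intro cInf_lower) (auto simp: E_def)
  have H0: "H0 S (V n i) (H n i)" for n i using VH(1) unfolding adm_def by blast
  have B: "n2 (H n i) \<le> m + 1" for n i
  proof -
    have "n2 (H n i) \<le> en (H n)" unfolding en_def by (rule member_le_sum) auto
    moreover have "1 / real (Suc n) \<le> 1" by simp
    ultimately show ?thesis using VH(2)[of n] by linarith
  qed
  obtain s where s: "strict_mono s" "\<forall>i. \<exists>u g c. tol2 (\<lambda>n. V (s n) i) u \<and> H0 S u g \<and>
    (\<lambda>n. n2 (H (s n) i)) \<longlonglongrightarrow> c \<and> n2 g \<le> c"
    using H0_compactness[OF S finite[of UNIV], of "\<lambda>i n. V n i" "\<lambda>i n. H n i" "m + 1"] H0 B by auto
  then obtain U G c where UG: "\<And>i. tol2 (\<lambda>n. V (s n) i) (U i)" "\<And>i. H0 S (U i) (G i)"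
    "\<And>i. (\<lambda>n. n2 (H (s n) i)) \<longlonglongrightarrow> c i" "\<And>i. n2 (G i) \<le> c i" by metis
  have nn: "AE x in lebesgue. V n i x \<ge> 0" "i \<noteq> j \<Longrightarrow> AE x in lebesgue. V n i x * V n j x = 0" for n i j
  proof -
    have "AE x in lebesgue. (\<forall>i. V n i x \<ge> 0) \<and> (\<forall>i j. i \<noteq> j \<longrightarrow> V n i x * V n j x = 0)"
      using VH(1)[of n] unfolding adm_def by blast
    then show "AE x in lebesgue. V n i x \<ge> 0" "i \<noteq> j \<Longrightarrow> AE x in lebesgue. V n i x * V n j x = 0"
      by (rule eventually_mono, blast)+
  qed
  have pos: "AE x in lebesgue. U i x \<ge> 0" for i by (rule tol2_AE_nonneg[OF UG(1) nn(1)])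
  \<comment> \<open>Disjointness passes to the limit as the integral identity ip = 0, and
    nonnegativity turns that back into a pointwise statement.\<close>
  have seg: "AE x in lebesgue. U i x * U j x = 0" if ij: "i \<noteq> j" for i j
  proof -
    have "(\<lambda>n. ip (V (s n) i) (V (s n) j)) \<longlonglongrightarrow> ip (U i) (U j)" by (intro tol2_ip UG)
    moreover have "ip (V n i) (V n j) = 0" for n
    proof -
      have "ip (V n i) (V n j) = (LINT x|(lebesgue :: 'a measure). 0)"
        unfolding ip_def using nn(2)[OF ij, of n] ip_integrable[OF H0_l2(1)[OF H0] H0_l2(1)[OF H0], of n i n j]
        by (intro integral_cong_AE) auto
      then show ?thesis by simp
    qed
    ultimately have "ip (U i) (U j) = 0" by (simp add: LIMSEQ_const_iff)
    moreover have "AE x in lebesgue. 0 \<le> U i x \<bullet> U j x" using pos[of i] pos[of j] by eventually_elim simp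
    ultimately show ?thesis
      using integral_nonneg_eq_0_iff_AE[OF ip_integrable[OF H0_l2(1)[OF UG(2)] H0_l2(1)[OF UG(2)]], of i j]
      by (auto simp: ip_def)
  qed
  have "adm S U G" unfolding adm_def
  proof (intro conjI allI)
    show "(LINT x|lebesgue. U i x) = 1" for i
      using H0_integral_tendsto[OF H0 UG(2) S UG(1), of i] VH(1) unfolding adm_def by (simp add: LIMSEQ_const_iff)
    have "AE x in lebesgue. \<forall>i. U i x \<ge> 0" using pos by (intro AE_finite_allI[of UNIV, simplified]) auto
    moreover have "AE x in lebesgue. \<forall>i j. i \<noteq> j \<longrightarrow> U i x * U j x = 0"
      using seg by (intro AE_finite_allI[of UNIV, simplified]) (auto intro: AE_impI)
    ultimately show "AE x in lebesgue. (\<forall>i. 0 \<le> U i x) \<and> (\<forall>i j. i \<noteq> j \<longrightarrow> U i x * U j x = 0)" by eventually_elim auto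
  qed (rule UG)
  moreover have "en G \<le> m"
  proof -
    have "en G \<le> (\<Sum>i\<in>UNIV. c i)" unfolding en_def by (intro sum_mono UG)
    also have "\<dots> \<le> m"
    proof (rule LIMSEQ_le)
      show "(\<lambda>n. en (H (s n))) \<longlonglongrightarrow> (\<Sum>i\<in>UNIV. c i)" unfolding en_def by (intro tendsto_sum UG)
      have "(\<lambda>n. m + 1 / Suc n) \<longlonglongrightarrow> m + 0" by (intro tendsto_add tendsto_const LIMSEQ_Suc[OF lim_1_over_n])
      then show "(\<lambda>n. m + 1 / Suc (s n)) \<longlonglongrightarrow> m"
        using LIMSEQ_subseq_LIMSEQ[OF _ s(1), of "\<lambda>n. m + 1 / Suc n"] by (simp add: o_def)
      show "\<exists>N. \<forall>n\<ge>N. en (H (s n)) \<le> m + 1 / Suc (s n)" using VH(2) less_imp_le by blast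
    qed
    finally show ?thesis .
  qed
  ultimately show ?thesis by (intro that[of U G]) (auto intro: order_trans[OF _ m_le])
qed

section \<open>Variational inequalities of a fixed minimiser\<close>

locale minimiser =
  fixes S :: "'a::euclidean_space set" and U :: "'k::finite \<Rightarrow> 'a \<Rightarrow> real" and G :: "'k \<Rightarrow> 'a \<Rightarrow> 'a"
  assumes op: "open S" and bd: "bounded S" and ad: "adm S U G"
    and mini: "\<And>(V :: 'k \<Rightarrow> 'a \<Rightarrow> real) H. adm S V H \<Longrightarrow> en G \<le> en H"
begin

lemma H: "H0 S (U i) (G i)" and int1: "(LINT x|lebesgue. U i x) = 1"
  using ad unfolding adm_def by auto

lemma lU: "l2 (U i)" and lG: "l2 (G i)"
  using H0_l2[OF H] by auto

lemma iU: "integrable lebesgue (U i)"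
  by (rule H0_integrable(1)[OF H bd])

lemma nonneg: "AE x in lebesgue. U i x \<ge> 0"
  using ad unfolding adm_def by (auto elim!: eventually_mono)

text \<open>A pointwise form of admissibility in which \<open>hat\<close> and all sums over
  components collapse to one term. Where everything vanishes any \<open>l\<close> serves.\<close>

lemma one_phase: "AE x in lebesgue. \<exists>l. U l x \<ge> 0 \<and> (U l x = 0 \<longrightarrow> G l x = 0) \<and> (\<forall>i. i \<noteq> l \<longrightarrow> U i x = 0 \<and> G i x = 0)"
proof -
  have "AE x in lebesgue. \<forall>i. U i x = 0 \<longrightarrow> G i x = 0"
    using H0_grad_zero[OF op H nonneg] by (intro AE_finite_allI[of UNIV, simplified]) auto
  moreover have "AE x in lebesgue. (\<forall>i. U i x \<ge> 0) \<and> (\<forall>i j. i \<noteq> j \<longrightarrow> U i x * U j x = 0)"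
    using ad unfolding adm_def by blast
  ultimately show ?thesis
  proof eventually_elim
    case (elim x)
    show ?case
    proof (cases "\<exists>l. U l x \<noteq> 0")
      case True
      then show ?thesis using elim by (metis mult_eq_0_iff)
    qed (use elim in auto)
  qed
qed

text \<open>Dividing each component by its mass frees competitors from the constraint; the masses
  enter squared because the energy is quadratic.\<close>

lemma quotient_bound:
  fixes W :: "'k \<Rightarrow> 'a \<Rightarrow> real"
  assumes W: "\<And>i. H0 S (W i) (K i)" and m: "\<And>i. (LINT x|lebesgue. W i x) = m i" "\<And>i. m i > 0"
    and ae: "AE x in lebesgue. (\<forall>i. W i x \<ge> 0) \<and> (\<forall>i j. i \<noteq> j \<longrightarrow> W i x * W j x = 0)"
  shows "en G \<le> (\<Sum>i\<in>UNIV. n2 (K i) / (m i)\<^sup>2)"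
proof -
  have "adm S (\<lambda>i x. (1 / m i) * W i x) (\<lambda>i x. (1 / m i) *\<^sub>R K i x)"
    unfolding adm_def
  proof (intro conjI allI)
    show "H0 S (\<lambda>x. (1 / m i) * W i x) (\<lambda>x. (1 / m i) *\<^sub>R K i x)" for i by (rule H0_scale[OF W])
    show "(LINT x|lebesgue. (1 / m i) * W i x) = 1" for i using m[of i] by simp
    show "AE x in lebesgue. (\<forall>i. (1 / m i) * W i x \<ge> 0) \<and> (\<forall>i j. i \<noteq> j \<longrightarrow> (1 / m i) * W i x * ((1 / m j) * W j x) = 0)"
      using ae by eventually_elim (use m(2) in \<open>auto intro!: divide_nonneg_pos\<close>)
  qed
  from mini[OF this] show ?thesis
    by (simp add: en_def n2_scaleR power_divide)
qed

lemma H0_integral: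
  "H0 S \<phi> \<gamma> \<Longrightarrow> integrable lebesgue \<phi>"
  by (rule H0_integrable(1)[OF _ bd])

text \<open>The competitor replaces only \<open>U j\<close>, by the positive part of U j - t \<phi>.
  Its support shrinks, its mass stays at least 1 - t I, and expanding the square of its gradient
  gives the first variation. The inequality is divided by 2 t, which leaves the cut-off at positive
  t still to be removed.\<close>

lemma sub_step:
  assumes P: "H0 S \<phi> \<gamma>" "AE x in lebesgue. \<phi> x \<ge> 0" and t: "t > 0" "t * (LINT x|lebesgue. \<phi> x) < 1"
  shows "ip (\<lambda>x. if U j x > t * \<phi> x then G j x else 0) \<gamma> \<le> n2 (G j) * (LINT x|lebesgue. \<phi> x) + t * n2 \<gamma> / 2"
proof -
  define I where "I = (LINT x|lebesgue. \<phi> x)"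
  have I: "I \<ge> 0" "t * I < 1" using P(2) t(2) by (auto simp: I_def intro: integral_nonneg_AE)
  define V where "V x = max 0 (U j x - t * \<phi> x)" for x
  define K where "K x = (if U j x - t * \<phi> x > 0 then G j x - t *\<^sub>R \<gamma> x else 0)" for x
  have VK: "H0 S V K" unfolding V_def K_def by (rule H0_max0[OF op H0_diff[OF H H0_scale[OF P(1)]]])
  define m where "m = (LINT x|lebesgue. V x)"
  have m: "1 - t * I \<le> m"
  proof -
    have "(LINT x|lebesgue. U j x - t * \<phi> x) \<le> m" unfolding m_def
      using iU H0_integral[OF P(1)] H0_integral[OF VK] by (intro integral_mono) (auto simp: V_def)
    then show ?thesis using iU H0_integral[OF P(1)] int1 by (simp add: I_def)
  qed
  have m0: "m > 0" using m I by linarith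
  have "en G \<le> (\<Sum>i\<in>UNIV. n2 ((G(j := K)) i) / (if i = j then m else 1)\<^sup>2)"
  proof (rule quotient_bound[of "U(j := V)"])
    show "H0 S ((U(j := V)) i) ((G(j := K)) i)" for i using H VK by simp
    show "(LINT x|lebesgue. (U(j := V)) i x) = (if i = j then m else 1)" for i using int1 by (simp add: m_def)
    show "(if i = j then m else 1) > 0" for i using m0 by simp
    have "AE x in lebesgue. (\<forall>i. U i x \<ge> 0) \<and> (\<forall>i j. i \<noteq> j \<longrightarrow> U i x * U j x = 0)"
      using ad unfolding adm_def by blast
    with P(2) show "AE x in lebesgue. (\<forall>i. (U(j := V)) i x \<ge> 0) \<and> (\<forall>i k. i \<noteq> k \<longrightarrow> (U(j := V)) i x * (U(j := V)) k x = 0)"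
    proof eventually_elim
      case (elim x)
      have "U j x = 0 \<Longrightarrow> V x = 0" "V x \<ge> 0" using elim t by (auto simp: V_def)
      moreover have "U i x = 0 \<or> U k x = 0" if "i \<noteq> k" for i k using elim(2) that by (simp add: mult_eq_0_iff)
      ultimately show ?case using elim(2) by auto
    qed
  qed
  also have "\<dots> = n2 K / m\<^sup>2 + (\<Sum>i\<in>UNIV - {j}. n2 (G i))"
    by (subst sum.remove[of _ j]) auto
  finally have "n2 (G j) \<le> n2 K / m\<^sup>2"
    unfolding en_def by (subst (asm) sum.remove[of _ j]) auto
  then have "n2 (G j) * m\<^sup>2 \<le> n2 K" using m0 by (simp add: field_simps)
  moreover have "n2 (G j) * (1 - t * I)\<^sup>2 \<le> n2 (G j) * m\<^sup>2"
    using m I by (intro mult_left_mono power_mono) auto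
  moreover have "n2 (G j) * (1 - t * I)\<^sup>2 = n2 (G j) - 2 * t * (n2 (G j) * I) + n2 (G j) * (t * I)\<^sup>2"
    by (simp add: power2_eq_square algebra_simps)
  moreover have "n2 (G j) * (t * I)\<^sup>2 \<ge> 0" by simp
  moreover have "n2 K \<le> n2 (G j) - 2 * t * ip (\<lambda>x. if U j x > t * \<phi> x then G j x else 0) \<gamma> + t\<^sup>2 * n2 \<gamma>"
  proof -
    define C where "C x = (if U j x > t * \<phi> x then G j x else 0)" for x
    note l = lG[of j] H0_l2[OF P(1)] H0_l2[OF VK]
    have [measurable]: "U j \<in> borel_measurable lebesgue" "G j \<in> borel_measurable lebesgue" "\<phi> \<in> borel_measurable lebesgue"
      using lU l by (auto simp: l2_measurable)
    have "C \<in> borel_measurable lebesgue" unfolding C_def[abs_def] by measurable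
    then have lC: "l2 C" by (rule l2_mono(1)[OF l(1)]) (auto simp: C_def)
    have "n2 K \<le> (LINT x|lebesgue. (norm (G j x))\<^sup>2 - 2 * t * (C x \<bullet> \<gamma> x) + t\<^sup>2 * (norm (\<gamma> x))\<^sup>2)"
      unfolding n2_def
    proof (rule integral_mono)
      show "integrable lebesgue (\<lambda>x. (norm (K x))\<^sup>2)" using l by (simp add: l2_def)
      show "integrable lebesgue (\<lambda>x. (norm (G j x))\<^sup>2 - 2 * t * (C x \<bullet> \<gamma> x) + t\<^sup>2 * (norm (\<gamma> x))\<^sup>2)"
        using l ip_integrable[OF lC l(3)] by (simp add: l2_def)
      have "(norm (G j x - t *\<^sub>R \<gamma> x))\<^sup>2 = (norm (G j x))\<^sup>2 - 2 * t * (G j x \<bullet> \<gamma> x) + t\<^sup>2 * (norm (\<gamma> x))\<^sup>2" for x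
        unfolding power2_norm_eq_inner by (simp add: inner_diff_left inner_diff_right inner_commute power2_eq_square)
      then show "(norm (K x))\<^sup>2 \<le> (norm (G j x))\<^sup>2 - 2 * t * (C x \<bullet> \<gamma> x) + t\<^sup>2 * (norm (\<gamma> x))\<^sup>2" for x
        by (simp add: K_def C_def)
    qed
    also have "\<dots> = n2 (G j) - 2 * t * ip C \<gamma> + t\<^sup>2 * n2 \<gamma>"
      unfolding n2_def ip_def using l ip_integrable[OF lC l(3)] by (simp add: l2_def)
    finally show ?thesis unfolding C_def .
  qed
  ultimately have "2 * t * ip (\<lambda>x. if U j x > t * \<phi> x then G j x else 0) \<gamma> \<le> 2 * t * (n2 (G j) * I) + t\<^sup>2 * n2 \<gamma>"
    by linarith
  also have "\<dots> = 2 * t * (n2 (G j) * I + t * n2 \<gamma> / 2)" by (simp add: power2_eq_square algebra_simps)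
  finally show ?thesis
    unfolding I_def by (rule mult_left_le_imp_le) (use t(1) in simp)
qed

lemma eventually_small: "\<forall>\<^sub>F n in sequentially. 1 / real (Suc n) * c < 1"
proof -
  have "(\<lambda>n. 1 / real (Suc n) * c) \<longlonglongrightarrow> 0 * c" by (intro tendsto_mult tendsto_const LIMSEQ_Suc[OF lim_1_over_n])
  then show ?thesis by (rule order_tendstoD(2)) simp
qed

text \<open>As t = 1 / (n + 1) tends to 0, the cut-off gradient of \<open>sub_step\<close> converges
  to \<open>G j\<close>, because \<open>G j\<close> vanishes where \<open>U j\<close> does.
  Enlarging \<open>n2 (G j)\<close> to \<open>en G\<close> yields the same constant as in
  \<open>supersolution\<close>.\<close>

lemma subsolution:
  assumes P: "H0 S \<phi> \<gamma>" "AE x in lebesgue. \<phi> x \<ge> 0"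
  shows "ip (G j) \<gamma> \<le> en G * (LINT x|lebesgue. \<phi> x)"
proof -
  define I where "I = (LINT x|lebesgue. \<phi> x)"
  have [measurable]: "U j \<in> borel_measurable lebesgue" "G j \<in> borel_measurable lebesgue" "\<phi> \<in> borel_measurable lebesgue"
    using lU lG H0_l2[OF P(1)] by (auto simp: l2_measurable)
  have "tol2 (\<lambda>n x. if U j x > (1 / Suc n) * \<phi> x then G j x else 0) (G j)"
  proof (rule tol2_dominated[OF _ _ lG])
    show "AE x in lebesgue. (\<lambda>n. if U j x > (1 / Suc n) * \<phi> x then G j x else 0) \<longlonglongrightarrow> G j x"
      using nonneg[of j] H0_grad_zero[OF op H nonneg, of j]
    proof eventually_elim
      case (elim x)
      show ?case
      proof (cases "U j x = 0")
        case False
        then have p: "U j x > 0" using elim by simp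
        have "\<forall>\<^sub>F n in sequentially. (if U j x > (1 / Suc n) * \<phi> x then G j x else 0) = G j x"
          using eventually_small[of "\<phi> x / U j x"]
          by eventually_elim (use p in \<open>auto simp: field_simps simp del: of_nat_Suc\<close>)
        then show ?thesis by (rule tendsto_eventually)
      qed (use elim in \<open>simp cong: if_cong\<close>)
    qed
  qed auto
  then have "(\<lambda>n. ip (\<lambda>x. if U j x > (1 / Suc n) * \<phi> x then G j x else 0) \<gamma>) \<longlonglongrightarrow> ip (G j) \<gamma>"
    by (intro tol2_ip tol2_const H0_l2[OF P(1)])
  note A = this
  have B: "(\<lambda>n. n2 (G j) * I + (1 / Suc n) * n2 \<gamma> / 2) \<longlonglongrightarrow> n2 (G j) * I + 0 * n2 \<gamma> / 2"
    by (intro tendsto_intros LIMSEQ_Suc[OF lim_1_over_n]) auto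
  have "\<forall>\<^sub>F n in sequentially. ip (\<lambda>x. if U j x > (1 / Suc n) * \<phi> x then G j x else 0) \<gamma> \<le> n2 (G j) * I + (1 / Suc n) * n2 \<gamma> / 2"
    using eventually_small[of I] unfolding I_def by eventually_elim (rule sub_step[OF P], auto)
  then have "ip (G j) \<gamma> \<le> n2 (G j) * I + 0 * n2 \<gamma> / 2"
    by (rule tendsto_le[OF sequentially_bot B A])
  also have "\<dots> \<le> en G * I"
  proof -
    have "n2 (G j) \<le> en G" unfolding en_def by (rule member_le_sum) auto
    moreover have "I \<ge> 0" unfolding I_def using P(2) by (rule integral_nonneg_AE)
    ultimately show ?thesis by (simp add: mult_right_mono)
  qed
  finally show ?thesis by (simp add: I_def)
qed

lemma H0_hat: "H0 S (\<lambda>x. hat (\<lambda>i. U i x) j) (\<lambda>x. hat (\<lambda>i. G i x) j)"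
  unfolding hat_def by (intro H0_diff H0_sum H)

text \<open>The competitor is read off from the single function v, which is \<open>hat\<close> of
  \<open>U\<close> plus t \<phi>: its positive part becomes component j, and its negative part is
  distributed over the other phases. Supports stay disjoint, the squared gradients add up to at most
  that of v, and no mass falls below 1 - t I. Since a single phase is active almost everywhere, the
  unperturbed energy of \<open>hat\<close> is the total energy \<open>en G\<close>.\<close>

lemma super_step:
  assumes P: "H0 S \<phi> \<gamma>" "AE x in lebesgue. \<phi> x \<ge> 0" and t: "t > 0" "t * (LINT x|lebesgue. \<phi> x) < 1"
  shows "- en G * (LINT x|lebesgue. \<phi> x) \<le> ip (\<lambda>x. hat (\<lambda>i. G i x) j) \<gamma> + t * n2 \<gamma> / 2"
proof -
  define I where "I = (LINT x|lebesgue. \<phi> x)"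
  have I: "I \<ge> 0" "t * I < 1" using P(2) t(2) by (auto simp: I_def intro: integral_nonneg_AE)
  define v where "v x = hat (\<lambda>i. U i x) j + t * \<phi> x" for x
  define g where "g x = hat (\<lambda>i. G i x) j + t *\<^sub>R \<gamma> x" for x
  define W where "W i x = (if i = j then max 0 (v x) else max 0 (U i x - t * \<phi> x))" for i x
  define K where "K i x = (if i = j then (if v x > 0 then g x else 0)
    else (if U i x - t * \<phi> x > 0 then G i x - t *\<^sub>R \<gamma> x else 0))" for i x
  have vg: "H0 S v g" unfolding v_def g_def by (intro H0_add H0_hat H0_scale P)
  have WK: "H0 S (W i) (K i)" for i
  proof (cases "i = j")
    case True
    then show ?thesis unfolding W_def K_def using H0_max0[OF op vg] by simp
  next
    case False
    then show ?thesis unfolding W_def K_def using H0_max0[OF op H0_diff[OF H H0_scale[OF P(1), of t]], of i] by simp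
  qed
  define m where "m i = (LINT x|lebesgue. W i x)" for i
  have ptw: "AE x in lebesgue. (\<forall>i. W i x \<ge> 0) \<and> (\<forall>i k. i \<noteq> k \<longrightarrow> W i x * W k x = 0) \<and>
      (\<forall>i. U i x - t * \<phi> x \<le> W i x) \<and> (\<Sum>i\<in>UNIV. (norm (K i x))\<^sup>2) \<le> (norm (g x))\<^sup>2 \<and>
      (\<Sum>i\<in>UNIV. (norm (G i x))\<^sup>2) = (norm (hat (\<lambda>i. G i x) j))\<^sup>2"
    using one_phase P(2)
  proof eventually_elim
    case (elim x)
    then obtain l where l: "U l x \<ge> 0" "U l x = 0 \<longrightarrow> G l x = 0" "\<And>i. i \<noteq> l \<Longrightarrow> U i x = 0" "\<And>i. i \<noteq> l \<Longrightarrow> G i x = 0"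
      by blast
    have tp: "t * \<phi> x \<ge> 0" using elim(2) t by simp
    have v: "v x = (if l = j then U l x else - U l x) + t * \<phi> x"
      unfolding v_def using hat_single[of l "\<lambda>i. U i x" j] l(3) by auto
    have hg: "hat (\<lambda>i. G i x) j = (if l = j then G l x else - G l x)"
      using hat_single[of l "\<lambda>i. G i x" j] l(4) by auto
    have W0: "W i x = 0" "K i x = 0" if "i \<noteq> l" "i \<noteq> j" for i
      using l(3)[OF that(1)] that tp by (auto simp: W_def K_def)
    have Wlj: "W l x * W j x = 0" "K l x = 0 \<or> K j x = 0" "norm (K l x) \<le> norm (g x)" "norm (K j x) \<le> norm (g x)" if "l \<noteq> j"
      using that v hg by (auto simp: W_def K_def g_def norm_minus_commute)
    have "W i x * W k x = 0" if "i \<noteq> k" for i k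
      using that W0 Wlj(1) by (metis mult_eq_0_iff)
    moreover have "(\<Sum>i\<in>UNIV. (norm (K i x))\<^sup>2) \<le> (norm (g x))\<^sup>2"
    proof (cases "l = j")
      case True
      then have "(\<Sum>i\<in>UNIV. (norm (K i x))\<^sup>2) = (norm (K j x))\<^sup>2"
        using sum_single[of UNIV j "\<lambda>i. (norm (K i x))\<^sup>2"] W0(2) by auto
      then show ?thesis by (simp add: K_def)
    next
      case False
      then obtain p where p: "p = l \<or> p = j" "\<And>i. i \<noteq> p \<Longrightarrow> K i x = 0" using Wlj(2) W0(2) by metis
      then have "(\<Sum>i\<in>UNIV. (norm (K i x))\<^sup>2) = (norm (K p x))\<^sup>2"
        using sum_single[of UNIV p "\<lambda>i. (norm (K i x))\<^sup>2"] by auto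
      then show ?thesis using Wlj(3,4)[OF False] p(1) by (auto intro!: power_mono)
    qed
    moreover have "(\<Sum>i\<in>UNIV. (norm (G i x))\<^sup>2) = (norm (hat (\<lambda>i. G i x) j))\<^sup>2"
      using sum_single[of UNIV l "\<lambda>i. (norm (G i x))\<^sup>2"] l(4) hg by auto
    moreover have "U i x - t * \<phi> x \<le> W i x" for i
      using v tp l(1) l(3)[of j] by (cases "i = j") (auto simp: W_def)
    moreover have "W i x \<ge> 0" for i by (simp add: W_def)
    ultimately show ?case by (intro conjI allI impI)
  qed
  have ptw': "AE x in lebesgue. (\<forall>i. W i x \<ge> 0) \<and> (\<forall>i k. i \<noteq> k \<longrightarrow> W i x * W k x = 0)"
    "AE x in lebesgue. U i x - t * \<phi> x \<le> W i x"
    "AE x in lebesgue. (\<Sum>i\<in>UNIV. (norm (K i x))\<^sup>2) \<le> (norm (g x))\<^sup>2"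
    "AE x in lebesgue. (\<Sum>i\<in>UNIV. (norm (G i x))\<^sup>2) = (norm (hat (\<lambda>i. G i x) j))\<^sup>2" for i
    by (rule eventually_mono[OF ptw], simp)+
  have m: "1 - t * I \<le> m i" for i
  proof -
    have "(LINT x|lebesgue. U i x - t * \<phi> x) \<le> m i" unfolding m_def
      using iU H0_integral[OF P(1)] H0_integral[OF WK] ptw'(2) by (intro integral_mono_AE) auto
    then show ?thesis using iU H0_integral[OF P(1)] int1 by (simp add: I_def)
  qed
  have m0: "m i > 0" for i using m[of i] I by linarith
  have "en G \<le> (\<Sum>i\<in>UNIV. n2 (K i) / (m i)\<^sup>2)"
    by (rule quotient_bound[of W K m, OF WK _ m0]) (use ptw'(1) in \<open>auto simp: m_def\<close>)
  also have "\<dots> \<le> (\<Sum>i\<in>UNIV. n2 (K i) / (1 - t * I)\<^sup>2)"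
    using I m m0 by (intro sum_mono frac_le power_mono) auto
  also have "\<dots> = (\<Sum>i\<in>UNIV. n2 (K i)) / (1 - t * I)\<^sup>2" by (simp add: sum_divide_distrib)
  finally have "en G * (1 - t * I)\<^sup>2 \<le> (\<Sum>i\<in>UNIV. n2 (K i))" using I by (simp add: pos_le_divide_eq)
  also have "\<dots> = (LINT x|lebesgue. (\<Sum>i\<in>UNIV. (norm (K i x))\<^sup>2))"
    unfolding n2_def using H0_l2(2)[OF WK] by (simp add: l2_def)
  also have "\<dots> \<le> n2 g" unfolding n2_def
    using H0_l2(2)[OF WK] H0_l2(2)[OF vg] ptw'(3) by (intro integral_mono_AE) (auto simp: l2_def)
  also have "\<dots> = n2 (\<lambda>x. hat (\<lambda>i. G i x) j) + 2 * t * ip (\<lambda>x. hat (\<lambda>i. G i x) j) \<gamma> + t\<^sup>2 * n2 \<gamma>"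
    unfolding g_def using n2_add[OF H0_l2(2)[OF H0_hat] l2_scaleR[OF H0_l2(2)[OF P(1)]], of j t] ip_scaleR[of t \<gamma>]
    by (simp add: n2_scaleR ip_commute[of "\<lambda>x. hat (\<lambda>i. G i x) j"])
  also have "n2 (\<lambda>x. hat (\<lambda>i. G i x) j) = en G"
  proof -
    have "n2 (\<lambda>x. hat (\<lambda>i. G i x) j) = (LINT x|lebesgue. (\<Sum>i\<in>UNIV. (norm (G i x))\<^sup>2))"
      unfolding n2_def using H0_l2(2)[OF H0_hat, of j] lG ptw'(4)
      by (intro integral_cong_AE borel_measurable_sum) (auto simp: l2_def)
    also have "\<dots> = en G" unfolding en_def n2_def using lG by (simp add: l2_def)
    finally show ?thesis .
  qed
  finally have "en G * (1 - t * I)\<^sup>2 \<le> en G + 2 * t * ip (\<lambda>x. hat (\<lambda>i. G i x) j) \<gamma> + t\<^sup>2 * n2 \<gamma>" .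
  moreover have "en G * (1 - t * I)\<^sup>2 = en G - 2 * t * (en G * I) + en G * (t * I)\<^sup>2"
    by (simp add: power2_eq_square algebra_simps)
  moreover have "en G * (t * I)\<^sup>2 \<ge> 0" by (simp add: en_nonneg)
  ultimately have "2 * t * (- (en G * I)) \<le> 2 * t * ip (\<lambda>x. hat (\<lambda>i. G i x) j) \<gamma> + t\<^sup>2 * n2 \<gamma>" by linarith
  also have "\<dots> = 2 * t * (ip (\<lambda>x. hat (\<lambda>i. G i x) j) \<gamma> + t * n2 \<gamma> / 2)" by (simp add: power2_eq_square algebra_simps)
  finally show ?thesis
    unfolding I_def mult_minus_left by (rule mult_left_le_imp_le) (use t(1) in simp)
qed

lemma supersolution:
  assumes P: "H0 S \<phi> \<gamma>" "AE x in lebesgue. \<phi> x \<ge> 0"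
  shows "- en G * (LINT x|lebesgue. \<phi> x) \<le> ip (\<lambda>x. hat (\<lambda>i. G i x) j) \<gamma>"
proof -
  have "(\<lambda>n. ip (\<lambda>x. hat (\<lambda>i. G i x) j) \<gamma> + (1 / Suc n) * n2 \<gamma> / 2) \<longlonglongrightarrow> ip (\<lambda>x. hat (\<lambda>i. G i x) j) \<gamma> + 0 * n2 \<gamma> / 2"
    by (intro tendsto_intros LIMSEQ_Suc[OF lim_1_over_n]) auto
  moreover have "\<forall>\<^sub>F n in sequentially. - en G * (LINT x|lebesgue. \<phi> x) \<le> ip (\<lambda>x. hat (\<lambda>i. G i x) j) \<gamma> + (1 / Suc n) * n2 \<gamma> / 2"
    using eventually_small[of "LINT x|lebesgue. \<phi> x"] by eventually_elim (rule super_step[OF P], auto)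
  ultimately show ?thesis using tendsto_le[OF sequentially_bot _ tendsto_const] by fastforce
qed

end

section \<open>Exterior balls and the boundary barrier\<close>

lemma smooth_grad_lipschitz:
  fixes f :: "'a::euclidean_space \<Rightarrow> real"
  assumes f: "smooth f" and C: "compact C" "convex C"
  obtains M where "M \<ge> 0" "\<And>x y. x \<in> C \<Longrightarrow> y \<in> C \<Longrightarrow> norm (grad f x - grad f y) \<le> M * norm (x - y)"
proof -
  have "\<exists>m\<ge>0. \<forall>x\<in>C. \<forall>y\<in>C. \<bar>frechet_derivative f (at x) b - frechet_derivative f (at y) b\<bar> \<le> m * norm (x - y)"
    if b: "b \<in> Basis" for b
  proof -
    define k where "k x = frechet_derivative f (at x) b" for x
    have k: "smooth k" unfolding k_def by (rule smooth_partial[OF f b])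
    have "compact (grad k ` C)" by (rule compact_continuous_image[OF smooth_grad_continuous[OF k] C(1)])
    then obtain m where m: "m > 0" "\<forall>z\<in>grad k ` C. norm z \<le> m"
      using compact_imp_bounded[of "grad k ` C"] unfolding bounded_pos by blast
    have "norm (k x - k y) \<le> m * norm (x - y)" if "x \<in> C" "y \<in> C" for x y
    proof (rule differentiable_bound[OF C(2)])
      show "(k has_derivative (\<lambda>v. grad k z \<bullet> v)) (at z within C)" for z
        by (rule has_derivative_at_withinI[OF has_derivative_grad[OF smooth_differentiable[OF k]]])
      show "onorm (\<lambda>v. grad k z \<bullet> v) \<le> m" if "z \<in> C" for z
        by (rule onorm_le) (use m(2) that in \<open>metis Cauchy_Schwarz_ineq2 image_eqI mult_right_mono norm_ge_zero order_trans real_norm_def\<close>)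
    qed (use that in auto)
    then show ?thesis using m(1) unfolding k_def by (intro exI[of _ m]) auto
  qed
  then obtain m where m: "\<And>b. b \<in> Basis \<Longrightarrow> m b \<ge> 0"
    "\<And>b x y. b \<in> Basis \<Longrightarrow> x \<in> C \<Longrightarrow> y \<in> C \<Longrightarrow>
      \<bar>frechet_derivative f (at x) b - frechet_derivative f (at y) b\<bar> \<le> m b * norm (x - y)" by metis
  show ?thesis
  proof (rule that[of "\<Sum>b\<in>Basis. m b"])
    show "norm (grad f x - grad f y) \<le> (\<Sum>b\<in>Basis. m b) * norm (x - y)" if "x \<in> C" "y \<in> C" for x y
    proof -
      have "norm (grad f x - grad f y) \<le> (\<Sum>b\<in>Basis. \<bar>(grad f x - grad f y) \<bullet> b\<bar>)" by (rule norm_le_l1)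
      also have "\<dots> \<le> (\<Sum>b\<in>Basis. m b * norm (x - y))"
        using m(2) that by (intro sum_mono) (simp add: inner_diff_left grad_inner)
      finally show ?thesis by (simp add: sum_distrib_right)
    qed
  qed (simp add: sum_nonneg m)
qed

text \<open>In the chart the domain is the set F > 0, where F has a Lipschitz gradient H of length
  at least 1. At a boundary point q, Taylor's formula gives H q . (x - q) \<ge> - M |x - q|^2 for x
  in the domain. A ball tangent at q, with centre on the side opposite to H q and radius t with 2 t
  M \<le> 1, therefore misses the domain.\<close>

lemma exterior_ball_local:
  fixes \<Omega> :: "'a::euclidean_space set"
  assumes op: "open \<Omega>" and r: "r > 0" and e: "norm e = 1" and \<gamma>: "smooth \<gamma>"
    and chart: "\<Omega> \<inter> ball p r = {x \<in> ball p r. \<gamma> (x - (x \<bullet> e) *\<^sub>R e) < x \<bullet> e}"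
  obtains \<rho> where "\<rho> > 0"
    "\<And>q t. q \<in> frontier \<Omega> \<Longrightarrow> q \<in> ball p (r / 2) \<Longrightarrow> 0 < t \<Longrightarrow> t \<le> \<rho> \<Longrightarrow> \<exists>y. dist y q = t \<and> (\<forall>x\<in>\<Omega>. t \<le> dist x y)"
proof -
  define pr where "pr x = x - (x \<bullet> e) *\<^sub>R e" for x
  have ee: "e \<bullet> e = 1" using e by (simp add: dot_square_norm)
  have prn: "norm (pr v) \<le> norm v" for v
  proof (rule power2_le_imp_le)
    have "(norm (pr v))\<^sup>2 = (norm v)\<^sup>2 - (v \<bullet> e)\<^sup>2"
      unfolding power2_norm_eq_inner pr_def
      by (simp add: inner_diff_left inner_diff_right inner_commute ee power2_eq_square)
    then show "(norm (pr v))\<^sup>2 \<le> (norm v)\<^sup>2" by simp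
  qed simp
  have prd: "pr x - pr y = pr (x - y)" for x y by (simp add: pr_def inner_diff_left algebra_simps)
  obtain M where M: "M \<ge> 0"
    "\<And>x y. x \<in> cball (pr p) r \<Longrightarrow> y \<in> cball (pr p) r \<Longrightarrow> norm (grad \<gamma> x - grad \<gamma> y) \<le> M * norm (x - y)"
    using smooth_grad_lipschitz[OF \<gamma> compact_cball convex_cball] by blast
  define F where "F x = x \<bullet> e - \<gamma> (pr x)" for x
  define H where "H x = e - pr (grad \<gamma> (pr x))" for x
  have chart': "x \<in> \<Omega> \<longleftrightarrow> F x > 0" if "x \<in> ball p r" for x
  proof -
    have "x \<in> \<Omega> \<longleftrightarrow> x \<in> \<Omega> \<inter> ball p r" using that by blast
    also have "\<dots> \<longleftrightarrow> \<gamma> (x - (x \<bullet> e) *\<^sub>R e) < x \<bullet> e" unfolding chart using that by simp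
    finally show ?thesis by (simp add: F_def pr_def)
  qed
  have DF: "(F has_derivative (\<lambda>v. H x \<bullet> v)) (at x)" for x
  proof -
    have "(pr has_derivative pr) (at x)"
      unfolding pr_def[abs_def] by (auto intro!: derivative_eq_intros)
    from has_derivative_compose[OF this has_derivative_grad[OF smooth_differentiable[OF \<gamma>]]]
    have "((\<lambda>x. \<gamma> (pr x)) has_derivative (\<lambda>v. grad \<gamma> (pr x) \<bullet> pr v)) (at x)" .
    then have "(F has_derivative (\<lambda>v. v \<bullet> e - grad \<gamma> (pr x) \<bullet> pr v)) (at x)"
      unfolding F_def[abs_def] by (intro has_derivative_diff) (auto intro!: derivative_eq_intros)
    moreover have "v \<bullet> e - grad \<gamma> (pr x) \<bullet> pr v = H x \<bullet> v" for v
      by (simp add: H_def pr_def inner_diff_left inner_diff_right inner_commute)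
    ultimately show ?thesis by simp
  qed
  have Hn: "norm (H x) \<ge> 1" for x
  proof -
    have "H x \<bullet> e = 1" by (simp add: H_def pr_def inner_diff_left ee)
    then show ?thesis using Cauchy_Schwarz_ineq2[of "H x" e] e by simp
  qed
  have pb: "pr x \<in> cball (pr p) r" if "x \<in> ball p r" for x
    using that prn[of "p - x"] by (simp add: dist_norm prd)
  have Hl: "norm (H x - H y) \<le> M * norm (x - y)" if "x \<in> ball p r" "y \<in> ball p r" for x y
  proof -
    have "norm (H x - H y) = norm (pr (grad \<gamma> (pr y) - grad \<gamma> (pr x)))"
      by (simp add: H_def prd[symmetric] algebra_simps)
    also have "\<dots> \<le> M * norm (pr y - pr x)" by (rule order_trans[OF prn M(2)]) (use pb that in auto)
    also have "\<dots> \<le> M * norm (x - y)"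
      using prn[of "y - x"] M(1) by (simp add: prd norm_minus_commute mult_left_mono)
    finally show ?thesis .
  qed
  have tay: "\<bar>F x - F q - H q \<bullet> (x - q)\<bar> \<le> M * norm (x - q) * norm (x - q)" if "x \<in> ball p r" "q \<in> ball p r" for x q
  proof (rule c1_taylor[where C="ball p r \<inter> cball q (norm (x - q))"])
    show "norm (H w - H q) \<le> M * norm (x - q)" if "w \<in> ball p r \<inter> cball q (norm (x - q))" for w
    proof -
      have "norm (w - q) \<le> norm (x - q)" using that by (simp add: dist_norm norm_minus_commute[of q w])
      then show ?thesis using order_trans[OF Hl[of w q] mult_left_mono[OF _ M(1)]] that \<open>q \<in> ball p r\<close> by blast
    qed
    show "convex (ball p r \<inter> cball q (norm (x - q)))" by (intro convex_Int convex_ball convex_cball)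
    show "q \<in> ball p r \<inter> cball q (norm (x - q))" "x \<in> ball p r \<inter> cball q (norm (x - q))"
      using that by (simp_all add: dist_norm norm_minus_commute[of q x])
  qed (rule DF)
  \<comment> \<open>The second bound is the condition 2 t M \<le> 1; the first keeps the tangent
    ball inside the chart.\<close>
  define \<rho> where "\<rho> = min (r / 8) (1 / (2 * (M + 1)))"
  have \<rho>: "\<rho> > 0" "\<rho> \<le> r / 8" "2 * \<rho> * M \<le> 1"
  proof -
    show "\<rho> > 0" "\<rho> \<le> r / 8" using r M by (auto simp: \<rho>_def)
    have "\<rho> * (2 * (M + 1)) \<le> 1"
      using M(1) unfolding \<rho>_def by (simp add: min_def field_simps)
    then show "2 * \<rho> * M \<le> 1" using \<open>\<rho> > 0\<close> by (simp add: algebra_simps)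
  qed
  show ?thesis
  proof (rule that[OF \<rho>(1)])
    fix q t assume q: "q \<in> frontier \<Omega>" "q \<in> ball p (r / 2)" and t: "0 < t" "t \<le> \<rho>"
    have qr: "q \<in> ball p r" using q(2) r by simp
    have "q \<notin> \<Omega>" using q(1) op by (simp add: frontier_def interior_open)
    then have Fq: "F q \<le> 0" using chart'[OF qr] by simp
    define n where "n = (1 / norm (H q)) *\<^sub>R H q"
    have nz: "norm (H q) \<noteq> 0" using Hn[of q] by linarith
    then have n: "norm n = 1" unfolding n_def by simp
    show "\<exists>y. dist y q = t \<and> (\<forall>x\<in>\<Omega>. t \<le> dist x y)"
    proof (intro exI[of _ "q - t *\<^sub>R n"] conjI ballI)
      show "dist (q - t *\<^sub>R n) q = t" using n t by (simp add: dist_norm)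
      fix x assume x: "x \<in> \<Omega>"
      show "t \<le> dist x (q - t *\<^sub>R n)"
      proof (cases "x \<in> ball p r")
        case True
        then have "F x > 0" using chart'[OF True] x by simp
        with Fq tay[OF True qr] have "H q \<bullet> (x - q) \<ge> - (M * norm (x - q) * norm (x - q))" by linarith
        moreover have "H q \<bullet> (x - q) = norm (H q) * (n \<bullet> (x - q))" using nz unfolding n_def by simp
        ultimately have 1: "norm (H q) * - (n \<bullet> (x - q)) \<le> M * norm (x - q) * norm (x - q)" by simp
        have 2: "- (n \<bullet> (x - q)) \<le> M * norm (x - q) * norm (x - q)"
        proof (cases "n \<bullet> (x - q) \<ge> 0")
          case True
          then show ?thesis using M(1) by (simp add: order_trans[of "- (n \<bullet> (x - q))" 0])
        next
          case False
          then have "1 * - (n \<bullet> (x - q)) \<le> norm (H q) * - (n \<bullet> (x - q))" using Hn[of q] by (intro mult_right_mono) auto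
          then show ?thesis using 1 by linarith
        qed
        have "(dist x (q - t *\<^sub>R n))\<^sup>2 = (norm (x - q))\<^sup>2 + 2 * t * (n \<bullet> (x - q)) + t\<^sup>2"
        proof -
          have "n \<bullet> n = 1" using n by (simp add: dot_square_norm)
          then show ?thesis unfolding dist_norm power2_norm_eq_inner
            by (simp add: inner_diff_left inner_diff_right inner_add_left inner_add_right inner_commute algebra_simps power2_eq_square)
        qed
        moreover have "2 * t * - (n \<bullet> (x - q)) \<le> (norm (x - q))\<^sup>2"
        proof -
          have "2 * t * - (n \<bullet> (x - q)) \<le> 2 * t * (M * norm (x - q) * norm (x - q))" using 2 t by (intro mult_left_mono) auto
          also have "\<dots> = (2 * t * M) * (norm (x - q))\<^sup>2" by (simp add: power2_eq_square)
          also have "\<dots> \<le> 1 * (norm (x - q))\<^sup>2"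
          proof (rule mult_right_mono)
            have "2 * t * M \<le> 2 * \<rho> * M" using t M by (intro mult_right_mono) auto
            then show "2 * t * M \<le> 1" using \<rho>(3) by linarith
          qed simp
          finally show ?thesis by simp
        qed
        ultimately have "t\<^sup>2 \<le> (dist x (q - t *\<^sub>R n))\<^sup>2" by simp
        then show ?thesis using power2_le_imp_le[of t] by simp
      next
        case False
        \<comment> \<open>A point outside the chart is at distance at least r / 2 from q, hence at
          least r / 2 - t from the centre, which exceeds t since t \<le> r / 8.\<close>
        have "dist (q - t *\<^sub>R n) q = t" using n t by (simp add: dist_norm)
        moreover have "dist p x \<ge> r" "dist p q < r / 2" using False q by auto
        ultimately show ?thesis
          using dist_triangle[of p x q] dist_triangle[of q x "q - t *\<^sub>R n"] t \<rho>(2) dist_commute[of x "q - t *\<^sub>R n"] dist_commute[of q "q - t *\<^sub>R n"]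
          by linarith
      qed
    qed
  qed
qed

text \<open>Compactness of the frontier leaves finitely many charts. Their minimal radius works
  everywhere because the local lemma provides tangent balls of all smaller radii.\<close>

lemma exterior_ball:
  fixes \<Omega> :: "'a::euclidean_space set"
  assumes "open \<Omega>" "bounded \<Omega>" "smooth_boundary \<Omega>"
  obtains \<rho> where "\<rho> > 0" "\<And>q. q \<in> frontier \<Omega> \<Longrightarrow> \<exists>y. dist y q = \<rho> \<and> (\<forall>x\<in>\<Omega>. \<rho> \<le> dist x y)"
proof -
  have "\<exists>s>0. \<exists>\<rho>>0. \<forall>q t. q \<in> frontier \<Omega> \<longrightarrow> q \<in> ball p s \<longrightarrow> 0 < t \<longrightarrow> t \<le> \<rho> \<longrightarrow> (\<exists>y. dist y q = t \<and> (\<forall>x\<in>\<Omega>. t \<le> dist x y))"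
    if p: "p \<in> frontier \<Omega>" for p
  proof -
    obtain r e \<gamma> where c: "r > 0" "norm e = 1" "smooth \<gamma>"
      "\<Omega> \<inter> ball p r = {x \<in> ball p r. \<gamma> (x - (x \<bullet> e) *\<^sub>R e) < x \<bullet> e}"
    proof -
      have "\<exists>r>0. \<exists>e \<gamma>. norm e = 1 \<and> smooth \<gamma> \<and> \<Omega> \<inter> ball p r = {x \<in> ball p r. \<gamma> (x - (x \<bullet> e) *\<^sub>R e) < x \<bullet> e}"
        using assms(3) p unfolding smooth_boundary_def by (rule bspec)
      then show ?thesis by (elim exE conjE) (rule that)
    qed
    obtain \<rho> where "\<rho> > 0" "\<And>q t. q \<in> frontier \<Omega> \<Longrightarrow> q \<in> ball p (r / 2) \<Longrightarrow> 0 < t \<Longrightarrow> t \<le> \<rho> \<Longrightarrow>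
        \<exists>y. dist y q = t \<and> (\<forall>x\<in>\<Omega>. t \<le> dist x y)"
      using exterior_ball_local[OF assms(1) c] by metis
    then show ?thesis using c(1) by (intro exI[of _ "r / 2"] conjI exI[of _ \<rho>]) auto
  qed
  then obtain s \<rho> where s: "\<And>p. p \<in> frontier \<Omega> \<Longrightarrow> s p > 0" "\<And>p. p \<in> frontier \<Omega> \<Longrightarrow> \<rho> p > 0"
    "\<And>p q t. p \<in> frontier \<Omega> \<Longrightarrow> q \<in> frontier \<Omega> \<Longrightarrow> q \<in> ball p (s p) \<Longrightarrow> 0 < t \<Longrightarrow> t \<le> \<rho> p \<Longrightarrow>
      \<exists>y. dist y q = t \<and> (\<forall>x\<in>\<Omega>. t \<le> dist x y)" by metis
  have "compact (frontier \<Omega>)" by (rule compact_frontier_bounded[OF assms(2)])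
  then obtain D where D: "D \<subseteq> frontier \<Omega>" "finite D" "frontier \<Omega> \<subseteq> (\<Union>p\<in>D. ball p (s p))"
    by (rule compactE_image[where C="frontier \<Omega>" and f="\<lambda>p. ball p (s p)"]) (use s(1) in auto)
  \<comment> \<open>The inserted 1 keeps \<open>Min\<close> meaningful when the frontier needs no
    chart at all.\<close>
  define R where "R = Min (insert 1 (\<rho> ` D))"
  have "R > 0" unfolding R_def using D s(2) by (subst Min_gr_iff) auto
  moreover have "\<exists>y. dist y q = R \<and> (\<forall>x\<in>\<Omega>. R \<le> dist x y)" if q: "q \<in> frontier \<Omega>" for q
  proof -
    obtain p where p: "p \<in> D" "q \<in> ball p (s p)" using D q by blast
    have "R \<le> \<rho> p" unfolding R_def using D p by (intro Min_le) auto
    then show ?thesis using s(3)[of p q R] p q D \<open>R > 0\<close> by blast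
  qed
  ultimately show ?thesis by (rule that)
qed

section \<open>Comparison with a barrier\<close>

lemma l2_continuous:
  assumes "bounded S" "open S" "continuous_on UNIV f"
  shows "l2 (\<lambda>x. indicator S x *\<^sub>R f x)"
proof -
  have K: "compact (closure S)" using assms(1) by (simp add: compact_closure)
  have "compact (f ` closure S)" by (rule compact_continuous_image[OF continuous_on_subset[OF assms(3)] K]) simp
  then obtain B where B: "B > 0" "\<forall>z\<in>f ` closure S. norm z \<le> B"
    using compact_imp_bounded[of "f ` closure S"] unfolding bounded_pos by blast
  have "f \<in> borel_measurable lebesgue"
    by (rule measurable_completion) (simp add: borel_measurable_continuous_onI[OF assms(3)])
  then have m: "(\<lambda>x. indicator S x *\<^sub>R f x) \<in> borel_measurable lebesgue"
    using assms(2) by (intro borel_measurable_scaleR borel_measurable_indicator) auto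
  show ?thesis
  proof (rule l2_mono(1)[OF l2_cmult[OF l2_indicator_lmeasurable(1)[OF lmeasurable_compact[OF K]], of B] m])
    show "AE x in lebesgue. norm (indicator S x *\<^sub>R f x) \<le> norm (B * indicator (closure S) x)"
      using B closure_subset[of S] by (intro AE_I2) (auto simp: indicator_def)
  qed
qed

lemma ip_components:
  assumes "l2 f" "l2 g"
  shows "ip f g = (\<Sum>b\<in>Basis. ip (\<lambda>x. f x \<bullet> b) (\<lambda>x. g x \<bullet> b))"
proof -
  have "(\<Sum>b\<in>Basis. ip (\<lambda>x. f x \<bullet> b) (\<lambda>x. g x \<bullet> b)) = (LINT x|lebesgue. (\<Sum>b\<in>Basis. (f x \<bullet> b) * (g x \<bullet> b)))"
    unfolding ip_def using ip_integrable[OF l2_inner_const[OF assms(1)] l2_inner_const[OF assms(2)]] by simp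
  then show ?thesis by (simp add: ip_def euclidean_inner[symmetric])
qed

text \<open>The Hopf barrier \<open>K (1 - exp (- \<alpha> (|x - y|\<^sup>2 - \<rho>\<^sup>2)))\<close> vanishes on the sphere of radius \<open>\<rho>\<close> about \<open>y\<close>
  and satisfies \<open>- \<Delta> w \<ge> \<Lambda>\<close> outside it once \<open>\<alpha> = (N + 1) / (2 \<rho>\<^sup>2)\<close>.\<close>

lemma (in minimiser) barrier:
  assumes y: "\<And>x. x \<in> S \<Longrightarrow> \<rho> \<le> dist x y" and \<rho>: "\<rho> > 0" and D: "\<And>x. x \<in> S \<Longrightarrow> dist x y \<le> D"
  shows "AE x in lebesgue. x \<in> S \<longrightarrow>
    U j x \<le> en G * exp ((real DIM('a) + 1) / (2 * \<rho>\<^sup>2) * D\<^sup>2) * (2 * D * (dist x y - \<rho>)) / 2"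
proof -
  define N where "N = real DIM('a)"
  define \<alpha> where "\<alpha> = (N + 1) / (2 * \<rho>\<^sup>2)"
  \<comment> \<open>Chosen so that 2 \<alpha> K times exp (- \<alpha> D^2), a lower bound for the
    coefficient 2 \<alpha> K E on \<open>S\<close>, equals \<open>en G\<close>.\<close>
  define K where "K = en G * exp (\<alpha> * D\<^sup>2) / (2 * \<alpha>)"
  define E where "E x = exp (- \<alpha> * ((x - y) \<bullet> (x - y) - \<rho>\<^sup>2))" for x
  define w where "w x = K * (1 - E x)" for x
  define w' where "w' x = (2 * \<alpha> * K * E x) *\<^sub>R (x - y)" for x
  \<comment> \<open>A column of the Hessian of w: the gradient of the component of \<open>w'\<close>
    along b. Summing \<open>W' b . b\<close> over the basis gives the Laplacian.\<close>
  define W' where "W' b x = (2 * \<alpha> * K * E x) *\<^sub>R (b - (2 * \<alpha> * ((x - y) \<bullet> b)) *\<^sub>R (x - y))" for b x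
  have \<alpha>: "\<alpha> > 0" "2 * \<alpha> * \<rho>\<^sup>2 = N + 1" using \<rho> by (auto simp: \<alpha>_def N_def add_nonneg_pos)
  have K: "K \<ge> 0" unfolding K_def using \<alpha> by (intro divide_nonneg_pos mult_nonneg_nonneg en_nonneg) auto
  have DE: "(E has_derivative (\<lambda>v. - (2 * \<alpha> * E x) * ((x - y) \<bullet> v))) (at x)" for x
    unfolding E_def by (auto intro!: derivative_eq_intros simp: inner_commute algebra_simps)
  have cE: "continuous_on UNIV E" unfolding E_def by (intro continuous_intros)
  have c1w: "c1 S w w'" unfolding c1_def
  proof safe
    show "(w has_derivative (\<lambda>v. w' x \<bullet> v)) (at x)" for x
      unfolding w_def by (auto intro!: derivative_eq_intros DE simp: w'_def algebra_simps)
    show "continuous_on S w'" unfolding w'_def by (intro continuous_intros continuous_on_subset[OF cE]) auto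
  qed
  have c1W: "c1 S (\<lambda>x. w' x \<bullet> b) (W' b)" for b unfolding c1_def
  proof safe
    show "((\<lambda>x. w' x \<bullet> b) has_derivative (\<lambda>v. W' b x \<bullet> v)) (at x)" for x
      unfolding w'_def by (auto intro!: derivative_eq_intros DE
          simp: W'_def inner_diff_left inner_diff_right inner_commute algebra_simps)
    show "continuous_on S (W' b)" unfolding W'_def by (intro continuous_intros continuous_on_subset[OF cE]) auto
  qed
  have l: "l2 (\<lambda>x. indicator S x * w x)" "l2 (\<lambda>x. indicator S x *\<^sub>R w' x)"
    "\<And>b. l2 (\<lambda>x. indicator S x * (w' x \<bullet> b))" "\<And>b. l2 (\<lambda>x. indicator S x *\<^sub>R W' b x)"
  proof -
    have "l2 (\<lambda>x. indicator S x *\<^sub>R w x)" "\<And>b. l2 (\<lambda>x. indicator S x *\<^sub>R (w' x \<bullet> b))"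
      "l2 (\<lambda>x. indicator S x *\<^sub>R w' x)" "\<And>b. l2 (\<lambda>x. indicator S x *\<^sub>R W' b x)"
      unfolding w_def w'_def W'_def by (intro l2_continuous bd op continuous_intros cE)+
    then show "l2 (\<lambda>x. indicator S x * w x)" "l2 (\<lambda>x. indicator S x *\<^sub>R w' x)"
      "\<And>b. l2 (\<lambda>x. indicator S x * (w' x \<bullet> b))" "\<And>b. l2 (\<lambda>x. indicator S x *\<^sub>R W' b x)" by simp_all
  qed
  have z: "\<rho>\<^sup>2 \<le> (x - y) \<bullet> (x - y)" "(x - y) \<bullet> (x - y) \<le> D\<^sup>2" if "x \<in> S" for x
    using y[OF that] D[OF that] \<rho> power_mono[of \<rho> "dist x y" 2] power_mono[of "dist x y" D 2]
    by (auto simp: dist_norm dot_square_norm)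
  have w0: "w x \<ge> 0" if "x \<in> S" for x
    using z(1)[OF that] K \<alpha>(1) by (simp add: w_def E_def)
  have lap: "(\<Sum>b\<in>Basis. W' b x \<bullet> b) \<le> - en G" if x: "x \<in> S" for x
  proof -
    have "(\<Sum>b\<in>Basis. W' b x \<bullet> b) = 2 * \<alpha> * K * E x * (\<Sum>b\<in>Basis. 1 - 2 * \<alpha> * (((x - y) \<bullet> b) * ((x - y) \<bullet> b)))"
      unfolding sum_distrib_left by (intro sum.cong refl) (simp add: W'_def inner_diff_left)
    also have "(\<Sum>b\<in>(Basis :: 'a set). 1 - 2 * \<alpha> * (((x - y) \<bullet> b) * ((x - y) \<bullet> b))) = N - 2 * \<alpha> * ((x - y) \<bullet> (x - y))"
      by (simp add: sum_subtractf sum_distrib_left[symmetric] euclidean_inner[symmetric] N_def)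
    also have "2 * \<alpha> * K * E x * (N - 2 * \<alpha> * ((x - y) \<bullet> (x - y))) \<le> 2 * \<alpha> * K * E x * (- 1)"
    proof (rule mult_left_mono)
      have "2 * \<alpha> * \<rho>\<^sup>2 \<le> 2 * \<alpha> * ((x - y) \<bullet> (x - y))" using z(1)[OF x] \<alpha> by (intro mult_left_mono) auto
      then show "N - 2 * \<alpha> * ((x - y) \<bullet> (x - y)) \<le> - 1" using \<alpha>(2) by linarith
      show "0 \<le> 2 * \<alpha> * K * E x" using \<alpha> K by (simp add: E_def)
    qed
    also have "2 * \<alpha> * K * E x = en G * exp (\<alpha> * D\<^sup>2 - \<alpha> * ((x - y) \<bullet> (x - y) - \<rho>\<^sup>2))"
    proof -
      have "2 * \<alpha> * K = en G * exp (\<alpha> * D\<^sup>2)" using \<alpha>(1) by (simp add: K_def)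
      then have "2 * \<alpha> * K * E x = en G * (exp (\<alpha> * D\<^sup>2) * exp (- \<alpha> * ((x - y) \<bullet> (x - y) - \<rho>\<^sup>2)))"
        by (simp only: E_def mult.assoc)
      then show ?thesis unfolding exp_add[symmetric] by simp
    qed
    also have "en G * exp (\<alpha> * D\<^sup>2 - \<alpha> * ((x - y) \<bullet> (x - y) - \<rho>\<^sup>2)) * (- 1) \<le> - en G"
    proof -
      have "\<alpha> * ((x - y) \<bullet> (x - y) - \<rho>\<^sup>2) \<le> \<alpha> * D\<^sup>2"
      proof (rule mult_left_mono)
        show "(x - y) \<bullet> (x - y) - \<rho>\<^sup>2 \<le> D\<^sup>2" using z(2)[OF x] zero_le_power2[of \<rho>] by linarith
      qed (use \<alpha> in simp)
      then have "1 \<le> exp (\<alpha> * D\<^sup>2 - \<alpha> * ((x - y) \<bullet> (x - y) - \<rho>\<^sup>2))" by simp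
      from mult_left_mono[OF this en_nonneg[of G]] show ?thesis by simp
    qed
    finally show ?thesis .
  qed
  \<comment> \<open>Weak comparison: testing both the inequality for \<open>U j\<close> and that for
    w with the positive part of their difference bounds the energy of this positive part by zero, so
    it vanishes by the Poincare inequality.\<close>
  define \<phi> where "\<phi> x = indicator S x * max 0 (U j x - w x)" for x
  define g where "g x = (indicator S x * (if U j x > w x then 1 else 0)) *\<^sub>R (G j x - w' x)" for x
  have P: "H0 S \<phi> g" unfolding \<phi>_def g_def by (rule H0_pos[OF op H c1w w0 l(1,2)])
  note lP = H0_l2[OF P]
  have P0: "AE x in lebesgue. \<phi> x \<ge> 0" by (simp add: \<phi>_def)
  have i\<phi>: "integrable lebesgue \<phi>" by (rule H0_integral[OF P])
  have "ip g (\<lambda>x. indicator S x *\<^sub>R w' x) = (\<Sum>b\<in>Basis. ip (\<lambda>x. g x \<bullet> b) (\<lambda>x. indicator S x * (w' x \<bullet> b)))"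
    by (subst ip_components[OF lP(2) l(2)]) simp
  also have "\<dots> = (\<Sum>b\<in>Basis. - ip \<phi> (\<lambda>x. (indicator S x *\<^sub>R W' b x) \<bullet> b))"
    using H0_ibp[OF op c1W l(3,4) P] by (intro sum.cong refl) (metis minus_minus)
  also have "\<dots> = - (LINT x|lebesgue. (\<Sum>b\<in>Basis. \<phi> x * ((indicator S x *\<^sub>R W' b x) \<bullet> b)))"
    unfolding ip_def using ip_integrable[OF lP(1) l2_inner_const[OF l(4)]]
    by (subst Bochner_Integration.integral_sum) (auto simp: sum_negf)
  also have "\<dots> \<ge> en G * (LINT x|lebesgue. \<phi> x)"
  proof -
    have "(LINT x|lebesgue. (\<Sum>b\<in>Basis. \<phi> x * ((indicator S x *\<^sub>R W' b x) \<bullet> b))) \<le> (LINT x|lebesgue. - en G * \<phi> x)"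
    proof (rule integral_mono)
      show "integrable lebesgue (\<lambda>x. \<Sum>b\<in>Basis. \<phi> x * ((indicator S x *\<^sub>R W' b x) \<bullet> b))"
        using ip_integrable[OF lP(1) l2_inner_const[OF l(4)]] by (intro Bochner_Integration.integrable_sum) auto
      show "(\<Sum>b\<in>Basis. \<phi> x * ((indicator S x *\<^sub>R W' b x) \<bullet> b)) \<le> - en G * \<phi> x" for x
      proof (cases "x \<in> S")
        case True
        have "\<phi> x * (\<Sum>b\<in>Basis. W' b x \<bullet> b) \<le> \<phi> x * (- en G)"
          using lap[OF True] by (intro mult_left_mono) (auto simp: \<phi>_def)
        then show ?thesis using True by (simp add: sum_distrib_left mult.commute)
      qed (simp add: \<phi>_def)
    qed (use i\<phi> in auto)
    then show ?thesis by simp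
  qed
  finally have 1: "en G * (LINT x|lebesgue. \<phi> x) \<le> ip g (\<lambda>x. indicator S x *\<^sub>R w' x)" .
  have 2: "ip (G j) g \<le> en G * (LINT x|lebesgue. \<phi> x)" by (rule subsolution[OF P P0])
  have "n2 g = ip (G j) g - ip (\<lambda>x. indicator S x *\<^sub>R w' x) g"
  proof -
    have "n2 g = ip (\<lambda>x. G j x - indicator S x *\<^sub>R w' x) g"
      unfolding ip_self[symmetric] unfolding ip_def
      by (intro Bochner_Integration.integral_cong refl) (auto simp: g_def indicator_def)
    then show ?thesis using ip_diff[OF lG l(2) lP(2)] by simp
  qed
  then have "n2 g \<le> 0" using 1 2 by (simp add: ip_commute[of g])
  moreover obtain R where "S \<subseteq> ball 0 R" using bounded_subset_ballD[OF bd] by blast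
  ultimately have "n2 \<phi> = 0" using H0_Poincare[OF P, of R] n2_nonneg[of \<phi>] n2_nonneg[of g]
    by (simp add: order_antisym)
  then have "AE x in lebesgue. \<phi> x = 0" by (rule n2_eq_0[OF lP(1)])
  then show ?thesis
  proof eventually_elim
    case (elim x)
    show ?case
    proof
      assume x: "x \<in> S"
      have "U j x \<le> w x" using elim x by (simp add: \<phi>_def)
      \<comment> \<open>The bound 1 - exp (- s) \<le> s makes the barrier linear in the distance to
        the sphere.\<close>
      also have "\<dots> \<le> K * (\<alpha> * ((x - y) \<bullet> (x - y) - \<rho>\<^sup>2))"
        unfolding w_def E_def using exp_ge_add_one_self[of "- \<alpha> * ((x - y) \<bullet> (x - y) - \<rho>\<^sup>2)"] K
        by (intro mult_left_mono) auto
      also have "\<dots> \<le> K * (\<alpha> * (2 * D * (dist x y - \<rho>)))"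
      proof (intro mult_left_mono)
        have "(x - y) \<bullet> (x - y) - \<rho>\<^sup>2 = (dist x y + \<rho>) * (dist x y - \<rho>)"
          by (simp add: dist_norm dot_square_norm power2_eq_square algebra_simps)
        also have "\<dots> \<le> (2 * D) * (dist x y - \<rho>)" using y[OF x] D[OF x] by (intro mult_right_mono) auto
        finally show "(x - y) \<bullet> (x - y) - \<rho>\<^sup>2 \<le> 2 * D * (dist x y - \<rho>)" .
      qed (use K \<alpha> in auto)
      also have "\<dots> = en G * exp (\<alpha> * D\<^sup>2) * (2 * D * (dist x y - \<rho>)) / 2"
        using \<alpha>(1) by (simp add: K_def)
      finally show "U j x \<le> en G * exp ((real DIM('a) + 1) / (2 * \<rho>\<^sup>2) * D\<^sup>2) * (2 * D * (dist x y - \<rho>)) / 2"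
        by (simp add: \<alpha>_def N_def)
    qed
  qed
qed

section \<open>The mean value inequality\<close>

text \<open>The uniform bound on \<open>k'\<close> dominates all difference quotients, so
  integrability is all that is asked of \<open>u\<close>.\<close>

lemma DERIV_under_integral:
  fixes u :: "'a::euclidean_space \<Rightarrow> real"
  assumes u: "integrable lebesgue u" and ab: "a < r" "r < b"
    and d: "\<And>s y. a < s \<Longrightarrow> s < b \<Longrightarrow> ((\<lambda>s. k s y) has_real_derivative k' s y) (at s)"
    and B: "\<And>s y. a < s \<Longrightarrow> s < b \<Longrightarrow> \<bar>k' s y\<bar> \<le> B"
    and i: "\<And>s. a < s \<Longrightarrow> s < b \<Longrightarrow> integrable lebesgue (\<lambda>y. k s y * u y)"
    and m: "(\<lambda>y. k' r y) \<in> borel_measurable lebesgue"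
  shows "((\<lambda>s. LINT y|lebesgue. k s y * u y) has_real_derivative (LINT y|lebesgue. k' r y * u y)) (at r)"
  unfolding DERIV_def tendsto_at_iff_sequentially comp_def
proof (intro allI impI)
  fix X :: "nat \<Rightarrow> real" assume X: "\<forall>n. X n \<in> UNIV - {0}" "X \<longlonglongrightarrow> 0"
  have "\<forall>\<^sub>F n in sequentially. a - r < X n" "\<forall>\<^sub>F n in sequentially. X n < b - r"
    using order_tendstoD[OF X(2)] ab by auto
  then have "\<forall>\<^sub>F n in sequentially. a < r + X n \<and> r + X n < b" by eventually_elim auto
  then obtain N where N: "\<And>n. n \<ge> N \<Longrightarrow> a < r + X n \<and> r + X n < b"
    unfolding eventually_sequentially by blast
  define q where "q n y = (k (r + X n) y - k r y) / X n" for n y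
  have "(\<lambda>n. LINT y|lebesgue. q (n + N) y * u y) \<longlonglongrightarrow> (LINT y|lebesgue. k' r y * u y)"
  proof (rule integral_dominated_convergence[where w="\<lambda>y. B * \<bar>u y\<bar>"])
    show "(\<lambda>y. k' r y * u y) \<in> borel_measurable lebesgue" using m u by (intro borel_measurable_times) auto
    show "(\<lambda>y. q (n + N) y * u y) \<in> borel_measurable lebesgue" for n
    proof -
      have "integrable lebesgue (\<lambda>y. (k (r + X (n + N)) y * u y - k r y * u y) / X (n + N))"
        using i N[of "n + N"] ab by (intro integrable_divide Bochner_Integration.integrable_diff) auto
      then show ?thesis by (simp add: q_def left_diff_distrib)
    qed
    show "integrable lebesgue (\<lambda>y. B * \<bar>u y\<bar>)" using u by simp
    have "(\<lambda>n. q n y) \<longlonglongrightarrow> k' r y" for y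
      using d[OF ab, of y] X unfolding DERIV_def tendsto_at_iff_sequentially comp_def q_def by blast
    then show "AE y in lebesgue. (\<lambda>n. q (n + N) y * u y) \<longlonglongrightarrow> k' r y * u y"
      by (intro AE_I2 tendsto_mult_right LIMSEQ_ignore_initial_segment)
    have "norm (q (n + N) y * u y) \<le> B * \<bar>u y\<bar>" for n y
    proof -
      have "norm (k (r + X (n + N)) y - k r y) \<le> B * norm (r + X (n + N) - r)"
      proof (rule field_differentiable_bound[of "{a<..<b}"])
        show "((\<lambda>s. k s y) has_real_derivative k' s y) (at s within {a<..<b})" if "s \<in> {a<..<b}" for s
          using d[of s y] that by (auto intro: has_field_derivative_at_within)
      qed (use B N[of "n + N"] ab in auto)
      then have "\<bar>q (n + N) y\<bar> \<le> B" using X(1) by (simp add: q_def divide_le_eq)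
      then show ?thesis by (simp add: abs_mult mult_right_mono)
    qed
    then show "AE y in lebesgue. norm (q (n + N) y * u y) \<le> B * \<bar>u y\<bar>" for n by simp
  qed
  moreover have "(LINT y|lebesgue. q (n + N) y * u y) =
      ((LINT y|lebesgue. k (r + X (n + N)) y * u y) - (LINT y|lebesgue. k r y * u y)) / X (n + N)" for n
  proof -
    have "(LINT y|lebesgue. q (n + N) y * u y) = (LINT y|lebesgue. (k (r + X (n + N)) y * u y - k r y * u y) / X (n + N))"
      by (simp add: q_def left_diff_distrib)
    then show ?thesis using i N[of "n + N"] ab by simp
  qed
  ultimately have "(\<lambda>n. ((LINT y|lebesgue. k (r + X (n + N)) y * u y) - (LINT y|lebesgue. k r y * u y)) / X (n + N))
      \<longlonglongrightarrow> (LINT y|lebesgue. k' r y * u y)" by simp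
  then show "(\<lambda>n. ((LINT y|lebesgue. k (r + X n) y * u y) - (LINT y|lebesgue. k r y * u y)) / X n)
      \<longlonglongrightarrow> (LINT y|lebesgue. k' r y * u y)"
    by (rule LIMSEQ_offset)
qed

section \<open>Averages as functions of the radius\<close>

lemma has_derivative_kP:
  "(kP a r has_derivative (\<lambda>v. (- (2 / r\<^sup>2 * psi 2 (1 - (x - a) \<bullet> (x - a) / r\<^sup>2)) *\<^sub>R (x - a)) \<bullet> v)) (at x)"
  using balg_psi_derivative[of 0 a r x] unfolding kP_def[abs_def] by (simp add: numeral_2_eq_2 mult_ac)

lemma grad_kP: "grad (kP a r) x = - (2 / r\<^sup>2 * psi 2 (1 - (x - a) \<bullet> (x - a) / r\<^sup>2)) *\<^sub>R (x - a)"
proof (rule euclidean_eqI)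
  fix b :: 'a assume "b \<in> Basis"
  then show "grad (kP a r) x \<bullet> b = (- (2 / r\<^sup>2 * psi 2 (1 - (x - a) \<bullet> (x - a) / r\<^sup>2)) *\<^sub>R (x - a)) \<bullet> b"
    by (simp add: grad_inner frechet_derivative_at[OF has_derivative_kP[of a r x], symmetric])
qed

lemma test_function_kP:
  assumes "r > 0" "cball a r \<subseteq> S" shows "test_function S (kP a r)"
  unfolding kP_def[abs_def]
  by (rule test_function_balg[OF balg_psi assms(2)]) (rule psi_ball_outside[OF assms(1)])

text \<open>The derivative of the kernel in \<open>r\<close> is a multiple of the Laplacian of \<^term>\<open>kP x r\<close>.\<close>

definition kern' :: "'a::euclidean_space \<Rightarrow> real \<Rightarrow> 'a \<Rightarrow> real" where
  "kern' x r y = (let s = 1 - (y - x) \<bullet> (y - x) / r\<^sup>2 in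
     ((psi 4 s - 2 * psi 3 s) * (2 * ((y - x) \<bullet> (y - x)) / r\<^sup>2) - real DIM('a) * psi 2 s) / (kmass TYPE('a) * r ^ (DIM('a) + 1)))"

lemma DERIV_kern:
  assumes "r > 0" shows "((\<lambda>r. kern x r y) has_real_derivative kern' x r y) (at r)"
proof -
  define c where "c = (y - x) \<bullet> (y - x)"
  define Z where "Z = kmass TYPE('a)"
  define n where "n = DIM('a) - 1"
  have n: "DIM('a) = Suc n" by (simp add: n_def)
  have Z: "Z > 0" unfolding Z_def by (rule kmass_pos)
  have 1: "((\<lambda>r. 1 - c / r\<^sup>2) has_real_derivative (2 * c / r ^ 3)) (at r)"
    using assms by (auto intro!: derivative_eq_intros simp: field_simps power2_eq_square power3_eq_cube)
  have "((\<lambda>r. psi 2 (1 - c / r\<^sup>2)) has_real_derivative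
      (psi 4 (1 - c / r\<^sup>2) - 2 * psi 3 (1 - c / r\<^sup>2)) * (2 * c / r ^ 3)) (at r)"
    using DERIV_chain2[OF DERIV_psi[of 2] 1] by simp
  moreover have "((\<lambda>r. Z * r ^ Suc n) has_real_derivative Z * (real (Suc n) * r ^ n)) (at r)"
    using DERIV_cmult[OF DERIV_pow[of "Suc n" r], of Z] by simp
  ultimately have "((\<lambda>r. psi 2 (1 - c / r\<^sup>2) / (Z * r ^ Suc n)) has_real_derivative
      ((psi 4 (1 - c / r\<^sup>2) - 2 * psi 3 (1 - c / r\<^sup>2)) * (2 * c / r ^ 3) * (Z * r ^ Suc n) -
        psi 2 (1 - c / r\<^sup>2) * (Z * (real (Suc n) * r ^ n))) / ((Z * r ^ Suc n) * (Z * r ^ Suc n))) (at r)"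
    by (rule DERIV_divide) (use assms Z in simp)
  also have "((psi 4 (1 - c / r\<^sup>2) - 2 * psi 3 (1 - c / r\<^sup>2)) * (2 * c / r ^ 3) * (Z * r ^ Suc n) -
        psi 2 (1 - c / r\<^sup>2) * (Z * (real (Suc n) * r ^ n))) / ((Z * r ^ Suc n) * (Z * r ^ Suc n)) =
      ((psi 4 (1 - c / r\<^sup>2) - 2 * psi 3 (1 - c / r\<^sup>2)) * (2 * c / r\<^sup>2) - real (Suc n) * psi 2 (1 - c / r\<^sup>2)) / (Z * r ^ (Suc n + 1))"
    (is "(?A * (2 * c / r ^ 3) * (Z * r ^ Suc n) - ?B * (Z * (real (Suc n) * r ^ n))) / _ = _")
  proof -
    have "(A * (2 * c / r ^ 3) * (Z * r ^ Suc n) - B * (Z * (N * r ^ n))) / ((Z * r ^ Suc n) * (Z * r ^ Suc n))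
      = (A * (2 * c / r\<^sup>2) - N * B) / (Z * r ^ (Suc n + 1))" for A B N
      using assms Z by (simp add: field_simps power2_eq_square power3_eq_cube)
    then show ?thesis .
  qed
  finally show ?thesis unfolding kern_def kern'_def Let_def n Z_def c_def .
qed

text \<open>In terms of s = 1 - |y - x|^2 / r^2 the unbounded-looking factor 2 |y - x|^2 / r^2 is 2
  (1 - s). It is large only for s negative, where the \<open>psi\<close> factors vanish.\<close>

lemma kern'_bounded:
  assumes "a > 0" obtains B where "\<And>r y. r > a \<Longrightarrow> \<bar>kern' (x :: 'a::euclidean_space) r y\<bar> \<le> B"
proof -
  obtain B2 where B2: "\<And>t. t \<le> 1 \<Longrightarrow> \<bar>psi 2 t\<bar> \<le> B2" using psi_bounded by blast
  obtain B3 where B3: "\<And>t. t \<le> 1 \<Longrightarrow> \<bar>psi 3 t\<bar> \<le> B3" using psi_bounded by blast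
  obtain B4 where B4: "\<And>t. t \<le> 1 \<Longrightarrow> \<bar>psi 4 t\<bar> \<le> B4" using psi_bounded by blast
  define B where "B = (B4 + 2 * B3) * 2 + real DIM('a) * B2"
  have B_nn: "B2 \<ge> 0" "B3 \<ge> 0" "B4 \<ge> 0" using B2[of 0] B3[of 0] B4[of 0] by linarith+
  have Z: "kmass TYPE('a) > 0" by (rule kmass_pos)
  have "\<bar>kern' x r y\<bar> \<le> B / (kmass TYPE('a) * a ^ (DIM('a) + 1))" if r: "r > a" for r y
  proof -
    have r0: "r > 0" using r assms by linarith
    define s where "s = 1 - (y - x) \<bullet> (y - x) / r\<^sup>2"
    have s1: "s \<le> 1" using r0 by (simp add: s_def)
    have s2: "(psi 4 s - 2 * psi 3 s) * (2 * ((y - x) \<bullet> (y - x)) / r\<^sup>2) = (psi 4 s - 2 * psi 3 s) * (2 * (1 - s))"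
      by (simp add: s_def)
    have 1: "\<bar>(psi 4 s - 2 * psi 3 s) * (2 * (1 - s))\<bar> \<le> (B4 + 2 * B3) * 2"
    proof (cases "s \<le> 0")
      case True
      then show ?thesis using B_nn by (simp add: psi_eq_0)
    next
      case False
      have "\<bar>psi 4 s - 2 * psi 3 s\<bar> \<le> B4 + 2 * B3" using B3[OF s1] B4[OF s1] by linarith
      moreover have "\<bar>2 * (1 - s)\<bar> \<le> 2" using False s1 by simp
      ultimately show ?thesis unfolding abs_mult using B_nn by (intro mult_mono) auto
    qed
    have 2: "\<bar>real DIM('a) * psi 2 s\<bar> \<le> real DIM('a) * B2" using B2[OF s1] by (simp add: abs_mult)
    have 3: "\<bar>(psi 4 s - 2 * psi 3 s) * (2 * (1 - s)) - real DIM('a) * psi 2 s\<bar> \<le> B"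
      using 1 2 unfolding B_def by linarith
    have B0: "B \<ge> 0" using 3 by linarith
    have "\<bar>kern' x r y\<bar> = \<bar>(psi 4 s - 2 * psi 3 s) * (2 * (1 - s)) - real DIM('a) * psi 2 s\<bar> / (kmass TYPE('a) * r ^ (DIM('a) + 1))"
      unfolding kern'_def Let_def s_def[symmetric] s2 using Z r0 by (simp add: abs_mult)
    also have "\<dots> \<le> B / (kmass TYPE('a) * a ^ (DIM('a) + 1))"
      using 3 Z r assms B0 by (intro frac_le mult_left_mono power_mono mult_pos_pos) auto
    finally show ?thesis .
  qed
  then show ?thesis by (rule that)
qed

text \<open>The vector field with components \<open>q b\<close> has divergence equal to minus the
  normalising factor times \<open>kern'\<close>, and at the same time equals - (r^2 / 2) times the
  gradient of \<open>kP x r\<close>. Integrating by parts in each coordinate thus turns the radial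
  derivative of an average into the weak Laplacian tested with \<open>kP x r\<close>.\<close>

lemma kern'_weak:
  fixes u :: "'a::euclidean_space \<Rightarrow> real"
  assumes "open S" "H0 S u g" and r: "r > 0" and ball: "cball x r \<subseteq> S"
  shows "(LINT y|lebesgue. kern' x r y * u y) = - ip g (grad (kP x r)) / (2 * kmass TYPE('a) * r ^ DIM('a)) * r"
proof -
  define s where "s y = 1 - (y - x) \<bullet> (y - x) / r\<^sup>2" for y
  define q where "q b y = ((y - x) \<bullet> b) * psi 2 (s y)" for b y
  define Z where "Z = kmass TYPE('a)"
  have Z: "Z > 0" unfolding Z_def by (rule kmass_pos)
  have tq: "test_function S (q b)" for b
  proof (rule test_function_balg[OF _ ball])
    have "(\<lambda>y. (y \<bullet> b + - (x \<bullet> b)) * psi 2 (1 - (y - x) \<bullet> (y - x) / r\<^sup>2)) \<in> balg x r"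
      by (intro balg_mult balg_add balg_inner balg_const balg_psi)
    then show "q b \<in> balg x r" by (simp add: q_def[abs_def] s_def inner_diff_left)
    show "r \<le> norm (y - x) \<Longrightarrow> q b y = 0" for y using psi_ball_outside[OF r, of y x 2] by (simp add: q_def s_def)
  qed
  have dq: "(q b has_derivative (\<lambda>v. (psi 2 (s y) *\<^sub>R b + (((y - x) \<bullet> b) * (psi 4 (s y) - 2 * psi 3 (s y)) * (- 2 / r\<^sup>2)) *\<^sub>R (y - x)) \<bullet> v)) (at y)" for b y
  proof -
    have 1: "((\<lambda>y. (y - x) \<bullet> b) has_derivative (\<lambda>v. v \<bullet> b)) (at y)" by (auto intro!: derivative_eq_intros)
    have 2: "((\<lambda>y. psi 2 (s y)) has_derivative (\<lambda>v. (psi 4 (s y) - 2 * psi 3 (s y)) * (- 2 / r\<^sup>2 * ((y - x) \<bullet> v)))) (at y)"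
      using balg_psi_derivative[of 2 x r y] by (simp add: s_def)
    have eq: "(\<lambda>v. (y - x) \<bullet> b * ((psi 4 (s y) - 2 * psi 3 (s y)) * (- 2 / r\<^sup>2 * ((y - x) \<bullet> v))) + v \<bullet> b * psi 2 (s y)) =
       (\<lambda>v. (psi 2 (s y) *\<^sub>R b + (((y - x) \<bullet> b) * (psi 4 (s y) - 2 * psi 3 (s y)) * (- 2 / r\<^sup>2)) *\<^sub>R (y - x)) \<bullet> v)"
      by (rule ext) (simp only: inner_add_left inner_scaleR_left inner_commute[of b] mult_ac add.commute)
    from has_derivative_mult[OF 1 2] show ?thesis unfolding eq q_def[abs_def] .
  qed
  have gq: "grad (q b) y \<bullet> b = psi 2 (s y) + ((y - x) \<bullet> b)\<^sup>2 * ((psi 4 (s y) - 2 * psi 3 (s y)) * (- 2 / r\<^sup>2))" if "b \<in> Basis" for b y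
    unfolding trans[OF grad_inner[OF that] fun_cong[OF frechet_derivative_at[OF dq[of b y]], symmetric]]
    using that by (simp only: inner_add_left inner_scaleR_left inner_same_Basis power2_eq_square mult_1_right mult_ac)
  have sum_q: "(\<Sum>b\<in>Basis. grad (q b) y \<bullet> b) = - (Z * r ^ (DIM('a) + 1)) * kern' x r y" for y
  proof -
    have "(\<Sum>b\<in>Basis. grad (q b) y \<bullet> b) = real DIM('a) * psi 2 (s y) +
        (\<Sum>b\<in>Basis. ((y - x) \<bullet> b)\<^sup>2) * ((psi 4 (s y) - 2 * psi 3 (s y)) * (- 2 / r\<^sup>2))"
      by (simp only: gq sum.distrib sum_distrib_right sum_constant cong: sum.cong)
    also have "(\<Sum>b\<in>Basis. ((y - x) \<bullet> b)\<^sup>2) = (y - x) \<bullet> (y - x)"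
      using euclidean_inner[of "y - x" "y - x"] by (simp only: power2_eq_square)
    also have "real DIM('a) * psi 2 (s y) + (y - x) \<bullet> (y - x) * ((psi 4 (s y) - 2 * psi 3 (s y)) * (- 2 / r\<^sup>2)) =
      - (Z * r ^ (DIM('a) + 1)) * kern' x r y"
      unfolding kern'_def Let_def s_def[symmetric] Z_def[symmetric] using Z r by (simp add: field_simps)
    finally show ?thesis .
  qed
  note lu = H0_l2[OF assms(2)] and ltq = c1c_l2[OF c1c_test_function[OF tq]]
  have z: "indicator S y * q b y = q b y" "indicator S y *\<^sub>R grad (q b) y = grad (q b) y" for b y
    using c1c_vanish[OF c1c_test_function[OF tq[of b]], of y] by (cases "y \<in> S"; simp)+
  have ibp: "ip u (\<lambda>y. grad (q b) y \<bullet> b) = - ip (\<lambda>y. g y \<bullet> b) (q b)" for b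
    using H0_ibp[OF assms(1) c1_c1c[OF c1c_test_function[OF tq[of b]]] _ _ assms(2), of b] ltq[of b] by (simp add: z)
  have "- (Z * r ^ (DIM('a) + 1)) * (LINT y|lebesgue. kern' x r y * u y) = (LINT y|lebesgue. (\<Sum>b\<in>Basis. u y \<bullet> (grad (q b) y \<bullet> b)))"
    unfolding inner_real_def sum_distrib_left[symmetric] sum_q
    by (subst integral_mult_right_zero[symmetric]) (simp only: mult_ac)
  also have "\<dots> = (\<Sum>b\<in>Basis. ip u (\<lambda>y. grad (q b) y \<bullet> b))"
    unfolding ip_def by (intro Bochner_Integration.integral_sum ip_integrable lu l2_inner_const ltq)
  also have "\<dots> = - (\<Sum>b\<in>Basis. ip (\<lambda>y. g y \<bullet> b) (q b))" by (simp add: ibp sum_negf)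
  also have "(\<Sum>b\<in>Basis. ip (\<lambda>y. g y \<bullet> b) (q b)) = - (r\<^sup>2 / 2) * ip g (grad (kP x r))"
  proof -
    have lk: "l2 (grad (kP x r))" by (rule c1c_l2(2)[OF c1c_test_function[OF test_function_kP[OF r ball]]])
    have "ip (\<lambda>y. g y \<bullet> b) (q b) = - (r\<^sup>2 / 2) * ip (\<lambda>y. g y \<bullet> b) (\<lambda>y. grad (kP x r) y \<bullet> b)" for b
    proof -
      have "q b = (\<lambda>y. (- (r\<^sup>2 / 2)) *\<^sub>R (grad (kP x r) y \<bullet> b))"
        using r by (simp add: q_def grad_kP s_def fun_eq_iff)
      then show ?thesis by (simp only: ip_commute[of "\<lambda>y. g y \<bullet> b"] ip_scaleR)
    qed
    then have "(\<Sum>b\<in>Basis. ip (\<lambda>y. g y \<bullet> b) (q b)) = (\<Sum>b\<in>Basis. - (r\<^sup>2 / 2) * ip (\<lambda>y. g y \<bullet> b) (\<lambda>y. grad (kP x r) y \<bullet> b))"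
      by simp
    then show ?thesis unfolding ip_components[OF lu(2) lk] sum_distrib_left .
  qed
  finally have "Z * r ^ (DIM('a) + 1) * (LINT y|lebesgue. kern' x r y * u y) = - (r\<^sup>2 / 2) * ip g (grad (kP x r))" by simp
  moreover have "I = - p / (2 * Z * R) * r" if "Z * (R * r) * I = - (r\<^sup>2 / 2) * p" "R > 0" for I p R
  proof -
    have "r * (2 * Z * R * I + r * p) = 0" using that(1) by (simp add: power2_eq_square algebra_simps)
    then have "2 * Z * R * I = - (r * p)" using r by (simp add: add_eq_0_iff)
    then show ?thesis using Z that(2) by (simp add: field_simps)
  qed
  ultimately show ?thesis using r unfolding Z_def[symmetric] by (simp add: mult.commute[of r])
qed

text \<open>A function with \<open>\<Delta> u \<ge> - C\<close> has almost increasing averages.\<close>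

lemma mollify_monotone:
  fixes u :: "'a::euclidean_space \<Rightarrow> real"
  assumes S: "open S" "bounded S" and H: "H0 S u g"
    and sub: "\<And>\<phi>. test_function S \<phi> \<Longrightarrow> (\<And>x. \<phi> x \<ge> 0) \<Longrightarrow> ip g (grad \<phi>) \<le> C * (LINT x|lebesgue. \<phi> x)" and C: "C \<ge> 0"
    and r: "0 < r" "r \<le> s" "cball x s \<subseteq> S"
  shows "mollify u r x + C * r\<^sup>2 / 4 \<le> mollify u s x + C * s\<^sup>2 / 4"
proof -
  note lu = H0_l2[OF H] note iu = H0_integrable(1)[OF H S(2)]
  define Z where "Z = kmass TYPE('a)"
  have Z: "Z > 0" unfolding Z_def by (rule kmass_pos)
  have D: "((\<lambda>t. mollify u t x) has_real_derivative (LINT y|lebesgue. kern' x t y * u y)) (at t)" if t: "t > 0" for t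
  proof -
    obtain B where B: "\<And>r y. r > t / 2 \<Longrightarrow> \<bar>kern' x r y\<bar> \<le> B" using kern'_bounded[of "t / 2" x] t by auto
    have "((\<lambda>s. LINT y|lebesgue. kern x s y * u y) has_real_derivative (LINT y|lebesgue. kern' x t y * u y)) (at t)"
    proof (rule DERIV_under_integral[OF iu, of "t / 2" _ "2 * t"])
      show "integrable lebesgue (\<lambda>y. kern x s y * u y)" if "t / 2 < s" for s using mollify_l2(2)[OF lu(1)] that t by auto
      show "((\<lambda>s. kern x s y) has_real_derivative kern' x s y) (at s)" if "t / 2 < s" for s y
        using that t by (intro DERIV_kern) linarith
      show "(\<lambda>y. kern' x t y) \<in> borel_measurable lebesgue"
      proof (rule measurable_completion)
        have "continuous_on UNIV (\<lambda>y. kern' x t y)"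
          unfolding kern'_def Let_def using t kmass_pos[where 'a='a] by (intro continuous_intros) auto
        then show "(\<lambda>y. kern' x t y) \<in> borel_measurable lborel" by (simp add: borel_measurable_continuous_onI)
      qed
    qed (use t B in auto)
    then show ?thesis by (simp add: mollify_def)
  qed
  \<comment> \<open>The correction C t^2 / 4 has derivative C t / 2, which exactly compensates this
    lower bound.\<close>
  have ge: "- C * t / 2 \<le> (LINT y|lebesgue. kern' x t y * u y)" if t: "r \<le> t" "t \<le> s" for t
  proof -
    have t0: "t > 0" using t r by linarith
    have ball: "cball x t \<subseteq> S" using r(3) t(2) by force
    have tk: "test_function S (kP x t)" by (rule test_function_kP[OF t0 ball])
    have kP0: "kP x t y \<ge> 0" for y by (simp add: kP_def psi_nonneg)
    \<comment> \<open>For arguments in (0, 1] dividing by a square only increases, so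
      \<open>psi 0\<close> is at most \<open>psi 2\<close>. The integral of \<open>kP x t\<close> is
      thus bounded by the normalising factor of the kernel.\<close>
    have kP_le: "kP x t y \<le> Z * t ^ DIM('a) * kern x t y" for y
    proof -
      define a where "a = 1 - (y - x) \<bullet> (y - x) / t\<^sup>2"
      have "a \<le> 1" using t0 by (simp add: a_def)
      then have "psi 0 a \<le> psi 2 a" by (auto simp: psi_def field_simps power_le_one)
      also have "psi 2 a = Z * t ^ DIM('a) * kern x t y" using Z t0 by (simp add: kern_def a_def Z_def)
      finally show ?thesis by (simp add: kP_def a_def)
    qed
    have "(LINT y|lebesgue. kP x t y) \<le> (LINT y|lebesgue. Z * t ^ DIM('a) * kern x t y)"
      using csupp_integrable[OF csupp_c1c(1)[OF c1c_test_function[OF tk]]] kern_integrable[OF t0, of x] kP_le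
      by (intro integral_mono) auto
    also have "\<dots> = Z * t ^ DIM('a)" by (simp add: kern_integral t0)
    finally have "ip g (grad (kP x t)) \<le> C * (Z * t ^ DIM('a))"
      using sub[OF tk kP0] mult_left_mono[OF _ C] by (blast intro: order_trans)
    then have "ip g (grad (kP x t)) / (2 * Z * t ^ DIM('a)) * t \<le> C * (Z * t ^ DIM('a)) / (2 * Z * t ^ DIM('a)) * t"
      using Z t0 by (intro mult_right_mono divide_right_mono) auto
    also have "\<dots> = C * t / 2" using Z t0 by simp
    finally show ?thesis using kern'_weak[OF S(1) H t0 ball] by (simp add: Z_def)
  qed
  show ?thesis
  proof (rule DERIV_nonneg_imp_nondecreasing[OF r(2)])
    fix t assume t: "r \<le> t" "t \<le> s"
    have "((\<lambda>t. mollify u t x + C * t\<^sup>2 / 4) has_real_derivative (LINT y|lebesgue. kern' x t y * u y) + C * (2 * t) / 4) (at t)"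
      using t r by (auto intro!: derivative_eq_intros D)
    moreover have "(LINT y|lebesgue. kern' x t y * u y) + C * (2 * t) / 4 \<ge> 0" using ge[OF t] by simp
    ultimately show "\<exists>y. ((\<lambda>t. mollify u t x + C * t\<^sup>2 / 4) has_real_derivative y) (at t) \<and> 0 \<le> y" by blast
  qed
qed

section \<open>The continuous representative\<close>

context minimiser
begin

text \<open>The precise representative. Only its values on \<open>S\<close> matter, where the limit
  of averages exists at every point.\<close>

definition us :: "'k \<Rightarrow> 'a \<Rightarrow> real" where
  "us i x = lim (\<lambda>n. mollify (U i) (1 / Suc n) x)"

lemma ball_in: "x \<in> S \<Longrightarrow> \<exists>r>0. cball x r \<subseteq> S"
  using op open_contains_cball by blast

lemma inv_small: "r > 0 \<Longrightarrow> \<forall>\<^sub>F n in sequentially. 1 / real (Suc n) \<le> r"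
  using order_tendstoD(2)[OF LIMSEQ_Suc[OF lim_1_over_n], of r] by (auto elim: eventually_mono)

lemma inv_cball: "x \<in> S \<Longrightarrow> \<forall>\<^sub>F n in sequentially. cball x (1 / real (Suc n)) \<subseteq> S"
proof -
  assume "x \<in> S"
  then obtain r where r: "r > 0" "cball x r \<subseteq> S" using ball_in by blast
  show ?thesis using inv_small[OF r(1)]
    by eventually_elim (use r(2) in force)
qed

lemma mollify_nonneg: "r > 0 \<Longrightarrow> mollify (U i) r x \<ge> 0"
  unfolding mollify_def using nonneg[of i]
  by (intro integral_nonneg_AE) (auto simp: kern_nonneg elim!: eventually_mono)

lemma mollify_U_monotone:
  assumes "0 < r" "r \<le> s" "cball x s \<subseteq> S"
  shows "mollify (U i) r x + en G * r\<^sup>2 / 4 \<le> mollify (U i) s x + en G * s\<^sup>2 / 4"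
  by (rule mollify_monotone[OF op bd H _ en_nonneg assms]) (rule subsolution[OF H0_test], auto)

lemma mollify_hat: "r > 0 \<Longrightarrow> mollify (\<lambda>y. - 1 * hat (\<lambda>i. U i y) j) r x = - hat (\<lambda>i. mollify (U i) r x) j"
proof -
  assume r: "r > 0"
  have "mollify (\<lambda>y. - 1 * hat (\<lambda>i. U i y) j) r x =
      (LINT y|lebesgue. (\<Sum>i\<in>- {j}. kern x r y * U i y) - kern x r y * U j y)"
    unfolding mollify_def hat_def
    by (intro Bochner_Integration.integral_cong refl) (simp add: right_diff_distrib sum_distrib_left sum_negf)
  also have "\<dots> = (\<Sum>i\<in>- {j}. mollify (U i) r x) - mollify (U j) r x"
    unfolding mollify_def using mollify_l2(2)[OF lU r] by simp
  finally show ?thesis by (simp add: hat_def)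
qed

text \<open>A supersolution inequality for \<open>hat\<close> is a subsolution inequality for its
  negative, so the same monotonicity applies with the same constant. It is the source of lower
  semicontinuity.\<close>

lemma mollify_hat_monotone:
  assumes "0 < r" "r \<le> s" "cball x s \<subseteq> S"
  shows "- hat (\<lambda>i. mollify (U i) r x) j + en G * r\<^sup>2 / 4 \<le> - hat (\<lambda>i. mollify (U i) s x) j + en G * s\<^sup>2 / 4"
proof -
  have "mollify (\<lambda>y. - 1 * hat (\<lambda>i. U i y) j) r x + en G * r\<^sup>2 / 4 \<le> mollify (\<lambda>y. - 1 * hat (\<lambda>i. U i y) j) s x + en G * s\<^sup>2 / 4"
  proof (rule mollify_monotone[OF op bd H0_scale[OF H0_hat] _ en_nonneg assms])
    fix \<phi> assume t: "test_function S \<phi>" "\<And>x. \<phi> x \<ge> 0"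
    have "- en G * (LINT x|lebesgue. \<phi> x) \<le> ip (\<lambda>x. hat (\<lambda>i. G i x) j) (grad \<phi>)"
      by (rule supersolution[OF H0_test[OF t(1)]]) (use t in auto)
    then show "ip (\<lambda>x. - 1 *\<^sub>R hat (\<lambda>i. G i x) j) (grad \<phi>) \<le> en G * (LINT x|lebesgue. \<phi> x)"
      by (simp only: ip_scaleR)
  qed
  then show ?thesis using mollify_hat assms by simp
qed

text \<open>After the correction by C r^2 / 4 the averages decrease as the radius shrinks, and they
  are nonnegative.\<close>

lemma us_limit:
  assumes x: "x \<in> S"
  shows "(\<lambda>n. mollify (U i) (1 / Suc n) x) \<longlonglongrightarrow> us i x"
proof -
  obtain N where N: "\<And>n. n \<ge> N \<Longrightarrow> cball x (1 / real (Suc n)) \<subseteq> S"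
    using inv_cball[OF x] unfolding eventually_sequentially by blast
  define a where "a n = mollify (U i) (1 / Suc n) x + en G * (1 / Suc n)\<^sup>2 / 4" for n
  have dec: "decseq (\<lambda>n. a (n + N))"
  proof (rule decseq_SucI)
    show "a (Suc n + N) \<le> a (n + N)" for n
      unfolding a_def by (rule mollify_U_monotone) (use N[of "n + N"] in \<open>auto intro!: divide_left_mono\<close>)
  qed
  have "0 \<le> a (n + N)" for n
    unfolding a_def by (intro add_nonneg_nonneg mollify_nonneg divide_nonneg_nonneg mult_nonneg_nonneg en_nonneg) auto
  then obtain L where "(\<lambda>n. a (n + N)) \<longlonglongrightarrow> L"
    using decseq_convergent[OF dec] by blast
  then have "a \<longlonglongrightarrow> L" by (rule LIMSEQ_offset)
  moreover have "(\<lambda>n. en G * (1 / Suc n)\<^sup>2 / 4) \<longlonglongrightarrow> en G * 0\<^sup>2 / 4"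
    by (intro tendsto_intros LIMSEQ_Suc[OF lim_1_over_n]) auto
  ultimately have "(\<lambda>n. a n - en G * (1 / Suc n)\<^sup>2 / 4) \<longlonglongrightarrow> L - en G * 0\<^sup>2 / 4"
    by (rule tendsto_diff)
  then have "(\<lambda>n. mollify (U i) (1 / Suc n) x) \<longlonglongrightarrow> L" by (simp add: a_def)
  then show ?thesis unfolding us_def by (simp add: limI)
qed

lemma us_nonneg: "x \<in> S \<Longrightarrow> us i x \<ge> 0"
  by (rule LIMSEQ_le_const[OF us_limit], assumption) (intro exI[of _ 0] allI impI mollify_nonneg, simp)

lemma limit_le:
  fixes c :: "real \<Rightarrow> real"
  assumes lim: "(\<lambda>n. c (1 / Suc n)) \<longlonglongrightarrow> L"
    and m: "\<And>s. 0 < s \<Longrightarrow> s \<le> r \<Longrightarrow> c s + C * s\<^sup>2 / 4 \<le> c r + C * r\<^sup>2 / 4" and r: "r > 0" and C: "C \<ge> 0"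
  shows "L \<le> c r + C * r\<^sup>2 / 4"
proof (rule tendsto_le[OF sequentially_bot tendsto_const lim])
  show "\<forall>\<^sub>F n in sequentially. c (1 / Suc n) \<le> c r + C * r\<^sup>2 / 4"
    using inv_small[OF r]
  proof eventually_elim
    case (elim n)
    have "0 \<le> C * (1 / real (Suc n))\<^sup>2 / 4" using C by simp
    then show ?case using m[of "1 / Suc n"] elim by simp
  qed
qed

lemma us_upper:
  assumes "x \<in> S" "r > 0" "cball x r \<subseteq> S"
  shows "us i x \<le> mollify (U i) r x + en G * r\<^sup>2 / 4"
  by (rule limit_le[OF us_limit[OF assms(1)] _ assms(2) en_nonneg]) (rule mollify_U_monotone[OF _ _ assms(3)])

lemma us_hat_limit: "x \<in> S \<Longrightarrow> (\<lambda>n. - hat (\<lambda>i. mollify (U i) (1 / Suc n) x) j) \<longlonglongrightarrow> - hat (\<lambda>i. us i x) j"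
  unfolding hat_def by (intro tendsto_minus tendsto_diff tendsto_sum us_limit)

lemma us_lower:
  assumes "x \<in> S" "r > 0" "cball x r \<subseteq> S"
  shows "- hat (\<lambda>i. us i x) j \<le> - hat (\<lambda>i. mollify (U i) r x) j + en G * r\<^sup>2 / 4"
  by (rule limit_le[OF us_hat_limit[OF assms(1)] _ assms(2) en_nonneg]) (rule mollify_hat_monotone[OF _ _ assms(3)])

lemma us_AE: "AE x in lebesgue. x \<in> S \<longrightarrow> us i x = U i x"
proof -
  have "tol2 (\<lambda>n. mollify (U i) (1 / Suc n)) (U i)"
  proof (rule tol2I_bound[OF _ lU])
    show "l2 (mollify (U i) (1 / Suc n))" for n
      using l2_add[OF mollification_H0(1)[OF H, of "1 / Suc n"] lU, of i i] by simp
    show "sqrt (n2 (\<lambda>x. mollify (U i) (1 / Suc n) x - U i x)) \<le> (1 / Suc n) * sqrt (n2 (G i))" for n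
      using real_sqrt_le_mono[OF mollification_H0(2)[OF H, of "1 / Suc n" i]] by (simp add: real_sqrt_mult real_sqrt_divide)
    show "(\<lambda>n. (1 / Suc n) * sqrt (n2 (G i))) \<longlonglongrightarrow> 0"
      by (rule tendsto_mult_left_zero[OF LIMSEQ_Suc[OF lim_1_over_n]])
  qed
  then obtain r where r: "strict_mono r" "AE x in lebesgue. (\<lambda>n. mollify (U i) (1 / Suc (r n)) x) \<longlonglongrightarrow> U i x"
    using tol2_AE_subseq by blast
  show ?thesis using r(2)
  proof eventually_elim
    case (elim x)
    show ?case
    proof
      assume "x \<in> S"
      from LIMSEQ_subseq_LIMSEQ[OF us_limit[OF this, of i] r(1)] show "us i x = U i x"
        using elim by (auto simp: o_def intro: LIMSEQ_unique)
    qed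
  qed
qed

text \<open>Near \<open>x\<close> the function f lies below the continuous functions c r + C r^2 /
  4, whose values at \<open>x\<close> come arbitrarily close to f x.\<close>

lemma usc_aux:
  fixes c :: "real \<Rightarrow> 'a \<Rightarrow> real"
  assumes cont: "\<And>r. r > 0 \<Longrightarrow> continuous_on UNIV (c r)"
    and up: "\<And>y r. y \<in> S \<Longrightarrow> r > 0 \<Longrightarrow> cball y r \<subseteq> S \<Longrightarrow> f y \<le> c r y + C * r\<^sup>2 / 4"
    and lim: "(\<lambda>n. c (1 / Suc n) x) \<longlonglongrightarrow> f x" and x: "x \<in> S" and e: "e > 0"
  shows "\<exists>d>0. \<forall>y. dist y x < d \<longrightarrow> y \<in> S \<and> f y < f x + e"
proof -
  obtain R where R: "R > 0" "cball x R \<subseteq> S" using ball_in[OF x] by blast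
  have l: "(\<lambda>n. c (1 / Suc n) x + C * (1 / Suc n)\<^sup>2 / 4) \<longlonglongrightarrow> f x + C * 0\<^sup>2 / 4"
    by (intro tendsto_intros lim LIMSEQ_Suc[OF lim_1_over_n]) auto
  have "\<forall>\<^sub>F n in sequentially. c (1 / Suc n) x + C * (1 / Suc n)\<^sup>2 / 4 < f x + e / 2"
    by (rule order_tendstoD(2)[OF l]) (use e in simp)
  moreover have "\<forall>\<^sub>F n in sequentially. 1 / real (Suc n) \<le> R / 2" by (rule inv_small) (use R in simp)
  ultimately have "\<forall>\<^sub>F n in sequentially. c (1 / Suc n) x + C * (1 / Suc n)\<^sup>2 / 4 < f x + e / 2 \<and> 1 / real (Suc n) \<le> R / 2"
    by (rule eventually_conj)
  then obtain n where n: "c (1 / Suc n) x + C * (1 / Suc n)\<^sup>2 / 4 < f x + e / 2" "1 / real (Suc n) \<le> R / 2"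
    using eventually_happens'[OF sequentially_bot] by blast
  \<comment> \<open>Since r \<le> R / 2, balls of radius r about points within r of x remain in
    \<open>cball x R\<close>, so the upper bound is available at all of them with one
    radius.\<close>
  define r where "r = 1 / real (Suc n)"
  have r: "r > 0" "r \<le> R / 2" using n(2) by (auto simp: r_def)
  obtain d where d: "d > 0" "\<And>y. dist y x < d \<Longrightarrow> dist (c r y) (c r x) < e / 2"
    using cont[OF r(1)] e unfolding continuous_on_iff by (metis UNIV_I half_gt_zero)
  show ?thesis
  proof (intro exI[of _ "min d r"] conjI allI impI)
    fix y assume y: "dist y x < min d r"
    have "cball y r \<subseteq> cball x R"
    proof
      fix z assume "z \<in> cball y r"
      then show "z \<in> cball x R" using y r dist_triangle[of x z y] by (simp add: dist_commute)
    qed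
    then have b: "cball y r \<subseteq> S" using R by blast
    then show yS: "y \<in> S" using r by force
    have "f y \<le> c r y + C * r\<^sup>2 / 4" by (rule up[OF yS r(1) b])
    moreover have "dist (c r y) (c r x) < e / 2" using y by (intro d(2)) simp
    then have "c r y < c r x + e / 2" unfolding dist_real_def by linarith
    ultimately show "f y < f x + e" using n(1) unfolding r_def by linarith
  qed (use d r in auto)
qed

lemma us_usc:
  assumes "x \<in> S" "e > 0"
  shows "\<exists>d>0. \<forall>y. dist y x < d \<longrightarrow> y \<in> S \<and> us i y < us i x + e"
  by (rule usc_aux[OF _ us_upper us_limit assms]) (use assms in \<open>auto intro: continuous_on_cvv lU iU\<close>)

lemma us_hat_lsc:
  assumes "x \<in> S" "e > 0"
  shows "\<exists>d>0. \<forall>y. dist y x < d \<longrightarrow> y \<in> S \<and> - hat (\<lambda>i. us i y) j < - hat (\<lambda>i. us i x) j + e"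
proof (rule usc_aux[OF _ us_lower us_hat_limit assms])
  show "continuous_on UNIV (\<lambda>x. - hat (\<lambda>i. mollify (U i) r x) j)" if "r > 0" for r
    unfolding hat_def by (intro continuous_intros continuous_on_cvv lU iU that)
qed (use assms in auto)

text \<open>If two densities were positive at \<open>x\<close>, upper semicontinuity would force each of two disjoint sets
  to have nearly full density at \<open>x\<close>.\<close>

lemma us_segregated:
  assumes x: "x \<in> S" and ij: "i \<noteq> j"
  shows "us i x = 0 \<or> us j x = 0"
proof (rule ccontr)
  assume "\<not> ?thesis"
  then have ab: "us i x > 0" "us j x > 0" using us_nonneg[OF x, of i] us_nonneg[OF x, of j] by auto
  \<comment> \<open>With the factor 3 / 2 the densities stay below a and b near x, so by
    disjointness the averages of U i / a + U j / b are at most 1, whereas in the limit each quotient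
    is 2 / 3.\<close>
  define a where "a = us i x + us i x / 2"
  define b where "b = us j x + us j x / 2"
  have ab0: "a > 0" "b > 0" using ab by (auto simp: a_def b_def)
  obtain d1 where d1: "d1 > 0" "\<And>y. dist y x < d1 \<Longrightarrow> y \<in> S \<and> us i y < a"
    using us_usc[OF x, of "us i x / 2" i] ab unfolding a_def by auto
  obtain d2 where d2: "d2 > 0" "\<And>y. dist y x < d2 \<Longrightarrow> us j y < b"
    using us_usc[OF x, of "us j x / 2" j] ab unfolding b_def by auto
  define d where "d = min d1 d2"
  have d: "d > 0" using d1 d2 by (simp add: d_def)
  have "AE y in lebesgue. (\<forall>i. U i y \<ge> 0) \<and> (\<forall>i j. i \<noteq> j \<longrightarrow> U i y * U j y = 0)"
    using ad unfolding adm_def by blast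
  then have seg: "AE y in lebesgue. U i y * U j y = 0" by (rule eventually_mono) (use ij in blast)
  have le: "mollify (U i) r x / a + mollify (U j) r x / b \<le> 1" if r: "0 < r" "r \<le> d" for r
  proof -
    have ii: "integrable lebesgue (\<lambda>y. kern x r y * U i y)" for i by (rule mollify_l2(2)[OF lU r(1)])
    have "mollify (U i) r x / a + mollify (U j) r x / b = (LINT y|lebesgue. kern x r y * U i y / a + kern x r y * U j y / b)"
      unfolding mollify_def using ii by simp
    also have "\<dots> \<le> (LINT y|lebesgue. kern x r y)"
    proof (rule integral_mono_AE)
      show "integrable lebesgue (\<lambda>y. kern x r y * U i y / a + kern x r y * U j y / b)" using ii by simp
      show "integrable lebesgue (kern x r)" by (rule kern_integrable[OF r(1)])
      show "AE y in lebesgue. kern x r y * U i y / a + kern x r y * U j y / b \<le> kern x r y"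
        using us_AE[of i] us_AE[of j] seg
      proof eventually_elim
        case (elim y)
        show ?case
        proof (cases "norm (y - x) < r")
          case True
          then have y: "dist y x < d1" "dist y x < d2" using r by (auto simp: d_def dist_norm)
          have "U i y \<le> a" "U j y \<le> b" using elim d1(2)[OF y(1)] d2(2)[OF y(2)] by auto
          then have "U i y / a + U j y / b \<le> 1" using elim ab0 by auto
          from mult_left_mono[OF this kern_nonneg[OF r(1), of x y]] show ?thesis by (simp add: distrib_left)
        next
          case False
          then show ?thesis using kern_outside[OF r(1), of y x] by simp
        qed
      qed
    qed
    finally show ?thesis by (simp add: kern_integral r(1))
  qed
  have "us i x / a + us j x / b \<le> 1"
  proof (rule tendsto_le[OF sequentially_bot tendsto_const])
    show "(\<lambda>n. mollify (U i) (1 / Suc n) x / a + mollify (U j) (1 / Suc n) x / b) \<longlonglongrightarrow> us i x / a + us j x / b"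
      using ab0 by (intro tendsto_intros us_limit x) auto
    show "\<forall>\<^sub>F n in sequentially. mollify (U i) (1 / Suc n) x / a + mollify (U j) (1 / Suc n) x / b \<le> 1"
      using inv_small[OF d] by eventually_elim (rule le, auto)
  qed
  moreover have "us i x / a = 2 / 3" "us j x / b = 2 / 3" using ab by (simp_all add: a_def b_def field_simps)
  ultimately show False by simp
qed

lemma us_hat_le: "x \<in> S \<Longrightarrow> hat (\<lambda>i. us i x) j \<le> us j x"
  unfolding hat_def by (simp add: sum_nonneg us_nonneg)

text \<open>Upper semicontinuity holds everywhere, and at a zero nonnegativity completes it. Where
  \<open>us i x > 0\<close> the other densities vanish at x, so \<open>hat\<close> agrees with
  \<open>us i\<close> there while lying below it nearby; its lower semicontinuity passes to
  \<open>us i\<close>.\<close>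

lemma continuous_on_us: "continuous_on S (us i)"
proof (rule continuous_onI)
  fix x and e :: real assume x: "x \<in> S" and e: "e > 0"
  obtain d1 where d1: "d1 > 0" "\<And>y. dist y x < d1 \<Longrightarrow> us i y < us i x + e" using us_usc[OF x e, of i] by blast
  show "\<exists>d>0. \<forall>y\<in>S. dist y x < d \<longrightarrow> dist (us i y) (us i x) \<le> e"
  proof (cases "us i x = 0")
    case True
    have "dist (us i y) (us i x) \<le> e" if "y \<in> S" "dist y x < d1" for y
      using d1(2)[OF that(2)] us_nonneg[OF that(1), of i] True by (simp add: dist_real_def)
    then show ?thesis using d1(1) by blast
  next
    case False
    then have "\<And>k. k \<noteq> i \<Longrightarrow> us k x = 0" using us_segregated[OF x] by blast
    then have h: "hat (\<lambda>i. us i x) i = us i x" using hat_single[of i "\<lambda>i. us i x" i] by simp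
    obtain d2 where d2: "d2 > 0" "\<And>y. dist y x < d2 \<Longrightarrow> - hat (\<lambda>i. us i y) i < - hat (\<lambda>i. us i x) i + e"
      using us_hat_lsc[OF x e, of i] by blast
    have "dist (us i y) (us i x) \<le> e" if "y \<in> S" "dist y x < min d1 d2" for y
      using d1(2)[of y] d2(2)[of y] that us_hat_le[OF that(1), of i] h by (simp add: dist_real_def)
    then show ?thesis using d1(1) d2(1) by (intro exI[of _ "min d1 d2"]) auto
  qed
qed

definition vs :: "'k \<Rightarrow> 'a \<Rightarrow> real" where
  "vs i x = (if x \<in> S then us i x else 0)"

lemma vs_AE: "AE x in lebesgue. vs i x = U i x"
  using us_AE[of i] H0_outside(1)[OF H[of i]] by eventually_elim (auto simp: vs_def)

lemma vs_nonneg: "vs i x \<ge> 0"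
  by (simp add: vs_def us_nonneg)

lemma vs_segregated: "i \<noteq> j \<Longrightarrow> vs i x = 0 \<or> vs j x = 0"
  using us_segregated by (auto simp: vs_def)

end

lemma AE_le_imp_le:
  fixes f g :: "'a::euclidean_space \<Rightarrow> real"
  assumes "open S" "continuous_on S f" "continuous_on S g" and ae: "AE x in lebesgue. x \<in> S \<longrightarrow> f x \<le> g x" and x: "x \<in> S"
  shows "f x \<le> g x"
proof (rule ccontr)
  assume n: "\<not> f x \<le> g x"
  define A where "A = S \<inter> (\<lambda>x. f x - g x) -` {0<..}"
  have "open A" unfolding A_def
    by (rule continuous_open_preimage[OF _ assms(1)]) (auto intro!: continuous_intros assms)
  have "x \<in> A" using n x by (simp add: A_def)
  have "AE x in lebesgue. x \<notin> A" using ae by eventually_elim (auto simp: A_def)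
  then have "negligible A"
    using \<open>open A\<close> by (simp add: negligible_iff_null_sets AE_iff_null_sets)
  then show False using open_not_negligible[OF \<open>open A\<close>] \<open>x \<in> A\<close> by blast
qed

text \<open>The reflection is diagonal in the standard basis with entries 1 and -1, so the Jacobian
  has absolute value one.\<close>

lemma integral_lebesgue_flip:
  fixes f :: "'a::euclidean_space \<Rightarrow> 'b::{banach, second_countable_topology}"
  assumes [measurable]: "f \<in> borel_measurable borel" and b: "b \<in> Basis"
  shows "(LINT x|lebesgue. f (x - (2 * (x \<bullet> b)) *\<^sub>R b)) = (LINT x|lebesgue. f x)"
proof -
  define c where "c j = (if j = b then - 1 else 1 :: real)" for j
  have T: "(\<Sum>j\<in>Basis. (c j * (x \<bullet> j)) *\<^sub>R j) = x - (2 * (x \<bullet> b)) *\<^sub>R b" for x :: 'a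
  proof -
    have "(\<Sum>j\<in>Basis. (c j * (x \<bullet> j)) *\<^sub>R j) = (\<Sum>j\<in>Basis. (x \<bullet> j) *\<^sub>R j - (if j = b then (2 * (x \<bullet> b)) *\<^sub>R b else 0))"
      by (rule sum.cong) (auto simp: c_def simp flip: scaleR_diff_left)
    then show ?thesis using b by (simp add: sum_subtractf euclidean_representation)
  qed
  have "(LINT x|lebesgue. f x) = (LINT x|lborel. f x)" by (rule integral_completion) simp
  also have "\<dots> = (LINT x|lborel. f (x - (2 * (x \<bullet> b)) *\<^sub>R b))"
  proof -
    have "c j \<noteq> 0" "\<bar>c j\<bar> = 1" for j by (auto simp: c_def)
    then show ?thesis by (subst lborel_affine_euclidean[of c 0]) (simp_all add: T density_1 integral_distr)
  qed
  also have "\<dots> = (LINT x|lebesgue. f (x - (2 * (x \<bullet> b)) *\<^sub>R b))"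
    by (rule integral_completion[symmetric]) simp
  finally show ?thesis ..
qed

section \<open>Lipschitz continuity\<close>

definition flip :: "'a::euclidean_space \<Rightarrow> 'a \<Rightarrow> 'a" where
  "flip b z = z - (2 * (z \<bullet> b)) *\<^sub>R b"

lemma flip_inner:
  assumes "b \<in> Basis" shows "flip b z \<bullet> flip b z = z \<bullet> z" "norm (flip b z) = norm z"
  "c \<in> Basis \<Longrightarrow> flip b z \<bullet> c = (if c = b then - (z \<bullet> b) else z \<bullet> c)"
proof -
  show 1: "flip b z \<bullet> flip b z = z \<bullet> z"
    using assms by (simp add: flip_def inner_diff_left inner_diff_right inner_commute)
  then show "norm (flip b z) = norm z" by (simp add: norm_eq_sqrt_inner)
  show "c \<in> Basis \<Longrightarrow> flip b z \<bullet> c = (if c = b then - (z \<bullet> b) else z \<bullet> c)"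
    using assms by (simp add: flip_def inner_diff_left inner_Basis)
qed

lemma kern_flip: "b \<in> Basis \<Longrightarrow> kern 0 s (flip b z) = kern 0 s z"
  by (simp add: kern_def flip_inner)

text \<open>The reflection in direction b preserves the kernel and changes the sign of the
  integrand.\<close>

lemma kern_first_moment:
  fixes b :: "'a::euclidean_space"
  assumes b: "b \<in> Basis" and s: "s > 0"
  shows "(LINT z|lebesgue. kern 0 s z * (z \<bullet> b)) = 0"
proof -
  have "csupp (\<lambda>z. kern 0 s z *\<^sub>R (z \<bullet> b))" by (intro csupp_times csupp_kern s continuous_intros)
  then have m: "(\<lambda>z. kern 0 s z * (z \<bullet> b)) \<in> borel_measurable borel" using csupp_measurable(1) by fastforce
  have "(LINT z|lebesgue. kern 0 s z * (z \<bullet> b)) = (LINT z|lebesgue. kern 0 s (flip b z) * (flip b z \<bullet> b))"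
    using integral_lebesgue_flip[OF m b] by (simp add: flip_def)
  also have "\<dots> = (LINT z|lebesgue. - (kern 0 s z * (z \<bullet> b)))"
    by (intro Bochner_Integration.integral_cong refl) (simp add: kern_flip flip_inner b)
  finally show ?thesis by simp
qed

definition kmom :: "'a::euclidean_space \<Rightarrow> real" where
  "kmom b = (LINT z|lebesgue. kern 0 1 z * (z \<bullet> b)\<^sup>2)"

lemma csupp_second_moment: "s > 0 \<Longrightarrow> csupp (\<lambda>z. kern 0 s z * (z \<bullet> b)\<^sup>2)"
  using csupp_times[OF csupp_kern, of s "\<lambda>z. (z \<bullet> b)\<^sup>2" 0] by (simp add: continuous_intros)

lemma kmom_pos:
  assumes "b \<in> Basis" shows "kmom b > 0"
  unfolding kmom_def
proof (rule csupp_nonneg_integral_pos[OF csupp_second_moment])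
  show "0 \<le> kern 0 1 z * (z \<bullet> b)\<^sup>2" for z by (simp add: kern_nonneg)
  have "psi 2 (1 - ((1/2) *\<^sub>R b - 0) \<bullet> ((1/2) *\<^sub>R b - 0) / 1\<^sup>2) > 0"
    by (rule psi_ball_pos) (use assms in simp)
  then show "0 < kern 0 1 ((1/2) *\<^sub>R b) * (((1/2) *\<^sub>R b) \<bullet> b)\<^sup>2"
    using assms kmass_pos[where 'a='a] by (simp add: kern_def)
qed simp

lemma kern_second_moment:
  fixes b :: "'a::euclidean_space"
  assumes s: "s > 0" shows "(LINT z|lebesgue. kern 0 s z * (z \<bullet> b)\<^sup>2) = s\<^sup>2 * kmom b"
proof -
  have m: "(\<lambda>z. kern 0 s z * (z \<bullet> b)\<^sup>2) \<in> borel_measurable borel"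
    by (rule csupp_measurable(1)[OF csupp_second_moment[OF s]])
  have k: "s ^ DIM('a) * (kern 0 s (s *\<^sub>R z) * ((s *\<^sub>R z) \<bullet> b)\<^sup>2) = s\<^sup>2 * (kern 0 1 z * (z \<bullet> b)\<^sup>2)" for z
    using s by (simp add: kern_def power_mult_distrib power2_eq_square[of s])
  have "(LINT z|lebesgue. kern 0 s z * (z \<bullet> b)\<^sup>2) = s ^ DIM('a) * (LINT z|lebesgue. kern 0 s (s *\<^sub>R z) * ((s *\<^sub>R z) \<bullet> b)\<^sup>2)"
    using integral_lebesgue_affine[OF m, of s 0] s by simp
  also have "\<dots> = (LINT z|lebesgue. s ^ DIM('a) * (kern 0 s (s *\<^sub>R z) * ((s *\<^sub>R z) \<bullet> b)\<^sup>2))" by simp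
  also have "\<dots> = s\<^sup>2 * kmom b" unfolding k kmom_def by simp
  finally show ?thesis .
qed

text \<open>Concave with second derivative -1 / D, and between t / 2 and t on [0, D]: a penalty
  comparable to the distance whose second-order gain is the same at every t. It is applied to each
  coordinate separately, to match a reflection that affects one coordinate of the
  difference.\<close>

definition phi :: "real \<Rightarrow> real \<Rightarrow> real" where
  "phi D t = t - t\<^sup>2 / (2 * D)"

context minimiser
begin

text \<open>The segment from an interior point y to an outside point x meets the frontier in some q.
  The barrier at the exterior ball touching q bounds the value at y by a multiple of dist y q, which
  is at most dist x y.\<close>

lemma boundary_estimate:
  assumes \<rho>: "\<rho> > 0" and ext: "\<And>q. q \<in> frontier S \<Longrightarrow> \<exists>y. dist y q = \<rho> \<and> (\<forall>x\<in>S. \<rho> \<le> dist x y)"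
  obtains C where "C \<ge> 0" "\<And>i x y. x \<notin> S \<Longrightarrow> vs i y \<le> C * dist x y"
proof -
  obtain R where R: "S \<subseteq> ball 0 R" using bounded_subset_ballD[OF bd] by blast
  \<comment> \<open>A bound for the distance from any point of \<open>S\<close> to the centre of an
    exterior ball: both x and q have norm at most |R|, and the centre is \<rho> away from q.\<close>
  define D where "D = 2 * \<bar>R\<bar> + \<rho>"
  define A where "A = en G * exp ((real DIM('a) + 1) / (2 * \<rho>\<^sup>2) * D\<^sup>2)"
  have A: "A \<ge> 0" unfolding A_def by (simp add: en_nonneg)
  have D: "D > 0" using \<rho> by (simp add: D_def)
  have 1: "us i x \<le> A * D * dist x q" if x: "x \<in> S" and q: "q \<in> frontier S" for i x q
  proof (rule AE_le_imp_le[OF op continuous_on_us _ _ x])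
    obtain y where y: "dist y q = \<rho>" "\<And>x. x \<in> S \<Longrightarrow> \<rho> \<le> dist x y" using ext[OF q] by blast
    have Dy: "dist x y \<le> D" if "x \<in> S" for x
    proof -
      have "S \<subseteq> cball 0 \<bar>R\<bar>" using R by force
      then have "closure S \<subseteq> cball 0 \<bar>R\<bar>" by (rule closure_minimal) simp
      then have "norm q \<le> \<bar>R\<bar>" "norm x \<le> \<bar>R\<bar>" using q that closure_subset[of S] by (auto simp: frontier_def)
      then show ?thesis
        using dist_triangle[of x y q] y(1) norm_triangle_ineq4[of x q] unfolding D_def by (simp add: dist_norm norm_minus_commute)
    qed
    have "AE x in lebesgue. x \<in> S \<longrightarrow> U i x \<le> A * (2 * D * (dist x y - \<rho>)) / 2"
      unfolding A_def by (rule barrier[OF y(2) \<rho> Dy])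
    then show "AE x in lebesgue. x \<in> S \<longrightarrow> us i x \<le> A * D * dist x q" using us_AE[of i]
    proof eventually_elim
      case (elim x)
      have "dist x y - \<rho> \<le> dist x q" using dist_triangle[of x y q] y(1) by (simp add: dist_commute)
      then have "A * D * (dist x y - \<rho>) \<le> A * D * dist x q" using A D by (intro mult_left_mono) auto
      then show ?case using elim by auto
    qed
  qed (intro continuous_intros)
  show ?thesis
  proof (rule that[of "A * D"])
    show "vs i y \<le> A * D * dist x y" if x: "x \<notin> S" for i x y
    proof (cases "y \<in> S")
      case True
      have "closed_segment y x \<inter> frontier S \<noteq> {}"
        by (rule connected_Int_frontier) (use x True in auto)
      then obtain q where q: "q \<in> closed_segment y x" "q \<in> frontier S" by blast
      have "dist y q \<le> dist y x" using q(1) dist_in_closed_segment[of q y x] by (simp add: dist_commute)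
      then have "A * D * dist y q \<le> A * D * dist x y" using A D by (simp add: dist_commute mult_left_mono)
      then show ?thesis using 1[OF True q(2), of i] True by (simp add: vs_def)
    qed (use A D in \<open>simp add: vs_def\<close>)
  qed (use A D in simp)
qed

text \<open>Within \<open>S\<close> continuity is that of \<open>us\<close>. At all other points,
  boundary points included, the linear bound forces the values to tend to zero.\<close>

lemma csupp_vs:
  assumes C: "\<And>x y. x \<notin> S \<Longrightarrow> vs i y \<le> C * dist x y" "C \<ge> 0"
  shows "csupp (vs i)"
proof (rule csuppI)
  show "compact (closure S)" using bd by (simp add: compact_closure)
  show "x \<notin> closure S \<Longrightarrow> vs i x = 0" for x using closure_subset[of S] by (auto simp: vs_def)
  show "continuous_on UNIV (vs i)"
  proof (rule continuous_at_imp_continuous_on, rule ballI)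
    fix x :: 'a
    show "isCont (vs i) x"
    proof (cases "x \<in> S")
      case True
      have "continuous_on S (vs i)"
        by (rule continuous_on_eq[OF continuous_on_us[of i]]) (simp add: vs_def)
      then show ?thesis using continuous_on_eq_continuous_at[OF op] True by blast
    next
      case False
      have "((\<lambda>y. C * dist x y) \<longlongrightarrow> C * dist x x) (at x)" by (intro tendsto_intros)
      then have "((\<lambda>y. C * dist x y) \<longlongrightarrow> 0) (at x)" by simp
      then have "(vs i \<longlongrightarrow> 0) (at x)"
        by (rule Lim_null_comparison[rotated]) (use C(1)[OF False] vs_nonneg in auto)
      then show ?thesis using False by (simp add: isCont_def vs_def)
    qed
  qed
qed

text \<open>Averages are needed along z and along its reflection simultaneously. The kernel is
  invariant under \<open>flip\<close>, so both kinds of average are the same mollification.\<close>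

lemma mollify_vs:
  assumes cs: "\<And>i. csupp (vs i)" and s: "s > 0"
  shows "mollify (U i) s x = (LINT z|lebesgue. kern 0 s z * vs i (x + z))"
    "integrable lebesgue (\<lambda>z. kern 0 s z * vs i (x + z))"
    "b \<in> Basis \<Longrightarrow> (LINT z|lebesgue. kern 0 s z * vs i (x + flip b z)) = mollify (U i) s x"
    "b \<in> Basis \<Longrightarrow> integrable lebesgue (\<lambda>z. kern 0 s z * vs i (x + flip b z))"
proof -
  have c: "continuous_on UNIV (vs i)" using cs by (simp add: csupp_def)
  have c1: "csupp (\<lambda>z. kern 0 s z * vs i (x + z))"
    using csupp_times[OF csupp_kern[OF s], of "\<lambda>z. vs i (x + z)" 0]
      continuous_on_compose2[OF c, of UNIV "\<lambda>z. x + z"] by (simp add: continuous_intros)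
  show "integrable lebesgue (\<lambda>z. kern 0 s z * vs i (x + z))" by (rule csupp_integrable[OF c1])
  have c2: "csupp (\<lambda>z. kern 0 s z * vs i (x + flip b z))"
    using csupp_times[OF csupp_kern[OF s], of "\<lambda>z. vs i (x + flip b z)" 0]
      continuous_on_compose2[OF c, of UNIV "\<lambda>z. x + flip b z"] by (simp add: continuous_intros flip_def)
  then show "integrable lebesgue (\<lambda>z. kern 0 s z * vs i (x + flip b z))" by (rule csupp_integrable)
  have [measurable]: "kern x s \<in> borel_measurable borel" "vs i \<in> borel_measurable borel"
    using csupp_measurable(1) csupp_kern[OF s] cs by blast+
  have "mollify (U i) s x = (LINT y|lebesgue. kern x s y * vs i y)"
    unfolding mollify_def
  proof (rule integral_cong_AE)
    show "(\<lambda>y. kern x s y *\<^sub>R U i y) \<in> borel_measurable lebesgue" using mollify_l2(2)[OF lU s] by simp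
    show "(\<lambda>y. kern x s y * vs i y) \<in> borel_measurable lebesgue" by (rule measurable_completion) simp
    show "AE y in lebesgue. kern x s y *\<^sub>R U i y = kern x s y * vs i y" using vs_AE[of i] by eventually_elim simp
  qed
  also have "\<dots> = (LINT z|lebesgue. kern x s (z + x) * vs i (z + x))"
    by (rule integral_lebesgue_translation[symmetric]) simp
  also have "\<dots> = (LINT z|lebesgue. kern 0 s z * vs i (x + z))" by (simp add: kern_def add.commute)
  finally show 1: "mollify (U i) s x = (LINT z|lebesgue. kern 0 s z * vs i (x + z))" .
  show "(LINT z|lebesgue. kern 0 s z * vs i (x + flip b z)) = mollify (U i) s x" if b: "b \<in> Basis"
    using integral_lebesgue_flip[OF csupp_measurable(1)[OF c1] b] unfolding 1
    by (simp add: flip_def[symmetric] kern_flip b)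
qed

text \<open>Ishii--Lions doubling with the coordinate reflection \<^const>\<open>flip\<close> as coupling: it changes
  \<open>x - y\<close> in the direction \<open>b\<close> only, where the strict concavity of \<^const>\<open>phi\<close> gains a large multiple
  of \<open>s\<^sup>2\<close>, whereas the two mean value inequalities lose at most \<open>en G * s\<^sup>2 / 2\<close>.\<close>

lemma doubling:
  assumes cs: "\<And>i. csupp (vs i)" and D: "D > 0" and L: "L \<ge> 0" "L > en G * D / (4 * kmom b)"
    and b: "b \<in> Basis" and xy: "x \<in> S" "y \<in> S" "(x - y) \<bullet> b \<noteq> 0" and j: "vs j x < vs j y"
    and max: "\<And>x' y'. x' \<in> S \<Longrightarrow> y' \<in> S \<Longrightarrow>
      (\<Sum>i\<in>UNIV. \<bar>vs i x' - vs i y'\<bar>) - L * (\<Sum>c\<in>Basis. phi D \<bar>(x' - y') \<bullet> c\<bar>) \<le>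
      (\<Sum>i\<in>UNIV. \<bar>vs i x - vs i y\<bar>) - L * (\<Sum>c\<in>Basis. phi D \<bar>(x - y) \<bullet> c\<bar>)"
  shows False
proof -
  define \<delta> where "\<delta> = (x - y) \<bullet> b"
  have \<delta>: "\<delta> \<noteq> 0" using xy(3) by (simp add: \<delta>_def)
  \<comment> \<open>The difference of the subsolution \<open>vs j\<close> in the second variable and
    the supersolution \<open>hat\<close> in the first. It lies below \<open>d\<close> wherever
    \<open>vs j y'\<close> is positive and touches it at the maximum point.\<close>
  define f where "f x' y' = vs j y' - hat (\<lambda>i. vs i x') j" for x' y'
  define d where "d x' y' = (\<Sum>i\<in>UNIV. \<bar>vs i x' - vs i y'\<bar>)" for x' y'
  have split: "d x' y' = \<bar>vs j x' - vs j y'\<bar> + (\<Sum>i\<in>- {j}. vs i x')" if "vs j y' > 0" for x' y'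
  proof -
    have "d x' y' = \<bar>vs j x' - vs j y'\<bar> + (\<Sum>i\<in>UNIV - {j}. \<bar>vs i x' - vs i y'\<bar>)"
      unfolding d_def by (rule sum.remove) auto
    also have "(\<Sum>i\<in>UNIV - {j}. \<bar>vs i x' - vs i y'\<bar>) = (\<Sum>i\<in>- {j}. vs i x')"
      using vs_segregated[of _ j y'] that vs_nonneg by (intro sum.cong) fastforce+
    finally show ?thesis .
  qed
  have fd: "f x' y' \<le> d x' y'" if "vs j y' > 0" for x' y' using split[OF that] by (simp add: f_def hat_def)
  have jy: "vs j y > 0" using j vs_nonneg[of j x] by linarith
  have f0: "f x y = d x y" using split[OF jy, of x] j by (simp add: f_def hat_def)
  obtain r1 where r1: "r1 > 0" "cball x r1 \<subseteq> S" using ball_in[OF xy(1)] by blast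
  obtain r2 where r2: "r2 > 0" "cball y r2 \<subseteq> S" using ball_in[OF xy(2)] by blast
  obtain r3 where r3: "r3 > 0" "\<And>w. dist w y < r3 \<Longrightarrow> dist (vs j w) (vs j y) < vs j y"
    using cs[of j] jy unfolding csupp_def continuous_on_iff by (metis UNIV_I)
  \<comment> \<open>The bound by r3 keeps \<open>vs j\<close> positive near y; the bound by
    |\<delta>| / 2 keeps the sign of \<delta> + 2 (z . b), so the absolute value is linear in
    z.\<close>
  define s where "s = min (min r1 r2) (min r3 (\<bar>\<delta>\<bar> / 2))"
  have s: "s > 0" "s \<le> r1" "s \<le> r2" "s \<le> r3" "2 * s \<le> \<bar>\<delta>\<bar>" using r1 r2 r3 \<delta> by (auto simp: s_def)
  have ball: "cball x s \<subseteq> S" "cball y s \<subseteq> S" using r1 r2 s subset_cball by (meson order_trans)+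
  \<comment> \<open>The first-order coefficient of the penalty along the coupling. Its value is
    immaterial in the end, since the first moment of the kernel vanishes.\<close>
  define c where "c = 2 * sgn \<delta> * (1 - \<bar>\<delta>\<bar> / D)"
  have main: "f (x + z) (y + flip b z) \<le> f x y + L * (c * (z \<bullet> b) - 2 / D * (z \<bullet> b)\<^sup>2)" if z: "norm z < s" for z
  proof -
    have "x + z \<in> cball x s" "y + flip b z \<in> cball y s"
      using z flip_inner(2)[OF b, of z] by (simp_all add: dist_norm)
    then have zS: "x + z \<in> S" "y + flip b z \<in> S" using ball by blast+
    have "dist (y + flip b z) y < r3" using z s flip_inner(2)[OF b, of z] by (simp add: dist_norm)
    from r3(2)[OF this] have p: "vs j (y + flip b z) > 0" by (simp add: dist_real_def abs_if split: if_splits)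
    have zb: "\<bar>z \<bullet> b\<bar> < s" using Basis_le_norm[OF b, of z] z by linarith
    have co: "(x + z - (y + flip b z)) \<bullet> c = (x - y) \<bullet> c + (if c = b then 2 * (z \<bullet> b) else 0)" if "c \<in> Basis" for c
      using flip_inner(3)[OF b that, of z] by (simp add: inner_diff_left inner_add_left)
    have "(\<Sum>c\<in>Basis. phi D \<bar>(x + z - (y + flip b z)) \<bullet> c\<bar>) - (\<Sum>c\<in>Basis. phi D \<bar>(x - y) \<bullet> c\<bar>)
        = phi D \<bar>\<delta> + 2 * (z \<bullet> b)\<bar> - phi D \<bar>\<delta>\<bar>"
    proof -
      have "(\<Sum>c\<in>Basis - {b}. phi D \<bar>(x + z - (y + flip b z)) \<bullet> c\<bar>) = (\<Sum>c\<in>Basis - {b}. phi D \<bar>(x - y) \<bullet> c\<bar>)"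
        by (rule sum.cong) (auto simp: co simp del: inner_diff_left)
      then show ?thesis
        using sum.remove[OF finite_Basis b, of "\<lambda>c. phi D \<bar>(x + z - (y + flip b z)) \<bullet> c\<bar>"]
          sum.remove[OF finite_Basis b, of "\<lambda>c. phi D \<bar>(x - y) \<bullet> c\<bar>"] co[OF b] by (simp add: \<delta>_def)
    qed
    also have "\<bar>\<delta> + 2 * (z \<bullet> b)\<bar> = \<bar>\<delta>\<bar> + 2 * sgn \<delta> * (z \<bullet> b)"
      using zb s(5) \<delta> by (auto simp: abs_if sgn_if split: if_splits)
    also have "phi D (\<bar>\<delta>\<bar> + 2 * sgn \<delta> * (z \<bullet> b)) - phi D \<bar>\<delta>\<bar> = c * (z \<bullet> b) - 2 / D * (z \<bullet> b)\<^sup>2"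
    proof -
      have "(\<bar>\<delta>\<bar> + t * w) - (\<bar>\<delta>\<bar> + t * w)\<^sup>2 / (2 * D) - (\<bar>\<delta>\<bar> - \<bar>\<delta>\<bar>\<^sup>2 / (2 * D)) = t * (1 - \<bar>\<delta>\<bar> / D) * w - t\<^sup>2 / (2 * D) * w\<^sup>2" for t w
        using D by (simp add: power2_eq_square divide_simps) (simp add: algebra_simps)
      from this[of "2 * sgn \<delta>" "z \<bullet> b"] show ?thesis
        using \<delta> by (simp add: phi_def c_def power_mult_distrib sgn_if)
    qed
    finally have "L * (\<Sum>c\<in>Basis. phi D \<bar>(x + z - (y + flip b z)) \<bullet> c\<bar>) =
        L * (\<Sum>c\<in>Basis. phi D \<bar>(x - y) \<bullet> c\<bar>) + L * (c * (z \<bullet> b) - 2 / D * (z \<bullet> b)\<^sup>2)"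
      by (simp only: diff_eq_eq distrib_left add.commute)
    moreover note max[OF zS, folded d_def] fd[OF p, of "x + z"] f0
    ultimately show ?thesis by linarith
  qed
  have k: "integrable lebesgue (kern (0::'a) s)" "integrable lebesgue (\<lambda>z. kern (0::'a) s z * (z \<bullet> b))" "integrable lebesgue (\<lambda>z. kern (0::'a) s z * (z \<bullet> b)\<^sup>2)"
  proof -
    show "integrable lebesgue (kern (0::'a) s)" by (rule kern_integrable[OF s(1)])
    show "integrable lebesgue (\<lambda>z. kern (0::'a) s z * (z \<bullet> b)\<^sup>2)" by (rule csupp_integrable[OF csupp_second_moment[OF s(1)]])
    have "csupp (\<lambda>z. kern (0::'a) s z *\<^sub>R (z \<bullet> b))" by (intro csupp_times csupp_kern s continuous_intros)
    from csupp_integrable[OF this] show "integrable lebesgue (\<lambda>z. kern (0::'a) s z * (z \<bullet> b))" by simp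
  qed
  have fe: "kern 0 s z * f (x + z) (y + flip b z) =
      kern 0 s z * vs j (y + flip b z) - (kern 0 s z * vs j (x + z) - (\<Sum>i\<in>- {j}. kern 0 s z * vs i (x + z)))" for z
    by (simp add: f_def hat_def right_diff_distrib sum_distrib_left)
  have fi: "integrable lebesgue (\<lambda>z. kern 0 s z * f (x + z) (y + flip b z))"
    unfolding fe using mollify_vs(2)[OF cs s(1)] mollify_vs(4)[OF cs s(1) b] by simp
  have "mollify (U j) s y - hat (\<lambda>i. mollify (U i) s x) j = (LINT z|lebesgue. kern 0 s z * f (x + z) (y + flip b z))"
    unfolding fe hat_def using mollify_vs[OF cs s(1)] b by simp
  also have "\<dots> \<le> (LINT z|lebesgue. f x y * kern 0 s z + (L * c) * (kern 0 s z * (z \<bullet> b)) - (L * (2 / D)) * (kern 0 s z * (z \<bullet> b)\<^sup>2))"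
  proof (rule integral_mono[OF fi])
    show "integrable lebesgue (\<lambda>z. f x y * kern 0 s z + (L * c) * (kern 0 s z * (z \<bullet> b)) - (L * (2 / D)) * (kern 0 s z * (z \<bullet> b)\<^sup>2))"
      using k by simp
    show "kern 0 s z * f (x + z) (y + flip b z) \<le> f x y * kern 0 s z + (L * c) * (kern 0 s z * (z \<bullet> b)) - (L * (2 / D)) * (kern 0 s z * (z \<bullet> b)\<^sup>2)" for z
    proof (cases "norm z < s")
      case True
      from mult_left_mono[OF main[OF True] kern_nonneg[OF s(1), of 0 z]] show ?thesis by (simp add: algebra_simps)
    next
      case False
      then show ?thesis using kern_outside[OF s(1), of z 0] by simp
    qed
  qed
  also have "\<dots> = f x y - L * (2 / D) * (s\<^sup>2 * kmom b)"
  proof -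
    have "(LINT z|lebesgue. p * a z + q * e z - r * g z) = p * (LINT z|lebesgue. a z) + q * (LINT z|lebesgue. e z) - r * (LINT z|lebesgue. g z)"
      if "integrable lebesgue a" "integrable lebesgue e" "integrable lebesgue g" for a e g :: "'a \<Rightarrow> real" and p q r
      using that by simp
    from this[OF k] show ?thesis
      by (simp only: kern_integral[OF s(1)] kern_first_moment[OF b s(1)] kern_second_moment[OF s(1)])
  qed
  finally have 1: "mollify (U j) s y - hat (\<lambda>i. mollify (U i) s x) j \<le> f x y - L * (2 / D) * (s\<^sup>2 * kmom b)" .
  have "us j y \<le> mollify (U j) s y + en G * s\<^sup>2 / 4" by (rule us_upper[OF xy(2) s(1) ball(2)])
  moreover have "- hat (\<lambda>i. us i x) j \<le> - hat (\<lambda>i. mollify (U i) s x) j + en G * s\<^sup>2 / 4" by (rule us_lower[OF xy(1) s(1) ball(1)])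
  moreover have "f x y = us j y - hat (\<lambda>i. us i x) j" using xy by (simp add: f_def vs_def)
  \<comment> \<open>The gain from concavity against two mean value errors of en G s^2 / 4 each.
    Cancelling s^2 leaves exactly the negation of the assumed lower bound on L.\<close>
  ultimately have "L * (2 / D) * (s\<^sup>2 * kmom b) \<le> en G * s\<^sup>2 / 2" using 1 by linarith
  then have "s\<^sup>2 * (L * (2 / D) * kmom b) \<le> s\<^sup>2 * (en G / 2)" by (simp add: algebra_simps)
  then have "L * (2 / D) * kmom b \<le> en G / 2" by (rule mult_left_le_imp_le) (use s(1) in simp)
  then have "L \<le> en G * D / (4 * kmom b)" using D kmom_pos[OF b] by (simp add: field_simps)
  then show False using L(2) by simp
qed

text \<open>If \<open>d - P\<close> were positive somewhere on the compact product, its maximum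
  would be attained at a pair inside \<open>S\<close>, by \<open>outer\<close>, and off the
  diagonal. Some component differs there, and \<open>doubling\<close> refutes the pair in one of its
  two orders. The bound d \<le> P then gives the Lipschitz estimate, as \<open>phi D t\<close> is at
  most t.\<close>

lemma vs_lipschitz:
  assumes \<rho>: "\<rho> > 0" and ext: "\<And>q. q \<in> frontier S \<Longrightarrow> \<exists>y. dist y q = \<rho> \<and> (\<forall>x\<in>S. \<rho> \<le> dist x y)"
  obtains L where "L \<ge> 0" "\<And>x y. x \<in> closure S \<Longrightarrow> y \<in> closure S \<Longrightarrow> (\<Sum>i\<in>UNIV. \<bar>vs i x - vs i y\<bar>) \<le> L * dist x y"
proof -
  obtain C where C: "C \<ge> 0" "\<And>i x y. x \<notin> S \<Longrightarrow> vs i y \<le> C * dist x y"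
    using boundary_estimate[OF \<rho> ext] by metis
  have cs: "csupp (vs i)" for i by (rule csupp_vs[OF C(2,1)])
  have cK: "compact (closure S)" using bd by (simp add: compact_closure)
  obtain R where R: "R > 0" "\<And>x. x \<in> closure S \<Longrightarrow> norm x \<le> R"
    using compact_imp_bounded[OF cK] unfolding bounded_pos by blast
  \<comment> \<open>No coordinate difference on the closure of \<open>S\<close> exceeds 2 R, so the
    penalty is only evaluated where \<open>phi D\<close> is at least half its argument.\<close>
  define D where "D = 2 * R"
  have D: "D > 0" using R by (simp add: D_def)
  have Db: "\<bar>(x - y) \<bullet> b\<bar> \<le> D" if "x \<in> closure S" "y \<in> closure S" "b \<in> Basis" for x y b
    using Basis_le_norm[OF that(3), of "x - y"] norm_triangle_ineq4[of x y] R(2)[OF that(1)] R(2)[OF that(2)] unfolding D_def by linarith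
  define n where "n = real CARD('k)"
  \<comment> \<open>The first term dominates the boundary decay of n components, with factor 2
    because \<open>phi D t\<close> may be as small as t / 2. The sum exceeds the threshold of
    \<open>doubling\<close> for every coordinate at once, and 1 makes this strict.\<close>
  define L where "L = 2 * n * C + (\<Sum>b\<in>Basis. en G * D / kmom (b::'a)) + 1"
  have Lb: "L > en G * D / (4 * kmom b)" if b: "b \<in> Basis" for b :: 'a
  proof -
    have p: "en G * D / kmom b \<ge> 0" if "b \<in> Basis" for b :: 'a
      using kmom_pos[OF that] D by (intro divide_nonneg_pos mult_nonneg_nonneg en_nonneg) auto
    have "X / 4 \<le> X" if "X \<ge> 0" for X :: real using that by simp
    from this[OF p[OF b]] have "en G * D / (4 * kmom b) \<le> en G * D / kmom b"
      by (simp only: divide_divide_eq_left mult.commute)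
    also have "\<dots> \<le> (\<Sum>b\<in>Basis. en G * D / kmom (b::'a))" by (rule member_le_sum[OF b]) (use p in auto)
    finally have "en G * D / (4 * kmom b) \<le> (\<Sum>b\<in>Basis. en G * D / kmom (b::'a))" .
    moreover have "x < y + s + 1" if "x \<le> s" "0 \<le> y" for x y s :: real using that by simp
    moreover have "0 \<le> 2 * n * C" using C(1) by (simp add: n_def)
    ultimately show ?thesis unfolding L_def by blast
  qed
  have L2: "L \<ge> 2 * n * C"
  proof -
    have "0 \<le> (\<Sum>b\<in>Basis. en G * D / kmom (b::'a))"
      using kmom_pos D by (intro sum_nonneg divide_nonneg_pos mult_nonneg_nonneg en_nonneg) auto
    then show ?thesis unfolding L_def by linarith
  qed
  have L0: "L \<ge> 0" by (rule order_trans[OF _ L2]) (use C(1) in \<open>simp add: n_def\<close>)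
  have phi_half: "t / 2 \<le> phi D t" "phi D t \<le> t" if "0 \<le> t" "t \<le> D" for t
  proof -
    have "t\<^sup>2 / (2 * D) \<le> t / 2" using that D mult_left_mono[OF that(2,1)] by (simp add: power2_eq_square field_simps)
    then show "t / 2 \<le> phi D t" "phi D t \<le> t" using D by (auto simp: phi_def)
  qed
  define d where "d p = (\<Sum>i\<in>UNIV. \<bar>vs i (fst p) - vs i (snd p)\<bar>)" for p
  define P where "P p = L * (\<Sum>c\<in>Basis. phi D \<bar>(fst p - snd p) \<bullet> c\<bar>)" for p :: "'a \<times> 'a"
  have outer: "d (x, y) \<le> P (x, y)" if xy: "x \<in> closure S" "y \<in> closure S" and x: "x \<notin> S" for x y
  proof -
    have "d (x, y) = (\<Sum>i\<in>UNIV. vs i y)" using x vs_nonneg by (simp add: d_def vs_def[of _ x])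
    also have "\<dots> \<le> (\<Sum>i\<in>(UNIV :: 'k set). C * dist x y)" by (intro sum_mono C x)
    also have "\<dots> = n * C * norm (x - y)" by (simp add: n_def dist_norm)
    also have "\<dots> \<le> n * C * (\<Sum>c\<in>Basis. \<bar>(x - y) \<bullet> c\<bar>)" using C(1) by (intro mult_left_mono norm_le_l1) (auto simp: n_def)
    also have "\<dots> \<le> n * C * (\<Sum>c\<in>Basis. 2 * phi D \<bar>(x - y) \<bullet> c\<bar>)"
      using C(1) phi_half(1)[OF _ Db[OF xy]] by (intro mult_left_mono sum_mono) (fastforce simp: n_def)+
    also have "\<dots> = 2 * n * C * (\<Sum>c\<in>Basis. phi D \<bar>(x - y) \<bullet> c\<bar>)" by (simp add: sum_distrib_left[symmetric])
    also have "\<dots> \<le> L * (\<Sum>c\<in>Basis. phi D \<bar>(x - y) \<bullet> c\<bar>)"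
      using phi_half(1)[OF _ Db[OF xy]] by (intro mult_right_mono L2 sum_nonneg) (smt (verit) abs_ge_zero divide_nonneg_pos)
    finally show ?thesis by (simp add: P_def)
  qed
  have sym: "d (x, y) = d (y, x)" "P (x, y) = P (y, x)" for x y
  proof -
    show "d (x, y) = d (y, x)" by (simp add: d_def abs_minus_commute)
    have "\<bar>(x - y) \<bullet> c\<bar> = \<bar>(y - x) \<bullet> c\<bar>" for c by (simp add: inner_diff_left abs_minus_commute)
    then show "P (x, y) = P (y, x)" by (simp add: P_def)
  qed
  have cv: "continuous_on UNIV (vs i)" for i using cs by (simp add: csupp_def)
  have "continuous_on (closure S \<times> closure S) (\<lambda>p. d p - P p)"
    unfolding d_def P_def phi_def using D
    by (intro continuous_intros continuous_on_compose2[OF cv]) auto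
  have le: "d (x, y) \<le> P (x, y)" if xy: "x \<in> closure S" "y \<in> closure S" for x y
  proof -
    have "closure S \<times> closure S \<noteq> {}" using xy by blast
    then obtain p where p: "p \<in> closure S \<times> closure S" "\<And>q. q \<in> closure S \<times> closure S \<Longrightarrow> d q - P q \<le> d p - P p"
      using continuous_attains_sup[OF compact_Times[OF cK cK] _ \<open>continuous_on (closure S \<times> closure S) (\<lambda>p. d p - P p)\<close>] by blast
    obtain a b where ab: "p = (a, b)" "a \<in> closure S" "b \<in> closure S" using p(1) by (cases p) auto
    have "d p - P p \<le> 0"
    proof (rule ccontr)
      assume n: "\<not> d p - P p \<le> 0"
      have aS: "a \<in> S" using n outer[of a b] ab by auto
      have bS: "b \<in> S" using n outer[of b a] ab sym by auto
      have "a \<noteq> b"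
      proof
        assume "a = b"
        then show False using n by (simp add: ab d_def P_def phi_def)
      qed
      then obtain e where e: "e \<in> Basis" "(a - b) \<bullet> e \<noteq> 0" using euclidean_eq_iff[of a b] by (auto simp: inner_diff_left)
      have Pn: "P p \<ge> 0" unfolding P_def using phi_half(1)[OF _ Db] ab L0
        by (intro mult_nonneg_nonneg sum_nonneg) (auto, smt (verit) abs_ge_zero divide_nonneg_pos)
      have "d p \<noteq> 0" using n Pn by linarith
      moreover have "d p = 0" if "\<forall>j. vs j a = vs j b" using that by (simp add: d_def ab)
      ultimately obtain j where j: "vs j a \<noteq> vs j b" by blast
      have mx: "d (x', y') - P (x', y') \<le> d (a, b) - P (a, b)" if "x' \<in> S" "y' \<in> S" for x' y'
        using p(2)[of "(x', y')"] that closure_subset[of S] ab by auto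
      show False
      proof (cases "vs j a < vs j b")
        case True
        show False
          by (rule doubling[OF cs D L0 Lb[OF e(1)] e(1) aS bS e(2) True])
            (use mx in \<open>simp add: d_def P_def\<close>)
      next
        case False
        then have "vs j b < vs j a" using j by simp
        moreover have "(b - a) \<bullet> e \<noteq> 0" using e(2) by (simp add: inner_diff_left)
        moreover have "d (x', y') - P (x', y') \<le> d (b, a) - P (b, a)" if "x' \<in> S" "y' \<in> S" for x' y'
          using mx[OF that] by (simp only: sym[of b a])
        ultimately show False
          by (intro doubling[OF cs D L0 Lb[OF e(1)] e(1) bS aS, of j]) (simp_all add: d_def P_def)
      qed
    qed
    then show ?thesis using p(2)[of "(x, y)"] xy by auto
  qed
  show ?thesis
  proof (rule that[of "L * real DIM('a)"])
    show "(\<Sum>i\<in>UNIV. \<bar>vs i x - vs i y\<bar>) \<le> L * real DIM('a) * dist x y" if xy: "x \<in> closure S" "y \<in> closure S" for x y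
    proof -
      have "d (x, y) \<le> L * (\<Sum>c\<in>(Basis::'a set). dist x y)"
      proof (rule order_trans[OF le[OF xy]])
        have "phi D \<bar>(x - y) \<bullet> c\<bar> \<le> dist x y" if c: "c \<in> Basis" for c
          using phi_half(2)[OF _ Db[OF xy c]] Basis_le_norm[OF c, of "x - y"] by (simp add: dist_norm)
        then show "P (x, y) \<le> L * (\<Sum>c\<in>(Basis::'a set). dist x y)"
          unfolding P_def using L0 by (intro mult_left_mono sum_mono) auto
      qed
      then show ?thesis by (simp add: d_def mult.assoc)
    qed
  qed (use L0 in simp)
qed

end

section \<open>Localisation to the positivity set\<close>

lemma tol2_bounded:
  assumes F: "tol2 F f" and m: "\<And>n. G n \<in> borel_measurable lebesgue" "g \<in> borel_measurable lebesgue"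
    and B: "\<And>n x. norm (G n x) \<le> B * norm (F n x)" "\<And>x. norm (g x) \<le> B * norm (f x)"
    and d: "\<And>n x. norm (G n x - g x) \<le> B * norm (F n x - f x)"
  shows "tol2 G g"
proof -
  have l: "l2 (G n)" for n by (rule l2_bound(1)[OF tol2D(1)[OF F, of n] m(1), where C = B]) (use B in simp)
  have lg: "l2 g" by (rule l2_bound(1)[OF tol2D(2)[OF F] m(2), where C = B]) (use B in simp)
  have "n2 (\<lambda>x. G n x - g x) \<le> B\<^sup>2 * n2 (\<lambda>x. F n x - f x)" for n
    by (rule l2_bound(2)[OF l2_diff[OF tol2D(1)[OF F] tol2D(2)[OF F]]]) (use m d in simp_all)
  then have "(\<lambda>n. n2 (\<lambda>x. G n x - g x)) \<longlonglongrightarrow> 0"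
    by (intro tendsto_0_le[OF tol2D(3)[OF F], of _ "B\<^sup>2"] always_eventually) (simp add: mult.commute)
  then show ?thesis using l lg by (simp add: tol2_def)
qed

text \<open>Localisation: the product lies in the space over \<open>T\<close>, where the cutoff has
  its support, wherever the approximants of \<open>u\<close> live.\<close>

lemma H0_mult:
  assumes H: "H0 S u g" and T: "open T" "c1c T w w'"
  shows "H0 T (\<lambda>x. w x * u x) (\<lambda>x. u x *\<^sub>R w' x + w x *\<^sub>R g x)"
proof -
  obtain f h where fh: "\<And>n. c1c S (f n) (h n)" "tol2 f u" "tol2 h g" using H0E[OF H] by blast
  have cs: "csupp w" "csupp w'" using csupp_c1c[OF T(2)] by blast+
  have [measurable]: "w \<in> borel_measurable lebesgue" "w' \<in> borel_measurable lebesgue"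
    using csupp_measurable(2) cs by blast+
  have [measurable]: "u \<in> borel_measurable lebesgue" "g \<in> borel_measurable lebesgue"
    "f n \<in> borel_measurable lebesgue" "h n \<in> borel_measurable lebesgue" for n
    using fh tol2D l2_measurable by blast+
  obtain B where B: "B > 0" "\<And>x. norm (w x) \<le> B" using csupp_bounded[OF cs(1)] by blast
  obtain C where C: "C > 0" "\<And>x. norm (w' x) \<le> C" using csupp_bounded[OF cs(2)] by blast
  have 1: "tol2 (\<lambda>n x. w x * f n x) (\<lambda>x. w x * u x)"
    by (rule tol2_bounded[OF fh(2), where B = B])
      (use B in \<open>auto simp: norm_mult abs_mult right_diff_distrib[symmetric] intro!: mult_right_mono\<close>)
  have 2: "tol2 (\<lambda>n x. f n x *\<^sub>R w' x) (\<lambda>x. u x *\<^sub>R w' x)"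
    by (rule tol2_bounded[OF fh(2), where B = C])
      (use C in \<open>auto simp: mult.commute[of C] scaleR_left_diff_distrib[symmetric] intro!: mult_left_mono\<close>)
  have 3: "tol2 (\<lambda>n x. w x *\<^sub>R h n x) (\<lambda>x. w x *\<^sub>R g x)"
    by (rule tol2_bounded[OF fh(3), where B = B])
      (use B in \<open>auto simp: scaleR_right_diff_distrib[symmetric] intro!: mult_right_mono\<close>)
  show ?thesis
    by (rule H0I[OF _ 1 tol2_add[OF 2 3]]) (rule c1c_mult[OF T c1_c1c[OF fh(1)]])
qed

text \<open>The ramp \<eta> rises from 0 at v = e / 4 to 1 at v = e / 2. Mollification at scale d /
  2, over which v varies by less than e / 4, keeps its support in v > 0 and leaves the value 1 on
  the open set v > 3 e / 4, so that the gradient vanishes where v > e.\<close>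

lemma superlevel_cutoff:
  fixes v :: "'a::euclidean_space \<Rightarrow> real"
  assumes v: "csupp v" and e: "e > 0"
  obtains w w' where "c1c {x. v x > 0} w w'" "\<And>x. v x > e \<Longrightarrow> w x = 1 \<and> w' x = 0"
proof -
  obtain d where d: "d > 0" "\<And>x y. norm (x - y) < d \<Longrightarrow> norm (v x - v y) < e / 4"
    using csupp_uniform[OF v, of "e / 4"] e by auto
  have cv: "continuous_on UNIV v" using v by (simp add: csupp_def)
  obtain K where K: "compact K" "\<And>x. x \<notin> K \<Longrightarrow> v x = 0" using v unfolding csupp_def by blast
  define \<eta> where "\<eta> x = max 0 (min 1 (4 * v x / e - 1))" for x
  have \<eta>: "v x \<ge> e / 2 \<Longrightarrow> \<eta> x = 1" "v x < e / 4 \<Longrightarrow> \<eta> x = 0" for x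
    using e by (auto simp: \<eta>_def field_simps max_def min_def)
  have c\<eta>: "csupp \<eta>"
  proof (rule csuppI[OF _ K(1)])
    show "continuous_on UNIV \<eta>" unfolding \<eta>_def using cv e by (intro continuous_intros) auto
    show "\<eta> x = 0" if "x \<notin> K" for x using \<eta>(2)[of x] K(2)[OF that] e by simp
  qed
  define w where "w = mollify \<eta> (d / 2)"
  have "test_function {x. v x > 0} w"
    unfolding w_def
  proof (rule test_function_cvv[OF c\<eta>])
    have "{x. e / 4 \<le> v x} = K \<inter> {x. e / 4 \<le> v x}" using K(2) e by fastforce
    moreover have "closed {x. e / 4 \<le> v x}" using cv by (intro closed_Collect_le) auto
    ultimately show "compact {x. e / 4 \<le> v x}" using compact_Int_closed[OF K(1)] by metis
    show "\<eta> x = 0" if "x \<notin> {x. e / 4 \<le> v x}" for x using \<eta>(2)[of x] that by simp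
    show "(\<Union>x\<in>{x. e / 4 \<le> v x}. cball x (d / 2)) \<subseteq> {x. 0 < v x}"
    proof safe
      fix x y assume "e / 4 \<le> v x" "y \<in> cball x (d / 2)"
      then show "0 < v y" using d(2)[of x y] d(1) by (simp add: dist_norm abs_if split: if_splits)
    qed
  qed (use d in simp)
  then have w: "c1c {x. v x > 0} w (grad w)" by (rule c1c_test_function)
  have w1: "w x = 1" if "v x > 3 * e / 4" for x
  proof -
    have "norm (mollify \<eta> (d / 2) x - 1) \<le> 0"
    proof (rule mollify_close[OF c\<eta>])
      fix y assume "norm (x - y) < d / 2"
      then have "v y \<ge> e / 2" using d(2)[of x y] d(1) that by (simp add: abs_if split: if_splits)
      then show "norm (\<eta> y - 1) \<le> 0" using \<eta>(1) by simp
    qed (use d in simp)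
    then show ?thesis by (simp add: w_def)
  qed
  show ?thesis
  proof (rule that[OF w])
    fix x assume x: "v x > e"
    have o: "open {x. v x > 3 * e / 4}" using cv by (intro open_Collect_less) auto
    have "(w has_derivative (\<lambda>v. 0)) (at x)"
      by (rule has_derivative_transform_within_open[OF has_derivative_const[of 1] o]) (use x e w1 in auto)
    from has_derivative_unique[OF this c1cD(1)[OF w]] have "grad w x \<bullet> grad w x = 0" by metis
    then show "w x = 1 \<and> grad w x = 0" using w1[of x] x e by simp
  qed
qed

text \<open>\<open>(v - \<epsilon>)\<^sup>+\<close> is supported well inside the positivity set, where a cutoff equal to 1 on its support makes
  the approximants of \<open>v\<close> admissible.\<close>

lemma H0_positivity_set:
  fixes u :: "'a::euclidean_space \<Rightarrow> real"
  assumes S: "open S" "bounded S" and H: "H0 S u g" and v: "csupp v" "\<And>x. v x \<ge> 0" "\<And>x. x \<notin> S \<Longrightarrow> v x = 0"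
    and ae: "AE x in lebesgue. v x = u x"
  shows "H0 {x. v x > 0} v g"
proof -
  have cv: "continuous_on UNIV v" using v(1) by (simp add: csupp_def)
  have o: "open {x. v x > 0}" using cv by (intro open_Collect_less) auto
  have mv [measurable]: "v \<in> borel_measurable lebesgue" by (rule csupp_measurable(2)[OF v(1)])
  have mg [measurable]: "g \<in> borel_measurable lebesgue" by (rule l2_measurable[OF H0_l2(2)[OF H]])
  have g0: "AE x in lebesgue. v x = 0 \<longrightarrow> g x = 0"
  proof -
    have "AE x in lebesgue. u x \<ge> 0" using ae v(2) by (auto elim!: eventually_mono) (metis)
    from H0_grad_zero[OF S(1) H this] ae show ?thesis by eventually_elim simp
  qed
  define V where "V n x = max 0 (v x - 1 / real (Suc n))" for n x
  define K where "K n x = (if v x > 1 / real (Suc n) then g x else 0)" for n x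
  have HV: "H0 {x. v x > 0} (V n) (K n)" for n
  proof -
    define e where "e = 1 / real (Suc n)"
    have e: "e > 0" by (simp add: e_def)
    obtain w w' where w: "c1c {x. v x > 0} w w'" "\<And>x. v x > e \<Longrightarrow> w x = 1 \<and> w' x = 0"
      using superlevel_cutoff[OF v(1) e] by blast
    have "H0 S (\<lambda>x. indicator S x * max 0 (u x - e))
      (\<lambda>x. (indicator S x * (if u x > e then 1 else 0)) *\<^sub>R (g x - 0))"
    proof (rule H0_pos[OF S(1) H])
      show "c1 S (\<lambda>x. e) (\<lambda>x. 0)" by (simp add: c1_def)
      show "l2 (\<lambda>x. indicator S x * e)" using l2_continuous[OF S(2,1), of "\<lambda>x. e"] by simp
      show "l2 (\<lambda>x. indicator S x *\<^sub>R (0::'a))" by simp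
    qed (use e in simp)
    from H0_mult[OF this o w(1)] show ?thesis
    proof (rule H0_cong_AE)
      show "AE x in lebesgue. w x * (indicator S x * max 0 (u x - e)) = V n x"
        using ae
      proof eventually_elim
        case (elim x)
        show ?case using w(2)[of x] v(3)[of x] e elim unfolding V_def e_def[symmetric]
          by (cases "v x > e") (auto simp: indicator_def max_def)
      qed
      show "AE x in lebesgue. (indicator S x * max 0 (u x - e)) *\<^sub>R w' x +
          w x *\<^sub>R (indicator S x * (if e < u x then 1 else 0)) *\<^sub>R (g x - 0) = K n x"
        using ae
      proof eventually_elim
        case (elim x)
        show ?case using w(2)[of x] v(3)[of x] e elim unfolding K_def e_def[symmetric]
          by (cases "v x > e") (auto simp: indicator_def max_def)
      qed
      show "V n \<in> borel_measurable lebesgue" "K n \<in> borel_measurable lebesgue"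
        unfolding V_def K_def by measurable
    qed
  qed
  have mV: "V n \<in> borel_measurable lebesgue" and mK: "K n \<in> borel_measurable lebesgue" for n
    unfolding V_def K_def by measurable
  have small: "\<forall>\<^sub>F n in sequentially. 1 / real (Suc n) < t" if "t > 0" for t :: real
    using order_tendstoD(2)[OF LIMSEQ_Suc[OF lim_1_over_n] that] by simp
  have "tol2 V v"
  proof (rule tol2_dominated)
    show "l2 v" by (rule csupp_l2[OF v(1)])
    have "(\<lambda>n. V n x) \<longlonglongrightarrow> v x" for x
    proof -
      have "(\<lambda>n. max 0 (v x - 1 / real (Suc n))) \<longlonglongrightarrow> max 0 (v x - 0)"
        by (intro tendsto_max tendsto_diff tendsto_const LIMSEQ_Suc[OF lim_1_over_n])
      then show ?thesis using v(2)[of x] by (simp add: V_def max_def)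
    qed
    then show "AE x in lebesgue. (\<lambda>n. V n x) \<longlonglongrightarrow> v x" by simp
    show "AE x in lebesgue. norm (V n x) \<le> norm (v x)" for n
      using v(2) by (auto simp: V_def max_def)
  qed (simp_all add: mV)
  moreover have "tol2 K g"
  proof (rule tol2_dominated)
    show "l2 g" by (rule H0_l2(2)[OF H])
    show "AE x in lebesgue. (\<lambda>n. K n x) \<longlonglongrightarrow> g x"
      using g0
    proof eventually_elim
      case (elim x)
      show ?case
      proof (cases "v x = 0")
        case True
        then show ?thesis using elim by (simp add: K_def)
      next
        case False
        then have "v x > 0" using v(2)[of x] by simp
        from small[OF this] have "\<forall>\<^sub>F n in sequentially. K n x = g x" by eventually_elim (simp add: K_def)
        then show ?thesis by (rule tendsto_eventually)
      qed
    qed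
  qed (simp_all add: mK K_def)
  ultimately show ?thesis by (rule H0_closed[OF HV])
qed

section \<open>The scalar problem\<close>

lemma AE_lebesgue_on: "S \<in> sets lebesgue \<Longrightarrow> (AE x in lebesgue_on S. P x) \<longleftrightarrow> (AE x in lebesgue. x \<in> S \<longrightarrow> P x)"
  by (simp add: AE_restrict_space_iff)

lemma open_sets_lebesgue: "open S \<Longrightarrow> S \<in> sets lebesgue"
  by (simp add: borel_open)

lemma L1_norm_lebesgue: "open S \<Longrightarrow> L1_norm S u = (LINT x|lebesgue. \<bar>indicator S x * u x\<bar>)"
  by (simp add: L1_norm_def integral_on[OF open_sets_lebesgue] abs_mult)

lemma dirichlet_weak_grad:
  "open S \<Longrightarrow> dirichlet S u = n2 (\<lambda>x. indicator S x *\<^sub>R weak_grad S u x)"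
  unfolding dirichlet_def n2_def norm_indicator_power2 by (simp add: integral_on[OF open_sets_lebesgue])

definition scalar_adm :: "'a::euclidean_space set \<Rightarrow> ('a \<Rightarrow> real) \<Rightarrow> ('a \<Rightarrow> 'a) \<Rightarrow> bool" where
  "scalar_adm S u g \<longleftrightarrow> H0 S u g \<and> (AE x in lebesgue. u x \<ge> 0) \<and> (LINT x|lebesgue. u x) = 1"

lemma scalar_adm_extend:
  assumes S: "open S" and u: "u \<in> H10 S" "AE x in lebesgue_on S. u x \<ge> 0" "L1_norm S u = 1"
  shows "scalar_adm S (\<lambda>x. indicator S x * u x) (\<lambda>x. indicator S x *\<^sub>R weak_grad S u x)"
proof -
  have H: "H0 S (\<lambda>x. indicator S x * u x) (\<lambda>x. indicator S x *\<^sub>R weak_grad S u x)" by (rule H10_imp_H0[OF S u(1)])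
  have n: "AE x in lebesgue. indicator S x * u x \<ge> 0"
    using u(2) unfolding AE_lebesgue_on[OF open_sets_lebesgue[OF S]] by eventually_elim (simp add: indicator_def)
  have m: "(\<lambda>x. indicator S x * u x) \<in> borel_measurable lebesgue" by (rule l2_measurable[OF H0_l2(1)[OF H]])
  have "(LINT x|lebesgue. indicator S x * u x) = (LINT x|lebesgue. \<bar>indicator S x * u x\<bar>)"
    by (rule integral_cong_AE) (use m n in auto)
  then show ?thesis using H n u(3) by (simp add: scalar_adm_def L1_norm_lebesgue[OF S])
qed

lemma scalar_adm_H10:
  assumes S: "open S" and u: "scalar_adm S u g"
  shows "u \<in> H10 S" "AE x in lebesgue_on S. u x \<ge> 0" "L1_norm S u = 1" "dirichlet S u = n2 g"
proof -
  have H: "H0 S u g" and n: "AE x in lebesgue. u x \<ge> 0" and 1: "(LINT x|lebesgue. u x) = 1"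
    using u by (auto simp: scalar_adm_def)
  show "u \<in> H10 S" by (rule H0_imp_H10[OF S H])
  show "dirichlet S u = n2 g" by (rule H0_dirichlet[OF S H])
  show "AE x in lebesgue_on S. u x \<ge> 0"
    unfolding AE_lebesgue_on[OF open_sets_lebesgue[OF S]] using n by eventually_elim simp
  have m: "u \<in> borel_measurable lebesgue" by (rule l2_measurable[OF H0_l2(1)[OF H]])
  have mi: "(\<lambda>x. \<bar>indicator S x * u x\<bar>) \<in> borel_measurable lebesgue"
    by (intro borel_measurable_abs borel_measurable_times borel_measurable_indicator m open_sets_lebesgue[OF S])
  have "(LINT x|lebesgue. \<bar>indicator S x * u x\<bar>) = (LINT x|lebesgue. u x)"
  proof (rule integral_cong_AE[OF mi m])
    show "AE x in lebesgue. \<bar>indicator S x * u x\<bar> = u x"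
      using H0_outside(1)[OF H] n by eventually_elim (auto simp: indicator_def)
  qed
  then show "L1_norm S u = 1" by (simp add: 1 L1_norm_lebesgue[OF S])
qed

text \<open>Non-emptiness of the admissible class: normalised kernels on disjoint balls about
  \<open>k\<close> distinct points, with the radius at most half of every mutual distance.\<close>

lemma bump_family:
  fixes S :: "'a::euclidean_space set"
  assumes "open S" "S \<noteq> {}"
  obtains U :: "'k::finite \<Rightarrow> 'a \<Rightarrow> real" and G where "adm S U G"
proof -
  have "infinite S" using assms finite_imp_not_open by blast
  then obtain T where T: "T \<subseteq> S" "finite T" "card T = CARD('k)" using infinite_arbitrarily_large by metis
  then obtain p where p: "bij_betw p (UNIV :: 'k set) T" using finite_same_card_bij[of "UNIV :: 'k set" T] by auto
  have pS: "p i \<in> S" for i using p T(1) by (auto simp: bij_betw_def)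
  have pd: "p i \<noteq> p j" if "i \<noteq> j" for i j using p that by (auto simp: bij_betw_def inj_on_def)
  have "\<forall>i. \<exists>r>0. cball (p i) r \<subseteq> S" using assms(1) pS open_contains_cball by blast
  then obtain \<rho> where \<rho>: "\<And>i. \<rho> i > 0" "\<And>i. cball (p i) (\<rho> i) \<subseteq> S" by metis
  define D where "D = range \<rho> \<union> (\<lambda>(i, j). dist (p i) (p j) / 2) ` {(i, j). i \<noteq> j}"
  define r where "r = Min D"
  have D: "finite D" "D \<noteq> {}" by (auto simp: D_def)
  have r: "r > 0" using Min_in[OF D] \<rho>(1) pd by (auto simp: r_def D_def)
  have rS: "cball (p i) r \<subseteq> S" for i
    using \<rho>(2)[of i] Min_le[OF D(1), of "\<rho> i"] by (auto simp: r_def D_def)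
  have rd: "2 * r \<le> dist (p i) (p j)" if "i \<noteq> j" for i j
  proof -
    have "dist (p i) (p j) / 2 \<in> D" using that by (force simp: D_def)
    from Min_le[OF D(1) this] show ?thesis by (simp add: r_def)
  qed
  have "adm S (\<lambda>i. kern (p i) r) (\<lambda>i. grad (kern (p i) r))"
    unfolding adm_def
  proof (intro conjI allI AE_I2 impI)
    show "H0 S (kern (p i) r) (grad (kern (p i) r))" for i by (rule H0_test[OF test_function_kern[OF r rS]])
    show "(LINT x|lebesgue. kern (p i) r x) = 1" for i by (rule kern_integral[OF r])
    show "kern (p i) r x \<ge> 0" for i x by (rule kern_nonneg[OF r])
    show "kern (p i) r x * kern (p j) r x = 0" if "i \<noteq> j" for i j x
    proof -
      have "r \<le> norm (x - p i) \<or> r \<le> norm (x - p j)"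
        using rd[OF that] dist_triangle[of "p i" "p j" x] by (auto simp: dist_norm norm_minus_commute)
      then show ?thesis using kern_outside[OF r] by auto
    qed
  qed
  then show ?thesis by (rule that)
qed

text \<open>The scalar problem is the vector problem with index type \<open>unit\<close>, so
  existence needs no separate proof.\<close>

lemma scalar_minimiser:
  fixes S :: "'a::euclidean_space set"
  assumes "open S" "bounded S" "S \<noteq> {}"
  obtains u g where "scalar_adm S u g" "\<And>v h. scalar_adm S v h \<Longrightarrow> n2 g \<le> n2 h"
proof -
  obtain U0 :: "unit \<Rightarrow> 'a \<Rightarrow> real" and G0 where "adm S U0 G0" using bump_family[OF assms(1,3)] by blast
  then obtain U :: "unit \<Rightarrow> 'a \<Rightarrow> real" and G where UG: "adm S U G"
    "\<And>(V :: unit \<Rightarrow> 'a \<Rightarrow> real) H. adm S V H \<Longrightarrow> en G \<le> en H" using adm_minimiser[OF assms(2)] by metis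
  show ?thesis
  proof (rule that)
    show "scalar_adm S (U ()) (G ())" using UG(1) by (simp add: adm_def scalar_adm_def)
    show "n2 (G ()) \<le> n2 h" if "scalar_adm S v h" for v h
      using UG(2)[of "\<lambda>_. v" "\<lambda>_. h"] that by (auto simp: adm_def scalar_adm_def en_def UNIV_unit)
  qed
qed

lemma scalar_solution_exists:
  fixes S :: "'a::euclidean_space set"
  assumes S: "open S" "bounded S" "S \<noteq> {}"
  obtains u where "scalar_solution S u"
proof -
  obtain u g where u: "scalar_adm S u g" "\<And>v h. scalar_adm S v h \<Longrightarrow> n2 g \<le> n2 h" using scalar_minimiser[OF S] by blast
  have "scalar_solution S u"
    unfolding scalar_solution_def is_arg_min_def
    using scalar_adm_H10[OF S(1) u(1)] u(2)[OF scalar_adm_extend[OF S(1)]] dirichlet_weak_grad[OF S(1)]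
    by (metis not_less)
  then show ?thesis by (rule that)
qed

lemma scalar_solutionD:
  assumes S: "open S" and u: "scalar_solution S u"
  shows "scalar_adm S (\<lambda>x. indicator S x * u x) (\<lambda>x. indicator S x *\<^sub>R weak_grad S u x)"
    "scalar_adm S v h \<Longrightarrow> dirichlet S u \<le> n2 h"
proof -
  have 1: "u \<in> H10 S" "AE x in lebesgue_on S. u x \<ge> 0" "L1_norm S u = 1"
    and 2: "\<And>v. v \<in> H10 S \<Longrightarrow> AE x in lebesgue_on S. v x \<ge> 0 \<Longrightarrow> L1_norm S v = 1 \<Longrightarrow> dirichlet S u \<le> dirichlet S v"
    using u by (auto simp: scalar_solution_def is_arg_min_linorder)
  show "scalar_adm S (\<lambda>x. indicator S x * u x) (\<lambda>x. indicator S x *\<^sub>R weak_grad S u x)"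
    by (rule scalar_adm_extend[OF S 1])
  show "dirichlet S u \<le> n2 h" if "scalar_adm S v h"
    using 2[of v] scalar_adm_H10[OF S that] by simp
qed

text \<open>\<open>lambda21\<close> admits functions of changing sign. Passing to the absolute value
  keeps the L1 norm and does not increase the energy, so the sign constraint of the scalar problem
  costs nothing.\<close>

lemma scalar_adm_abs:
  assumes S: "open S" and u: "u \<in> H10 S" "L1_norm S u = 1"
  obtains v h where "scalar_adm S v h" "n2 h \<le> dirichlet S u"
proof -
  obtain h where h: "H0 S (\<lambda>x. \<bar>indicator S x * u x\<bar>) h" "n2 h \<le> n2 (\<lambda>x. indicator S x *\<^sub>R weak_grad S u x)"
    using H0_abs[OF S H10_imp_H0[OF S u(1)]] by blast
  have "scalar_adm S (\<lambda>x. \<bar>indicator S x * u x\<bar>) h"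
    using h(1) u(2) unfolding L1_norm_lebesgue[OF S] by (simp add: scalar_adm_def)
  then show ?thesis using h(2) that unfolding dirichlet_weak_grad[OF S] by blast
qed

lemma lambda21_scalar_solution:
  assumes S: "open S" and u: "scalar_solution S u"
  shows "lambda21 S = dirichlet S u"
  unfolding lambda21_def
proof (rule cInf_eq_minimum)
  show "dirichlet S u \<in> {dirichlet S u |u. u \<in> H10 S \<and> L1_norm S u = 1}"
    using u by (auto simp: scalar_solution_def is_arg_min_def)
  fix d assume "d \<in> {dirichlet S u |u. u \<in> H10 S \<and> L1_norm S u = 1}"
  then obtain w where w: "w \<in> H10 S" "L1_norm S w = 1" "d = dirichlet S w" by blast
  obtain v h where "scalar_adm S v h" "n2 h \<le> dirichlet S w" using scalar_adm_abs[OF S w(1,2)] by blast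
  then show "dirichlet S u \<le> d" using scalar_solutionD(2)[OF S u] w(3) by fastforce
qed

lemma lambda21_le:
  fixes S :: "'a::euclidean_space set"
  assumes S: "open S" "bounded S" and v: "scalar_adm S v h"
  shows "lambda21 S \<le> n2 h"
proof -
  have "S \<noteq> {}"
  proof
    assume "S = {}"
    then have 0: "AE x in lebesgue. v x = 0" using H0_outside(1)[of S v h] v by (simp add: scalar_adm_def)
    have "v \<in> borel_measurable lebesgue" using v by (auto simp: scalar_adm_def intro: l2_measurable H0_l2)
    then have "(LINT x|lebesgue. v x) = (LINT (x::'a)|lebesgue. 0)" by (rule integral_cong_AE) (use 0 in auto)
    then show False using v by (simp add: scalar_adm_def)
  qed
  then obtain u where u: "scalar_solution S u" using scalar_solution_exists[OF S] by blast
  show ?thesis using scalar_solutionD(2)[OF S(1) u v] lambda21_scalar_solution[OF S(1) u] by simp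
qed

text \<open>Strict convexity: the midpoint of two minimisers is admissible because the mass
  constraint is linear on nonnegative functions. The parallelogram law then annihilates the gradient
  of the difference, and the Poincare inequality the difference itself.\<close>

lemma scalar_solution_unique:
  fixes S :: "'a::euclidean_space set"
  assumes S: "open S" "bounded S" and u: "scalar_solution S u" "scalar_solution S v"
  shows "AE x in lebesgue_on S. u x = v x"
proof -
  define u' g where "u' = (\<lambda>x. indicator S x * u x)" and "g = (\<lambda>x. indicator S x *\<^sub>R weak_grad S u x)"
  define v' h where "v' = (\<lambda>x. indicator S x * v x)" and "h = (\<lambda>x. indicator S x *\<^sub>R weak_grad S v x)"
  have A: "scalar_adm S u' g" "scalar_adm S v' h"
    unfolding u'_def g_def v'_def h_def by (rule scalar_solutionD(1)[OF S(1)], rule u)+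
  have H: "H0 S u' g" "H0 S v' h" using A by (simp_all add: scalar_adm_def)
  have l: "l2 g" "l2 h" using H H0_l2 by blast+
  have i: "integrable lebesgue u'" "integrable lebesgue v'" using H S(2) H0_integrable(1) by blast+
  have gh: "n2 g = n2 h"
    using lambda21_scalar_solution[OF S(1) u(1)] lambda21_scalar_solution[OF S(1) u(2)]
    by (simp add: dirichlet_weak_grad[OF S(1)] g_def h_def)
  have "scalar_adm S (\<lambda>x. 1/2 * (u' x + v' x)) (\<lambda>x. (1/2) *\<^sub>R (g x + h x))"
    unfolding scalar_adm_def
  proof (intro conjI)
    show "H0 S (\<lambda>x. 1/2 * (u' x + v' x)) (\<lambda>x. (1/2) *\<^sub>R (g x + h x))"
      by (rule H0_scale[OF H0_add[OF H]])
    have "AE x in lebesgue. u' x \<ge> 0" "AE x in lebesgue. v' x \<ge> 0" using A by (simp_all add: scalar_adm_def)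
    then show "AE x in lebesgue. 0 \<le> 1/2 * (u' x + v' x)" by eventually_elim simp
    show "(LINT x|lebesgue. 1/2 * (u' x + v' x)) = 1" using A i by (simp add: scalar_adm_def)
  qed
  from scalar_solutionD(2)[OF S(1) u(1) this] have "n2 g \<le> n2 (\<lambda>x. (1/2) *\<^sub>R (g x + h x))"
    by (simp add: dirichlet_weak_grad[OF S(1)] g_def)
  then have d: "n2 (\<lambda>x. (1/2) *\<^sub>R (g x - h x)) \<le> 0" using n2_parallelogram[OF l] gh by simp
  obtain R where R: "S \<subseteq> ball 0 R" using bounded_subset_ballD[OF S(2)] by blast
  have Hd: "H0 S (\<lambda>x. 1/2 * (u' x - v' x)) (\<lambda>x. (1/2) *\<^sub>R (g x - h x))" by (rule H0_scale[OF H0_diff[OF H]])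
  have "n2 (\<lambda>x. 1/2 * (u' x - v' x)) \<le> 4 * R\<^sup>2 * n2 (\<lambda>x. (1/2) *\<^sub>R (g x - h x))" by (rule H0_Poincare[OF Hd R])
  also have "\<dots> \<le> 0" using d by (intro mult_nonneg_nonpos) auto
  finally have "n2 (\<lambda>x. 1/2 * (u' x - v' x)) = 0" using n2_nonneg by (intro antisym)
  from n2_eq_0[OF H0_l2(1)[OF Hd] this] show ?thesis
    unfolding AE_lebesgue_on[OF open_sets_lebesgue[OF S(1)]] by eventually_elim (auto simp: u'_def v'_def indicator_def)
qed

section \<open>The vector problem and the partition problem\<close>

lemma Sigma_k_iff: "\<xi> \<in> Sigma_k \<longleftrightarrow> (\<forall>i j. i \<noteq> j \<longrightarrow> \<xi> $ i * \<xi> $ j = 0)"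
proof -
  have "\<xi> \<in> Sigma_k \<longleftrightarrow> (\<forall>p\<in>{(i, j). i \<noteq> j}. (case p of (i, j) \<Rightarrow> (\<xi> $ i)\<^sup>2 * (\<xi> $ j)\<^sup>2) = 0)"
    unfolding Sigma_k_def mem_Collect_eq by (rule sum_nonneg_eq_0_iff) auto
  then show ?thesis by auto
qed

lemma admissible_imp_adm:
  fixes u :: "'a::euclidean_space \<Rightarrow> real^'k"
  assumes S: "open S" and u: "u \<in> admissible S"
  shows "adm S (\<lambda>i x. indicator S x * u x $ i) (\<lambda>i x. indicator S x *\<^sub>R weak_grad S (\<lambda>x. u x $ i) x)"
proof -
  have 1: "(\<lambda>x. u x $ i) \<in> H10 S" "L1_norm S (\<lambda>x. u x $ i) = 1" for i
    using u by (auto simp: admissible_def H10_Sigma_def)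
  have n: "AE x in lebesgue_on S. \<forall>i. u x $ i \<ge> 0" and s: "AE x in lebesgue_on S. u x \<in> Sigma_k"
    using u by (auto simp: admissible_def H10_Sigma_def)
  have "AE x in lebesgue_on S. u x $ i \<ge> 0" for i using n by eventually_elim simp
  from scalar_adm_extend[OF S 1(1) this 1(2)]
  have A: "scalar_adm S (\<lambda>x. indicator S x * u x $ i) (\<lambda>x. indicator S x *\<^sub>R weak_grad S (\<lambda>x. u x $ i) x)" for i .
  have "AE x in lebesgue. (\<forall>i. indicator S x * u x $ i \<ge> 0) \<and>
      (\<forall>i j. i \<noteq> j \<longrightarrow> (indicator S x * u x $ i) * (indicator S x * u x $ j) = 0)"
    using n s unfolding AE_lebesgue_on[OF open_sets_lebesgue[OF S]]
    by eventually_elim (simp add: indicator_def Sigma_k_iff)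
  then show ?thesis using A unfolding adm_def scalar_adm_def by blast
qed

lemma energy_en:
  assumes "open S"
  shows "energy S u = en (\<lambda>i x. indicator S x *\<^sub>R weak_grad S (\<lambda>x. u x $ i) x)"
  by (simp add: energy_def en_def dirichlet_weak_grad[OF assms])

lemma adm_imp_admissible:
  fixes U :: "'k::finite \<Rightarrow> 'a::euclidean_space \<Rightarrow> real"
  assumes S: "open S" and U: "adm S U G"
  shows "(\<lambda>x. \<chi> i. U i x) \<in> admissible S" "energy S (\<lambda>x. \<chi> i. U i x) = en G"
proof -
  have ae: "AE x in lebesgue. (\<forall>i. U i x \<ge> 0) \<and> (\<forall>i j. i \<noteq> j \<longrightarrow> U i x * U j x = 0)" using U by (simp add: adm_def)
  have A: "scalar_adm S (U i) (G i)" for i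
    using U eventually_mono[OF ae, of "\<lambda>x. U i x \<ge> 0"] by (simp add: adm_def scalar_adm_def)
  have "AE x in lebesgue_on S. \<forall>i. U i x \<ge> 0"
    unfolding AE_lebesgue_on[OF open_sets_lebesgue[OF S]] using ae by (rule eventually_mono) simp
  moreover have "AE x in lebesgue_on S. (\<chi> i. U i x) \<in> Sigma_k"
    unfolding AE_lebesgue_on[OF open_sets_lebesgue[OF S]] using ae by (rule eventually_mono) (simp add: Sigma_k_iff)
  ultimately show "(\<lambda>x. \<chi> i. U i x) \<in> admissible S"
    using scalar_adm_H10[OF S A] by (simp add: admissible_def H10_Sigma_def)
  show "energy S (\<lambda>x. \<chi> i. U i x) = en G"
    using scalar_adm_H10(4)[OF S A] by (simp add: energy_def en_def)
qed

lemma energy_solution_exists: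
  fixes S :: "'a::euclidean_space set"
  assumes S: "open S" "bounded S" "S \<noteq> {}"
  obtains u :: "'a \<Rightarrow> real^'k" where "energy_solution S u"
proof -
  obtain U0 :: "'k \<Rightarrow> 'a \<Rightarrow> real" and G0 where "adm S U0 G0" using bump_family[OF S(1,3)] by blast
  then obtain U :: "'k \<Rightarrow> 'a \<Rightarrow> real" and G where UG: "adm S U G"
    "\<And>(V :: 'k \<Rightarrow> 'a \<Rightarrow> real) H. adm S V H \<Longrightarrow> en G \<le> en H" using adm_minimiser[OF S(2)] by metis
  have "energy_solution S (\<lambda>x. \<chi> i. U i x)"
    unfolding energy_solution_def is_arg_min_linorder
    using adm_imp_admissible[OF S(1) UG(1)] UG(2)[OF admissible_imp_adm[OF S(1)]] energy_en[OF S(1)] by metis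
  then show ?thesis by (rule that)
qed

lemma energy_solution_minimiser:
  fixes u :: "'a::euclidean_space \<Rightarrow> real^'k"
  assumes S: "open S" "bounded S" and u: "energy_solution S u"
  shows "minimiser S (\<lambda>i x. indicator S x * u x $ i) (\<lambda>i x. indicator S x *\<^sub>R weak_grad S (\<lambda>x. u x $ i) x)"
proof
  have 1: "u \<in> admissible S" and 2: "\<And>v :: 'a \<Rightarrow> real^'k. v \<in> admissible S \<Longrightarrow> energy S u \<le> energy S v"
    using u by (auto simp: energy_solution_def is_arg_min_linorder)
  show "adm S (\<lambda>i x. indicator S x * u x $ i) (\<lambda>i x. indicator S x *\<^sub>R weak_grad S (\<lambda>x. u x $ i) x)"
    by (rule admissible_imp_adm[OF S(1) 1])
  show "en (\<lambda>i x. indicator S x *\<^sub>R weak_grad S (\<lambda>x. u x $ i) x) \<le> en H" if "adm S V H" for V :: "'k \<Rightarrow> 'a \<Rightarrow> real" and H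
    using 2[OF adm_imp_admissible(1)[OF S(1) that]] adm_imp_admissible(2)[OF S(1) that] energy_en[OF S(1), of u] by simp
qed (use S in auto)

lemma energy_solution_inf: "energy_solution S (u :: _ \<Rightarrow> real^'k) \<Longrightarrow> inf_energy TYPE('k) S = energy S u"
  unfolding inf_energy_def energy_solution_def is_arg_min_linorder by (intro cInf_eq_minimum) auto

section \<open>Regularity and positivity sets of an energy solution\<close>

context
  fixes S :: "'a::euclidean_space set" and u :: "'a \<Rightarrow> real^'k" and \<rho> :: real
  assumes S: "open S" "bounded S" and u: "energy_solution S u"
    and ext: "\<rho> > 0" "\<And>q. q \<in> frontier S \<Longrightarrow> \<exists>y. dist y q = \<rho> \<and> (\<forall>x\<in>S. \<rho> \<le> dist x y)"
begin

interpretation minimiser S "\<lambda>i x. indicator S x * u x $ i" "\<lambda>i x. indicator S x *\<^sub>R weak_grad S (\<lambda>x. u x $ i) x"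
  by (rule energy_solution_minimiser[OF S u])

lemma vs_csupp: "csupp (vs i)"
proof -
  obtain C where "C \<ge> 0" "\<And>i x y. x \<notin> S \<Longrightarrow> vs i y \<le> C * dist x y" using boundary_estimate[OF ext] by metis
  then show ?thesis by (intro csupp_vs) auto
qed

lemma vs_representative: "AE x in lebesgue_on S. (\<chi> i. vs i x) = u x"
proof -
  have "AE x in lebesgue. \<forall>i. vs i x = indicator S x * u x $ i" using vs_AE by (simp add: AE_all_countable)
  then show ?thesis unfolding AE_lebesgue_on[OF open_sets_lebesgue[OF S(1)]]
    by eventually_elim (simp add: vec_eq_iff)
qed

lemma lipschitz_representative:
  obtains v C where "continuous_representative S u v" "C-lipschitz_on (closure S) v"
proof -
  obtain L where L: "L \<ge> 0" "\<And>x y. x \<in> closure S \<Longrightarrow> y \<in> closure S \<Longrightarrow> (\<Sum>i\<in>UNIV. \<bar>vs i x - vs i y\<bar>) \<le> L * dist x y"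
    using vs_lipschitz[OF ext] by blast
  have 1: "L-lipschitz_on (closure S) (\<lambda>x. \<chi> i. vs i x)"
  proof (rule lipschitz_onI[OF _ L(1)])
    fix x y assume "x \<in> closure S" "y \<in> closure S"
    from L(2)[OF this] norm_le_l1_cart[of "(\<chi> i. vs i x) - (\<chi> i. vs i y)"]
    show "dist (\<chi> i. vs i x) (\<chi> i. vs i y) \<le> L * dist x y" by (simp add: dist_norm)
  qed
  have "continuous_on S (\<lambda>x. \<chi> i. vs i x)"
    by (rule continuous_on_subset[OF lipschitz_on_continuous_on[OF 1] closure_subset])
  then show ?thesis using that[OF _ 1] vs_representative by (simp add: continuous_representative_def)
qed

text \<open>Two continuous functions that agree almost everywhere on an open set agree on it, so
  positivity sets do not depend on the representative.\<close>

lemma continuous_representative_eq: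
  assumes v: "continuous_representative S u v" and x: "x \<in> S"
  shows "v x $ i = vs i x"
proof -
  have ae: "AE x in lebesgue. x \<in> S \<longrightarrow> v x $ i = vs i x"
  proof -
    have "AE x in lebesgue. x \<in> S \<longrightarrow> v x = u x"
      using v by (simp add: continuous_representative_def AE_lebesgue_on[OF open_sets_lebesgue[OF S(1)]])
    then show ?thesis using vs_AE[of i] by eventually_elim simp
  qed
  have c: "continuous_on S (\<lambda>x. v x $ i)" using v by (intro continuous_intros) (simp add: continuous_representative_def)
  have d: "continuous_on S (vs i)" using vs_csupp[of i] continuous_on_subset by (auto simp: csupp_def)
  show ?thesis
    using AE_le_imp_le[OF S(1) c d _ x] AE_le_imp_le[OF S(1) d c _ x]
      eventually_mono[OF ae, of "\<lambda>x. x \<in> S \<longrightarrow> v x $ i \<le> vs i x"] eventually_mono[OF ae, of "\<lambda>x. x \<in> S \<longrightarrow> vs i x \<le> v x $ i"]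
    by (intro antisym) auto
qed

text \<open>Each component competes in the scalar problem on its own positivity set, by
  \<open>H0_positivity_set\<close>. Openness comes from continuity, and non-emptiness from the unit
  mass.\<close>

lemma positivity_partition:
  assumes v: "continuous_representative S u v"
  shows "(\<lambda>i. {x \<in> S. v x $ i > 0}) \<in> partitions S" "partition_cost (\<lambda>i. {x \<in> S. v x $ i > 0}) \<le> energy S u"
proof -
  have e: "{x \<in> S. v x $ i > 0} = {x. vs i x > 0}" for i
    using continuous_representative_eq[OF v] by (auto simp: vs_def)
  have cv: "continuous_on UNIV (vs i)" for i using vs_csupp[of i] by (simp add: csupp_def)
  have o: "open {x. vs i x > 0}" for i using cv by (intro open_Collect_less) auto
  have b: "bounded {x. vs i x > 0}" for i by (rule bounded_subset[OF S(2)]) (auto simp: vs_def)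
  have A: "scalar_adm {x. vs i x > 0} (vs i) (\<lambda>x. indicator S x *\<^sub>R weak_grad S (\<lambda>x. u x $ i) x)" for i
    unfolding scalar_adm_def
  proof (intro conjI)
    show "H0 {x. vs i x > 0} (vs i) (\<lambda>x. indicator S x *\<^sub>R weak_grad S (\<lambda>x. u x $ i) x)"
      by (rule H0_positivity_set[OF S H vs_csupp]) (simp_all add: vs_nonneg vs_AE, simp add: vs_def)
    show "AE x in lebesgue. vs i x \<ge> 0" by (simp add: vs_nonneg)
    have "(LINT x|lebesgue. vs i x) = (LINT x|lebesgue. indicator S x * u x $ i)"
      by (rule integral_cong_AE[OF csupp_measurable(2)[OF vs_csupp] l2_measurable[OF lU] vs_AE])
    then show "(LINT x|lebesgue. vs i x) = 1" using int1[of i] by simp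
  qed
  show "(\<lambda>i. {x \<in> S. v x $ i > 0}) \<in> partitions S"
    unfolding partitions_def e
  proof (intro CollectI conjI allI impI)
    show "{x. vs i x > 0} \<subseteq> S" for i by (auto simp: vs_def)
    show "{x. vs i x > 0} \<inter> {x. vs j x > 0} = {}" if ij: "i \<noteq> j" for i j
    proof -
      have "\<not> (vs i x > 0 \<and> vs j x > 0)" for x using vs_segregated[OF ij, of x] by auto
      then show ?thesis by blast
    qed
    show "{x. vs i x > 0} \<noteq> {}" for i
    proof
      assume "{x. vs i x > 0} = {}"
      then have "vs i x = 0" for x using vs_nonneg[of i x] by (simp add: set_eq_iff not_less antisym)
      then show False using A[of i] by (simp add: scalar_adm_def)
    qed
  qed (rule o)
  have "partition_cost (\<lambda>i. {x \<in> S. v x $ i > 0}) \<le> (\<Sum>i\<in>UNIV. n2 (\<lambda>x. indicator S x *\<^sub>R weak_grad S (\<lambda>x. u x $ i) x))"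
    unfolding partition_cost_def e by (intro sum_mono lambda21_le[OF o b A])
  then show "partition_cost (\<lambda>i. {x \<in> S. v x $ i > 0}) \<le> energy S u" by (simp add: energy_en[OF S(1)] en_def)
qed

end

text \<open>Approximants with compact support in the sets \<open>\<omega> i\<close> are approximants
  in \<open>S\<close> as well. Extension by zero therefore creates no energy, and the cost is
  attained with equality.\<close>

lemma zero_extension_admissible:
  fixes \<omega> :: "'k::finite \<Rightarrow> 'a::euclidean_space set"
  assumes S: "open S" and \<omega>: "\<omega> \<in> partitions S" and w: "\<And>i. scalar_solution (\<omega> i) (w i)"
  shows "zero_extension \<omega> w \<in> admissible S" "energy S (zero_extension \<omega> w) = partition_cost \<omega>"
proof -
  have o: "open (\<omega> i)" and sub: "\<omega> i \<subseteq> S" and dj: "i \<noteq> j \<Longrightarrow> \<omega> i \<inter> \<omega> j = {}" for i j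
    using \<omega> by (auto simp: partitions_def)
  define U where "U i x = indicator (\<omega> i) x * w i x" for i x
  define G where "G i x = indicator (\<omega> i) x *\<^sub>R weak_grad (\<omega> i) (w i) x" for i x
  have A: "scalar_adm (\<omega> i) (U i) (G i)" for i
    using scalar_solutionD(1)[OF o w] by (simp add: U_def[abs_def] G_def[abs_def])
  have "AE x in lebesgue. \<forall>i. U i x \<ge> 0" using A by (simp add: scalar_adm_def AE_all_countable)
  moreover have "U i x * U j x = 0" if "i \<noteq> j" for i j x
    using dj[OF that] by (auto simp: U_def indicator_def)
  moreover have "H0 S (U i) (G i)" for i using A[of i] H0_mono[OF _ sub[of i]] by (simp add: scalar_adm_def)
  ultimately have a: "adm S U G"
    using A by (simp add: adm_def scalar_adm_def)
  have e: "zero_extension \<omega> w = (\<lambda>x. \<chi> i. U i x)"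
    by (rule ext) (simp add: zero_extension_def U_def vec_eq_iff indicator_def)
  show "zero_extension \<omega> w \<in> admissible S" unfolding e by (rule adm_imp_admissible(1)[OF S a])
  have "energy S (zero_extension \<omega> w) = en G" unfolding e by (rule adm_imp_admissible(2)[OF S a])
  also have "\<dots> = (\<Sum>i\<in>UNIV. dirichlet (\<omega> i) (w i))"
    by (simp add: en_def G_def[abs_def] dirichlet_weak_grad[OF o])
  also have "\<dots> = partition_cost \<omega>" by (simp add: partition_cost_def lambda21_scalar_solution[OF o w])
  finally show "energy S (zero_extension \<omega> w) = partition_cost \<omega>" .
qed

text \<open>An argmin is a function only up to null sets, so existence and almost everywhere
  uniqueness of the scalar minimisers belong to the conclusion. Regularity concerns a
  representative, whose values on the frontier are part of what is asserted to exist.\<close>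

theorem theorem1p1:
  fixes \<Omega> :: "(real^'n) set"
  assumes "CARD('n) \<ge> 2" and "bounded_smooth_domain \<Omega>"
  shows
    "(\<exists>u :: real^'n \<Rightarrow> real^'k. energy_solution \<Omega> u) \<and>
     (\<forall>u :: real^'n \<Rightarrow> real^'k. energy_solution \<Omega> u \<longrightarrow>
        (\<exists>v. continuous_representative \<Omega> u v \<and> (\<exists>C. C-lipschitz_on (closure \<Omega>) v))) \<and>
     inf_partition TYPE('k) \<Omega> = inf_energy TYPE('k) \<Omega> \<and>
     (\<forall>(u :: real^'n \<Rightarrow> real^'k) v. energy_solution \<Omega> u \<and> continuous_representative \<Omega> u v \<longrightarrow>
        partition_solution \<Omega> (\<lambda>i. {x \<in> \<Omega>. v x $ i > 0})) \<and>
     (\<forall>\<omega> :: 'k \<Rightarrow> (real^'n) set. partition_solution \<Omega> \<omega> \<longrightarrow>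
        (\<forall>i. (\<exists>w. scalar_solution (\<omega> i) w) \<and>
             (\<forall>w w'. scalar_solution (\<omega> i) w \<and> scalar_solution (\<omega> i) w' \<longrightarrow>
                (AE x in lebesgue_on (\<omega> i). w x = w' x))) \<and>
        (\<forall>w. (\<forall>i. scalar_solution (\<omega> i) (w i)) \<longrightarrow> energy_solution \<Omega> (zero_extension \<omega> w))) \<and>
     (\<exists>\<omega> :: 'k \<Rightarrow> (real^'n) set. partition_solution \<Omega> \<omega>)"
proof -
  have S: "open \<Omega>" "bounded \<Omega>" "\<Omega> \<noteq> {}" and sb: "smooth_boundary \<Omega>"
    using assms(2) by (auto simp: bounded_smooth_domain_def)
  obtain \<rho> where \<rho>: "\<rho> > 0" "\<And>q. q \<in> frontier \<Omega> \<Longrightarrow> \<exists>y. dist y q = \<rho> \<and> (\<forall>x\<in>\<Omega>. \<rho> \<le> dist x y)"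
    using exterior_ball[OF S(1,2) sb] by blast
  have part: "open (\<omega> i)" "bounded (\<omega> i)" "\<omega> i \<noteq> {}" if "\<omega> \<in> partitions \<Omega>" for \<omega> :: "'k \<Rightarrow> (real^'n) set" and i
    using that bounded_subset[OF S(2)] by (auto simp: partitions_def)
  \<comment> \<open>The zero extension of scalar minimisers turns any partition into a competitor of
    equal energy. Together with \<open>positivity_partition\<close> this closes the circle of
    inequalities between the two infima.\<close>
  have lower: "energy \<Omega> u \<le> partition_cost \<omega>"
    if u: "energy_solution \<Omega> u" and \<omega>: "\<omega> \<in> partitions \<Omega>" for u :: "real^'n \<Rightarrow> real^'k" and \<omega> :: "'k \<Rightarrow> (real^'n) set"
  proof -
    have "\<forall>i. \<exists>w. scalar_solution (\<omega> i) w" using scalar_solution_exists[OF part[OF \<omega>]] by blast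
    then obtain w where "\<And>i. scalar_solution (\<omega> i) (w i)" by metis
    from zero_extension_admissible[OF S(1) \<omega> this] show ?thesis
      using u by (metis energy_solution_def is_arg_min_linorder)
  qed
  have sol: "partition_solution \<Omega> (\<lambda>i. {x \<in> \<Omega>. v x $ i > 0})"
    and cost: "partition_cost (\<lambda>i. {x \<in> \<Omega>. v x $ i > 0}) = energy \<Omega> u"
    if u: "energy_solution \<Omega> u" and v: "continuous_representative \<Omega> u v" for u v :: "real^'n \<Rightarrow> real^'k"
  proof -
    note p = positivity_partition[OF S(1,2) u \<rho> v]
    show c: "partition_cost (\<lambda>i. {x \<in> \<Omega>. v x $ i > 0}) = energy \<Omega> u"
      using p(2) lower[OF u p(1)] by simp
    show "partition_solution \<Omega> (\<lambda>i. {x \<in> \<Omega>. v x $ i > 0})"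
      unfolding partition_solution_def is_arg_min_linorder using p(1) lower[OF u] c by auto
  qed
  obtain u :: "real^'n \<Rightarrow> real^'k" where u: "energy_solution \<Omega> u" using energy_solution_exists[OF S] .
  obtain v where v: "continuous_representative \<Omega> u v" using lipschitz_representative[OF S(1,2) u \<rho>] by blast
  \<comment> \<open>Every optimal partition has the cost of the one formed by the positivity sets,
    hence the minimal energy.\<close>
  have opt: "partition_cost \<omega> = energy \<Omega> u" if "partition_solution \<Omega> \<omega>" for \<omega> :: "'k \<Rightarrow> (real^'n) set"
    unfolding cost[OF u v, symmetric]
    using that sol[OF u v] unfolding partition_solution_def is_arg_min_linorder by (intro antisym) auto
  show ?thesis
  proof (intro conjI allI impI)
    show "\<exists>u :: real^'n \<Rightarrow> real^'k. energy_solution \<Omega> u" using u by blast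
    show "\<exists>v. continuous_representative \<Omega> u v \<and> (\<exists>C. C-lipschitz_on (closure \<Omega>) v)"
      if "energy_solution \<Omega> u" for u :: "real^'n \<Rightarrow> real^'k"
      using lipschitz_representative[OF S(1,2) that \<rho>] by blast
    have "inf_partition TYPE('k) \<Omega> = partition_cost (\<lambda>i. {x \<in> \<Omega>. v x $ i > 0})"
      using sol[OF u v] unfolding inf_partition_def partition_solution_def is_arg_min_linorder
      by (intro cInf_eq_minimum) auto
    then show "inf_partition TYPE('k) \<Omega> = inf_energy TYPE('k) \<Omega>"
      using cost[OF u v] energy_solution_inf[OF u] by simp
    show "\<exists>\<omega> :: 'k \<Rightarrow> (real^'n) set. partition_solution \<Omega> \<omega>" using sol[OF u v] by blast
  next
    fix u v :: "real^'n \<Rightarrow> real^'k" assume "energy_solution \<Omega> u \<and> continuous_representative \<Omega> u v"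
    then show "partition_solution \<Omega> (\<lambda>i. {x \<in> \<Omega>. v x $ i > 0})" using sol by blast
  next
    fix \<omega> :: "'k \<Rightarrow> (real^'n) set" and i assume "partition_solution \<Omega> \<omega>"
    then have \<omega>: "\<omega> \<in> partitions \<Omega>" by (simp add: partition_solution_def is_arg_min_def)
    show "\<exists>w. scalar_solution (\<omega> i) w" using scalar_solution_exists[OF part[OF \<omega>]] by blast
    show "AE x in lebesgue_on (\<omega> i). w x = w' x" if "scalar_solution (\<omega> i) w \<and> scalar_solution (\<omega> i) w'" for w w'
      using scalar_solution_unique[OF part(1,2)[OF \<omega>]] that by blast
  next
    fix \<omega> :: "'k \<Rightarrow> (real^'n) set" and w assume \<omega>: "partition_solution \<Omega> \<omega>" and "\<forall>i. scalar_solution (\<omega> i) (w i)"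
    then have "zero_extension \<omega> w \<in> admissible \<Omega>" "energy \<Omega> (zero_extension \<omega> w) = energy \<Omega> u"
      using zero_extension_admissible[OF S(1), of \<omega> w] opt[OF \<omega>] by (auto simp: partition_solution_def is_arg_min_def)
    then show "energy_solution \<Omega> (zero_extension \<omega> w)"
      using u unfolding energy_solution_def is_arg_min_linorder by auto
  qed
qed

end
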